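(* Let $\Sigma$ and $\Sigma'$ be two tropical fans. Then $\Sigma\times\Sigma'$ is smooth if and only if $\Sigma$ and $\Sigma'$ are smooth. In particular, the category of smooth tropical fans is stable under products.
   Context: **Fans.** $N$ is a free $\mathbb Z$-module of finite rank, $N_{\mathbb R}=N\otimes\mathbb R$. A rational fan $\Sigma$ in $N_{\mathbb R}$ is a non-empty finite collection of strongly convex rational polyhedral cones, closed under taking faces, any two of which meet along a common face. $\Sigma_k$ is the set of $k$-dimensional cones, $\underline0=\{0\}$; $\tau\prec\sigma$ means that $\tau$ is a face of $\sigma$. Put $N_\sigma=N\cap\mathrm{span}(\sigma)$, $N^\sigma=N/N_\sigma$. The star fan $\Sigma^\sigma$ is the fan in $N^\sigma_{\mathbb R}$ formed by the images of the cones of $\Sigma$ containing $\sigma$. If $\tau\prec\sigma$ has codimension one, $e^\tau_\sigma$ is the generator of $N_\sigma/N_\tau$ lying in the image of $\sigma$. A tropical fan of dimension $d$ is a rational fan of pure dimension $d$ with $\sum_{\sigma\in\Sigma_d,\sigma\supset\tau}e^\tau_\sigma=0$ in $N^\tau$ for every $\tau\in\Sigma_{d-1}$. The product $\Sigma\times\Sigma'$ is the tropical fan in $(N\times N')_{\mathbb R}$ with cones $\sigma\times\sigma'$, $\sigma\in\Sigma$, $\sigma'\in\Sigma'$. **Poincaré duality and smoothness.** $\mathbf F_p(\sigma)=\sum_{\eta\in\Sigma,\eta\supseteq\sigma}\bigwedge^pN_\eta\subseteq\bigwedge^pN$, $\mathbf F^p(\sigma)=\mathrm{Hom}(\mathbf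 F_p(\sigma),\mathbb Z)$. Fix generators $\nu_\sigma$ of $\bigwedge^{\dim\sigma}N_\sigma$. The tropical Borel–Moore homology $H^{BM}_{p,q}(\Sigma)$ is the $q$-th homology of $C^{BM}_{p,q}(\Sigma)=\bigoplus_{\sigma\in\Sigma_q}\mathbf F_p(\sigma)$, with boundary the sum over codimension one faces $\tau\prec\sigma$ of $\mathrm{sign}(\tau,\sigma)$ times the inclusion $\mathbf F_p(\sigma)\subseteq\mathbf F_p(\tau)$, where $n\wedge\nu_\tau=\mathrm{sign}(\tau,\sigma)\nu_\sigma$ for any $n\in N_\sigma$ lifting $e^\tau_\sigma$. For a tropical fan of dimension $d$, $\nu_\Sigma=(\nu_\sigma)_{\sigma\in\Sigma_d}$ is a cycle, giving the fundamental class. The tropical cohomology is $H^{p,0}(\Sigma)=\mathbf F^p(\underline0)$ and $H^{p,q}(\Sigma)=0$ for $q\ne0$; the cap product with $\nu_\Sigma$ is $\mathbf F^p(\underline0)\to H^{BM}_{d-p,d}(\Sigma)$, $\alpha\mapsto(\iota_\alpha(\nu_\sigma))_\sigma$, with $\iota_\alpha$ the contraction ($\iota_\ell(v_1\wedge\dots\wedge v_k)=\sum_i(-1)^{i-1}\ell(v_i)v_1\wedge\dots\wedge\widehat{v_i}\wedge\dots\wedge v_k$, $\iota_{\ell\wedge\alpha}=\iota_\alpha\circ\iota_\ell$). $\Sigma$ satisfies Poincaré duality if $\cdot\frown\nu_\Sigma\colon H^{p,q}(\Sigma)\to H^{BM}_{d-p,d-q}(\Sigma)$ is an isomorphism for all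 $p,q$, i.e. $H^{BM}_{a,b}(\Sigma)=0$ for $b\ne d$ and $\mathbf F^p(\underline0)\to H^{BM}_{d-p,d}(\Sigma)$ is an isomorphism for all $p$. $\Sigma$ is smooth if $\Sigma^\sigma$ satisfies Poincaré duality for every $\sigma\in\Sigma$. *)

theory Defs
  imports
    "HOL-Analysis.Analysis"
    "HOL-Algebra.Elementary_Groups"
    "HOL-Combinatorics.Permutations"
    "HOL-Computational_Algebra.Group_Closure"
    "HOL-Library.Function_Algebras"
begin

section \<open>Lattices\<close>

text \<open>A free \<open>\<int>\<close>-module \<open>N\<close> of finite rank is realised as the subgroup generated by a linearly
  independent (hence finite) subset of a Euclidean space, so that \<open>N\<^sub>\<real>\<close> is \<open>span N\<close>. The rank may be
  smaller than the dimension of the ambient space, and it may be \<open>0\<close>.\<close>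

definition lattice_basis :: "'a::euclidean_space list \<Rightarrow> 'a set \<Rightarrow> bool" where
  "lattice_basis bs M \<longleftrightarrow> distinct bs \<and> independent (set bs) \<and> group_closure (set bs) = M"

definition lattice_subgroup :: "'a::euclidean_space set \<Rightarrow> bool" where
  "lattice_subgroup N \<longleftrightarrow> (\<exists>bs. lattice_basis bs N)"

definition sublattice :: "'a::euclidean_space set \<Rightarrow> 'a set \<Rightarrow> 'a set" where
  "sublattice N \<sigma> = N \<inter> span \<sigma>"

text \<open>The quotient \<open>N\<^sub>\<real> \<rightarrow> N\<^sub>\<real> / span \<sigma>\<close> is realised by the orthogonal projection along \<open>span \<sigma>\<close>, so
  that the quotient lattice \<open>N / (N \<inter> span \<sigma>)\<close> is the image of \<open>N\<close> in the orthogonal complement of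
  \<open>\<sigma>\<close>.\<close>

definition quot :: "'a::euclidean_space set \<Rightarrow> 'a \<Rightarrow> 'a" where
  "quot \<sigma> v = (THE w. w \<in> orthogonal_comp \<sigma> \<and> v - w \<in> span \<sigma>)"

section \<open>Tropical fans\<close>

definition rational_cone :: "'a::euclidean_space set \<Rightarrow> 'a set \<Rightarrow> bool" where
  "rational_cone N \<sigma> \<longleftrightarrow> (\<exists>S. finite S \<and> S \<subseteq> N \<and> \<sigma> = convex_cone hull S)"

definition strongly_convex :: "'a::euclidean_space set \<Rightarrow> bool" where
  "strongly_convex \<sigma> \<longleftrightarrow> \<sigma> \<inter> uminus ` \<sigma> = {0}"

text \<open>In the library, the empty set is a face of every convex set; it is not a face in the sense of
  fans.\<close>

definition rational_fan :: "'a::euclidean_space set \<Rightarrow> 'a set set \<Rightarrow> bool" where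
  "rational_fan N \<Sigma> \<longleftrightarrow>
     lattice_subgroup N \<and> finite \<Sigma> \<and> \<Sigma> \<noteq> {} \<and>
     (\<forall>\<sigma>\<in>\<Sigma>. rational_cone N \<sigma> \<and> strongly_convex \<sigma>) \<and>
     (\<forall>\<sigma>\<in>\<Sigma>. \<forall>\<tau>. \<tau> \<noteq> {} \<and> \<tau> face_of \<sigma> \<longrightarrow> \<tau> \<in> \<Sigma>) \<and>
     (\<forall>\<sigma>\<in>\<Sigma>. \<forall>\<tau>\<in>\<Sigma>. \<sigma> \<inter> \<tau> face_of \<sigma> \<and> \<sigma> \<inter> \<tau> face_of \<tau>)"

definition cones :: "'a::euclidean_space set set \<Rightarrow> int \<Rightarrow> 'a set set" where
  "cones \<Sigma> k = {\<sigma> \<in> \<Sigma>. int (dim \<sigma>) = k}"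

definition fan_dim :: "'a::euclidean_space set set \<Rightarrow> int" where
  "fan_dim \<Sigma> = int (Max (dim ` \<Sigma>))"

definition pure_dimensional :: "'a::euclidean_space set set \<Rightarrow> bool" where
  "pure_dimensional \<Sigma> \<longleftrightarrow> (\<forall>\<tau>\<in>\<Sigma>. \<exists>\<sigma>\<in>cones \<Sigma> (fan_dim \<Sigma>). \<tau> \<subseteq> \<sigma>)"

text \<open>For a face \<open>\<tau>\<close> of \<open>\<sigma>\<close> of codimension one, the generator of \<open>N\<^sub>\<sigma> / N\<^sub>\<tau>\<close> in the image of \<open>\<sigma>\<close>.\<close>

definition normal_gen :: "'a::euclidean_space set \<Rightarrow> 'a set \<Rightarrow> 'a set \<Rightarrow> 'a" where
  "normal_gen N \<tau> \<sigma> = (THE e. e \<in> quot \<tau> ` \<sigma> \<and> group_closure {e} = quot \<tau> ` sublattice N \<sigma>)"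

definition tropical_fan :: "'a::euclidean_space set \<Rightarrow> 'a set set \<Rightarrow> bool" where
  "tropical_fan N \<Sigma> \<longleftrightarrow>
     rational_fan N \<Sigma> \<and> pure_dimensional \<Sigma> \<and>
     (\<forall>\<tau>\<in>cones \<Sigma> (fan_dim \<Sigma> - 1).
        (\<Sum>\<sigma>\<in>{\<sigma> \<in> cones \<Sigma> (fan_dim \<Sigma>). \<tau> \<subseteq> \<sigma>}. normal_gen N \<tau> \<sigma>) = 0)"

definition star_fan :: "'a::euclidean_space set set \<Rightarrow> 'a set \<Rightarrow> 'a set set" where
  "star_fan \<Sigma> \<sigma> = (\<lambda>\<eta>. quot \<sigma> ` \<eta>) ` {\<eta> \<in> \<Sigma>. \<sigma> \<subseteq> \<eta>}"

definition product_fan ::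
  "'a::euclidean_space set set \<Rightarrow> 'b::euclidean_space set set \<Rightarrow> ('a \<times> 'b) set set" where
  "product_fan \<Sigma> \<Sigma>' = (\<lambda>(\<sigma>, \<sigma>'). \<sigma> \<times> \<sigma>') ` (\<Sigma> \<times> \<Sigma>')"

section \<open>Exterior powers\<close>

text \<open>The \<open>p\<close>-th exterior power of a real vector space is realised as a space of alternating
  \<open>p\<close>-linear forms on the dual space, \<open>v\<^sub>1 \<and> \<dots> \<and> v\<^sub>p\<close> being the form that takes
  \<open>\<phi>\<^sub>1, \<dots>, \<phi>\<^sub>p\<close> to the determinant of \<open>(\<phi>\<^sub>i (v\<^sub>j))\<close>. For a lattice \<open>M\<close>, the group \<open>\<And>\<^sup>p M\<close> is the subgroup
  generated by the \<open>v\<^sub>1 \<and> \<dots> \<and> v\<^sub>p\<close> with all \<open>v\<^sub>i\<close> in \<open>M\<close>, and the inclusion of a saturated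
  sublattice induces an inclusion of exterior powers. The degree \<open>p\<close> is an integer, and
  \<open>\<And>\<^sup>p M = 0\<close> for negative \<open>p\<close>.\<close>

type_synonym 'a multivector = "('a \<Rightarrow> real) list \<Rightarrow> real"

definition wedge :: "'a::euclidean_space list \<Rightarrow> 'a multivector" where
  "wedge vs = (\<lambda>\<phi>s.
     if length \<phi>s = length vs \<and> (\<forall>\<phi>\<in>set \<phi>s. linear \<phi>)
     then (\<Sum>\<pi> | \<pi> permutes {..<length vs}. of_int (sign \<pi>) * (\<Prod>i<length vs. (\<phi>s ! i) (vs ! \<pi> i)))
     else 0)"

definition exterior_power :: "int \<Rightarrow> 'a::euclidean_space set \<Rightarrow> 'a multivector set" where
  "exterior_power p M = group_closure {wedge vs |vs. int (length vs) = p \<and> set vs \<subseteq> M}"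

definition mv_scale :: "real \<Rightarrow> 'a multivector \<Rightarrow> 'a multivector" where
  "mv_scale c x = (\<lambda>\<phi>s. c * x \<phi>s)"

section \<open>Tropical homology and cohomology\<close>

text \<open>All groups of (multi)vectors, chains and homomorphisms below are groups of functions under
  pointwise addition; they are written as multiplicative group records, like \<^const>\<open>integer_group\<close>.\<close>

definition add_group :: "'a::ab_group_add set \<Rightarrow> 'a monoid" where
  "add_group A = \<lparr>carrier = A, monoid.mult = (+), one = 0\<rparr>"

text \<open>The group \<open>Hom(A, \<int>)\<close>; homomorphisms are extended by \<open>0\<close> outside \<open>A\<close>.\<close>

definition int_dual :: "'a::ab_group_add set \<Rightarrow> ('a \<Rightarrow> int) set" where
  "int_dual A = {\<alpha> \<in> hom (add_group A) integer_group. \<forall>x. x \<notin> A \<longrightarrow> \<alpha> x = 0}"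

definition F_lower ::
  "'a::euclidean_space set \<Rightarrow> 'a set set \<Rightarrow> int \<Rightarrow> 'a set \<Rightarrow> 'a multivector set" where
  "F_lower N \<Sigma> p \<sigma> = group_closure (\<Union>\<eta>\<in>{\<eta> \<in> \<Sigma>. \<sigma> \<subseteq> \<eta>}. exterior_power p (sublattice N \<eta>))"

definition F_upper ::
  "'a::euclidean_space set \<Rightarrow> 'a set set \<Rightarrow> int \<Rightarrow> 'a set \<Rightarrow> ('a multivector \<Rightarrow> int) set" where
  "F_upper N \<Sigma> p \<sigma> = int_dual (F_lower N \<Sigma> p \<sigma>)"

text \<open>The generator \<open>\<nu>\<^sub>\<sigma>\<close> of the top exterior power of \<open>N\<^sub>\<sigma>\<close> is fixed as the exterior product of an
  arbitrarily chosen basis of \<open>N\<^sub>\<sigma>\<close>.\<close>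

definition frame :: "'a::euclidean_space set \<Rightarrow> 'a set \<Rightarrow> 'a list" where
  "frame N \<sigma> = (SOME bs. lattice_basis bs (sublattice N \<sigma>))"

definition orientation :: "'a::euclidean_space set \<Rightarrow> 'a set \<Rightarrow> 'a multivector" where
  "orientation N \<sigma> = wedge (frame N \<sigma>)"

text \<open>Here \<open>wedge (n # frame N \<tau>)\<close> is \<open>n \<and> \<nu>\<^sub>\<tau>\<close>.\<close>

definition cone_sign :: "'a::euclidean_space set \<Rightarrow> 'a set \<Rightarrow> 'a set \<Rightarrow> int" where
  "cone_sign N \<tau> \<sigma> = (THE s. \<forall>n\<in>sublattice N \<sigma>. quot \<tau> n = normal_gen N \<tau> \<sigma> \<longrightarrow>
     wedge (n # frame N \<tau>) = mv_scale (of_int s) (orientation N \<sigma>))"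

definition BM_chains ::
  "'a::euclidean_space set \<Rightarrow> 'a set set \<Rightarrow> int \<Rightarrow> int \<Rightarrow> ('a set \<Rightarrow> 'a multivector) set" where
  "BM_chains N \<Sigma> p q =
     {c. (\<forall>\<sigma>\<in>cones \<Sigma> q. c \<sigma> \<in> F_lower N \<Sigma> p \<sigma>) \<and> (\<forall>\<sigma>. \<sigma> \<notin> cones \<Sigma> q \<longrightarrow> c \<sigma> = 0)}"

definition BM_boundary ::
  "'a::euclidean_space set \<Rightarrow> 'a set set \<Rightarrow> int \<Rightarrow> ('a set \<Rightarrow> 'a multivector) \<Rightarrow> 'a set \<Rightarrow> 'a multivector"
  where
  "BM_boundary N \<Sigma> q c = (\<lambda>\<tau>.
     if \<tau> \<in> cones \<Sigma> (q - 1)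
     then (\<Sum>\<sigma>\<in>{\<sigma> \<in> cones \<Sigma> q. \<tau> face_of \<sigma>}. mv_scale (of_int (cone_sign N \<tau> \<sigma>)) (c \<sigma>))
     else 0)"

definition BM_cycles ::
  "'a::euclidean_space set \<Rightarrow> 'a set set \<Rightarrow> int \<Rightarrow> int \<Rightarrow> ('a set \<Rightarrow> 'a multivector) set" where
  "BM_cycles N \<Sigma> p q = {c \<in> BM_chains N \<Sigma> p q. BM_boundary N \<Sigma> q c = 0}"

definition BM_boundaries ::
  "'a::euclidean_space set \<Rightarrow> 'a set set \<Rightarrow> int \<Rightarrow> int \<Rightarrow> ('a set \<Rightarrow> 'a multivector) set" where
  "BM_boundaries N \<Sigma> p q = BM_boundary N \<Sigma> (q + 1) ` BM_chains N \<Sigma> p (q + 1)"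

definition BM_homology ::
  "'a::euclidean_space set \<Rightarrow> 'a set set \<Rightarrow> int \<Rightarrow> int \<Rightarrow> ('a set \<Rightarrow> 'a multivector) set monoid" where
  "BM_homology N \<Sigma> p q = add_group (BM_cycles N \<Sigma> p q) Mod BM_boundaries N \<Sigma> p q"

definition trop_cohomology ::
  "'a::euclidean_space set \<Rightarrow> 'a set set \<Rightarrow> int \<Rightarrow> int \<Rightarrow> ('a multivector \<Rightarrow> int) monoid" where
  "trop_cohomology N \<Sigma> p q = add_group (if q = 0 then F_upper N \<Sigma> p {0} else {0})"

section \<open>Poincare duality and smoothness\<close>

text \<open>\<open>contract [\<ell>\<^sub>1, \<dots>, \<ell>\<^sub>p] [v\<^sub>1, \<dots>, v\<^sub>k]\<close> is the contraction of \<open>v\<^sub>1 \<and> \<dots> \<and> v\<^sub>k\<close> by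
  \<open>\<ell>\<^sub>1 \<and> \<dots> \<and> \<ell>\<^sub>p\<close>.\<close>

fun contract :: "('a::euclidean_space \<Rightarrow> real) list \<Rightarrow> 'a list \<Rightarrow> 'a multivector" where
  "contract [] vs = wedge vs"
| "contract (l # ls) vs =
     (\<Sum>i<length vs. mv_scale ((-1) ^ i * l (vs ! i)) (contract ls (take i vs @ drop (Suc i) vs)))"

text \<open>The basis of \<open>Hom(N\<^sub>\<sigma>, \<int>)\<close> dual to \<open>bs\<close>.\<close>

definition dual_frame :: "'a::euclidean_space list \<Rightarrow> ('a \<Rightarrow> real) list" where
  "dual_frame bs = map (\<lambda>b v. representation (set bs) v b) bs"

text \<open>The contraction of \<open>\<nu>\<^sub>\<sigma>\<close> by \<open>\<alpha> \<in> F\<^sup>p(0)\<close>. Let \<open>b\<^sub>1, \<dots>, b\<^sub>k\<close> be the chosen basis of \<open>N\<^sub>\<sigma>\<close>, and let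
  \<open>\<ell>\<^sub>1, \<dots>, \<ell>\<^sub>k\<close> be the dual basis. The restriction of \<open>\<alpha>\<close> to \<open>\<And>\<^sup>p N\<^sub>\<sigma>\<close> is the sum over
  \<open>I = {i\<^sub>1 < \<dots> < i\<^sub>p}\<close> of \<open>\<alpha>(b\<^sub>i\<^sub>1 \<and> \<dots> \<and> b\<^sub>i\<^sub>p)\<close> times \<open>\<ell>\<^sub>i\<^sub>1 \<and> \<dots> \<and> \<ell>\<^sub>i\<^sub>p\<close>, and the contraction is
  linear in \<open>\<alpha>\<close>.\<close>

definition contract_orientation ::
  "'a::euclidean_space set \<Rightarrow> int \<Rightarrow> ('a multivector \<Rightarrow> int) \<Rightarrow> 'a set \<Rightarrow> 'a multivector" where
  "contract_orientation N p \<alpha> \<sigma> =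
     (let bs = frame N \<sigma> in
      \<Sum>I | I \<subseteq> {..<length bs} \<and> int (card I) = p.
        mv_scale (of_int (\<alpha> (wedge (nths bs I)))) (contract (nths (dual_frame bs) I) bs))"

definition cap_product ::
  "'a::euclidean_space set \<Rightarrow> 'a set set \<Rightarrow> int \<Rightarrow> int \<Rightarrow>
    ('a multivector \<Rightarrow> int) \<Rightarrow> ('a set \<Rightarrow> 'a multivector) set" where
  "cap_product N \<Sigma> p q \<alpha> =
     (let d = fan_dim \<Sigma> in
      BM_boundaries N \<Sigma> (d - p) (d - q) #>\<^bsub>add_group (BM_cycles N \<Sigma> (d - p) (d - q))\<^esub>
        (if q = 0
         then (\<lambda>\<sigma>. if \<sigma> \<in> cones \<Sigma> d then contract_orientation N p \<alpha> \<sigma> else 0)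
         else 0))"

definition poincare_duality :: "'a::euclidean_space set \<Rightarrow> 'a set set \<Rightarrow> bool" where
  "poincare_duality N \<Sigma> \<longleftrightarrow>
     (\<forall>p q. cap_product N \<Sigma> p q
        \<in> iso (trop_cohomology N \<Sigma> p q) (BM_homology N \<Sigma> (fan_dim \<Sigma> - p) (fan_dim \<Sigma> - q)))"

definition smooth_fan :: "'a::euclidean_space set \<Rightarrow> 'a set set \<Rightarrow> bool" where
  "smooth_fan N \<Sigma> \<longleftrightarrow> (\<forall>\<sigma>\<in>\<Sigma>. poincare_duality (quot \<sigma> ` N) (star_fan \<Sigma> \<sigma>))"

end

theory Submission
  imports Defs "Jordan_Normal_Form.Determinant"
begin

hide_const (open) Determinant.det Matrix.mat Matrix.vec
no_notation Matrix.vec_index (infixl \<open>$\<close> 100)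

text \<open>The star of \<open>\<Sigma> \<times> \<Sigma>'\<close> at \<open>\<sigma> \<times> \<sigma>'\<close> is the product of the stars, so it suffices to compare
  Poincare duality of a product with Poincare duality of its factors. Since \<open>F\<^sub>p(\<sigma> \<times> \<sigma>')\<close> is the sum of
  the \<open>F\<^sub>a(\<sigma>) \<otimes> F\<^sub>b(\<sigma>')\<close> with \<open>a + b = p\<close>, the Borel--Moore complex of the product is, up to orientation
  signs, the tensor product of the complexes of the factors, with fundamental class the product of the
  fundamental classes, and cap products are compatible with tensor products up to sign.

  If both factors satisfy Poincare duality, their complexes are exact below the top degree, and as they
  consist of free groups of finite rank, contracting homotopies exist there. They push every cycle
  of the tensor product into the tensor product of the top cycles, which lies in the image of the
  cap product. Conversely, pairing the second factor with the dual basis of a fixed top-dimensional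
  cone \<open>\<sigma>'\<close> is a chain map (up to degree shift) from the product to the first factor that retracts \<open>z \<mapsto> z \<otimes> \<nu>'\<close>,
  so exactness and surjectivity of the cap product pass to the factors. Injectivity of the cap product
  holds for every pure-dimensional fan.\<close>

section \<open>Determinantal forms\<close>

text \<open>Multivectors are functions of lists of linear forms, so a chain is a function of pairs
  (cone, list of forms), and the tensor product of two complexes is a group of functions of two such
  variables. The groups \<open>F_lower\<close> are sums of exterior powers and may fail to be
  saturated, so an integral functional on them need not come from an integral form. It is therefore
  written as a real combination of evaluations at lists of forms; its contraction with every
  orientation is the same combination of the orientation with its first slots filled. Cap products
  of different fans are compared through these evaluation points, not through the frames, which are
  arbitrary choices. The retraction onto a factor is evaluation of the other variable at a top cone
  and the dual basis of its frame: a top cone is a facet of no cone, so boundaries vanish there, and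
  the coefficient group there is the exterior power of the lattice of the cone, so values are
  integers. The cycle condition on the fundamental chain enters through degree 0, where capping with
  the unit functional returns that chain.\<close>

definition remove_nth :: "nat \<Rightarrow> 'x list \<Rightarrow> 'x list" where
  "remove_nth i xs = take i xs @ drop (Suc i) xs"

lemma length_remove_nth: "i < length xs \<Longrightarrow> length (remove_nth i xs) = length xs - 1"
  by (auto simp: remove_nth_def)

lemma nth_remove_nth:
  "i < length xs \<Longrightarrow> j < length xs - 1 \<Longrightarrow> remove_nth i xs ! j = xs ! (if j < i then j else Suc j)"
  by (auto simp: remove_nth_def nth_append min_def)

lemma set_remove_nth_subset: "set (remove_nth i xs) \<subseteq> set xs"
  by (auto simp: remove_nth_def dest: in_set_takeD in_set_dropD)

lemma remove_nth_Cons_0 [simp]: "remove_nth 0 (x # xs) = xs"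
  by (simp add: remove_nth_def)

lemma remove_nth_Cons_Suc [simp]: "remove_nth (Suc i) (x # xs) = x # remove_nth i xs"
  by (simp add: remove_nth_def)

lemma map_remove_nth: "map f (remove_nth i xs) = remove_nth i (map f xs)"
  by (simp add: remove_nth_def take_map drop_map)

lemma remove_nth_append:
  "remove_nth i (xs @ ys) =
     (if i < length xs then remove_nth i xs @ ys else xs @ remove_nth (i - length xs) ys)"
  by (auto simp: remove_nth_def Suc_diff_le)

lemma sum_lessThan_add:
  fixes f :: "nat \<Rightarrow> 'b::comm_monoid_add"
  shows "(\<Sum>i<m + n. f i) = (\<Sum>i<m. f i) + (\<Sum>i<n. f (m + i))"
  by (induction n) (simp_all add: add.assoc)

lemma wedge_eq_0_length: "length \<phi>s \<noteq> length vs \<Longrightarrow> wedge vs \<phi>s = 0"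
  by (simp add: wedge_def)

lemma wedge_eq_0_nonlinear: "\<exists>\<phi>\<in>set \<phi>s. \<not> linear \<phi> \<Longrightarrow> wedge vs \<phi>s = 0"
  by (auto simp: wedge_def)

abbreviation pairing :: "'a list \<Rightarrow> ('a \<Rightarrow> real) list \<Rightarrow> real mat" where
  "pairing vs \<phi>s \<equiv> Matrix.mat (length vs) (length vs) (\<lambda>(i, j). (\<phi>s ! i) (vs ! j))"

text \<open>The definition of \<open>wedge\<close> is the Leibniz formula; as a matrix determinant,
  with rows for forms and columns for vectors, it admits Laplace expansion and vanishes on repeated
  rows or columns.\<close>

lemma wedge_eq_det:
  assumes "length \<phi>s = length vs" "\<forall>\<phi>\<in>set \<phi>s. linear \<phi>"
  shows "wedge vs \<phi>s = Determinant.det (pairing vs \<phi>s)"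
proof -
  have "Determinant.det (pairing vs \<phi>s) =
    (\<Sum>\<pi> | \<pi> permutes {0..<length vs}. of_int (sign \<pi>) *
       (\<Prod>i = 0..<length vs. pairing vs \<phi>s $$ (i, \<pi> i)))"
    by (subst det_def') auto
  also have "\<dots> = (\<Sum>\<pi> | \<pi> permutes {..<length vs}. of_int (sign \<pi>) *
       (\<Prod>i<length vs. (\<phi>s ! i) (vs ! \<pi> i)))"
    unfolding lessThan_atLeast0
    by (intro sum.cong refl arg_cong2[where f = "(*)"] prod.cong)
       (auto simp: permutes_in_image[of _ "{0..<length vs}", simplified] dest: permutes_in_image[of _ "{0..<length vs}"])
  finally show ?thesis using assms by (simp add: wedge_def)
qed

lemma wedge_Nil: "wedge [] \<phi>s = (if \<phi>s = [] then 1 else 0)"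
  by (simp add: wedge_def)

lemma wedge_Nil_right: "wedge vs [] = (if vs = [] then 1 else 0)"
  by (auto simp: wedge_def)

text \<open>Laplace expansion along the first row. Its summands have the shape of the recursion of
  \<open>contract\<close>, which later turns contraction by a form into insertion of that form as
  first argument.\<close>

lemma wedge_Cons_row:
  assumes "linear \<phi>"
  shows "wedge vs (\<phi> # \<phi>s) = (\<Sum>i<length vs. (-1) ^ i * \<phi> (vs ! i) * wedge (remove_nth i vs) \<phi>s)"
proof (cases "length vs = Suc (length \<phi>s) \<and> (\<forall>\<phi>\<in>set \<phi>s. linear \<phi>)")
  case False
  have "wedge vs (\<phi> # \<phi>s) = 0" using False by (auto simp: wedge_def)
  moreover have "wedge (remove_nth i vs) \<phi>s = 0" if "i < length vs" for i
    using False that by (auto simp: wedge_def length_remove_nth)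
  ultimately show ?thesis by simp
next
  case True
  define n where "n = length \<phi>s"
  have n: "length vs = Suc n" using True n_def by simp
  have "wedge vs (\<phi> # \<phi>s) = Determinant.det (pairing vs (\<phi> # \<phi>s))"
    by (rule wedge_eq_det) (use True assms in auto)
  also have "\<dots> = (\<Sum>j<length vs. pairing vs (\<phi> # \<phi>s) $$ (0, j) * cofactor (pairing vs (\<phi> # \<phi>s)) 0 j)"
    by (rule laplace_expansion_row) (auto simp: n)
  also have "\<dots> = (\<Sum>i<length vs. (-1) ^ i * \<phi> (vs ! i) * wedge (remove_nth i vs) \<phi>s)"
  proof (rule sum.cong[OF refl])
    fix j assume j: "j \<in> {..<length vs}"
    have "mat_delete (pairing vs (\<phi> # \<phi>s)) 0 j = pairing (remove_nth j vs) \<phi>s"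
      using j by (intro eq_matI) (auto simp: mat_delete_def n length_remove_nth nth_remove_nth)
    moreover have "wedge (remove_nth j vs) \<phi>s = Determinant.det (pairing (remove_nth j vs) \<phi>s)"
      by (rule wedge_eq_det) (use True j in \<open>auto simp: length_remove_nth\<close>)
    ultimately show "pairing vs (\<phi> # \<phi>s) $$ (0, j) * cofactor (pairing vs (\<phi> # \<phi>s)) 0 j =
        (-1) ^ j * \<phi> (vs ! j) * wedge (remove_nth j vs) \<phi>s"
      using j by (simp add: cofactor_def n)
  qed
  finally show ?thesis .
qed

text \<open>The column expansion drives inductions on the vectors, as the row expansion drives
  inductions on the forms.\<close>

lemma wedge_Cons_col:
  assumes "\<forall>\<phi>\<in>set \<phi>s. linear \<phi>"
  shows "wedge (v # vs) \<phi>s = (\<Sum>i<length \<phi>s. (-1) ^ i * (\<phi>s ! i) v * wedge vs (remove_nth i \<phi>s))"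
proof (cases "length \<phi>s = Suc (length vs)")
  case False
  have "wedge (v # vs) \<phi>s = 0" using False by (auto simp: wedge_def)
  moreover have "wedge vs (remove_nth i \<phi>s) = 0" if "i < length \<phi>s" for i
    using False that by (auto simp: wedge_def length_remove_nth)
  ultimately show ?thesis by simp
next
  case True
  define n where "n = length vs"
  have n: "length \<phi>s = Suc n" using True n_def by simp
  have "wedge (v # vs) \<phi>s = Determinant.det (pairing (v # vs) \<phi>s)"
    by (rule wedge_eq_det) (use True assms in auto)
  also have "\<dots> = (\<Sum>i<length \<phi>s. pairing (v # vs) \<phi>s $$ (i, 0) * cofactor (pairing (v # vs) \<phi>s) i 0)"
    by (rule laplace_expansion_column) (auto simp: n n_def)
  also have "\<dots> = (\<Sum>i<length \<phi>s. (-1) ^ i * (\<phi>s ! i) v * wedge vs (remove_nth i \<phi>s))"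
  proof (rule sum.cong[OF refl])
    fix j assume j: "j \<in> {..<length \<phi>s}"
    have "mat_delete (pairing (v # vs) \<phi>s) j 0 = pairing vs (remove_nth j \<phi>s)"
      using j by (intro eq_matI) (auto simp: mat_delete_def n n_def length_remove_nth nth_remove_nth)
    moreover have "wedge vs (remove_nth j \<phi>s) = Determinant.det (pairing vs (remove_nth j \<phi>s))"
      by (rule wedge_eq_det) (use True j assms set_remove_nth_subset in \<open>fastforce simp: length_remove_nth\<close>)+
    ultimately show "pairing (v # vs) \<phi>s $$ (j, 0) * cofactor (pairing (v # vs) \<phi>s) j 0 =
        (-1) ^ j * (\<phi>s ! j) v * wedge vs (remove_nth j \<phi>s)"
      using j by (simp add: cofactor_def n n_def)
  qed
  finally show ?thesis .
qed

lemma wedge_identical_rows: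
  assumes "i < length \<phi>s" "j < length \<phi>s" "i \<noteq> j" "\<phi>s ! i = \<phi>s ! j"
  shows "wedge vs \<phi>s = 0"
proof (cases "length \<phi>s = length vs \<and> (\<forall>\<phi>\<in>set \<phi>s. linear \<phi>)")
  case True
  have "Determinant.det (pairing vs \<phi>s) = 0"
    by (rule det_identical_rows[of _ "length vs" i j]) (use assms True in \<open>auto intro!: eq_vecI\<close>)
  then show ?thesis using True by (simp add: wedge_eq_det)
qed (auto simp: wedge_def)

lemma wedge_identical_cols:
  assumes "i < length vs" "j < length vs" "i \<noteq> j" "vs ! i = vs ! j"
  shows "wedge vs \<phi>s = 0"
proof (cases "length \<phi>s = length vs \<and> (\<forall>\<phi>\<in>set \<phi>s. linear \<phi>)")
  case True
  have "Determinant.det (pairing vs \<phi>s) = 0"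
    by (rule det_identical_columns[of _ "length vs" i j]) (use assms True in \<open>auto intro!: eq_vecI\<close>)
  then show ?thesis using True by (simp add: wedge_eq_det)
qed (auto simp: wedge_def)

lemma wedge_cong_on:
  assumes "length \<phi>s = length \<psi>s" "\<forall>\<phi>\<in>set \<phi>s. linear \<phi>" "\<forall>\<psi>\<in>set \<psi>s. linear \<psi>"
    "\<And>i v. i < length \<phi>s \<Longrightarrow> v \<in> set vs \<Longrightarrow> (\<phi>s ! i) v = (\<psi>s ! i) v"
  shows "wedge vs \<phi>s = wedge vs \<psi>s"
proof (cases "length \<phi>s = length vs")
  case True
  have "pairing vs \<phi>s = pairing vs \<psi>s"
    using assms(4) True by (intro eq_matI) auto
  then show ?thesis using assms True by (simp add: wedge_eq_det)
qed (use assms in \<open>auto simp: wedge_def\<close>)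

text \<open>Additivity and homogeneity in one row, packed into one equation. Induction over the rows
  above it: the first row is the same in all three determinants, and a non-linear form there makes
  all of them 0.\<close>

lemma wedge_row_add:
  assumes "linear \<phi>" "linear \<psi>"
  shows "wedge vs (\<alpha>s @ (\<lambda>v. \<phi> v + c * \<psi> v) # \<beta>s) =
    wedge vs (\<alpha>s @ \<phi> # \<beta>s) + c * wedge vs (\<alpha>s @ \<psi> # \<beta>s)"
proof (induction \<alpha>s arbitrary: vs)
  case Nil
  have l: "linear (\<lambda>v. \<phi> v + c * \<psi> v)"
    using linear_compose_add[OF assms(1) linear_compose_scale_right[OF assms(2), of c]] by simp
  show ?case
    by (simp add: wedge_Cons_row[OF l] wedge_Cons_row[OF assms(1)] wedge_Cons_row[OF assms(2)]
        sum_distrib_left sum.distrib[symmetric] algebra_simps)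
next
  case (Cons \<alpha> \<alpha>s)
  show ?case
  proof (cases "linear \<alpha>")
    case True
    then show ?thesis
      by (simp add: wedge_Cons_row[OF True] Cons.IH sum_distrib_left sum.distrib[symmetric] algebra_simps)
  next
    case False
    then show ?thesis by (simp add: wedge_eq_0_nonlinear)
  qed
qed

lemma wedge_col_add: "wedge (us @ (v + w) # ws) \<phi>s = wedge (us @ v # ws) \<phi>s + wedge (us @ w # ws) \<phi>s"
proof (cases "\<forall>\<phi>\<in>set \<phi>s. linear \<phi>")
  case False
  then show ?thesis by (simp add: wedge_eq_0_nonlinear)
next
  case True
  then show ?thesis
  proof (induction us arbitrary: \<phi>s)
    case Nil
    have "(\<phi>s ! i) (v + w) = (\<phi>s ! i) v + (\<phi>s ! i) w" if "i < length \<phi>s" for i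
      using Nil that by (simp add: linear_add)
    then show ?case
      by (simp add: wedge_Cons_col[OF Nil] sum.distrib[symmetric] algebra_simps)
  next
    case (Cons u us)
    have "wedge (us @ (v + w) # ws) (remove_nth i \<phi>s) =
        wedge (us @ v # ws) (remove_nth i \<phi>s) + wedge (us @ w # ws) (remove_nth i \<phi>s)" for i
      by (rule Cons.IH) (use Cons.prems set_remove_nth_subset in fastforce)
    then show ?case
      by (simp add: wedge_Cons_col[OF Cons.prems] sum.distrib[symmetric] algebra_simps)
  qed
qed

lemma wedge_col_scale: "wedge (us @ (c *\<^sub>R v) # ws) \<phi>s = c * wedge (us @ v # ws) \<phi>s"
proof (cases "\<forall>\<phi>\<in>set \<phi>s. linear \<phi>")
  case False
  then show ?thesis by (simp add: wedge_eq_0_nonlinear)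
next
  case True
  then show ?thesis
  proof (induction us arbitrary: \<phi>s)
    case Nil
    have "(\<phi>s ! i) (c *\<^sub>R v) = c * (\<phi>s ! i) v" if "i < length \<phi>s" for i
      using Nil that by (simp add: linear_scale)
    then show ?case
      by (simp add: wedge_Cons_col[OF Nil] sum_distrib_left algebra_simps)
  next
    case (Cons u us)
    have "wedge (us @ (c *\<^sub>R v) # ws) (remove_nth i \<phi>s) = c * wedge (us @ v # ws) (remove_nth i \<phi>s)" for i
      by (rule Cons.IH) (use Cons.prems set_remove_nth_subset in fastforce)
    then show ?case
      by (simp add: wedge_Cons_col[OF Cons.prems] sum_distrib_left algebra_simps)
  qed
qed

text \<open>Column expansion sees the tail only through its own wedges, so proportional tails stay
  proportional. This carries signs between frames past an extra vector.\<close>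

lemma wedge_Cons_scale:
  assumes "\<And>\<phi>s. wedge vs \<phi>s = c * wedge ws \<phi>s"
  shows "wedge (v # vs) \<phi>s = c * wedge (v # ws) \<phi>s"
proof (cases "\<forall>\<phi>\<in>set \<phi>s. linear \<phi>")
  case True
  show ?thesis
    by (simp add: wedge_Cons_col[OF True] assms sum_distrib_left algebra_simps)
qed (simp add: wedge_eq_0_nonlinear)

text \<open>Polarisation: the wedge with both neighbours replaced by their sum vanishes, and so do
  the terms with \<open>a\<close> twice and \<open>b\<close> twice, which leaves the two mixed
  terms.\<close>

lemma wedge_row_swap:
  assumes "linear a" "linear b"
  shows "wedge vs (\<alpha>s @ a # b # \<beta>s) = - wedge vs (\<alpha>s @ b # a # \<beta>s)"
proof -
  \<comment> \<open>The factor \<open>1\<close> keeps the sum in the syntactic shape of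
    \<open>wedge_row_add\<close>.\<close>
  let ?c = "\<lambda>v. a v + 1 * b v"
  have c: "linear ?c"
    using linear_compose_add[OF assms] by simp
  have z: "wedge vs (\<alpha>s @ x # x # \<beta>s) = 0" for x
    by (rule wedge_identical_rows[of "length \<alpha>s" _ "Suc (length \<alpha>s)"]) (auto simp: nth_append)
  have "0 = wedge vs (\<alpha>s @ ?c # ?c # \<beta>s)" by (simp only: z)
  also have "\<dots> = wedge vs (\<alpha>s @ a # ?c # \<beta>s) + wedge vs (\<alpha>s @ b # ?c # \<beta>s)"
    by (subst wedge_row_add[OF assms]) simp
  also have "wedge vs (\<alpha>s @ a # ?c # \<beta>s) = wedge vs (\<alpha>s @ a # b # \<beta>s)"
    using wedge_row_add[OF assms, of vs "\<alpha>s @ [a]" 1 \<beta>s] by (simp add: z)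
  also have "wedge vs (\<alpha>s @ b # ?c # \<beta>s) = wedge vs (\<alpha>s @ b # a # \<beta>s)"
    using wedge_row_add[OF assms, of vs "\<alpha>s @ [b]" 1 \<beta>s] by (simp add: z)
  finally show ?thesis by simp
qed

lemma wedge_col_swap: "wedge (us @ a # b # ws) \<phi>s = - wedge (us @ b # a # ws) \<phi>s"
proof -
  have z: "wedge (us @ x # x # ws) \<phi>s = 0" for x
    by (rule wedge_identical_cols[of "length us" _ "Suc (length us)"]) (auto simp: nth_append)
  have "0 = wedge (us @ (a + b) # (a + b) # ws) \<phi>s" by (simp only: z)
  also have "\<dots> = wedge (us @ a # (a + b) # ws) \<phi>s + wedge (us @ b # (a + b) # ws) \<phi>s"
    by (rule wedge_col_add)
  also have "wedge (us @ a # (a + b) # ws) \<phi>s = wedge (us @ a # b # ws) \<phi>s"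
    using wedge_col_add[of "us @ [a]" a b ws \<phi>s] by (simp add: z)
  also have "wedge (us @ b # (a + b) # ws) \<phi>s = wedge (us @ b # a # ws) \<phi>s"
    using wedge_col_add[of "us @ [b]" a b ws \<phi>s] by (simp add: z)
  finally show ?thesis by simp
qed

lemma wedge_row_move:
  assumes "linear a" "\<forall>\<alpha>\<in>set \<alpha>s. linear \<alpha>"
  shows "wedge vs (\<gamma>s @ \<alpha>s @ a # \<beta>s) = (-1) ^ length \<alpha>s * wedge vs (\<gamma>s @ a # \<alpha>s @ \<beta>s)"
  using assms(2)
proof (induction \<alpha>s arbitrary: \<gamma>s)
  case (Cons b \<alpha>s)
  show ?case
    using Cons.IH[of "\<gamma>s @ [b]"] Cons.prems wedge_row_swap[of b a vs \<gamma>s "\<alpha>s @ \<beta>s"] assms(1) by simp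
qed simp

lemma wedge_col_move: "wedge (ts @ us @ a # ws) \<phi>s = (-1) ^ length us * wedge (ts @ a # us @ ws) \<phi>s"
proof (induction us arbitrary: ts)
  case (Cons b us)
  show ?case
    using Cons.IH[of "ts @ [b]"] wedge_col_swap[of ts b a "us @ ws"] by simp
qed simp

text \<open>Each form of the second block passes all forms of the first. Exponents of this kind are
  the signs in the cap product on a product.\<close>

lemma wedge_row_block_move:
  assumes "\<forall>\<alpha>\<in>set \<alpha>s. linear \<alpha>" "\<forall>\<beta>\<in>set \<beta>s. linear \<beta>"
  shows "wedge vs (\<gamma>s @ \<alpha>s @ \<beta>s @ \<delta>s) =
    (-1) ^ (length \<alpha>s * length \<beta>s) * wedge vs (\<gamma>s @ \<beta>s @ \<alpha>s @ \<delta>s)"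
  using assms(2)
proof (induction \<beta>s arbitrary: \<gamma>s)
  case (Cons b \<beta>s)
  have "wedge vs (\<gamma>s @ \<alpha>s @ b # \<beta>s @ \<delta>s) = (-1) ^ length \<alpha>s * wedge vs ((\<gamma>s @ [b]) @ \<alpha>s @ \<beta>s @ \<delta>s)"
    using wedge_row_move[of b \<alpha>s vs \<gamma>s "\<beta>s @ \<delta>s"] assms(1) Cons.prems by simp
  also have "\<dots> = (-1) ^ length \<alpha>s * ((-1) ^ (length \<alpha>s * length \<beta>s) * wedge vs ((\<gamma>s @ [b]) @ \<beta>s @ \<alpha>s @ \<delta>s))"
    using Cons.IH[of "\<gamma>s @ [b]"] Cons.prems by simp
  finally show ?case by (simp add: power_add)
qed simp

lemma wedge_append_Cons_scale:
  assumes "\<And>\<phi>s. wedge vs \<phi>s = c * wedge ws \<phi>s"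
  shows "wedge (us @ vs) \<phi>s = c * wedge (us @ ws) \<phi>s"
  using assms by (induction us arbitrary: \<phi>s) (auto intro: wedge_Cons_scale)

section \<open>Alternating forms and the Cauchy--Binet expansion\<close>

text \<open>Adjacent swaps suffice: over the reals they already make a form with two equal
  neighbours vanish. Abstracting from \<open>wedge\<close> lets the expansion below freeze leading
  forms (\<open>alternating_form_Cons\<close>) and carry trailing ones along
  (\<open>alternating_form_wedge\<close>).\<close>

definition alternating_form :: "'a::euclidean_space multivector \<Rightarrow> bool" where
  "alternating_form g \<longleftrightarrow>
     (\<forall>\<alpha>s \<beta>s \<phi> \<psi> c. (\<forall>\<alpha>\<in>set (\<alpha>s @ \<beta>s). linear \<alpha>) \<longrightarrow> linear \<phi> \<longrightarrow> linear \<psi> \<longrightarrow>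
        g (\<alpha>s @ (\<lambda>v. \<phi> v + c * \<psi> v) # \<beta>s) = g (\<alpha>s @ \<phi> # \<beta>s) + c * g (\<alpha>s @ \<psi> # \<beta>s)) \<and>
     (\<forall>\<alpha>s \<beta>s \<phi> \<psi>. (\<forall>\<alpha>\<in>set (\<alpha>s @ \<beta>s). linear \<alpha>) \<longrightarrow> linear \<phi> \<longrightarrow> linear \<psi> \<longrightarrow>
        g (\<alpha>s @ \<phi> # \<psi> # \<beta>s) = - g (\<alpha>s @ \<psi> # \<phi> # \<beta>s))"

lemma alternating_form_addD:
  "alternating_form g \<Longrightarrow> \<forall>\<alpha>\<in>set (\<alpha>s @ \<beta>s). linear \<alpha> \<Longrightarrow> linear \<phi> \<Longrightarrow> linear \<psi> \<Longrightarrow>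
     g (\<alpha>s @ (\<lambda>v. \<phi> v + c * \<psi> v) # \<beta>s) = g (\<alpha>s @ \<phi> # \<beta>s) + c * g (\<alpha>s @ \<psi> # \<beta>s)"
  unfolding alternating_form_def by blast

lemma alternating_form_swapD:
  "alternating_form g \<Longrightarrow> \<forall>\<alpha>\<in>set (\<alpha>s @ \<beta>s). linear \<alpha> \<Longrightarrow> linear \<phi> \<Longrightarrow> linear \<psi> \<Longrightarrow>
     g (\<alpha>s @ \<phi> # \<psi> # \<beta>s) = - g (\<alpha>s @ \<psi> # \<phi> # \<beta>s)"
  unfolding alternating_form_def by blast

lemma alternating_formI:
  assumes "\<And>\<alpha>s \<beta>s \<phi> \<psi> c. \<forall>\<alpha>\<in>set (\<alpha>s @ \<beta>s). linear \<alpha> \<Longrightarrow> linear \<phi> \<Longrightarrow> linear \<psi> \<Longrightarrow>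
     g (\<alpha>s @ (\<lambda>v. \<phi> v + c * \<psi> v) # \<beta>s) = g (\<alpha>s @ \<phi> # \<beta>s) + c * g (\<alpha>s @ \<psi> # \<beta>s)"
    and "\<And>\<alpha>s \<beta>s \<phi> \<psi>. \<forall>\<alpha>\<in>set (\<alpha>s @ \<beta>s). linear \<alpha> \<Longrightarrow> linear \<phi> \<Longrightarrow> linear \<psi> \<Longrightarrow>
     g (\<alpha>s @ \<phi> # \<psi> # \<beta>s) = - g (\<alpha>s @ \<psi> # \<phi> # \<beta>s)"
  shows "alternating_form g"
  unfolding alternating_form_def using assms by blast

lemma alternating_form_wedge:
  fixes vs :: "'a::euclidean_space list"
  shows "alternating_form (\<lambda>\<phi>s. wedge vs (\<phi>s @ \<psi>s))"
proof (rule alternating_formI)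
  fix \<alpha>s \<beta>s :: "('a \<Rightarrow> real) list" and \<phi> \<psi> :: "'a \<Rightarrow> real" and c assume "linear \<phi>" "linear \<psi>"
  then show "wedge vs ((\<alpha>s @ (\<lambda>v. \<phi> v + c * \<psi> v) # \<beta>s) @ \<psi>s) =
      wedge vs ((\<alpha>s @ \<phi> # \<beta>s) @ \<psi>s) + c * wedge vs ((\<alpha>s @ \<psi> # \<beta>s) @ \<psi>s)"
    using wedge_row_add[of \<phi> \<psi> vs \<alpha>s c "\<beta>s @ \<psi>s"] by simp
next
  fix \<alpha>s \<beta>s :: "('a \<Rightarrow> real) list" and \<phi> \<psi> :: "'a \<Rightarrow> real" assume "linear \<phi>" "linear \<psi>"
  then show "wedge vs ((\<alpha>s @ \<phi> # \<psi> # \<beta>s) @ \<psi>s) = - wedge vs ((\<alpha>s @ \<psi> # \<phi> # \<beta>s) @ \<psi>s)"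
    using wedge_row_swap[of \<phi> \<psi> vs \<alpha>s "\<beta>s @ \<psi>s"] by simp
qed

lemma alternating_form_Cons:
  fixes \<gamma> :: "'a::euclidean_space \<Rightarrow> real"
  assumes g: "alternating_form g" and l: "linear \<gamma>"
  shows "alternating_form (\<lambda>\<phi>s. g (\<gamma> # \<phi>s))"
proof (rule alternating_formI)
  fix \<alpha>s \<beta>s :: "('a \<Rightarrow> real) list" and \<phi> \<psi> :: "'a \<Rightarrow> real" and c assume a: "\<forall>\<alpha>\<in>set (\<alpha>s @ \<beta>s). linear \<alpha>" "linear \<phi>" "linear \<psi>"
  then show "g (\<gamma> # \<alpha>s @ (\<lambda>v. \<phi> v + c * \<psi> v) # \<beta>s) = g (\<gamma> # \<alpha>s @ \<phi> # \<beta>s) + c * g (\<gamma> # \<alpha>s @ \<psi> # \<beta>s)"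
    using alternating_form_addD[OF g, of "\<gamma> # \<alpha>s" \<beta>s \<phi> \<psi> c] l by simp
  from a show "g (\<gamma> # \<alpha>s @ \<phi> # \<psi> # \<beta>s) = - g (\<gamma> # \<alpha>s @ \<psi> # \<phi> # \<beta>s)"
    using alternating_form_swapD[OF g, of "\<gamma> # \<alpha>s" \<beta>s \<phi> \<psi>] l by simp
qed

lemma alternating_form_add_Cons:
  "alternating_form g \<Longrightarrow> \<forall>\<beta>\<in>set \<beta>s. linear \<beta> \<Longrightarrow> linear \<phi> \<Longrightarrow> linear \<psi> \<Longrightarrow>
     g ((\<lambda>v. \<phi> v + c * \<psi> v) # \<beta>s) = g (\<phi> # \<beta>s) + c * g (\<psi> # \<beta>s)"
  using alternating_form_addD[of g "[]" \<beta>s \<phi> \<psi> c] by simp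

lemma alternating_form_swap_Cons:
  "alternating_form g \<Longrightarrow> \<forall>\<beta>\<in>set \<beta>s. linear \<beta> \<Longrightarrow> linear \<phi> \<Longrightarrow> linear \<psi> \<Longrightarrow>
     g (\<phi> # \<psi> # \<beta>s) = - g (\<psi> # \<phi> # \<beta>s)"
  using alternating_form_swapD[of g "[]" \<beta>s \<phi> \<psi>] by simp

lemma linear_add_scaled: "linear \<phi> \<Longrightarrow> linear \<psi> \<Longrightarrow> linear (\<lambda>v. \<phi> v + c * (\<psi> v :: real))"
  using linear_compose_add[of \<phi> "\<lambda>v. c *\<^sub>R \<psi> v"] linear_compose_scale_right[of \<psi> c] by simp

text \<open>Terms with two entries \<open>L\<close> vanish, so the expansion is linear in the coefficients \<open>c\<close>.\<close>

lemma alternating_form_expand_direction: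
  assumes "alternating_form g" "linear L" "\<forall>\<phi>\<in>set \<phi>s. linear (P \<phi>)"
  shows "g (map (\<lambda>\<phi> v. P \<phi> v + c \<phi> * L v) \<phi>s) =
    g (map P \<phi>s) + (\<Sum>i<length \<phi>s. (-1) ^ i * c (\<phi>s ! i) * g (L # map P (remove_nth i \<phi>s)))"
  using assms
proof (induction \<phi>s arbitrary: g)
  case Nil
  then show ?case by simp
next
  case (Cons \<phi> \<phi>s)
  let ?Q = "\<lambda>\<phi> v. P \<phi> v + c \<phi> * L v"
  have Q: "\<forall>\<beta>\<in>set (map ?Q \<phi>s). linear \<beta>" and P: "\<forall>\<beta>\<in>set (map P \<phi>s). linear \<beta>"
    using Cons.prems by (auto intro: linear_add_scaled)
  have P': "\<forall>\<beta>\<in>set (map P (remove_nth i \<phi>s)). linear \<beta>" for i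
    using P set_remove_nth_subset[of i "map P \<phi>s"] by (auto simp: map_remove_nth)
  have LL: "g (L # L # \<beta>s) = 0" if "\<forall>\<beta>\<in>set \<beta>s. linear \<beta>" for \<beta>s
    using alternating_form_swap_Cons[OF Cons.prems(1) that Cons.prems(2) Cons.prems(2)] by simp
  have "g (map ?Q (\<phi> # \<phi>s)) = g (P \<phi> # map ?Q \<phi>s) + c \<phi> * g (L # map ?Q \<phi>s)"
    using alternating_form_add_Cons[OF Cons.prems(1) Q] Cons.prems by simp
  also have "g (L # map ?Q \<phi>s) = g (L # map P \<phi>s)"
    using Cons.IH[OF alternating_form_Cons[OF Cons.prems(1,2)] Cons.prems(2)] Cons.prems(3)
    by (simp add: LL[OF P'])
  also have "g (P \<phi> # map ?Q \<phi>s) = g (P \<phi> # map P \<phi>s) +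
      (\<Sum>i<length \<phi>s. (-1) ^ i * c (\<phi>s ! i) * g (P \<phi> # L # map P (remove_nth i \<phi>s)))"
    using Cons.IH[OF alternating_form_Cons[OF Cons.prems(1)] Cons.prems(2)] Cons.prems(3) by simp
  \<comment> \<open>Bringing \<open>L\<close> to the front past \<open>P \<phi>\<close> costs one
    sign, which is the shift of the index from \<open>i\<close> to \<open>Suc i\<close>.\<close>
  also have "(\<Sum>i<length \<phi>s. (-1) ^ i * c (\<phi>s ! i) * g (P \<phi> # L # map P (remove_nth i \<phi>s))) =
      (\<Sum>i<length \<phi>s. (-1) ^ Suc i * c (\<phi>s ! i) * g (L # P \<phi> # map P (remove_nth i \<phi>s)))"
    by (rule sum.cong[OF refl], subst alternating_form_swap_Cons[OF Cons.prems(1) P'])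
       (use Cons.prems in auto)
  finally show ?case
    by (simp del: sum.lessThan_Suc add: sum.lessThan_Suc_shift)
qed

text \<open>The pullback of \<open>\<phi>\<close> along the map sending v to the sum of the L_i(v)
  b_i. For dual lists this map projects onto the span of \<open>bs\<close>, so the pullback agrees
  with \<open>\<phi>\<close> there while involving only the forms \<open>Ls\<close>.\<close>

definition dual_projection :: "'a::euclidean_space list \<Rightarrow> ('a \<Rightarrow> real) list \<Rightarrow> ('a \<Rightarrow> real) \<Rightarrow> 'a \<Rightarrow> real" where
  "dual_projection bs Ls \<phi> = (\<lambda>v. \<Sum>(b, L)\<leftarrow>zip bs Ls. \<phi> b * L v)"

lemma linear_dual_projection: "\<forall>L\<in>set Ls. linear L \<Longrightarrow> linear (dual_projection bs Ls \<phi>)"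
proof (induction Ls arbitrary: bs)
  case Nil
  then show ?case by (simp add: dual_projection_def linear_zero)
next
  case (Cons L Ls)
  then show ?case
    by (cases bs) (auto simp: dual_projection_def linear_zero add.commute[of "_ * L _"]
        intro!: linear_add_scaled)
qed

text \<open>Splitting index sets by whether they contain 0 matches the recursion of
  \<open>nths\<close> on a nonempty list, so sums over minors can be treated by induction on the
  list.\<close>

lemma sum_subsets_Suc:
  fixes f :: "nat set \<Rightarrow> 'b::comm_monoid_add"
  shows "(\<Sum>I | I \<subseteq> {..<Suc n} \<and> card I = p. f I) =
    (\<Sum>I | I \<subseteq> {..<n} \<and> Suc (card I) = p. f (insert 0 (Suc ` I))) +
    (\<Sum>I | I \<subseteq> {..<n} \<and> card I = p. f (Suc ` I))"
proof -
  let ?S = "{I. I \<subseteq> {..<Suc n} \<and> card I = p}"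
  let ?A = "{I. I \<subseteq> {..<n} \<and> Suc (card I) = p}"
  let ?B = "{I. I \<subseteq> {..<n} \<and> card I = p}"
  have fin: "finite I" if "I \<subseteq> {..<m}" for I :: "nat set" and m using that finite_subset by blast
  have A: "bij_betw (\<lambda>I. insert 0 (Suc ` I)) ?A {I\<in>?S. 0 \<in> I}"
  proof (rule bij_betw_byWitness[where f' = "\<lambda>I. {i. Suc i \<in> I}"])
    have "insert 0 (Suc ` {i. Suc i \<in> I}) = I" if "0 \<in> I" for I
      using that by (auto simp: image_iff) (metis not0_implies_Suc)
    then show "\<forall>I\<in>{I \<in> ?S. 0 \<in> I}. insert 0 (Suc ` {i. Suc i \<in> I}) = I" by auto
    show "(\<lambda>I. {i. Suc i \<in> I}) ` {I \<in> ?S. 0 \<in> I} \<subseteq> ?A"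
    proof clarsimp
      fix I assume I: "I \<subseteq> {..<Suc n}" "0 \<in> I" "p = card I"
      have e: "insert 0 (Suc ` {i. Suc i \<in> I}) = I"
        using I by (auto simp: image_iff) (metis not0_implies_Suc)
      have f: "finite {i. Suc i \<in> I}" using fin[OF I(1)] by (simp add: finite_vimageI vimage_def[symmetric])
      have "card (insert 0 (Suc ` {i. Suc i \<in> I})) = Suc (card {i. Suc i \<in> I})"
        using f by (subst card_insert_disjoint) (auto simp: card_image)
      then show "{i. Suc i \<in> I} \<subseteq> {..<n} \<and> Suc (card {i. Suc i \<in> I}) = card I"
        using I e by auto
    qed
  qed (auto simp: card_insert_if card_image fin)
  have B: "bij_betw (\<lambda>I. Suc ` I) ?B {I\<in>?S. 0 \<notin> I}"
  proof (rule bij_betw_byWitness[where f' = "\<lambda>I. {i. Suc i \<in> I}"])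
    have e: "Suc ` {i. Suc i \<in> I} = I" if "0 \<notin> I" for I
      using that by (auto simp: image_iff) (metis not0_implies_Suc)
    then show "\<forall>I\<in>{I \<in> ?S. 0 \<notin> I}. Suc ` {i. Suc i \<in> I} = I" by auto
    show "(\<lambda>I. {i. Suc i \<in> I}) ` {I \<in> ?S. 0 \<notin> I} \<subseteq> ?B"
    proof clarsimp
      fix I assume I: "I \<subseteq> {..<Suc n}" "0 \<notin> I" "p = card I"
      have "card (Suc ` {i. Suc i \<in> I}) = card {i. Suc i \<in> I}" by (simp add: card_image)
      then show "{i. Suc i \<in> I} \<subseteq> {..<n} \<and> card {i. Suc i \<in> I} = card I"
        using I e by auto
    qed
  qed (auto simp: card_image)
  have "finite ?S" by (rule finite_subset[of _ "Pow {..<Suc n}"]) auto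
  then have "sum f ?S = sum f {I\<in>?S. 0 \<in> I} + sum f {I\<in>?S. 0 \<notin> I}"
    by (subst sum.union_disjoint[symmetric]) (auto intro!: sum.cong)
  then show ?thesis
    using sum.reindex_bij_betw[OF A, of f] sum.reindex_bij_betw[OF B, of f] by simp
qed

lemma nths_Cons_insert_0: "nths (x # xs) (insert 0 (Suc ` I)) = x # nths xs I"
proof -
  have "{j. Suc j \<in> insert 0 (Suc ` I)} = I" by auto
  then show ?thesis by (simp only: nths_Cons) simp
qed

lemma nths_Cons_Suc_image: "nths (x # xs) (Suc ` I) = nths xs I"
proof -
  have "{j. Suc j \<in> Suc ` I} = I" by auto
  then show ?thesis by (simp only: nths_Cons) simp
qed

text \<open>Cauchy--Binet. Splitting off the heads \<open>b\<close> and \<open>L\<close> adds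
  \<phi>(b) L to each projected form. The terms free of \<open>L\<close> belong to index sets
  without 0, the terms with \<open>L\<close> to index sets containing 0, whose minors are recovered
  by expansion along the column of \<open>b\<close>.\<close>

lemma alternating_form_expand:
  assumes "alternating_form g" "\<forall>\<phi>\<in>set \<phi>s. linear \<phi>" "\<forall>L\<in>set Ls. linear L" "length bs = length Ls"
  shows "g (map (dual_projection bs Ls) \<phi>s) =
    (\<Sum>I | I \<subseteq> {..<length bs} \<and> card I = length \<phi>s. wedge (nths bs I) \<phi>s * g (nths Ls I))"
  using assms(4,1,2,3)
proof (induction bs Ls arbitrary: g \<phi>s rule: list_induct2)
  case Nil
  have *: "{I :: nat set. I = {} \<and> card I = p} = (if p = 0 then {{}} else {})" for p by auto
  show ?case
  proof (cases \<phi>s)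
    case (Cons \<phi> \<phi>s')
    have "linear (\<lambda>v :: 'a. 0 :: real)" by (rule linear_zero)
    \<comment> \<open>Over empty lists every projected form is 0, and additivity applied to 0 + 1 *
      0 says that the value equals twice itself.\<close>
    from alternating_form_add_Cons[OF Nil(1) _ this this, of "map (dual_projection [] []) \<phi>s'" 1]
    have "g ((\<lambda>v. 0) # map (dual_projection [] []) \<phi>s') = 0"
      by (simp add: linear_dual_projection)
    moreover have "dual_projection [] [] = (\<lambda>\<phi> :: 'a \<Rightarrow> real. \<lambda>v. 0)"
      by (simp add: dual_projection_def fun_eq_iff)
    ultimately show ?thesis using Cons by (simp add: *)
  qed (simp add: * wedge_Nil)
next
  case (Cons b bs L Ls)
  let ?P = "dual_projection bs Ls"
  have L: "linear L" and Ls: "\<forall>L\<in>set Ls. linear L" using Cons.prems by auto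
  have lP: "linear (?P \<phi>)" for \<phi> by (rule linear_dual_projection[OF Ls])
  have R: "\<forall>\<phi>\<in>set (remove_nth i \<phi>s). linear \<phi>" for i
    using Cons.prems(2) set_remove_nth_subset by fastforce
  have "g (map (dual_projection (b # bs) (L # Ls)) \<phi>s) = g (map (\<lambda>\<phi> v. ?P \<phi> v + \<phi> b * L v) \<phi>s)"
  proof -
    have "dual_projection (b # bs) (L # Ls) = (\<lambda>\<phi> v. ?P \<phi> v + \<phi> b * L v)"
      by (simp add: dual_projection_def fun_eq_iff)
    then show ?thesis by simp
  qed
  also have "\<dots> = g (map ?P \<phi>s) + (\<Sum>i<length \<phi>s. (-1) ^ i * (\<phi>s ! i) b * g (L # map ?P (remove_nth i \<phi>s)))"
    by (rule alternating_form_expand_direction[OF Cons.prems(1) L, where c = "\<lambda>\<phi>. \<phi> b"]) (simp add: lP)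
  also have "g (map ?P \<phi>s) = (\<Sum>I | I \<subseteq> {..<length bs} \<and> card I = length \<phi>s. wedge (nths bs I) \<phi>s * g (nths Ls I))"
    by (rule Cons.IH[OF Cons.prems(1,2) Ls])
  also have "(\<Sum>i<length \<phi>s. (-1) ^ i * (\<phi>s ! i) b * g (L # map ?P (remove_nth i \<phi>s))) =
      (\<Sum>i<length \<phi>s. \<Sum>I | I \<subseteq> {..<length bs} \<and> Suc (card I) = length \<phi>s.
         (-1) ^ i * (\<phi>s ! i) b * (wedge (nths bs I) (remove_nth i \<phi>s) * g (L # nths Ls I)))"
  proof (rule sum.cong[OF refl])
    fix i assume "i \<in> {..<length \<phi>s}"
    then have i: "i < length \<phi>s" by simp
    have e: "{I. I \<subseteq> {..<length bs} \<and> card I = length (remove_nth i \<phi>s)} =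
        {I. I \<subseteq> {..<length bs} \<and> Suc (card I) = length \<phi>s}"
      using i by (auto simp: length_remove_nth)
    show "(-1) ^ i * (\<phi>s ! i) b * g (L # map ?P (remove_nth i \<phi>s)) =
      (\<Sum>I | I \<subseteq> {..<length bs} \<and> Suc (card I) = length \<phi>s.
         (-1) ^ i * (\<phi>s ! i) b * (wedge (nths bs I) (remove_nth i \<phi>s) * g (L # nths Ls I)))"
      using Cons.IH[OF alternating_form_Cons[OF Cons.prems(1) L] R[of i] Ls]
      by (simp add: e sum_distrib_left)
  qed
  \<comment> \<open>After the exchange of sums, the inner one is the column expansion of the minor
    that contains \<open>b\<close>.\<close>
  also have "\<dots> = (\<Sum>I | I \<subseteq> {..<length bs} \<and> Suc (card I) = length \<phi>s.
      wedge (b # nths bs I) \<phi>s * g (L # nths Ls I))"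
    by (subst sum.swap) (simp add: wedge_Cons_col[OF Cons.prems(2)] sum_distrib_right mult.assoc)
  finally show ?case
    by (simp add: sum_subsets_Suc nths_Cons_insert_0 nths_Cons_Suc_image add.commute)
qed

hide_const (open) Matrix.orthogonal

section \<open>Subgroups and lattices\<close>

definition add_subgroup :: "'b::ab_group_add set \<Rightarrow> bool" where
  "add_subgroup H \<longleftrightarrow> 0 \<in> H \<and> (\<forall>x\<in>H. \<forall>y\<in>H. x - y \<in> H)"

lemma add_subgroup_zero: "add_subgroup H \<Longrightarrow> 0 \<in> H"
  and add_subgroup_diff: "add_subgroup H \<Longrightarrow> x \<in> H \<Longrightarrow> y \<in> H \<Longrightarrow> x - y \<in> H"
  by (auto simp: add_subgroup_def)

lemma add_subgroup_minus: "add_subgroup H \<Longrightarrow> x \<in> H \<Longrightarrow> - x \<in> H"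
  using add_subgroup_diff[of H 0 x] by (simp add: add_subgroup_zero)

lemma add_subgroup_add: "add_subgroup H \<Longrightarrow> x \<in> H \<Longrightarrow> y \<in> H \<Longrightarrow> x + y \<in> H"
  using add_subgroup_diff[of H x "- y"] by (simp add: add_subgroup_minus)

lemma add_subgroup_sum: "add_subgroup H \<Longrightarrow> (\<And>i. i \<in> I \<Longrightarrow> f i \<in> H) \<Longrightarrow> sum f I \<in> H"
  by (induction I rule: infinite_finite_induct) (auto intro: add_subgroup_zero add_subgroup_add)

lemma add_subgroup_group_closure: "add_subgroup (group_closure S)"
  by (auto simp: add_subgroup_def intro: group_closure.diff)

lemma group_closure_superset: "S \<subseteq> group_closure S"
  by (auto intro: group_closure.base)

lemma group_closure_minimal: "S \<subseteq> H \<Longrightarrow> add_subgroup H \<Longrightarrow> group_closure S \<subseteq> H"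
proof
  fix x assume "S \<subseteq> H" "add_subgroup H" "x \<in> group_closure S"
  from this(3) show "x \<in> H"
    by induction (use \<open>S \<subseteq> H\<close> \<open>add_subgroup H\<close> in \<open>auto simp: add_subgroup_def\<close>)
qed

lemma group_closure_mono: "S \<subseteq> T \<Longrightarrow> group_closure S \<subseteq> group_closure T"
  by (rule group_closure_minimal) (use group_closure_superset in \<open>auto simp: add_subgroup_group_closure\<close>)

lemma add_subgroup_image:
  assumes "add_subgroup H" "\<And>x y. x \<in> H \<Longrightarrow> y \<in> H \<Longrightarrow> f (x - y) = f x - f y"
  shows "add_subgroup (f ` H)"
  using assms by (auto simp: add_subgroup_def image_iff) (metis diff_self)+

lemma group_closure_image:
  assumes "\<And>x y. f (x - y) = f x - f y"
  shows "f ` group_closure S = group_closure (f ` S)"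
proof
  have f0: "f 0 = 0" using assms[of 0 0] by simp
  show "f ` group_closure S \<subseteq> group_closure (f ` S)"
  proof clarify
    fix x assume "x \<in> group_closure S"
    then show "f x \<in> group_closure (f ` S)"
      by induction (auto simp: assms f0 intro: group_closure.intros)
  qed
  show "group_closure (f ` S) \<subseteq> f ` group_closure S"
    by (rule group_closure_minimal)
       (use group_closure_superset in \<open>auto intro!: add_subgroup_image add_subgroup_group_closure assms\<close>)
qed

text \<open>Abstract in the scalar action, so that the same lattice argument serves Euclidean
  vectors (\<open>scaleR\<close>) and real functions with pointwise scaling
  (\<open>real_fun\<close>), the home of multivectors and chains.\<close>

locale real_space = vector_space scale for scale :: "real \<Rightarrow> 'b::ab_group_add \<Rightarrow> 'b"
begin

lemma add_subgroup_scale_int: "add_subgroup H \<Longrightarrow> x \<in> H \<Longrightarrow> scale (of_int m) x \<in> H"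
proof (induction m rule: int_induct[of _ 0])
  case (step1 i)
  then show ?case using add_subgroup_add[of H "scale (of_int i) x" x] by (simp add: scale_left_distrib)
next
  case (step2 i)
  then show ?case using add_subgroup_diff[of H "scale (of_int i) x" x] by (simp add: scale_left_diff_distrib)
qed (simp add: add_subgroup_zero)

lemma group_closure_subset_span: "group_closure B \<subseteq> span B"
  by (rule group_closure_minimal) (auto simp: add_subgroup_def span_base span_zero intro: span_diff)

text \<open>Integer-valued linear functionals that separate the points of a subgroup make it discrete.
  The induction splits off one functional at a time.\<close>

lemma subgroup_basis:
  assumes "finite S" "add_subgroup H"
    and "\<And>f x y. f \<in> S \<Longrightarrow> f (x + y) = f x + f y" "\<And>f r x. f \<in> S \<Longrightarrow> f (scale r x) = r * f x"
    and "\<And>f h. f \<in> S \<Longrightarrow> h \<in> H \<Longrightarrow> f h \<in> \<int>"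
    and "\<And>h. h \<in> H \<Longrightarrow> (\<And>f. f \<in> S \<Longrightarrow> f h = 0) \<Longrightarrow> h = 0"
  shows "\<exists>B. finite B \<and> independent B \<and> group_closure B = H"
  using assms
proof (induction S arbitrary: H rule: finite_induct)
  case empty
  then have "H = {0}" using add_subgroup_zero[of H] by auto
  then show ?case by (intro exI[of _ "{}"]) (auto simp: independent_empty)
next
  case (insert f S)
  have add: "f (x + y) = f x + f y" and sc: "f (scale r x) = r * f x" for x y r
    using insert.prems by auto
  have sub: "f (x - y) = f x - f y" for x y
    using add[of x "scale (-1) y"] sc[of "-1" y] by simp
  have f0: "f 0 = 0" using sub[of 0 0] by simp
  define H0 where "H0 = {h\<in>H. f h = 0}"
  have H0: "add_subgroup H0"
    using insert.prems(1) by (auto simp: H0_def add_subgroup_def sub f0)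
  have "\<exists>B. finite B \<and> independent B \<and> group_closure B = H0"
  proof (rule insert.IH[OF H0])
    fix h assume h: "h \<in> H0" "\<And>g. g \<in> S \<Longrightarrow> g h = 0"
    then show "h = 0"
      using insert.prems(5)[of h] by (auto simp: H0_def)
  qed (use insert.prems in \<open>auto simp: H0_def\<close>)
  then obtain B where B: "finite B" "independent B" "group_closure B = H0" by auto
  show ?case
  proof (cases "H = H0")
    case True
    then show ?thesis using B by auto
  next
    case False
    \<comment> \<open>The values of \<open>f\<close> on \<open>H\<close> form a nonzero group of
      integers; its least positive element \<open>k\<close>, attained at \<open>h0\<close>,
      generates it.\<close>
    define K where "K k \<longleftrightarrow> k > 0 \<and> (\<exists>h\<in>H. f h = real k)" for k :: nat
    obtain h1 where h1: "h1 \<in> H" "f h1 \<noteq> 0" using False by (auto simp: H0_def)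
    then obtain m where m: "f h1 = of_int m" using insert.prems(4)[of f h1] by (auto elim: Ints_cases)
    have "K (nat \<bar>m\<bar>)"
    proof (cases "m > 0")
      case True
      then show ?thesis using h1 m by (auto simp: K_def intro!: bexI[of _ h1])
    next
      case False
      have "f (- h1) = - f h1" using sub[of 0 h1] by (simp add: f0)
      then show ?thesis
        using False h1 m add_subgroup_minus[OF insert.prems(1)]
        by (auto simp: K_def intro!: bexI[of _ "- h1"])
    qed
    define k where "k = (LEAST k. K k)"
    have "K k" unfolding k_def by (rule LeastI) fact
    then obtain h0 where h0: "h0 \<in> H" "f h0 = real k" "k > 0" by (auto simp: K_def)
    have least: "\<not> K j" if "j < k" for j using not_less_Least that unfolding k_def by blast
    \<comment> \<open>Division with remainder: a positive remainder would be a value of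
      \<open>f\<close> below \<open>k\<close>.\<close>
    have dec: "\<exists>q. h - scale (of_int q) h0 \<in> H0" if h: "h \<in> H" for h
    proof -
      obtain a where a: "f h = of_int a" using insert.prems(4)[of f h] h by (auto elim: Ints_cases)
      define q where "q = a div int k"
      have mem: "h - scale (of_int q) h0 \<in> H"
        by (intro add_subgroup_diff insert.prems(1) h add_subgroup_scale_int h0)
      have "a = q * int k + a mod int k" by (simp add: q_def)
      then have "(of_int a :: real) = of_int q * real k + of_int (a mod int k)"
        by (metis of_int_add of_int_mult of_int_of_nat_eq)
      then have val: "f (h - scale (of_int q) h0) = of_int (a mod int k)"
        by (simp add: sub sc a h0)
      have "0 \<le> a mod int k" "a mod int k < int k" using h0 by auto
      then have "\<not> a mod int k > 0"
        using least[of "nat (a mod int k)"] mem val by (auto simp: K_def nat_less_iff)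
      then have "a mod int k = 0" using \<open>0 \<le> a mod int k\<close> by simp
      then show ?thesis using mem val by (auto simp: H0_def)
    qed
    \<comment> \<open>\<open>f\<close> separates \<open>h0\<close> from the real span of
      \<open>B\<close>, so the enlarged basis is independent over \<real> and not merely over
      \<int>.\<close>
    have "\<forall>x\<in>span B. f x = 0"
    proof
      fix x assume "x \<in> span B"
      then show "f x = 0"
        by (induction rule: span_induct_alt)
           (use B group_closure_superset[of B] in \<open>auto simp: add sc f0 H0_def\<close>)
    qed
    then have "h0 \<notin> span B" using h0 by auto
    moreover have "group_closure (insert h0 B) = H"
    proof
      show "group_closure (insert h0 B) \<subseteq> H"
        using h0 B group_closure_superset[of B] by (intro group_closure_minimal insert.prems) (auto simp: H0_def)
      show "H \<subseteq> group_closure (insert h0 B)"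
      proof
        fix h assume "h \<in> H"
        then obtain q where q: "h - scale (of_int q) h0 \<in> H0" using dec by blast
        then have "h - scale (of_int q) h0 \<in> group_closure (insert h0 B)"
          using B group_closure_mono[of B "insert h0 B"] by auto
        moreover have "scale (of_int q) h0 \<in> group_closure (insert h0 B)"
          by (intro add_subgroup_scale_int add_subgroup_group_closure) (auto intro: group_closure.base)
        ultimately show "h \<in> group_closure (insert h0 B)"
          using group_closure_add by (metis diff_add_cancel)
      qed
    qed
    ultimately show ?thesis
      using B by (intro exI[of _ "insert h0 B"]) (auto simp: independent_insert)
  qed
qed

end

interpretation scaleR: real_space "scaleR :: real \<Rightarrow> 'a::real_vector \<Rightarrow> 'a"
  by unfold_locales

lemma scaleR_subgroup_basis:
  fixes H :: "'a::euclidean_space set" and S :: "('a \<Rightarrow> real) set"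
  assumes "finite S" "add_subgroup H" "\<And>f. f \<in> S \<Longrightarrow> linear f"
    and "\<And>f h. f \<in> S \<Longrightarrow> h \<in> H \<Longrightarrow> f h \<in> \<int>"
    and "\<And>h. h \<in> H \<Longrightarrow> (\<And>f. f \<in> S \<Longrightarrow> f h = 0) \<Longrightarrow> h = 0"
  shows "lattice_subgroup H"
proof -
  have "\<exists>B. finite B \<and> independent B \<and> group_closure B = H"
    by (rule scaleR.subgroup_basis[OF assms(1,2)])
       (use assms in \<open>auto simp: linear_add linear_scale\<close>)
  then obtain B where B: "finite B" "independent B" "group_closure B = H" by auto
  obtain bs where "distinct bs" "set bs = B" using finite_distinct_list[OF B(1)] by auto
  then show ?thesis using B by (auto simp: lattice_subgroup_def lattice_basis_def)
qed

section \<open>Lattices and dual bases\<close>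

lemma lattice_subgroup_add_subgroup: "lattice_subgroup N \<Longrightarrow> add_subgroup N"
  by (auto simp: lattice_subgroup_def lattice_basis_def add_subgroup_group_closure)

lemma lattice_basis_span: "lattice_basis bs M \<Longrightarrow> span (set bs) = span M"
proof (rule span_subspace)
  assume b: "lattice_basis bs M"
  show "set bs \<subseteq> span M"
    using b group_closure_superset[of "set bs"] span_superset[of M] by (auto simp: lattice_basis_def)
  have "M \<subseteq> span (set bs)"
    using scaleR.group_closure_subset_span[of "set bs"] b by (auto simp: lattice_basis_def span_raw_def)
  then show "span M \<subseteq> span (set bs)" by (simp add: span_minimal)
qed simp

lemma lattice_basis_length: "lattice_basis bs M \<Longrightarrow> length bs = dim M"
  by (metis lattice_basis_def lattice_basis_span dim_eq_card_independent distinct_card dim_span)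

text \<open>The forms are linear on the whole ambient space, so multivectors can be evaluated at
  them. The coordinate functions in \<open>dual_frame\<close> are 0 off the span of the frame and
  hence in general not linear.\<close>

definition dual_lists :: "'a::euclidean_space list \<Rightarrow> ('a \<Rightarrow> real) list \<Rightarrow> bool" where
  "dual_lists bs Ls \<longleftrightarrow> length bs = length Ls \<and> (\<forall>L\<in>set Ls. linear L) \<and>
     (\<forall>i<length bs. \<forall>j<length bs. (Ls ! i) (bs ! j) = (if i = j then 1 else 0))"

lemma dual_lists_Cons:
  assumes "dual_lists (b # bs) (L # Ls)"
  shows "dual_lists bs Ls" "L b = 1" "\<And>i. i < length bs \<Longrightarrow> L (bs ! i) = 0"
    "\<And>i. i < length Ls \<Longrightarrow> (Ls ! i) b = 0" "linear L"
proof -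
  have *: "((L # Ls) ! i) ((b # bs) ! j) = (if i = j then 1 else 0)" if "i < Suc (length bs)" "j < Suc (length bs)" for i j
    using assms that by (auto simp: dual_lists_def)
  show "L b = 1" using *[of 0 0] by simp
  show "L (bs ! i) = 0" if "i < length bs" for i using *[of 0 "Suc i"] that by simp
  show "(Ls ! i) b = 0" if "i < length Ls" for i
    using *[of "Suc i" 0] that assms by (simp add: dual_lists_def)
  show "dual_lists bs Ls" using *[of "Suc _" "Suc _"] assms by (auto simp: dual_lists_def)
  show "linear L" using assms by (simp add: dual_lists_def)
qed

lemma lattice_basis_dual:
  assumes "lattice_basis bs M"
  obtains Ls where "dual_lists bs Ls"
proof -
  have ind: "independent (set bs)" and d: "distinct bs" using assms by (auto simp: lattice_basis_def)
  have "\<exists>g :: 'a \<Rightarrow> real. linear g \<and> (\<forall>x\<in>set bs. g x = (if x = b then 1 else 0))" for b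
    using linear_independent_extend[OF ind, of "\<lambda>x. if x = b then 1 else 0"] by auto
  then obtain g where g: "\<And>b. linear (g b)" "\<And>b x. x \<in> set bs \<Longrightarrow> g b x = (if x = b then 1 else (0::real))"
    by metis
  have "dual_lists bs (map g bs)"
    using g d by (auto simp: dual_lists_def nth_eq_iff_index_eq)
  then show ?thesis by (rule that)
qed

lemma dual_lists_linear: "dual_lists bs Ls \<Longrightarrow> i < length bs \<Longrightarrow> linear (Ls ! i)"
  by (simp add: dual_lists_def)

lemma dual_lists_expand:
  assumes "dual_lists bs Ls" "x \<in> span (set bs)"
  shows "x = (\<Sum>i<length bs. (Ls ! i) x *\<^sub>R bs ! i)"
  using assms(2)
proof (induction rule: span_induct_alt)
  case base
  then show ?case using assms(1) by (simp add: dual_lists_linear linear_0)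
next
  case (step c b x)
  then obtain j where j: "j < length bs" "b = bs ! j" by (auto simp: in_set_conv_nth)
  have "(\<Sum>i<length bs. (Ls ! i) b *\<^sub>R bs ! i) = (\<Sum>i<length bs. if i = j then b else 0)"
    using assms(1) j by (intro sum.cong) (auto simp: dual_lists_def)
  then have b: "(\<Sum>i<length bs. (Ls ! i) b *\<^sub>R bs ! i) = b" using j by simp
  have "(\<Sum>i<length bs. (Ls ! i) (c *\<^sub>R b + x) *\<^sub>R bs ! i) =
      c *\<^sub>R (\<Sum>i<length bs. (Ls ! i) b *\<^sub>R bs ! i) + (\<Sum>i<length bs. (Ls ! i) x *\<^sub>R bs ! i)"
    unfolding scaleR_sum_right sum.distrib[symmetric]
    by (intro sum.cong refl)
       (use assms(1) in \<open>auto simp: dual_lists_linear linear_add linear_scale scaleR_add_left\<close>)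
  then show ?case using step.IH by (simp add: b)
qed

lemma dual_lists_Ints:
  assumes "dual_lists bs Ls" "x \<in> group_closure (set bs)" "i < length bs"
  shows "(Ls ! i) x \<in> \<int>"
  using assms(2)
proof induction
  case (base s)
  then show ?case
    using assms(1,3) linear_0[OF dual_lists_linear[OF assms(1,3)]]
    by (auto simp: dual_lists_def in_set_conv_nth)
next
  case (diff s t)
  then show ?case using assms(1,3) by (simp add: dual_lists_linear linear_diff)
qed

lemma dual_lists_set_Ints:
  "dual_lists bs Ls \<Longrightarrow> L \<in> set Ls \<Longrightarrow> x \<in> group_closure (set bs) \<Longrightarrow> L x \<in> \<int>"
  using dual_lists_Ints[of bs Ls x] by (auto simp: in_set_conv_nth dual_lists_def)

text \<open>The coordinates of the ambient lattice are integral on every subgroup and separate its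
  points.\<close>

lemma sublattice_lattice:
  assumes "lattice_subgroup N" "add_subgroup H" "H \<subseteq> N"
  shows "lattice_subgroup H"
proof -
  obtain bs where bs: "lattice_basis bs N" using assms(1) by (auto simp: lattice_subgroup_def)
  then obtain Ls where Ls: "dual_lists bs Ls" by (rule lattice_basis_dual)
  show ?thesis
  proof (rule scaleR_subgroup_basis[of "set Ls"])
    show "add_subgroup H" by fact
    show "linear f" if "f \<in> set Ls" for f using Ls that by (simp add: dual_lists_def)
    show "f h \<in> \<int>" if "f \<in> set Ls" "h \<in> H" for f h
      using dual_lists_Ints[OF Ls] that assms(3) bs Ls
      by (auto simp: lattice_basis_def in_set_conv_nth dual_lists_def)
    show "h = 0" if h: "h \<in> H" "\<And>f. f \<in> set Ls \<Longrightarrow> f h = 0" for h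
    proof -
      have "h \<in> span (set bs)"
        using h(1) assms(3) lattice_basis_span[OF bs] by (auto intro: span_base)
      from dual_lists_expand[OF Ls this] have "h = (\<Sum>i<length bs. (Ls ! i) h *\<^sub>R bs ! i)" .
      also have "\<dots> = 0" using h(2) Ls by (intro sum.neutral) (auto simp: dual_lists_def)
      finally show ?thesis .
    qed
  qed simp
qed

lemma add_subgroup_sublattice: "lattice_subgroup N \<Longrightarrow> add_subgroup (sublattice N \<sigma>)"
  using lattice_subgroup_add_subgroup[of N]
  by (auto simp: sublattice_def add_subgroup_def span_zero intro: span_diff)

lemma lattice_subgroup_sublattice: "lattice_subgroup N \<Longrightarrow> lattice_subgroup (sublattice N \<sigma>)"
  by (rule sublattice_lattice[OF _ add_subgroup_sublattice]) (auto simp: sublattice_def)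

lemma lattice_basis_frame: "lattice_subgroup N \<Longrightarrow> lattice_basis (frame N \<sigma>) (sublattice N \<sigma>)"
  unfolding frame_def using lattice_subgroup_sublattice[of N \<sigma>]
  by (auto simp: lattice_subgroup_def intro: someI_ex)

text \<open>Each new vector \<open>v\<close> of \<open>C\<close> with \<open>f(v) \<noteq> 0\<close> replaces the functionals \<open>g\<close> by \<open>f(v) g - g(v) f\<close>.\<close>

lemma integral_equations:
  assumes "lattice_subgroup N" "finite C" "C \<subseteq> N"
  shows "\<exists>S. finite S \<and> (\<forall>f\<in>S. linear f \<and> (\<forall>x\<in>N. f x \<in> \<int>)) \<and>
    (\<forall>x\<in>span N. (\<forall>f\<in>S. f x = (0::real)) \<longleftrightarrow> x \<in> span C)"
  using assms(2,3)
proof (induction C rule: finite_induct)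
  case empty
  obtain bs where bs: "lattice_basis bs N" using assms(1) by (auto simp: lattice_subgroup_def)
  then obtain Ls where Ls: "dual_lists bs Ls" by (rule lattice_basis_dual)
  have "(\<forall>f\<in>set Ls. f x = 0) \<longleftrightarrow> x \<in> span {}" if x: "x \<in> span N" for x
  proof
    assume z: "\<forall>f\<in>set Ls. f x = 0"
    have "x = (\<Sum>i<length bs. (Ls ! i) x *\<^sub>R bs ! i)"
      using dual_lists_expand[OF Ls] x lattice_basis_span[OF bs] by blast
    also have "\<dots> = 0" using z Ls by (intro sum.neutral) (auto simp: dual_lists_def)
    finally show "x \<in> span {}" by simp
  qed (use Ls in \<open>auto simp: dual_lists_def linear_0\<close>)
  moreover have "f x \<in> \<int>" if "f \<in> set Ls" "x \<in> N" for f x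
    using dual_lists_Ints[OF Ls] that bs Ls
    by (auto simp: lattice_basis_def in_set_conv_nth dual_lists_def)
  ultimately show ?case using Ls by (intro exI[of _ "set Ls"]) (auto simp: dual_lists_def)
next
  case (insert v C)
  then have "C \<subseteq> N" by simp
  from insert.IH[OF this] obtain S where S0: "finite S" "\<forall>f\<in>S. linear f \<and> (\<forall>x\<in>N. f x \<in> \<int>)"
    "\<forall>x\<in>span N. (\<forall>f\<in>S. f x = (0::real)) \<longleftrightarrow> x \<in> span C" by (elim exE conjE)
  have S: "finite S" "\<And>f. f \<in> S \<Longrightarrow> linear f" "\<And>f x. f \<in> S \<Longrightarrow> x \<in> N \<Longrightarrow> f x \<in> \<int>"
    "\<And>x. x \<in> span N \<Longrightarrow> (\<forall>f\<in>S. f x = 0) \<longleftrightarrow> x \<in> span C"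
    using S0 by blast+
  have v: "v \<in> N" "v \<in> span N" using insert.prems by (auto intro: span_base)
  show ?case
  proof (cases "\<forall>f\<in>S. f v = 0")
    case True
    then have "v \<in> span C" using S(4)[OF v(2)] by simp
    then have "span (insert v C) = span C" by (rule span_redundant)
    then show ?thesis using S by (intro exI[of _ S]) auto
  next
    case False
    then obtain f where f: "f \<in> S" "f v \<noteq> 0" by auto
    define D where "D g x = g x * f v + (- g v) * f x" for g x
    have lin: "linear (D g)" if "g \<in> S" for g
    proof -
      have "linear (\<lambda>x. f v * g x)" using S(2)[OF that] linear_compose_scale_right[of g "f v"] by simp
      from linear_add_scaled[OF this S(2)[OF f(1)], of "- g v"] show ?thesis
        by (simp add: D_def[abs_def] mult.commute)
    qed
    have int: "D g x \<in> \<int>" if "g \<in> S" "x \<in> N" for g x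
      unfolding D_def using S(3) f that v by (auto intro!: Ints_add Ints_mult Ints_minus)
    have ker: "(\<forall>h\<in>D ` S. h x = 0) \<longleftrightarrow> x \<in> span (insert v C)" if x: "x \<in> span N" for x
    proof
      assume h: "\<forall>h\<in>D ` S. h x = 0"
      \<comment> \<open>Removing the component along \<open>v\<close> makes \<open>f\<close> vanish;
        then \<open>D g x = 0\<close> says that \<open>g\<close> vanishes as well, so the old
        equations put \<open>y\<close> into the span of \<open>C\<close>.\<close>
      define y where "y = x - (f x / f v) *\<^sub>R v"
      have "y \<in> span N" unfolding y_def by (intro span_diff span_scale x v)
      moreover have "g y = 0" if g: "g \<in> S" for g
      proof -
        have "g x * f v = g v * f x" using h g by (simp add: D_def)
        then show ?thesis using f S(2)[OF g] by (simp add: y_def linear_diff linear_scale field_simps)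
      qed
      ultimately have "y \<in> span C" using S(4) by blast
      then show "x \<in> span (insert v C)" unfolding y_def span_insert by blast
    next
      assume "x \<in> span (insert v C)"
      then obtain k where k: "x - k *\<^sub>R v \<in> span C" by (auto simp: span_insert)
      have "x - k *\<^sub>R v \<in> span N" by (intro span_diff span_scale x v)
      then have z: "g (x - k *\<^sub>R v) = 0" if "g \<in> S" for g using S(4) k that by blast
      have gx: "g x = k * g v" if "g \<in> S" for g
        using z[OF that] S(2)[OF that] by (simp add: linear_diff linear_scale)
      then have "D g x = 0" if "g \<in> S" for g
        by (simp add: D_def gx[OF that] gx[OF f(1)])
      then show "\<forall>h\<in>D ` S. h x = 0" by blast
    qed
    show ?thesis using lin int ker S(1) by (intro exI[of _ "D ` S"]) auto
  qed
qed

section \<open>Quotients by the span of a cone\<close>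

lemma quot_properties:
  fixes \<sigma> :: "'a::euclidean_space set"
  shows "quot \<sigma> v \<in> orthogonal_comp \<sigma>" "v - quot \<sigma> v \<in> span \<sigma>"
    and quot_unique: "w \<in> orthogonal_comp \<sigma> \<Longrightarrow> v - w \<in> span \<sigma> \<Longrightarrow> quot \<sigma> v = w"
proof -
  have uniq: "w = w'" if "w \<in> orthogonal_comp \<sigma>" "v - w \<in> span \<sigma>" "w' \<in> orthogonal_comp \<sigma>" "v - w' \<in> span \<sigma>" for w w'
  proof -
    have "w - w' \<in> orthogonal_comp \<sigma>" using that
      by (auto simp: orthogonal_comp_def real_inner_class.orthogonal_def inner_diff_right)
    moreover have "w - w' \<in> span \<sigma>" using span_diff[OF that(4,2)] by simp
    ultimately have "orthogonal (w - w') (w - w')"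
      by (intro orthogonal_to_span[of "w - w'" \<sigma>]) (auto simp: orthogonal_comp_def orthogonal_commute)
    then show ?thesis by (simp add: real_inner_class.orthogonal_def)
  qed
  obtain y z where yz: "y \<in> span \<sigma>" "\<And>w. w \<in> span \<sigma> \<Longrightarrow> orthogonal z w" "v = y + z"
    using orthogonal_subspace_decomp_exists[of \<sigma> v] by blast
  have z: "z \<in> orthogonal_comp \<sigma> \<and> v - z \<in> span \<sigma>"
    using yz by (auto simp: orthogonal_comp_def orthogonal_commute span_base)
  then have ex1: "\<exists>!w. w \<in> orthogonal_comp \<sigma> \<and> v - w \<in> span \<sigma>" using uniq by blast
  from theI'[OF this] show "quot \<sigma> v \<in> orthogonal_comp \<sigma>" "v - quot \<sigma> v \<in> span \<sigma>"
    unfolding quot_def by auto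
  show "w \<in> orthogonal_comp \<sigma> \<Longrightarrow> v - w \<in> span \<sigma> \<Longrightarrow> quot \<sigma> v = w"
    using uniq \<open>quot \<sigma> v \<in> orthogonal_comp \<sigma>\<close> \<open>v - quot \<sigma> v \<in> span \<sigma>\<close> by blast
qed

lemma linear_quot: "linear (quot \<sigma>)"
proof (rule linearI)
  fix u v :: 'a
  show "quot \<sigma> (u + v) = quot \<sigma> u + quot \<sigma> v"
  proof (rule quot_unique)
    show "quot \<sigma> u + quot \<sigma> v \<in> orthogonal_comp \<sigma>"
      using quot_properties(1)[of \<sigma>] by (auto simp: orthogonal_comp_def real_inner_class.orthogonal_def inner_add_right)
    show "u + v - (quot \<sigma> u + quot \<sigma> v) \<in> span \<sigma>"
      using span_add[OF quot_properties(2)[where v = u] quot_properties(2)[where v = v]]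
      by (simp add: algebra_simps)
  qed
next
  fix c :: real and v :: 'a
  show "quot \<sigma> (c *\<^sub>R v) = c *\<^sub>R quot \<sigma> v"
  proof (rule quot_unique)
    show "c *\<^sub>R quot \<sigma> v \<in> orthogonal_comp \<sigma>"
      using quot_properties(1)[of \<sigma>] by (auto simp: orthogonal_comp_def real_inner_class.orthogonal_def)
    show "c *\<^sub>R v - c *\<^sub>R quot \<sigma> v \<in> span \<sigma>"
      using span_scale[OF quot_properties(2)[where v = v], of c] by (simp add: algebra_simps)
  qed
qed

lemmas quot_add = linear_add[OF linear_quot]
  and quot_diff = linear_diff[OF linear_quot]
  and quot_scale = linear_scale[OF linear_quot]
  and quot_0 = linear_0[OF linear_quot]
  and quot_minus = linear_neg[OF linear_quot]

lemma quot_eq_0_iff: "quot \<sigma> v = 0 \<longleftrightarrow> v \<in> span \<sigma>"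
proof
  show "quot \<sigma> v = 0 \<Longrightarrow> v \<in> span \<sigma>" using quot_properties(2)[where v = v and \<sigma> = \<sigma>] by simp
  show "v \<in> span \<sigma> \<Longrightarrow> quot \<sigma> v = 0"
    by (rule quot_unique) (auto simp: orthogonal_comp_def real_inner_class.orthogonal_def)
qed

lemma quot_eq_iff: "quot \<sigma> u = quot \<sigma> v \<longleftrightarrow> u - v \<in> span \<sigma>"
  using quot_eq_0_iff[of \<sigma> "u - v"] by (simp add: quot_diff)

text \<open>The projection subtracts only elements of span \<tau>, which lie in span A, so its image
  of span A is the orthogonal complement of span \<tau> inside span A.\<close>

lemma dim_quot_image:
  assumes "\<tau> \<subseteq> span A"
  shows "dim (quot \<tau> ` A) + dim \<tau> = dim A"
proof -
  have sub: "span \<tau> \<subseteq> span A" using span_minimal[OF assms subspace_span] .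
  have "quot \<tau> ` span A = {y \<in> span A. \<forall>x\<in>span \<tau>. orthogonal x y}"
  proof (intro equalityI subsetI)
    fix y assume "y \<in> quot \<tau> ` span A"
    then obtain v where v: "v \<in> span A" "y = quot \<tau> v" by auto
    have "v - (v - quot \<tau> v) \<in> span A"
      by (intro span_diff v) (use quot_properties(2)[where v = v and \<sigma> = \<tau>] sub v in \<open>auto dest: span_diff\<close>)
    moreover have "orthogonal x y" if "x \<in> span \<tau>" for x
      using orthogonal_to_span[OF that, of y] quot_properties(1)[where v = v and \<sigma> = \<tau>] v
      by (auto simp: orthogonal_comp_def orthogonal_commute)
    ultimately show "y \<in> {y \<in> span A. \<forall>x\<in>span \<tau>. orthogonal x y}" using v by simp
  next
    fix y assume y: "y \<in> {y \<in> span A. \<forall>x\<in>span \<tau>. orthogonal x y}"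
    have "quot \<tau> y = y"
      by (rule quot_unique) (use y in \<open>auto simp: orthogonal_comp_def span_zero intro: span_base\<close>)
    then show "y \<in> quot \<tau> ` span A" using y by force
  qed
  moreover have "dim {y \<in> span A. \<forall>x\<in>span \<tau>. orthogonal x y} + dim (span \<tau>) = dim (span A)"
    by (rule dim_subspace_orthogonal_to_vectors[OF subspace_span subspace_span sub])
  moreover have "dim (quot \<tau> ` span A) = dim (quot \<tau> ` A)"
    by (metis dim_span linear_quot linear_span_image)
  ultimately show ?thesis by simp
qed

text \<open>Discreteness of the projected lattice comes from rationality of \<rho>: the integral
  equations of span \<rho> keep their values under \<open>quot\<close>, hence are integral on the
  image and separate its points.\<close>

lemma lattice_subgroup_quot:
  assumes "lattice_subgroup N" "finite C" "C \<subseteq> N" "span C = span \<rho>"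
  shows "lattice_subgroup (quot \<rho> ` N)"
proof -
  from integral_equations[OF assms(1-3)] obtain S where S0: "finite S"
    "\<forall>f\<in>S. linear f \<and> (\<forall>x\<in>N. f x \<in> \<int>)"
    "\<forall>x\<in>span N. (\<forall>f\<in>S. f x = (0::real)) \<longleftrightarrow> x \<in> span C" by (elim exE conjE)
  have S: "finite S" "\<And>f. f \<in> S \<Longrightarrow> linear f" "\<And>f x. f \<in> S \<Longrightarrow> x \<in> N \<Longrightarrow> f x \<in> \<int>"
    "\<And>x. x \<in> span N \<Longrightarrow> (\<forall>f\<in>S. f x = 0) \<longleftrightarrow> x \<in> span C"
    using S0 by blast+
  have CN: "span C \<subseteq> span N" using assms(3) by (rule span_mono)
  have f: "f (quot \<rho> x) = f x" if "f \<in> S" for f x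
  proof -
    have "x - quot \<rho> x \<in> span C" using quot_properties(2) assms(4) by blast
    then have "f (x - quot \<rho> x) = 0" using S(4) CN that by blast
    then show ?thesis using S(2)[OF that] by (simp add: linear_diff)
  qed
  show ?thesis
  proof (rule scaleR_subgroup_basis[OF S(1)])
    show "add_subgroup (quot \<rho> ` N)"
      by (intro add_subgroup_image lattice_subgroup_add_subgroup assms quot_diff)
    show "h = 0" if "h \<in> quot \<rho> ` N" "\<And>f. f \<in> S \<Longrightarrow> f h = 0" for h
    proof -
      from that obtain x where x: "x \<in> N" "h = quot \<rho> x" by auto
      have "\<forall>g\<in>S. g x = 0" using x that f by metis
      then have "x \<in> span C" using S(4) x by (blast intro: span_base)
      then show ?thesis using x assms(4) by (simp add: quot_eq_0_iff)
    qed
    show "f h \<in> \<int>" if "f \<in> S" "h \<in> quot \<rho> ` N" for f h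
      using that S(3) f by fastforce
  qed (use S in auto)
qed

section \<open>Bases of product lattices\<close>

abbreviation "inl \<equiv> (\<lambda>v. (v, 0))"
abbreviation "inr \<equiv> (\<lambda>v. (0, v))"

lemma linear_inl: "linear (inl :: 'a::real_vector \<Rightarrow> 'a \<times> 'b::real_vector)"
  and linear_inr: "linear (inr :: 'b \<Rightarrow> 'a \<times> 'b)"
  by (auto intro: linearI)

lemma linear_comp_fst: "linear \<phi> \<Longrightarrow> linear (\<phi> \<circ> fst)"
  and linear_comp_snd: "linear \<psi> \<Longrightarrow> linear (\<psi> \<circ> snd)"
  by (auto intro: linear_compose linear_fst linear_snd)

lemma dual_lists_Times:
  assumes "dual_lists bs Ls" "dual_lists bs' Ls'"
  shows "dual_lists (map inl bs @ map inr bs') (map (\<lambda>\<phi>. \<phi> \<circ> fst) Ls @ map (\<lambda>\<phi>. \<phi> \<circ> snd) Ls')"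
proof -
  have lin: "linear (Ls ! i)" if "i < length bs" for i using dual_lists_linear[OF assms(1) that] .
  have lin': "linear (Ls' ! i)" if "i < length bs'" for i using dual_lists_linear[OF assms(2) that] .
  show ?thesis
    unfolding dual_lists_def
  proof (intro conjI allI impI)
    fix i j assume "i < length (map inl bs @ map inr bs')" "j < length (map inl bs @ map inr bs')"
    then show "((map (\<lambda>\<phi>. \<phi> \<circ> fst) Ls @ map (\<lambda>\<phi>. \<phi> \<circ> snd) Ls') ! i) ((map inl bs @ map inr bs') ! j) =
        (if i = j then 1 else 0)"
      using assms lin lin' by (auto simp: dual_lists_def nth_append linear_0)
  qed (use assms in \<open>auto simp: dual_lists_def linear_comp_fst linear_comp_snd\<close>)
qed

lemma dual_lists_independent:
  assumes "dual_lists bs Ls"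
  shows "distinct bs" "independent (set bs)"
proof -
  show d: "distinct bs"
    unfolding distinct_conv_nth
  proof (intro allI impI)
    fix i j assume "i < length bs" "j < length bs" "i \<noteq> j"
    then have "(Ls ! i) (bs ! i) = 1" "(Ls ! i) (bs ! j) = 0" using assms by (auto simp: dual_lists_def)
    then show "bs ! i \<noteq> bs ! j" by auto
  qed
  show "independent (set bs)"
  proof
    assume "dependent (set bs)"
    then obtain u v where u: "v \<in> set bs" "u v \<noteq> 0" "(\<Sum>v\<in>set bs. u v *\<^sub>R v) = 0"
      by (auto simp: dependent_finite)
    then obtain i where i: "i < length bs" "v = bs ! i" by (auto simp: in_set_conv_nth)
    have l: "linear (Ls ! i)" using dual_lists_linear[OF assms i(1)] .
    have "0 = (Ls ! i) (\<Sum>v\<in>set bs. u v *\<^sub>R v)" using l by (simp add: u linear_0)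
    also have "\<dots> = (\<Sum>w\<in>set bs. u w * (Ls ! i) w)" using l by (simp add: linear_sum linear_scale)
    also have "\<dots> = (\<Sum>w\<in>set bs. if w = v then u v else 0)"
    proof (intro sum.cong refl)
      fix w assume "w \<in> set bs"
      then obtain j where "j < length bs" "w = bs ! j" by (auto simp: in_set_conv_nth)
      then show "u w * (Ls ! i) w = (if w = v then u v else 0)"
        using assms i nth_eq_iff_index_eq[OF d, of i j] by (cases "i = j") (auto simp: dual_lists_def)
    qed
    also have "\<dots> = u v" using u(1) by simp
    finally show False using u(2) by simp
  qed
qed

lemma lattice_basis_Times:
  fixes bs :: "'a::euclidean_space list" and bs' :: "'b::euclidean_space list"
  assumes "lattice_basis bs M" "lattice_basis bs' M'"
  shows "lattice_basis (map inl bs @ map inr bs') (M \<times> M')"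
proof -
  obtain Ls where Ls: "dual_lists bs Ls" by (rule lattice_basis_dual[OF assms(1)])
  obtain Ls' where Ls': "dual_lists bs' Ls'" by (rule lattice_basis_dual[OF assms(2)])
  note d = dual_lists_independent[OF dual_lists_Times[OF Ls Ls']]
  have "group_closure (set (map inl bs @ map inr bs')) = M \<times> M'"
  proof
    show "group_closure (set (map inl bs @ map inr bs')) \<subseteq> M \<times> M'"
    proof (rule group_closure_minimal)
      have M: "add_subgroup M" "add_subgroup M'" "set bs \<subseteq> M" "set bs' \<subseteq> M'"
        using assms group_closure_superset[of "set bs"] group_closure_superset[of "set bs'"]
          add_subgroup_group_closure[of "set bs"] add_subgroup_group_closure[of "set bs'"]
        by (simp_all add: lattice_basis_def)
      then show "set (map inl bs @ map inr bs') \<subseteq> M \<times> M'" by (auto simp: add_subgroup_def)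
      show "add_subgroup (M \<times> M')" using M by (auto simp: add_subgroup_def zero_prod_def)
    qed
    show "M \<times> M' \<subseteq> group_closure (set (map inl bs @ map inr bs'))"
    proof clarify
      fix x y assume xy: "x \<in> M" "y \<in> M'"
      have "(inl x :: 'a \<times> 'b) \<in> inl ` group_closure (set bs)"
        "(inr y :: 'a \<times> 'b) \<in> inr ` group_closure (set bs')"
        using xy assms by (auto simp: lattice_basis_def)
      moreover have "inl ` group_closure (set bs) = (group_closure (inl ` set bs) :: ('a \<times> 'b) set)"
        by (rule group_closure_image) simp
      moreover have "inr ` group_closure (set bs') = (group_closure (inr ` set bs') :: ('a \<times> 'b) set)"
        by (rule group_closure_image) simp
      ultimately have "(inl x :: 'a \<times> 'b) \<in> group_closure (inl ` set bs)"
        "(inr y :: 'a \<times> 'b) \<in> group_closure (inr ` set bs')"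
        by blast+
      then have "(inl x :: 'a \<times> 'b) \<in> group_closure (set (map inl bs @ map inr bs'))"
         "(inr y :: 'a \<times> 'b) \<in> group_closure (set (map inl bs @ map inr bs'))"
        using group_closure_mono[of "inl ` set bs" "set (map inl bs @ map inr bs')"]
          group_closure_mono[of "inr ` set bs'" "set (map inl bs @ map inr bs')"] by auto
      from group_closure_add[OF this] show "(x, y) \<in> group_closure (set (map inl bs @ map inr bs'))" by simp
    qed
  qed
  then show ?thesis using d by (simp add: lattice_basis_def)
qed

lemma lattice_subgroup_Times:
  "lattice_subgroup N \<Longrightarrow> lattice_subgroup N' \<Longrightarrow> lattice_subgroup (N \<times> N')"
  unfolding lattice_subgroup_def using lattice_basis_Times by blast

section \<open>Exterior powers of lattices\<close>

lemma set_nths_subset': "\<forall>x\<in>set xs. P x \<Longrightarrow> \<forall>x\<in>set (nths xs I). P x"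
  using set_nths_subset[of xs I] by blast

lemma length_nths_lessThan: "I \<subseteq> {..<length xs} \<Longrightarrow> length (nths xs I) = card I"
  by (simp add: length_nths) (rule arg_cong[where f = card], auto)

lemma wedge_dual:
  assumes "dual_lists bs Ls"
  shows "wedge bs Ls = 1"
  using assms
proof (induction bs arbitrary: Ls)
  case Nil
  then show ?case by (simp add: dual_lists_def wedge_Nil)
next
  case (Cons b bs)
  then obtain L Ls' where Ls: "Ls = L # Ls'" by (cases Ls) (auto simp: dual_lists_def)
  note d = dual_lists_Cons[OF Cons.prems[unfolded Ls]]
  have "wedge (b # bs) (L # Ls') = wedge bs Ls'"
    unfolding wedge_Cons_row[OF d(5)] by (simp add: sum.lessThan_Suc_shift d(2,3) del: sum.lessThan_Suc)
  then show ?case using Cons.IH[OF d(1)] by (simp add: Ls)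
qed

text \<open>Replacing the forms of the first block by their \<open>dual_projection\<close> changes
  nothing on the span of \<open>bs\<close>, and then Cauchy--Binet applies. The second block stays
  frozen, which makes the formula usable for contractions as well as for coordinates.\<close>

lemma wedge_expand:
  assumes d: "dual_lists bs Ls" and vs: "set vs \<subseteq> span (set bs)" and \<phi>s: "\<forall>\<phi>\<in>set \<phi>s. linear \<phi>"
  shows "wedge vs (\<phi>s @ \<psi>s) =
    (\<Sum>I | I \<subseteq> {..<length bs} \<and> card I = length \<phi>s. wedge (nths bs I) \<phi>s * wedge vs (nths Ls I @ \<psi>s))"
proof (cases "\<forall>\<psi>\<in>set \<psi>s. linear \<psi>")
  case False
  then show ?thesis by (simp add: wedge_eq_0_nonlinear bex_Un)
next
  case True
  have lL: "\<forall>L\<in>set Ls. linear L" using d by (simp add: dual_lists_def)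
  have proj: "dual_projection bs Ls \<phi> v = \<phi> v" if "linear \<phi>" "v \<in> span (set bs)" for \<phi> v
  proof -
    have "\<phi> v = \<phi> (\<Sum>i<length bs. (Ls ! i) v *\<^sub>R bs ! i)"
      using dual_lists_expand[OF d that(2)] by simp
    also have "\<dots> = (\<Sum>i<length bs. \<phi> (bs ! i) * (Ls ! i) v)"
      using that(1) by (simp add: linear_sum linear_scale mult.commute)
    also have "\<dots> = dual_projection bs Ls \<phi> v"
      using d by (simp add: dual_projection_def sum_list_sum_nth dual_lists_def lessThan_atLeast0)
    finally show ?thesis by simp
  qed
  have "wedge vs (\<phi>s @ \<psi>s) = wedge vs (map (dual_projection bs Ls) \<phi>s @ \<psi>s)"
    by (rule wedge_cong_on)
       (use \<phi>s True vs in \<open>auto simp: nth_append proj linear_dual_projection[OF lL] subset_iff\<close>)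
  also have "\<dots> = (\<Sum>I | I \<subseteq> {..<length bs} \<and> card I = length \<phi>s.
      wedge (nths bs I) \<phi>s * wedge vs (nths Ls I @ \<psi>s))"
    by (rule alternating_form_expand[OF alternating_form_wedge \<phi>s lL]) (use d in \<open>simp add: dual_lists_def\<close>)
  finally show ?thesis .
qed

text \<open>In top degree only the full index set survives in \<open>wedge_expand\<close>.\<close>

lemma wedge_top:
  assumes "dual_lists bs Ls" "set vs \<subseteq> span (set bs)" "length vs = length bs"
  shows "wedge vs \<phi>s = wedge vs Ls * wedge bs \<phi>s"
proof (cases "length \<phi>s = length bs \<and> (\<forall>\<phi>\<in>set \<phi>s. linear \<phi>)")
  case False
  then show ?thesis using assms(3) by (auto simp: wedge_def)
next
  case True
  have "{I. I \<subseteq> {..<length bs} \<and> card I = length \<phi>s} = {{..<length bs}}"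
    using True card_subset_eq[of "{..<length bs}"] by auto
  moreover have "nths bs {..<length bs} = bs" "nths Ls {..<length bs} = Ls"
    using assms(1) by (auto simp: dual_lists_def)
  ultimately show ?thesis
    using wedge_expand[OF assms(1,2), of \<phi>s "[]"] True by simp
qed

lemma wedge_Ints:
  assumes "\<And>\<phi> v. \<phi> \<in> set \<phi>s \<Longrightarrow> v \<in> set vs \<Longrightarrow> \<phi> v \<in> \<int>"
  shows "wedge vs \<phi>s \<in> \<int>"
  unfolding wedge_def using assms permutes_in_image[of _ "{..<length vs}"]
  by (auto intro!: Ints_sum Ints_mult Ints_prod)

text \<open>The two transition determinants are integers with product 1. Hence arbitrary frames cost
  no more than a sign.\<close>

lemma wedge_basis_change:
  assumes "lattice_basis bs M" "lattice_basis bs' M"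
  obtains s :: int where "s = 1 \<or> s = -1" "\<And>\<phi>s. wedge bs' \<phi>s = of_int s * wedge bs \<phi>s"
proof -
  obtain Ls where Ls: "dual_lists bs Ls" by (rule lattice_basis_dual[OF assms(1)])
  obtain Ls' where Ls': "dual_lists bs' Ls'" by (rule lattice_basis_dual[OF assms(2)])
  have sub: "set bs \<subseteq> M" "set bs' \<subseteq> M" "M \<subseteq> span (set bs)" "M \<subseteq> span (set bs')"
    using assms group_closure_superset[of "set bs"] group_closure_superset[of "set bs'"]
      lattice_basis_span[OF assms(1)] lattice_basis_span[OF assms(2)] span_superset[of M]
    by (simp_all add: lattice_basis_def)
  have len: "length bs = length bs'" using assms lattice_basis_length by metis
  have int: "wedge bs' Ls \<in> \<int>" "wedge bs Ls' \<in> \<int>"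
    using sub assms dual_lists_set_Ints[OF Ls] dual_lists_set_Ints[OF Ls']
    by (auto intro!: wedge_Ints simp: lattice_basis_def)
  then obtain s t :: int where st: "wedge bs' Ls = of_int s" "wedge bs Ls' = of_int t" by (auto elim!: Ints_cases)
  have 1: "wedge bs' \<phi>s = of_int s * wedge bs \<phi>s" for \<phi>s
    using wedge_top[OF Ls subset_trans[OF sub(2,3)], of \<phi>s] len st(1) by simp
  have "1 = real_of_int s * real_of_int t" using 1[of Ls'] wedge_dual[OF Ls'] st(2) by simp
  then have "s * t = 1" by (metis of_int_1 of_int_eq_iff of_int_mult)
  then have "s = 1 \<or> s = -1" using pos_zmult_eq_1_iff_lemma zmult_eq_1_iff by blast
  then show ?thesis using 1 by (rule that)
qed

text \<open>Coordinates with respect to the wedges of sublists of \<open>bs\<close> are read off at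
  the dual sublists, so finitely many evaluations determine an element. For negative
  \<open>p\<close> the sum is empty, in accordance with the group being 0.\<close>

lemma exterior_power_expand:
  assumes d: "dual_lists bs Ls" and x: "x \<in> exterior_power p (group_closure (set bs))"
  shows "x \<phi>s = (\<Sum>I | I \<subseteq> {..<length bs} \<and> int (card I) = p. x (nths Ls I) * wedge (nths bs I) \<phi>s)"
  using x unfolding exterior_power_def
proof induction
  case (base x)
  show ?case
  proof (cases "x = 0")
    case False
    then obtain vs where vs: "x = wedge vs" "int (length vs) = p" "set vs \<subseteq> group_closure (set bs)"
      using base by auto
    have vs': "set vs \<subseteq> span (set bs)"
      using vs(3) scaleR.group_closure_subset_span[of "set bs"] by (auto simp: span_raw_def)
    show ?thesis
    proof (cases "length \<phi>s = length vs \<and> (\<forall>\<phi>\<in>set \<phi>s. linear \<phi>)")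
      case True
      then have "{I. I \<subseteq> {..<length bs} \<and> int (card I) = p} = {I. I \<subseteq> {..<length bs} \<and> card I = length \<phi>s}"
        using vs(2) by auto
      then show ?thesis using wedge_expand[OF d vs', of \<phi>s "[]"] True by (simp add: vs(1) mult.commute)
    next
      case False
      have "wedge (nths bs I) \<phi>s = 0" if "I \<subseteq> {..<length bs}" "int (card I) = p" for I
        using False that vs(2) by (auto simp: wedge_def length_nths_lessThan)
      then show ?thesis using False by (auto simp: vs(1) wedge_def)
    qed
  qed simp
next
  case (diff x y)
  then show ?case by (simp add: left_diff_distrib sum_subtractf)
qed

lemma add_subgroup_exterior_power: "add_subgroup (exterior_power p M)"
  by (simp add: exterior_power_def add_subgroup_group_closure)

lemma exterior_power_Ints:
  assumes "x \<in> exterior_power p M" "\<And>\<phi> v. \<phi> \<in> set \<phi>s \<Longrightarrow> v \<in> M \<Longrightarrow> \<phi> v \<in> \<int>"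
  shows "x \<phi>s \<in> \<int>"
  using assms(1) unfolding exterior_power_def
proof induction
  case (base x)
  then show ?case using assms(2) by (auto intro!: wedge_Ints)
qed (auto)

lemma exterior_power_eq_0:
  assumes "x \<in> exterior_power p M" "int (length \<phi>s) \<noteq> p \<or> (\<exists>\<phi>\<in>set \<phi>s. \<not> linear \<phi>)"
  shows "x \<phi>s = 0"
  using assms(1) unfolding exterior_power_def
proof induction
  case (base x)
  then show ?case using assms(2) by (auto simp: wedge_def)
qed (auto)

lemma exterior_power_mono: "M \<subseteq> M' \<Longrightarrow> exterior_power p M \<subseteq> exterior_power p M'"
  unfolding exterior_power_def by (rule group_closure_mono) auto

lemma wedge_in_exterior_power: "set vs \<subseteq> M \<Longrightarrow> int (length vs) = p \<Longrightarrow> wedge vs \<in> exterior_power p M"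
  by (auto simp: exterior_power_def intro!: group_closure.base)

section \<open>Cones and their facets\<close>

text \<open>The part of the structure of a tropical fan that Poincare duality depends on. It passes to stars and
  products without reference to balancing or to intersections of cones.\<close>

definition cone_complex :: "'a::euclidean_space set \<Rightarrow> 'a set set \<Rightarrow> bool" where
  "cone_complex N \<Sigma> \<longleftrightarrow> lattice_subgroup N \<and> finite \<Sigma> \<and> \<Sigma> \<noteq> {} \<and>
     (\<forall>\<sigma>\<in>\<Sigma>. rational_cone N \<sigma>) \<and> (\<forall>\<sigma>\<in>\<Sigma>. \<forall>\<tau>. \<tau> \<noteq> {} \<and> \<tau> face_of \<sigma> \<longrightarrow> \<tau> \<in> \<Sigma>) \<and>
     pure_dimensional \<Sigma>"

lemma rational_cone_convex_cone: "rational_cone N \<sigma> \<Longrightarrow> convex_cone \<sigma>"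
  by (auto simp: rational_cone_def convex_cone_convex_cone_hull)

lemma rational_cone_0: "rational_cone N \<sigma> \<Longrightarrow> 0 \<in> \<sigma>"
  by (simp add: rational_cone_convex_cone convex_cone_contains_0)

lemma rational_cone_convex: "rational_cone N \<sigma> \<Longrightarrow> convex \<sigma>"
  using rational_cone_convex_cone by (auto simp: convex_cone_def)

lemma rational_cone_scale: "rational_cone N \<sigma> \<Longrightarrow> x \<in> \<sigma> \<Longrightarrow> 0 \<le> c \<Longrightarrow> c *\<^sub>R x \<in> \<sigma>"
  by (simp add: rational_cone_convex_cone convex_cone_scaleR)

lemma rational_cone_add: "rational_cone N \<sigma> \<Longrightarrow> x \<in> \<sigma> \<Longrightarrow> y \<in> \<sigma> \<Longrightarrow> x + y \<in> \<sigma>"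
  by (simp add: rational_cone_convex_cone convex_cone_add)

lemma rational_cone_polyhedron: "rational_cone N \<sigma> \<Longrightarrow> polyhedron \<sigma>"
  by (auto simp: rational_cone_def polyhedron_convex_cone_hull)

lemma rational_cone_generators:
  assumes "rational_cone N \<sigma>"
  obtains S where "finite S" "S \<subseteq> N" "S \<subseteq> \<sigma>" "span S = span \<sigma>"
proof -
  obtain S where S: "finite S" "S \<subseteq> N" "\<sigma> = convex_cone hull S"
    using assms by (auto simp: rational_cone_def)
  have 1: "S \<subseteq> \<sigma>" using S(3) by (simp add: hull_subset)
  have "\<sigma> \<subseteq> span S"
    using S(3) hull_minimal[of S "span S" convex_cone] by (simp add: span_superset convex_cone_span)
  then have "span \<sigma> \<subseteq> span S" by (simp add: span_minimal)
  with span_mono[OF 1] have "span S = span \<sigma>" by blast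
  then show ?thesis using that[OF S(1,2) 1] by blast
qed

lemma span_sublattice:
  assumes "rational_cone N \<sigma>"
  shows "span (sublattice N \<sigma>) = span \<sigma>"
proof -
  obtain S where S: "finite S" "S \<subseteq> N" "S \<subseteq> \<sigma>" "span S = span \<sigma>"
    using rational_cone_generators[OF assms] .
  then have "S \<subseteq> sublattice N \<sigma>" by (auto simp: sublattice_def span_base)
  then have "span \<sigma> \<subseteq> span (sublattice N \<sigma>)" using S(4) span_mono by metis
  moreover have "span (sublattice N \<sigma>) \<subseteq> span \<sigma>"
    by (rule span_minimal) (auto simp: sublattice_def)
  ultimately show ?thesis by blast
qed

lemma aff_dim_cone:
  fixes \<sigma> :: "'a::euclidean_space set"
  shows "0 \<in> \<sigma> \<Longrightarrow> aff_dim \<sigma> = int (dim \<sigma>)"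
  by (simp add: aff_dim_zero hull_inc)

lemma face_eq_span_Int:
  fixes \<sigma> :: "'a::euclidean_space set"
  assumes "convex \<sigma>" "\<tau> face_of \<sigma>" "0 \<in> \<tau>"
  shows "\<tau> = span \<tau> \<inter> \<sigma>"
  using face_of_imp_eq_affine_Int[OF assms(1,2)] assms(3) affine_hull_span_0[of \<tau>]
  by (simp add: hull_inc)

text \<open>A nonzero point x of the face lies inside the segment from 0 to 2x, whose ends belong to
  the cone.\<close>

lemma face_contains_0:
  assumes "rational_cone N \<sigma>" "\<tau> face_of \<sigma>" "\<tau> \<noteq> {}"
  shows "0 \<in> \<tau>"
proof -
  obtain x where x: "x \<in> \<tau>" using assms(3) by auto
  show ?thesis
  proof (cases "x = 0")
    case False
    have \<sigma>: "x \<in> \<sigma>" using x face_of_imp_subset[OF assms(2)] by auto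
    have "2 *\<^sub>R x \<in> \<sigma>" by (intro rational_cone_scale[OF assms(1)] \<sigma>) simp
    moreover have "x \<in> open_segment 0 (2 *\<^sub>R x)"
      using False by (auto simp: in_segment intro!: exI[of _ "1/2"])
    ultimately show ?thesis
      using assms(2) rational_cone_0[OF assms(1)] x unfolding face_of_def by blast
  qed (use x in auto)
qed

text \<open>Half of the sum lies in the cone and in span \<tau>, hence in \<tau>, and it is the
  midpoint of \<open>x\<close> and \<open>y\<close>; the face property then captures both
  ends.\<close>

lemma face_add_mem:
  assumes "rational_cone N \<sigma>" "\<tau> face_of \<sigma>" "x \<in> \<sigma>" "y \<in> \<sigma>" "x + y \<in> span \<tau>" "\<tau> \<noteq> {}"
  shows "x \<in> \<tau>" "y \<in> \<tau>"
proof -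
  have 0: "0 \<in> \<tau>" using face_contains_0 assms by blast
  have \<tau>: "\<tau> = span \<tau> \<inter> \<sigma>" using face_eq_span_Int[OF rational_cone_convex[OF assms(1)] assms(2) 0] .
  have "(1/2) *\<^sub>R (x + y) \<in> \<tau>"
    by (subst \<tau>) (auto intro!: span_scale assms rational_cone_scale[OF assms(1)] rational_cone_add[OF assms(1)]
        simp del: scaleR_add_right)
  then have m: "midpoint x y \<in> \<tau>" by (simp add: midpoint_def)
  have "x \<in> \<tau> \<and> y \<in> \<tau>"
  proof (cases "x = y")
    case True
    then show ?thesis using m by simp
  next
    case False
    then have "midpoint x y \<in> open_segment x y" by simp
    then show ?thesis using assms(2-4) m unfolding face_of_def by blast
  qed
  then show "x \<in> \<tau>" "y \<in> \<tau>" by auto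
qed

lemma group_closure_singleton:
  "group_closure {e} = range (\<lambda>k :: int. of_int k *\<^sub>R (e :: 'a::real_vector))"
proof
  show "group_closure {e} \<subseteq> range (\<lambda>k :: int. of_int k *\<^sub>R e)"
  proof (rule group_closure_minimal)
    show "{e} \<subseteq> range (\<lambda>k :: int. of_int k *\<^sub>R e)" by (auto intro!: image_eqI[of _ _ 1])
    show "add_subgroup (range (\<lambda>k :: int. of_int k *\<^sub>R e))"
    proof (unfold add_subgroup_def, intro conjI ballI)
      show "0 \<in> range (\<lambda>k :: int. of_int k *\<^sub>R e)" by (auto intro!: image_eqI[of _ _ 0])
      fix x y assume "x \<in> range (\<lambda>k :: int. of_int k *\<^sub>R e)" "y \<in> range (\<lambda>k :: int. of_int k *\<^sub>R e)"
      then obtain j k :: int where "x = of_int j *\<^sub>R e" "y = of_int k *\<^sub>R e" by auto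
      then have "x - y = of_int (j - k) *\<^sub>R e" by (simp add: scaleR_left_diff_distrib)
      then show "x - y \<in> range (\<lambda>k :: int. of_int k *\<^sub>R e)" by blast
    qed
  qed
  show "range (\<lambda>k :: int. of_int k *\<^sub>R e) \<subseteq> group_closure {e}"
    using scaleR.add_subgroup_scale_int[OF add_subgroup_group_closure, of e "{e}"]
      group_closure_superset[of "{e}"] by auto
qed

definition facet_pair :: "'a::euclidean_space set \<Rightarrow> 'a set \<Rightarrow> 'a set \<Rightarrow> bool" where
  "facet_pair N \<tau> \<sigma> \<longleftrightarrow> lattice_subgroup N \<and> rational_cone N \<tau> \<and> rational_cone N \<sigma> \<and>
     \<tau> face_of \<sigma> \<and> dim \<sigma> = Suc (dim \<tau>)"

lemma facet_pair_span_Int: "facet_pair N \<tau> \<sigma> \<Longrightarrow> \<tau> = span \<tau> \<inter> \<sigma>"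
  unfolding facet_pair_def by (intro face_eq_span_Int) (auto dest: rational_cone_convex rational_cone_0)

text \<open>The quotient lattice is discrete because \<tau> is rational, and its rank is dim
  \<sigma> - dim \<tau> = 1, so it is generated by a single vector.\<close>

lemma normal_gen_exists:
  assumes "facet_pair N \<tau> \<sigma>"
  obtains e where "e \<noteq> 0" "e \<in> quot \<tau> ` \<sigma>" "group_closure {e} = quot \<tau> ` sublattice N \<sigma>"
proof -
  have N: "lattice_subgroup N" and \<tau>: "rational_cone N \<tau>" and \<sigma>: "rational_cone N \<sigma>"
    and f: "\<tau> face_of \<sigma>" and d: "dim \<sigma> = Suc (dim \<tau>)" using assms by (auto simp: facet_pair_def)
  have sub: "\<tau> \<subseteq> \<sigma>" using face_of_imp_subset[OF f] .
  obtain C where C: "finite C" "C \<subseteq> N" "C \<subseteq> \<tau>" "span C = span \<tau>" using rational_cone_generators[OF \<tau>] .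
  obtain S where S: "finite S" "S \<subseteq> N" "S \<subseteq> \<sigma>" "span S = span \<sigma>" using rational_cone_generators[OF \<sigma>] .
  have C': "C \<subseteq> sublattice N \<sigma>" using C sub by (auto simp: sublattice_def intro: span_base)
  have "lattice_subgroup (quot \<tau> ` sublattice N \<sigma>)"
    by (rule lattice_subgroup_quot[OF lattice_subgroup_sublattice[OF N] C(1) C' C(4)])
  then obtain bs where bs: "lattice_basis bs (quot \<tau> ` sublattice N \<sigma>)" by (auto simp: lattice_subgroup_def)
  have "dim (quot \<tau> ` sublattice N \<sigma>) + dim \<tau> = dim (sublattice N \<sigma>)"
    using sub span_sublattice[OF \<sigma>] span_superset[of \<sigma>] by (intro dim_quot_image) auto
  also have "dim (sublattice N \<sigma>) = dim \<sigma>" by (metis span_sublattice[OF \<sigma>] dim_span)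
  finally have "length bs = 1" using lattice_basis_length[OF bs] d by simp
  then obtain e0 where e0: "bs = [e0]" by (auto simp: length_Suc_conv)
  have e0': "e0 \<noteq> 0" "group_closure {e0} = quot \<tau> ` sublattice N \<sigma>"
    using bs by (auto simp: e0 lattice_basis_def)
  have "\<not> S \<subseteq> span \<tau>"
  proof
    assume "S \<subseteq> span \<tau>"
    then have "span \<sigma> \<subseteq> span \<tau>" using S(4) by (metis span_minimal subspace_span)
    then have "dim \<sigma> \<le> dim \<tau>" using dim_subset dim_span by metis
    then show False using d by simp
  qed
  then obtain s where s: "s \<in> S" "s \<notin> span \<tau>" by auto
  have "s \<in> sublattice N \<sigma>" using s S by (auto simp: sublattice_def intro: span_base)
  then have "quot \<tau> s \<in> group_closure {e0}" using e0' by simp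
  then obtain k :: int where k: "quot \<tau> s = of_int k *\<^sub>R e0" by (auto simp: group_closure_singleton)
  have k0: "k \<noteq> 0" using k s by (auto simp flip: quot_eq_0_iff)
  \<comment> \<open>\<open>e0\<close> is determined up to sign only; the multiple \<open>k\<close>
    belonging to a vector of \<sigma> outside span \<tau> tells on which side \<sigma> lies.\<close>
  define e where "e = of_int (sgn k) *\<^sub>R e0"
  have ge: "group_closure {e} = group_closure {e0}"
  proof (cases "k > 0")
    case False
    then have e: "e = - e0" using k0 by (simp add: e_def)
    have "range (\<lambda>k :: int. of_int k *\<^sub>R (- e0)) = range (\<lambda>k :: int. of_int k *\<^sub>R e0)"
    proof (intro equalityI image_subsetI)
      fix k :: int
      show "of_int k *\<^sub>R (- e0) \<in> range (\<lambda>k :: int. of_int k *\<^sub>R e0)"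
        by (rule image_eqI[of _ _ "- k"]) auto
      show "of_int k *\<^sub>R e0 \<in> range (\<lambda>k :: int. of_int k *\<^sub>R (- e0))"
        by (rule image_eqI[of _ _ "- k"]) auto
    qed
    then show ?thesis by (simp add: e group_closure_singleton)
  qed (simp add: e_def)
  have "quot \<tau> ((1 / \<bar>of_int k\<bar>) *\<^sub>R s) = e"
    using k0 by (simp add: quot_scale k e_def) (simp add: sgn_if abs_if)
  moreover have "(1 / \<bar>of_int k\<bar>) *\<^sub>R s \<in> \<sigma>" using s S by (intro rational_cone_scale[OF \<sigma>]) auto
  ultimately have "e \<in> quot \<tau> ` \<sigma>" by blast
  moreover have "e \<noteq> 0" using e0' k0 by (simp add: e_def sgn_if)
  ultimately show ?thesis using ge e0' by (intro that) auto
qed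

text \<open>If \<open>c\<close> were negative, adding \<open>- c\<close> times a vector of \<sigma>
  over \<open>e\<close> would lead into span \<tau>, so \<open>x\<close> would lie in the face
  \<tau> and project to 0.\<close>

lemma facet_pair_halfline:
  assumes "facet_pair N \<tau> \<sigma>" "e \<noteq> 0" "e \<in> quot \<tau> ` \<sigma>" "group_closure {e} = quot \<tau> ` sublattice N \<sigma>" "x \<in> \<sigma>"
  obtains c where "c \<ge> 0" "quot \<tau> x = c *\<^sub>R e"
proof -
  have \<sigma>: "rational_cone N \<sigma>" and f: "\<tau> face_of \<sigma>" and ne: "\<tau> \<noteq> {}"
    using assms(1) rational_cone_0 by (auto simp: facet_pair_def)
  have "quot \<tau> ` span (sublattice N \<sigma>) = span (group_closure {e})"
    using assms(4) by (simp add: linear_span_image[OF linear_quot])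
  also have "\<dots> \<subseteq> span {e}"
    by (rule span_minimal) (auto simp: group_closure_singleton span_scale span_base)
  finally have "quot \<tau> x \<in> span {e}" using assms(5) span_sublattice[OF \<sigma>] by (auto intro: span_base)
  then obtain c where c: "quot \<tau> x = c *\<^sub>R e" by (auto simp: span_singleton)
  show ?thesis
  proof (cases "c \<ge> 0")
    case False
    obtain y where y: "y \<in> \<sigma>" "e = quot \<tau> y" using assms(3) by auto
    have "quot \<tau> (x + (- c) *\<^sub>R y) = 0" using c y by (simp add: quot_add quot_diff quot_scale)
    then have "x + (- c) *\<^sub>R y \<in> span \<tau>" by (simp only: quot_eq_0_iff)
    moreover have "(- c) *\<^sub>R y \<in> \<sigma>" using False y by (intro rational_cone_scale[OF \<sigma>]) auto
    ultimately have "x \<in> \<tau>" using face_add_mem(1)[OF \<sigma> f assms(5)] ne by blast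
    then have "quot \<tau> x = 0" by (simp add: quot_eq_0_iff span_base)
    then show ?thesis using that[of 0] by simp
  qed (use that c in auto)
qed

text \<open>Two generators of an infinite cyclic group differ by a sign, and the half-line excludes
  the negative one.\<close>

lemma normal_gen_unique:
  assumes "facet_pair N \<tau> \<sigma>" "e \<noteq> 0" "e \<in> quot \<tau> ` \<sigma>" "group_closure {e} = quot \<tau> ` sublattice N \<sigma>"
    and "e' \<in> quot \<tau> ` \<sigma>" "group_closure {e'} = quot \<tau> ` sublattice N \<sigma>"
  shows "e' = e"
proof -
  have "e' \<in> group_closure {e}" "e \<in> group_closure {e'}"
    using assms(4,6) group_closure_superset by blast+
  then have "\<exists>j :: int. e' = of_int j *\<^sub>R e" "\<exists>k :: int. e = of_int k *\<^sub>R e'"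
    by (simp_all add: group_closure_singleton image_iff)
  then obtain j k :: int where jk: "e' = of_int j *\<^sub>R e" "e = of_int k *\<^sub>R e'" by metis
  then have "real_of_int (k * j) *\<^sub>R e = 1 *\<^sub>R e" by (metis scaleR_scaleR of_int_mult scaleR_one)
  then have "real_of_int (k * j) = 1" using assms(2) by (simp only: scaleR_cancel_right) simp
  then have "k * j = 1" by linarith
  then have j: "j = 1 \<or> j = -1" by (auto simp: zmult_eq_1_iff)
  obtain x where x: "x \<in> \<sigma>" "e' = quot \<tau> x" using assms(5) by auto
  obtain c where c: "c \<ge> 0" "quot \<tau> x = c *\<^sub>R e" using facet_pair_halfline[OF assms(1-4) x(1)] .
  have "of_int j *\<^sub>R e = c *\<^sub>R e" using c(2) x(2) jk(1) by simp
  then have "c = of_int j" using assms(2) by simp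
  then show ?thesis using j c(1) jk(1) by auto
qed

lemma normal_gen_eqI:
  assumes "facet_pair N \<tau> \<sigma>" "e \<noteq> 0" "e \<in> quot \<tau> ` \<sigma>" "group_closure {e} = quot \<tau> ` sublattice N \<sigma>"
  shows "normal_gen N \<tau> \<sigma> = e"
  unfolding normal_gen_def
proof (rule the_equality)
  show "e \<in> quot \<tau> ` \<sigma> \<and> group_closure {e} = quot \<tau> ` sublattice N \<sigma>" using assms by simp
  show "e' = e" if "e' \<in> quot \<tau> ` \<sigma> \<and> group_closure {e'} = quot \<tau> ` sublattice N \<sigma>" for e'
    using normal_gen_unique[OF assms] that by blast
qed

lemma normal_gen_properties:
  assumes "facet_pair N \<tau> \<sigma>"
  shows "normal_gen N \<tau> \<sigma> \<noteq> 0" "normal_gen N \<tau> \<sigma> \<in> quot \<tau> ` \<sigma>"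
    "group_closure {normal_gen N \<tau> \<sigma>} = quot \<tau> ` sublattice N \<sigma>"
proof -
  obtain e where e: "e \<noteq> 0" "e \<in> quot \<tau> ` \<sigma>" "group_closure {e} = quot \<tau> ` sublattice N \<sigma>"
    using normal_gen_exists[OF assms] .
  then show "normal_gen N \<tau> \<sigma> \<noteq> 0" "normal_gen N \<tau> \<sigma> \<in> quot \<tau> ` \<sigma>"
    "group_closure {normal_gen N \<tau> \<sigma>} = quot \<tau> ` sublattice N \<sigma>"
    by (simp_all add: normal_gen_eqI[OF assms e])
qed

section \<open>Signs\<close>

lemma orientation_nonzero:
  assumes "lattice_subgroup N"
  obtains \<phi>s where "orientation N \<sigma> \<phi>s = 1"
  using lattice_basis_dual[OF lattice_basis_frame[OF assms]] wedge_dual that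
  unfolding orientation_def by blast

lemma span_frame: "lattice_subgroup N \<Longrightarrow> rational_cone N \<sigma> \<Longrightarrow> span (set (frame N \<sigma>)) = span \<sigma>"
  using lattice_basis_span[OF lattice_basis_frame] span_sublattice by metis

lemma length_frame: "lattice_subgroup N \<Longrightarrow> rational_cone N \<sigma> \<Longrightarrow> length (frame N \<sigma>) = dim \<sigma>"
  by (metis lattice_basis_frame lattice_basis_length span_sublattice dim_span)

text \<open>Subtracting a multiple of \<open>n\<close> makes any vector of the lattice of \<sigma>
  vanish modulo \<tau>; what remains lies in the lattice of \<tau>, which is saturated by definition
  of \<open>sublattice\<close>.\<close>

lemma lattice_basis_Cons_frame:
  assumes "facet_pair N \<tau> \<sigma>" "n \<in> sublattice N \<sigma>" "quot \<tau> n = normal_gen N \<tau> \<sigma>"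
  shows "lattice_basis (n # frame N \<tau>) (sublattice N \<sigma>)"
proof -
  have N: "lattice_subgroup N" and \<tau>: "rational_cone N \<tau>" and \<sigma>: "rational_cone N \<sigma>"
    and f: "\<tau> face_of \<sigma>" using assms by (auto simp: facet_pair_def)
  note b = lattice_basis_frame[OF N, of \<tau>]
  have n: "n \<notin> span (set (frame N \<tau>))"
    using normal_gen_properties(1)[OF assms(1)] assms(3) span_frame[OF N \<tau>] quot_eq_0_iff by metis
  then have n': "n \<notin> set (frame N \<tau>)" by (auto intro: span_base)
  have sub: "set (frame N \<tau>) \<subseteq> sublattice N \<sigma>"
    using b group_closure_superset[of "set (frame N \<tau>)"] span_mono[OF face_of_imp_subset[OF f]]
    by (auto simp: lattice_basis_def sublattice_def)
  have "group_closure (set (n # frame N \<tau>)) = sublattice N \<sigma>"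
  proof
    show "group_closure (set (n # frame N \<tau>)) \<subseteq> sublattice N \<sigma>"
      by (rule group_closure_minimal) (use sub assms(2) N in \<open>auto intro: add_subgroup_sublattice\<close>)
    show "sublattice N \<sigma> \<subseteq> group_closure (set (n # frame N \<tau>))"
    proof
      fix x assume x: "x \<in> sublattice N \<sigma>"
      then have "quot \<tau> x \<in> group_closure {normal_gen N \<tau> \<sigma>}" using normal_gen_properties(3)[OF assms(1)] by auto
      then obtain k :: int where k: "quot \<tau> x = of_int k *\<^sub>R normal_gen N \<tau> \<sigma>"
        by (auto simp: group_closure_singleton)
      have kn: "of_int k *\<^sub>R n \<in> sublattice N \<sigma>"
        by (intro scaleR.add_subgroup_scale_int add_subgroup_sublattice N assms)
      have "x - of_int k *\<^sub>R n \<in> sublattice N \<sigma>"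
        by (intro add_subgroup_diff add_subgroup_sublattice N x kn)
      moreover have "quot \<tau> (x - of_int k *\<^sub>R n) = 0" by (simp add: quot_diff quot_scale k assms(3))
      ultimately have "x - of_int k *\<^sub>R n \<in> sublattice N \<tau>"
        by (auto simp: sublattice_def quot_eq_0_iff)
      then have "x - of_int k *\<^sub>R n \<in> group_closure (set (n # frame N \<tau>))"
        using b group_closure_mono[of "set (frame N \<tau>)" "set (n # frame N \<tau>)"]
        by (auto simp: lattice_basis_def)
      moreover have "of_int k *\<^sub>R n \<in> group_closure (set (n # frame N \<tau>))"
        by (intro scaleR.add_subgroup_scale_int add_subgroup_group_closure) (auto intro: group_closure.base)
      ultimately show "x \<in> group_closure (set (n # frame N \<tau>))"
        using group_closure_add by (metis diff_add_cancel)
    qed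
  qed
  then show ?thesis using b n n' by (auto simp: lattice_basis_def independent_insert)
qed

text \<open>More vectors than the rank: no index set in the expansion is large enough.\<close>

lemma wedge_dependent:
  assumes "lattice_basis bs M" "v \<in> span (set bs)"
  shows "wedge (v # bs) \<phi>s = 0"
proof (cases "\<forall>\<phi>\<in>set \<phi>s. linear \<phi>")
  case True
  obtain Ls where Ls: "dual_lists bs Ls" by (rule lattice_basis_dual[OF assms(1)])
  show ?thesis
  proof (cases "length \<phi>s = Suc (length bs)")
    case len: True
    have "{I. I \<subseteq> {..<length bs} \<and> card I = length \<phi>s} = {}"
    proof -
      have "card I \<noteq> length \<phi>s" if "I \<subseteq> {..<length bs}" for I
        using card_mono[OF _ that] len by simp
      then show ?thesis by blast
    qed
    moreover have "set (v # bs) \<subseteq> span (set bs)" using assms(2) by (auto intro: span_base)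
    ultimately show ?thesis using wedge_expand[OF Ls _ True, of "v # bs" "[]"] by (simp only: append_Nil2 sum.empty)
  qed (simp add: wedge_eq_0_length)
qed (auto intro: wedge_eq_0_nonlinear)

text \<open>Two lifts of the normal vector differ by an element of span \<tau>, which
  \<open>wedge_dependent\<close> removes, so the sign does not depend on the lift. The second part
  admits every real multiple of the normal vector, hence vectors of the cone outside the lattice;
  for these only the sign of \<open>c\<close> matters later.\<close>

lemma cone_sign_properties:
  assumes "facet_pair N \<tau> \<sigma>"
  shows "cone_sign N \<tau> \<sigma> = 1 \<or> cone_sign N \<tau> \<sigma> = -1"
    and cone_sign_vector: "quot \<tau> x = c *\<^sub>R normal_gen N \<tau> \<sigma> \<Longrightarrow>
      wedge (x # frame N \<tau>) \<phi>s = c * of_int (cone_sign N \<tau> \<sigma>) * orientation N \<sigma> \<phi>s"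
proof -
  have N: "lattice_subgroup N" and \<tau>: "rational_cone N \<tau>" using assms by (auto simp: facet_pair_def)
  have "normal_gen N \<tau> \<sigma> \<in> quot \<tau> ` sublattice N \<sigma>"
    using normal_gen_properties(3)[OF assms] group_closure_superset by blast
  then obtain n where n: "n \<in> sublattice N \<sigma>" "quot \<tau> n = normal_gen N \<tau> \<sigma>" by auto
  obtain s :: int where s: "s = 1 \<or> s = -1" "\<And>\<phi>s. wedge (n # frame N \<tau>) \<phi>s = of_int s * wedge (frame N \<sigma>) \<phi>s"
    by (rule wedge_basis_change[OF lattice_basis_frame[OF N] lattice_basis_Cons_frame[OF assms n]])
       (rule that)
  have gen: "wedge (x # frame N \<tau>) \<phi>s = c * of_int s * orientation N \<sigma> \<phi>s"
    if x: "quot \<tau> x = c *\<^sub>R normal_gen N \<tau> \<sigma>" for x c \<phi>s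
  proof -
    have "quot \<tau> x = quot \<tau> (c *\<^sub>R n)" using x n by (simp add: quot_scale)
    then have "x - c *\<^sub>R n \<in> span (set (frame N \<tau>))" using span_frame[OF N \<tau>] by (simp add: quot_eq_iff)
    then have "wedge ((x - c *\<^sub>R n) # frame N \<tau>) \<phi>s = 0"
      by (rule wedge_dependent[OF lattice_basis_frame[OF N]])
    then have "wedge (x # frame N \<tau>) \<phi>s = wedge ((c *\<^sub>R n) # frame N \<tau>) \<phi>s"
      using wedge_col_add[of "[]" "x - c *\<^sub>R n" "c *\<^sub>R n" "frame N \<tau>" \<phi>s] by simp
    also have "\<dots> = c * (of_int s * orientation N \<sigma> \<phi>s)"
      using wedge_col_scale[of "[]" c n] s(2) by (simp add: orientation_def)
    finally show ?thesis by simp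
  qed
  have "cone_sign N \<tau> \<sigma> = s"
    unfolding cone_sign_def
  proof (rule the_equality)
    show "\<forall>n\<in>sublattice N \<sigma>. quot \<tau> n = normal_gen N \<tau> \<sigma> \<longrightarrow>
        wedge (n # frame N \<tau>) = mv_scale (of_int s) (orientation N \<sigma>)"
      using gen[where c = 1] by (auto simp: mv_scale_def fun_eq_iff)
    fix t assume "\<forall>n\<in>sublattice N \<sigma>. quot \<tau> n = normal_gen N \<tau> \<sigma> \<longrightarrow>
        wedge (n # frame N \<tau>) = mv_scale (of_int t) (orientation N \<sigma>)"
    then have t: "wedge (n # frame N \<tau>) \<phi>s = of_int t * orientation N \<sigma> \<phi>s" for \<phi>s
      using n by (auto simp: mv_scale_def)
    obtain \<phi>s where "orientation N \<sigma> \<phi>s = 1" using orientation_nonzero[OF N] .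
    then show "t = s" using t[of \<phi>s] gen[where c = 1 and x = n and \<phi>s = \<phi>s] n by simp
  qed
  then show "cone_sign N \<tau> \<sigma> = 1 \<or> cone_sign N \<tau> \<sigma> = -1"
    "quot \<tau> x = c *\<^sub>R normal_gen N \<tau> \<sigma> \<Longrightarrow>
      wedge (x # frame N \<tau>) \<phi>s = c * of_int (cone_sign N \<tau> \<sigma>) * orientation N \<sigma> \<phi>s"
    using s gen by auto
qed

section \<open>Codimension two: cancellation in the square of the boundary\<close>

lemma dim_eq_span_subset:
  fixes A B :: "'a::euclidean_space set"
  assumes "A \<subseteq> span B" "dim B \<le> dim A" shows "span A = span B"
proof -
  have "span A \<subseteq> span B" using assms(1) by (simp add: span_minimal)
  then show ?thesis using dim_eq_span[of "span A" "span B"] assms(2) by (simp add: span_span)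
qed

text \<open>Take vectors x of \<rho> and x' of \<rho>' over the normal vectors of \<tau>. Then x'
  \<and> x \<and> \<nu> of \<tau> is a positive multiple of the first sign product times the
  orientation of \<sigma>, because x' lies in \<sigma> beyond \<rho>. Exchanging the roles gives the
  second product, and the wedge changes sign.\<close>

lemma facet_pairs_opposite_signs:
  assumes "facet_pair N \<tau> \<rho>" "facet_pair N \<tau> \<rho>'" "facet_pair N \<rho> \<sigma>" "facet_pair N \<rho>' \<sigma>" "\<rho> \<noteq> \<rho>'"
  shows "cone_sign N \<tau> \<rho> * cone_sign N \<rho> \<sigma> = - (cone_sign N \<tau> \<rho>' * cone_sign N \<rho>' \<sigma>)"
proof -
  have N: "lattice_subgroup N" using assms by (auto simp: facet_pair_def)
  have key: "\<exists>c>0. \<forall>\<phi>s. wedge (x' # x # frame N \<tau>) \<phi>s =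
      c * of_int (cone_sign N \<tau> \<rho> * cone_sign N \<rho> \<sigma>) * orientation N \<sigma> \<phi>s"
    if \<rho>: "facet_pair N \<tau> \<rho>" "facet_pair N \<tau> \<rho>'" "facet_pair N \<rho> \<sigma>" "facet_pair N \<rho>' \<sigma>" "\<rho> \<noteq> \<rho>'"
      "quot \<tau> x = normal_gen N \<tau> \<rho>" "x' \<in> \<rho>'" "x' \<notin> span \<tau>" for \<rho> \<rho>' x x'
  proof -
    have sub: "\<rho>' \<subseteq> \<sigma>" using \<rho>(4) by (auto simp: facet_pair_def dest: face_of_imp_subset)
    \<comment> \<open>Otherwise \<tau> together with x' would span both facets, and each facet is
      \<sigma> cut by its span.\<close>
    have nx': "x' \<notin> span \<rho>"
    proof
      assume x': "x' \<in> span \<rho>"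
      have d: "dim (insert x' \<tau>) = Suc (dim \<tau>)" using \<rho>(8) by (simp add: dim_insert)
      have "\<tau> \<subseteq> span \<rho>'" "\<tau> \<subseteq> span \<rho>"
        using \<rho>(1,2) by (auto simp: facet_pair_def dest: face_of_imp_subset intro: span_base)
      then have "span (insert x' \<tau>) = span \<rho>'" "span (insert x' \<tau>) = span \<rho>"
        using \<rho>(1,2,7) d x' by (auto intro!: dim_eq_span_subset simp: facet_pair_def span_base)
      then have "\<rho> = \<rho>'" using facet_pair_span_Int[OF \<rho>(3)] facet_pair_span_Int[OF \<rho>(4)] by auto
      then show False using \<rho>(5) by simp
    qed
    obtain c where c: "c \<ge> 0" "quot \<rho> x' = c *\<^sub>R normal_gen N \<rho> \<sigma>"
      using facet_pair_halfline[OF \<rho>(3) normal_gen_properties[OF \<rho>(3)]] sub \<rho>(7) by blast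
    have "c \<noteq> 0" using c nx' by (auto simp flip: quot_eq_0_iff)
    have "wedge (x' # x # frame N \<tau>) \<phi>s =
        c * of_int (cone_sign N \<tau> \<rho> * cone_sign N \<rho> \<sigma>) * orientation N \<sigma> \<phi>s" for \<phi>s
    proof -
      have "wedge (x # frame N \<tau>) \<psi>s = of_int (cone_sign N \<tau> \<rho>) * wedge (frame N \<rho>) \<psi>s" for \<psi>s
        using cone_sign_vector[OF \<rho>(1), of x 1 \<psi>s] \<rho>(6) by (simp add: orientation_def)
      then have "wedge (x' # x # frame N \<tau>) \<phi>s = of_int (cone_sign N \<tau> \<rho>) * wedge (x' # frame N \<rho>) \<phi>s"
        by (rule wedge_Cons_scale)
      then show ?thesis using cone_sign_vector[OF \<rho>(3) c(2), of \<phi>s] by simp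
    qed
    then show ?thesis using c(1) \<open>c \<noteq> 0\<close> by (intro exI[of _ c]) auto
  qed
  have rep: "\<exists>x\<in>\<rho>. quot \<tau> x = normal_gen N \<tau> \<rho> \<and> x \<notin> span \<tau>" if "facet_pair N \<tau> \<rho>" for \<rho>
    using normal_gen_properties(1,2)[OF that] by (auto simp flip: quot_eq_0_iff)
  obtain x where x: "x \<in> \<rho>" "quot \<tau> x = normal_gen N \<tau> \<rho>" "x \<notin> span \<tau>" using rep[OF assms(1)] by auto
  obtain x' where x': "x' \<in> \<rho>'" "quot \<tau> x' = normal_gen N \<tau> \<rho>'" "x' \<notin> span \<tau>" using rep[OF assms(2)] by auto
  obtain c where c: "c > 0" "\<And>\<phi>s. wedge (x' # x # frame N \<tau>) \<phi>s =
      c * of_int (cone_sign N \<tau> \<rho> * cone_sign N \<rho> \<sigma>) * orientation N \<sigma> \<phi>s"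
    using key[OF assms x(2) x'(1,3)] by auto
  obtain c' where c': "c' > 0" "\<And>\<phi>s. wedge (x # x' # frame N \<tau>) \<phi>s =
      c' * of_int (cone_sign N \<tau> \<rho>' * cone_sign N \<rho>' \<sigma>) * orientation N \<sigma> \<phi>s"
    using key[OF assms(2,1,4,3) assms(5)[symmetric] x'(2) x(1,3)] by auto
  obtain \<phi>s where \<phi>s: "orientation N \<sigma> \<phi>s = 1" using orientation_nonzero[OF N] .
  have "c * of_int (cone_sign N \<tau> \<rho> * cone_sign N \<rho> \<sigma>) = - (c' * of_int (cone_sign N \<tau> \<rho>' * cone_sign N \<rho>' \<sigma>))"
    using c(2)[of \<phi>s] c'(2)[of \<phi>s] wedge_col_swap[of "[]" x' x "frame N \<tau>" \<phi>s] \<phi>s by simp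
  then show ?thesis
    using cone_sign_properties(1)[OF assms(1)] cone_sign_properties(1)[OF assms(2)]
      cone_sign_properties(1)[OF assms(3)] cone_sign_properties(1)[OF assms(4)] c(1) c'(1)
    by auto
qed

text \<open>Extended by 0 to all pairs of sets and read as a real number, so that the boundary in
  all degrees is one matrix with index set \<open>\<Sigma>\<close>.\<close>

definition incidence :: "'a::euclidean_space set \<Rightarrow> 'a set set \<Rightarrow> 'a set \<Rightarrow> 'a set \<Rightarrow> real" where
  "incidence N \<Sigma> \<tau> \<sigma> =
     (if \<tau> \<in> \<Sigma> \<and> \<sigma> \<in> \<Sigma> \<and> \<tau> face_of \<sigma> \<and> dim \<sigma> = Suc (dim \<tau>) then of_int (cone_sign N \<tau> \<sigma>) else 0)"

lemma cone_complex_rational: "cone_complex N \<Sigma> \<Longrightarrow> \<sigma> \<in> \<Sigma> \<Longrightarrow> rational_cone N \<sigma>"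
  by (simp add: cone_complex_def)

lemma cone_complex_lattice: "cone_complex N \<Sigma> \<Longrightarrow> lattice_subgroup N"
  and cone_complex_finite: "cone_complex N \<Sigma> \<Longrightarrow> finite \<Sigma>"
  by (simp_all add: cone_complex_def)

lemma cone_complex_facet_pair:
  "cone_complex N \<Sigma> \<Longrightarrow> \<tau> \<in> \<Sigma> \<Longrightarrow> \<sigma> \<in> \<Sigma> \<Longrightarrow> \<tau> face_of \<sigma> \<Longrightarrow> dim \<sigma> = Suc (dim \<tau>) \<Longrightarrow> facet_pair N \<tau> \<sigma>"
  by (simp add: facet_pair_def cone_complex_def)

text \<open>A proper face of a polyhedron is the intersection of the facets containing it. With no
  such facet it would be everything, and with only one it would be that facet, which has larger
  dimension.\<close>

lemma two_facets:
  assumes \<Sigma>: "cone_complex N \<Sigma>" and \<sigma>: "\<sigma> \<in> \<Sigma>" and \<tau>: "\<tau> \<in> \<Sigma>" "\<tau> face_of \<sigma>" "dim \<sigma> = Suc (Suc (dim \<tau>))"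
  obtains \<rho> \<rho>' where "\<rho> \<noteq> \<rho>'" "\<And>\<mu>. \<mu> \<in> {\<rho>, \<rho>'} \<Longrightarrow> \<mu> \<in> \<Sigma> \<and> \<tau> face_of \<mu> \<and> \<mu> face_of \<sigma> \<and> dim \<mu> = Suc (dim \<tau>)"
proof -
  have r: "rational_cone N \<sigma>" "rational_cone N \<tau>" using cone_complex_rational \<Sigma> \<sigma> \<tau> by auto
  let ?F = "{F. F facet_of \<sigma> \<and> \<tau> \<subseteq> F}"
  have F: "\<mu> \<in> \<Sigma> \<and> \<tau> face_of \<mu> \<and> \<mu> face_of \<sigma> \<and> dim \<mu> = Suc (dim \<tau>)" if "\<mu> \<in> ?F" for \<mu>
  proof -
    have \<mu>: "\<mu> face_of \<sigma>" "\<mu> \<noteq> {}" "aff_dim \<mu> = aff_dim \<sigma> - 1" "\<tau> \<subseteq> \<mu>"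
      using that by (auto simp: facet_of_def)
    have "0 \<in> \<mu>" using r \<mu>(4) rational_cone_0 by auto
    then have "dim \<mu> = Suc (dim \<tau>)"
      using \<mu>(3) \<tau>(3) aff_dim_cone[of \<mu>] aff_dim_cone[of \<sigma>] rational_cone_0[OF r(1)] by simp
    moreover have "\<tau> face_of \<mu>" using \<mu> \<tau> by (meson face_of_subset face_of_imp_subset)
    ultimately show ?thesis using \<mu> \<Sigma> \<sigma> by (auto simp: cone_complex_def)
  qed
  have "\<tau> \<noteq> {}" "\<tau> \<noteq> \<sigma>" using \<tau>(3) rational_cone_0[OF r(2)] by auto
  then have int: "\<tau> = \<Inter>?F" using face_of_polyhedron[OF rational_cone_polyhedron[OF r(1)] \<tau>(2)] by simp
  have "?F \<noteq> {}"
  proof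
    assume "?F = {}"
    with int have "\<tau> = \<Inter>{}" by (simp only:)
    then have "\<tau> = UNIV" by simp
    then have "\<tau> = \<sigma>" using face_of_imp_subset[OF \<tau>(2)] by auto
    then show False using \<open>\<tau> \<noteq> \<sigma>\<close> by simp
  qed
  then obtain \<rho> where \<rho>: "\<rho> \<in> ?F" by blast
  have "?F \<noteq> {\<rho>}"
  proof
    assume "?F = {\<rho>}"
    with int have "\<tau> = \<Inter>{\<rho>}" by (simp only:)
    then have "\<tau> = \<rho>" by simp
    then show False using F[OF \<rho>] by simp
  qed
  then obtain \<rho>' where "\<rho>' \<in> ?F" "\<rho> \<noteq> \<rho>'" using \<rho> by blast
  then show ?thesis using F \<rho> by (intro that[of \<rho> \<rho>']) blast+
qed

text \<open>Any two intermediate cones contribute opposite signs. Three nonzero numbers cannot be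
  pairwise opposite, so the two cones from \<open>two_facets\<close> are all there are, and they
  cancel.\<close>

lemma incidence_square:
  assumes \<Sigma>: "cone_complex N \<Sigma>"
  shows "(\<Sum>\<rho>\<in>\<Sigma>. incidence N \<Sigma> \<tau> \<rho> * incidence N \<Sigma> \<rho> \<sigma>) = 0"
proof (cases "\<tau> \<in> \<Sigma> \<and> \<sigma> \<in> \<Sigma> \<and> \<tau> face_of \<sigma> \<and> dim \<sigma> = Suc (Suc (dim \<tau>))")
  case False
  have "incidence N \<Sigma> \<tau> \<rho> * incidence N \<Sigma> \<rho> \<sigma> = 0" for \<rho>
    using False face_of_trans by (auto simp: incidence_def)
  then show ?thesis by (intro sum.neutral) blast
next
  case True
  obtain \<rho> \<rho>' where \<rho>: "\<rho> \<noteq> \<rho>'" "\<And>\<mu>. \<mu> \<in> {\<rho>, \<rho>'} \<Longrightarrow> \<mu> \<in> \<Sigma> \<and> \<tau> face_of \<mu> \<and> \<mu> face_of \<sigma> \<and> dim \<mu> = Suc (dim \<tau>)"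
    using two_facets[OF \<Sigma>] True by metis
  let ?R = "{\<mu> \<in> \<Sigma>. \<tau> face_of \<mu> \<and> \<mu> face_of \<sigma> \<and> dim \<mu> = Suc (dim \<tau>)}"
  let ?P = "\<lambda>\<mu>. cone_sign N \<tau> \<mu> * cone_sign N \<mu> \<sigma>"
  have pair: "facet_pair N \<tau> \<mu>" "facet_pair N \<mu> \<sigma>" if "\<mu> \<in> ?R" for \<mu>
    using that True by (auto intro!: cone_complex_facet_pair[OF \<Sigma>])
  have opp: "?P \<mu> = - ?P \<mu>'" if "\<mu> \<in> ?R" "\<mu>' \<in> ?R" "\<mu> \<noteq> \<mu>'" for \<mu> \<mu>'
    using facet_pairs_opposite_signs[OF pair(1)[OF that(1)] pair(1)[OF that(2)] pair(2)[OF that(1)] pair(2)[OF that(2)] that(3)] .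
  have mem: "\<rho> \<in> ?R" "\<rho>' \<in> ?R" using \<rho>(2) by auto
  have nz: "?P \<mu> \<noteq> 0" if "\<mu> \<in> ?R" for \<mu>
    using cone_sign_properties(1)[OF pair(1)[OF that]] cone_sign_properties(1)[OF pair(2)[OF that]] by auto
  have R: "?R = {\<rho>, \<rho>'}"
  proof (rule ccontr)
    assume "?R \<noteq> {\<rho>, \<rho>'}"
    then obtain \<mu> where \<mu>: "\<mu> \<in> ?R" "\<mu> \<noteq> \<rho>" "\<mu> \<noteq> \<rho>'" using mem by blast
    have "?P \<mu> = - ?P \<rho>" "?P \<mu> = - ?P \<rho>'" "?P \<rho> = - ?P \<rho>'"
      using opp[OF \<mu>(1) mem(1)] opp[OF \<mu>(1) mem(2)] opp[OF mem] \<mu> \<rho>(1) by auto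
    then show False using nz[OF mem(1)] by simp
  qed
  have "(\<Sum>\<mu>\<in>\<Sigma>. incidence N \<Sigma> \<tau> \<mu> * incidence N \<Sigma> \<mu> \<sigma>) = (\<Sum>\<mu>\<in>?R. of_int (?P \<mu>))"
    using True cone_complex_finite[OF \<Sigma>] by (intro sum.mono_neutral_cong_right) (auto simp: incidence_def)
  also have "\<dots> = 0" unfolding R using \<rho>(1) opp[OF mem] by (simp flip: of_int_mult)
  finally show ?thesis .
qed

section \<open>Star fans\<close>

lemma fan_dim_eqI:
  assumes "finite \<Sigma>" "\<And>\<sigma>. \<sigma> \<in> \<Sigma> \<Longrightarrow> dim \<sigma> \<le> d" "\<sigma> \<in> \<Sigma>" "dim \<sigma> = d"
  shows "fan_dim \<Sigma> = int d"
  unfolding fan_dim_def using assms by (intro arg_cong[where f = int] Max_eqI) auto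

lemma dim_le_fan_dim: "finite \<Sigma> \<Longrightarrow> \<sigma> \<in> \<Sigma> \<Longrightarrow> int (dim \<sigma>) \<le> fan_dim \<Sigma>"
  by (simp add: fan_dim_def)

lemma cone_complex_top:
  assumes "cone_complex N \<Sigma>" "\<tau> \<in> \<Sigma>"
  obtains \<sigma> where "\<sigma> \<in> \<Sigma>" "int (dim \<sigma>) = fan_dim \<Sigma>" "\<tau> \<subseteq> \<sigma>"
proof -
  have "pure_dimensional \<Sigma>" using assms(1) by (simp add: cone_complex_def)
  then have "\<exists>\<sigma>\<in>cones \<Sigma> (fan_dim \<Sigma>). \<tau> \<subseteq> \<sigma>" using assms(2) by (simp add: pure_dimensional_def)
  then show ?thesis using that by (auto simp: cones_def)
qed

lemma pure_dimensionalI: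
  assumes "finite \<Sigma>" "\<Sigma> \<noteq> {}" "\<And>\<sigma>. \<sigma> \<in> \<Sigma> \<Longrightarrow> dim \<sigma> \<le> d"
    "\<And>\<tau>. \<tau> \<in> \<Sigma> \<Longrightarrow> \<exists>\<sigma>\<in>\<Sigma>. \<tau> \<subseteq> \<sigma> \<and> dim \<sigma> = d"
  shows "pure_dimensional \<Sigma>" "fan_dim \<Sigma> = int d"
proof -
  obtain \<sigma> where "\<sigma> \<in> \<Sigma>" "dim \<sigma> = d" using assms(2,4) by blast
  then show "fan_dim \<Sigma> = int d" using fan_dim_eqI assms by metis
  then show "pure_dimensional \<Sigma>" using assms(4) by (auto simp: pure_dimensional_def cones_def)
qed

lemma dim_star_cone: "\<rho> \<subseteq> \<eta> \<Longrightarrow> dim (quot \<rho> ` \<eta>) + dim \<rho> = dim \<eta>"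
  by (rule dim_quot_image) (use span_superset in blast)

lemma rational_cone_quot:
  assumes "rational_cone N \<eta>"
  shows "rational_cone (quot \<rho> ` N) (quot \<rho> ` \<eta>)"
proof -
  obtain S where S: "finite S" "S \<subseteq> N" "\<eta> = convex_cone hull S" using assms by (auto simp: rational_cone_def)
  then have "quot \<rho> ` \<eta> = convex_cone hull (quot \<rho> ` S)"
    by (simp add: convex_cone_hull_linear_image[OF linear_quot])
  then show ?thesis using S unfolding rational_cone_def by blast
qed

text \<open>Preimages of faces of a projected cone are faces upstairs containing \<rho>; this makes
  the star closed under faces.\<close>

lemma face_of_quot_image:
  assumes \<eta>: "rational_cone N \<eta>" and sub: "\<rho> \<subseteq> \<eta>" and T: "T face_of quot \<rho> ` \<eta>" "T \<noteq> {}"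
  shows "{x \<in> \<eta>. quot \<rho> x \<in> T} face_of \<eta>" "quot \<rho> ` {x \<in> \<eta>. quot \<rho> x \<in> T} = T"
    "\<rho> \<subseteq> {x \<in> \<eta>. quot \<rho> x \<in> T}"
proof -
  have Tsub: "T \<subseteq> quot \<rho> ` \<eta>" using T(1) by (rule face_of_imp_subset)
  have "0 \<in> T" using face_contains_0[OF rational_cone_quot[OF \<eta>] T] .
  moreover have "quot \<rho> x = 0" if "x \<in> \<rho>" for x using that by (simp add: quot_eq_0_iff span_base)
  ultimately show "\<rho> \<subseteq> {x \<in> \<eta>. quot \<rho> x \<in> T}" using sub by auto
  show "quot \<rho> ` {x \<in> \<eta>. quot \<rho> x \<in> T} = T" using Tsub by auto
  have conv: "convex (quot \<rho> -` T)"
    using face_of_imp_convex[OF T(1)] by (rule convex_linear_vimage[OF linear_quot])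
  show "{x \<in> \<eta>. quot \<rho> x \<in> T} face_of \<eta>"
    unfolding face_of_def
  proof (intro conjI ballI impI)
    have "{x \<in> \<eta>. quot \<rho> x \<in> T} = \<eta> \<inter> quot \<rho> -` T" by auto
    then show "convex {x \<in> \<eta>. quot \<rho> x \<in> T}" using conv rational_cone_convex[OF \<eta>] by (simp add: convex_Int)
    fix a b x assume a: "a \<in> \<eta>" and b: "b \<in> \<eta>" and x: "x \<in> {x \<in> \<eta>. quot \<rho> x \<in> T}" "x \<in> open_segment a b"
    obtain u where u: "0 < u" "u < 1" "x = (1 - u) *\<^sub>R a + u *\<^sub>R b" using x(2) by (auto simp: in_segment)
    have qx: "quot \<rho> x = (1 - u) *\<^sub>R quot \<rho> a + u *\<^sub>R quot \<rho> b" by (simp add: u quot_add quot_scale)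
    have "quot \<rho> a \<in> T \<and> quot \<rho> b \<in> T"
    \<comment> \<open>The projection may collapse the segment to a point, which leaves no open
      segment for the face property of \<open>T\<close>.\<close>
    proof (cases "quot \<rho> a = quot \<rho> b")
      case True
      then have "quot \<rho> x = quot \<rho> a" using qx by (simp flip: scaleR_left_distrib)
      then show ?thesis using x True by simp
    next
      case False
      then have "quot \<rho> x \<in> open_segment (quot \<rho> a) (quot \<rho> b)" using qx u by (auto simp: in_segment)
      then show ?thesis using T(1) a b x(1) unfolding face_of_def by blast
    qed
    then show "a \<in> {x \<in> \<eta>. quot \<rho> x \<in> T}" "b \<in> {x \<in> \<eta>. quot \<rho> x \<in> T}" using a b by auto
  qed auto
qed

text \<open>All dimensions drop by dim \<rho>, so purity passes to the star.\<close>

lemma cone_complex_star: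
  assumes \<Sigma>: "cone_complex N \<Sigma>" and \<rho>: "\<rho> \<in> \<Sigma>"
  shows "cone_complex (quot \<rho> ` N) (star_fan \<Sigma> \<rho>)"
proof -
  note N = cone_complex_lattice[OF \<Sigma>] and fin = cone_complex_finite[OF \<Sigma>] and rat = cone_complex_rational[OF \<Sigma>]
  obtain C where C: "finite C" "C \<subseteq> N" "C \<subseteq> \<rho>" "span C = span \<rho>" using rational_cone_generators[OF rat[OF \<rho>]] .
  define d where "d = nat (fan_dim \<Sigma>)"
  have d: "fan_dim \<Sigma> = int d" by (simp add: d_def fan_dim_def)
  have pure: "pure_dimensional (star_fan \<Sigma> \<rho>)"
  proof (rule pure_dimensionalI)
    show "finite (star_fan \<Sigma> \<rho>)" using fin by (simp add: star_fan_def)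
    show "star_fan \<Sigma> \<rho> \<noteq> {}" using \<rho> by (auto simp: star_fan_def)
    fix \<tau> assume "\<tau> \<in> star_fan \<Sigma> \<rho>"
    then obtain \<eta> where \<eta>: "\<eta> \<in> \<Sigma>" "\<rho> \<subseteq> \<eta>" "\<tau> = quot \<rho> ` \<eta>" by (auto simp: star_fan_def)
    show "dim \<tau> \<le> d - dim \<rho>"
      using dim_star_cone[OF \<eta>(2)] dim_le_fan_dim[OF fin \<eta>(1)] \<eta>(3) d by simp
    obtain \<sigma> where "\<sigma> \<in> \<Sigma>" "int (dim \<sigma>) = fan_dim \<Sigma>" "\<eta> \<subseteq> \<sigma>" using cone_complex_top[OF \<Sigma> \<eta>(1)] .
    moreover from this have "\<rho> \<subseteq> \<sigma>" using \<eta>(2) by blast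
    ultimately show "\<exists>\<sigma>\<in>star_fan \<Sigma> \<rho>. \<tau> \<subseteq> \<sigma> \<and> dim \<sigma> = d - dim \<rho>"
      using \<eta> dim_star_cone[of \<rho> \<sigma>] d by (intro bexI[of _ "quot \<rho> ` \<sigma>"]) (auto simp: star_fan_def)
  qed
  have "T \<in> star_fan \<Sigma> \<rho>" if a: "\<sigma> \<in> star_fan \<Sigma> \<rho>" "T \<noteq> {}" "T face_of \<sigma>" for \<sigma> T
  proof -
    obtain \<eta> where \<eta>: "\<eta> \<in> \<Sigma>" "\<rho> \<subseteq> \<eta>" "\<sigma> = quot \<rho> ` \<eta>" using a(1) by (auto simp: star_fan_def)
    note f = face_of_quot_image[OF rat[OF \<eta>(1)] \<eta>(2) a(3)[unfolded \<eta>(3)] a(2)]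
    have "{x \<in> \<eta>. quot \<rho> x \<in> T} \<in> \<Sigma>"
      using \<Sigma> \<eta>(1) f(1,3) rational_cone_0[OF rat[OF \<rho>]] unfolding cone_complex_def by blast
    then show ?thesis unfolding star_fan_def using f(2,3) by blast
  qed
  moreover have "rational_cone (quot \<rho> ` N) \<sigma>" if \<sigma>: "\<sigma> \<in> star_fan \<Sigma> \<rho>" for \<sigma>
  proof -
    obtain \<eta> where "\<eta> \<in> \<Sigma>" "\<sigma> = quot \<rho> ` \<eta>" using \<sigma> by (auto simp: star_fan_def)
    then show ?thesis using rational_cone_quot[OF rat] by simp
  qed
  moreover have "finite (star_fan \<Sigma> \<rho>)" "star_fan \<Sigma> \<rho> \<noteq> {}"
    using fin \<rho> by (auto simp: star_fan_def)
  ultimately show ?thesis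
    unfolding cone_complex_def using lattice_subgroup_quot[OF N C(1,2,4)] pure by blast
qed

section \<open>Products\<close>

lemma span_Times:
  fixes A :: "'a::euclidean_space set" and B :: "'b::euclidean_space set"
  assumes "0 \<in> A" "0 \<in> B"
  shows "span (A \<times> B) = span A \<times> span B"
proof
  show "span (A \<times> B) \<subseteq> span A \<times> span B"
    by (rule span_minimal) (auto simp: span_base subspace_Times)
  show "span A \<times> span B \<subseteq> span (A \<times> B)"
  proof clarify
    fix x y assume "x \<in> span A" "y \<in> span B"
    then have "(x, 0) \<in> inl ` span A" "(0, y) \<in> inr ` span B" by auto
    then have "(x, 0) \<in> span (inl ` A :: ('a \<times> 'b) set)" "(0, y) \<in> span (inr ` B :: ('a \<times> 'b) set)"
      using linear_span_image[OF linear_inl] linear_span_image[OF linear_inr] by blast+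
    moreover have "inl ` A \<subseteq> A \<times> B" "inr ` B \<subseteq> A \<times> B" using assms by auto
    ultimately have "(x, 0) \<in> span (A \<times> B)" "(0, y) \<in> span (A \<times> B)" using span_mono by blast+
    from span_add[OF this] show "(x, y) \<in> span (A \<times> B)" by simp
  qed
qed

lemma dim_Times':
  fixes A :: "'a::euclidean_space set" and B :: "'b::euclidean_space set"
  assumes "0 \<in> A" "0 \<in> B"
  shows "dim (A \<times> B) = dim A + dim B"
proof -
  have "dim (A \<times> B) = dim (span A \<times> span B)" using span_Times[OF assms] by (metis dim_span)
  then show ?thesis by (simp add: dim_Times)
qed

lemma sublattice_Times:
  "0 \<in> A \<Longrightarrow> 0 \<in> B \<Longrightarrow> sublattice (N \<times> N') (A \<times> B) = sublattice N A \<times> sublattice N' B"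
  by (auto simp: sublattice_def span_Times)

lemma quot_Times:
  assumes "0 \<in> A" "0 \<in> B"
  shows "quot (A \<times> B) (v, w) = (quot A v, quot B w)"
proof (rule quot_unique)
  show "(quot A v, quot B w) \<in> orthogonal_comp (A \<times> B)"
    using quot_properties(1)[of A v] quot_properties(1)[of B w]
    by (auto simp: orthogonal_comp_def real_inner_class.orthogonal_def)
  show "(v, w) - (quot A v, quot B w) \<in> span (A \<times> B)"
    using quot_properties(2)[where v = v and \<sigma> = A] quot_properties(2)[where v = w and \<sigma> = B]
    by (simp add: span_Times[OF assms])
qed

lemma quot_Times_image:
  assumes "0 \<in> A" "0 \<in> B"
  shows "quot (A \<times> B) ` (X \<times> Y) = quot A ` X \<times> quot B ` Y"
proof (intro equalityI subsetI)
  fix p assume "p \<in> quot A ` X \<times> quot B ` Y"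
  then obtain x y where "x \<in> X" "y \<in> Y" "p = quot (A \<times> B) (x, y)" by (auto simp: quot_Times[OF assms])
  then show "p \<in> quot (A \<times> B) ` (X \<times> Y)" by blast
qed (auto simp: quot_Times[OF assms])

lemma star_fan_Times:
  assumes "0 \<in> \<sigma>" "0 \<in> \<sigma>'"
  shows "star_fan (product_fan \<Sigma> \<Sigma>') (\<sigma> \<times> \<sigma>') = product_fan (star_fan \<Sigma> \<sigma>) (star_fan \<Sigma>' \<sigma>')"
proof -
  have sub: "\<sigma> \<times> \<sigma>' \<subseteq> \<eta> \<times> \<eta>' \<longleftrightarrow> \<sigma> \<subseteq> \<eta> \<and> \<sigma>' \<subseteq> \<eta>'" for \<eta> \<eta>'
    using assms by auto
  show ?thesis
  proof (intro equalityI subsetI)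
    fix T assume "T \<in> star_fan (product_fan \<Sigma> \<Sigma>') (\<sigma> \<times> \<sigma>')"
    then obtain \<eta> \<eta>' where "\<eta> \<in> \<Sigma>" "\<eta>' \<in> \<Sigma>'" "\<sigma> \<times> \<sigma>' \<subseteq> \<eta> \<times> \<eta>'" "T = quot (\<sigma> \<times> \<sigma>') ` (\<eta> \<times> \<eta>')"
      by (auto simp: star_fan_def product_fan_def)
    then show "T \<in> product_fan (star_fan \<Sigma> \<sigma>) (star_fan \<Sigma>' \<sigma>')"
      unfolding quot_Times_image[OF assms] sub by (auto simp: star_fan_def product_fan_def)
  next
    fix T assume "T \<in> product_fan (star_fan \<Sigma> \<sigma>) (star_fan \<Sigma>' \<sigma>')"
    then obtain \<eta> \<eta>' where \<eta>: "\<eta> \<in> \<Sigma>" "\<eta>' \<in> \<Sigma>'" "\<sigma> \<subseteq> \<eta>" "\<sigma>' \<subseteq> \<eta>'" "T = quot \<sigma> ` \<eta> \<times> quot \<sigma>' ` \<eta>'"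
      by (auto simp: star_fan_def product_fan_def)
    then have "T = quot (\<sigma> \<times> \<sigma>') ` (\<eta> \<times> \<eta>')" by (simp add: quot_Times_image[OF assms])
    then show "T \<in> star_fan (product_fan \<Sigma> \<Sigma>') (\<sigma> \<times> \<sigma>')"
    proof -
      have "\<eta> \<times> \<eta>' \<in> product_fan \<Sigma> \<Sigma>'" using \<eta>(1,2) by (auto simp: product_fan_def)
      moreover have "\<sigma> \<times> \<sigma>' \<subseteq> \<eta> \<times> \<eta>'" using \<eta>(3,4) by blast
      ultimately show ?thesis using \<open>T = quot (\<sigma> \<times> \<sigma>') ` (\<eta> \<times> \<eta>')\<close> unfolding star_fan_def by blast
    qed
  qed
qed

text \<open>The generators of the factors, put on the two axes, generate the product, since the cone
  generated by a union is the sum of the cones.\<close>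

lemma rational_cone_Times:
  fixes N :: "'a::euclidean_space set" and N' :: "'b::euclidean_space set"
  assumes "rational_cone N \<sigma>" "rational_cone N' \<sigma>'" "0 \<in> N" "0 \<in> N'"
  shows "rational_cone (N \<times> N') (\<sigma> \<times> \<sigma>')"
proof -
  obtain S where S: "finite S" "S \<subseteq> N" "\<sigma> = convex_cone hull S" using assms(1) by (auto simp: rational_cone_def)
  obtain S' where S': "finite S'" "S' \<subseteq> N'" "\<sigma>' = convex_cone hull S'" using assms(2) by (auto simp: rational_cone_def)
  have "convex_cone hull (inl ` S \<union> inr ` S') = (\<Union>x\<in>inl ` \<sigma>. \<Union>y\<in>inr ` \<sigma>'. {x + y})"
    unfolding convex_cone_hull_Un S(3) S'(3)
    by (simp only: convex_cone_hull_linear_image[OF linear_inl] convex_cone_hull_linear_image[OF linear_inr])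
  also have "\<dots> = \<sigma> \<times> \<sigma>'" by auto
  finally have "\<sigma> \<times> \<sigma>' = convex_cone hull (inl ` S \<union> inr ` S')" by simp
  moreover have "finite (inl ` S \<union> inr ` S')" "inl ` S \<union> inr ` S' \<subseteq> N \<times> N'"
    using S S' assms by auto
  ultimately show ?thesis unfolding rational_cone_def by blast
qed

lemma fan_dim_nonneg: "fan_dim \<Sigma> \<ge> 0"
  by (simp add: fan_dim_def)

lemma cone_complex_0: "cone_complex N \<Sigma> \<Longrightarrow> \<sigma> \<in> \<Sigma> \<Longrightarrow> 0 \<in> \<sigma>"
  using cone_complex_rational rational_cone_0 by blast

lemma lattice_subgroup_0: "lattice_subgroup N \<Longrightarrow> 0 \<in> N"
  by (intro add_subgroup_zero lattice_subgroup_add_subgroup)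

lemma cone_complex_Times:
  assumes \<Sigma>: "cone_complex N \<Sigma>" and \<Sigma>': "cone_complex N' \<Sigma>'"
  shows "cone_complex (N \<times> N') (product_fan \<Sigma> \<Sigma>')" "fan_dim (product_fan \<Sigma> \<Sigma>') = fan_dim \<Sigma> + fan_dim \<Sigma>'"
proof -
  note N = cone_complex_lattice[OF \<Sigma>] and fin = cone_complex_finite[OF \<Sigma>] and rat = cone_complex_rational[OF \<Sigma>]
  note N' = cone_complex_lattice[OF \<Sigma>'] and fin' = cone_complex_finite[OF \<Sigma>'] and rat' = cone_complex_rational[OF \<Sigma>']
  note z = cone_complex_0[OF \<Sigma>] cone_complex_0[OF \<Sigma>']
  have finP: "finite (product_fan \<Sigma> \<Sigma>')" using fin fin' by (simp add: product_fan_def)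
  have neP: "product_fan \<Sigma> \<Sigma>' \<noteq> {}" using \<Sigma> \<Sigma>' by (auto simp: product_fan_def cone_complex_def)
  define d where "d = nat (fan_dim \<Sigma>) + nat (fan_dim \<Sigma>')"
  have d: "fan_dim \<Sigma> + fan_dim \<Sigma>' = int d" using fan_dim_nonneg[of \<Sigma>] fan_dim_nonneg[of \<Sigma>'] by (simp add: d_def)
  have dim_le: "dim \<sigma> \<le> d" if "\<sigma> \<in> product_fan \<Sigma> \<Sigma>'" for \<sigma>
    using that dim_le_fan_dim[OF fin] dim_le_fan_dim[OF fin'] d z
    by (fastforce simp: product_fan_def dim_Times')
  have top: "\<exists>\<sigma>\<in>product_fan \<Sigma> \<Sigma>'. \<tau> \<subseteq> \<sigma> \<and> dim \<sigma> = d" if \<tau>: "\<tau> \<in> product_fan \<Sigma> \<Sigma>'" for \<tau>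
  proof -
    obtain \<tau>1 \<tau>2 where t: "\<tau>1 \<in> \<Sigma>" "\<tau>2 \<in> \<Sigma>'" "\<tau> = \<tau>1 \<times> \<tau>2" using \<tau> by (auto simp: product_fan_def)
    obtain \<sigma>1 where 1: "\<sigma>1 \<in> \<Sigma>" "int (dim \<sigma>1) = fan_dim \<Sigma>" "\<tau>1 \<subseteq> \<sigma>1" using cone_complex_top[OF \<Sigma> t(1)] .
    obtain \<sigma>2 where 2: "\<sigma>2 \<in> \<Sigma>'" "int (dim \<sigma>2) = fan_dim \<Sigma>'" "\<tau>2 \<subseteq> \<sigma>2" using cone_complex_top[OF \<Sigma>' t(2)] .
    show ?thesis
      using 1 2 t d z by (intro bexI[of _ "\<sigma>1 \<times> \<sigma>2"]) (auto simp: product_fan_def dim_Times')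
  qed
  note pure = pure_dimensionalI[OF finP neP dim_le top]
  show "fan_dim (product_fan \<Sigma> \<Sigma>') = fan_dim \<Sigma> + fan_dim \<Sigma>'" using pure(2) d by simp
  have "\<tau> \<in> product_fan \<Sigma> \<Sigma>'" if a: "\<sigma> \<in> product_fan \<Sigma> \<Sigma>'" "\<tau> \<noteq> {}" "\<tau> face_of \<sigma>" for \<sigma> \<tau>
  proof -
    obtain \<sigma>1 \<sigma>2 where s: "\<sigma>1 \<in> \<Sigma>" "\<sigma>2 \<in> \<Sigma>'" "\<sigma> = \<sigma>1 \<times> \<sigma>2" using a(1) by (auto simp: product_fan_def)
    then obtain F F' where F: "F face_of \<sigma>1" "F' face_of \<sigma>2" "\<tau> = F \<times> F'"
      using a(3) by (auto simp: face_of_Times_decomp)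
    then have "F \<in> \<Sigma>" "F' \<in> \<Sigma>'" using a(2) s \<Sigma> \<Sigma>' unfolding cone_complex_def by blast+
    then show ?thesis using F(3) by (auto simp: product_fan_def)
  qed
  moreover have "rational_cone (N \<times> N') \<sigma>" if "\<sigma> \<in> product_fan \<Sigma> \<Sigma>'" for \<sigma>
    using that rat rat' lattice_subgroup_0[OF N] lattice_subgroup_0[OF N']
    by (auto simp: product_fan_def intro: rational_cone_Times)
  ultimately show "cone_complex (N \<times> N') (product_fan \<Sigma> \<Sigma>')"
    unfolding cone_complex_def using lattice_subgroup_Times[OF N N'] finP neP pure(1) by blast
qed

section \<open>Wedge products of product vectors\<close>

abbreviation fst_forms :: "('a \<Rightarrow> real) list \<Rightarrow> ('a \<times> 'b \<Rightarrow> real) list" where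
  "fst_forms \<phi>s \<equiv> map (\<lambda>\<phi>. \<phi> \<circ> fst) \<phi>s"

abbreviation snd_forms :: "('b \<Rightarrow> real) list \<Rightarrow> ('a \<times> 'b \<Rightarrow> real) list" where
  "snd_forms \<psi>s \<equiv> map (\<lambda>\<psi>. \<psi> \<circ> snd) \<psi>s"

lemma linear_comp_fst_iff:
  fixes \<phi> :: "'a::euclidean_space \<Rightarrow> real"
  shows "linear (\<phi> \<circ> fst :: 'a \<times> 'b::euclidean_space \<Rightarrow> real) \<longleftrightarrow> linear \<phi>"
proof
  assume "linear (\<phi> \<circ> fst :: 'a \<times> 'b \<Rightarrow> real)"
  from linear_compose[OF linear_inl this] show "linear \<phi>" by (simp add: comp_def)
qed (rule linear_comp_fst)

lemma linear_comp_snd_iff: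
  fixes \<psi> :: "'b::euclidean_space \<Rightarrow> real"
  shows "linear (\<psi> \<circ> snd :: 'a::euclidean_space \<times> 'b \<Rightarrow> real) \<longleftrightarrow> linear \<psi>"
proof
  assume "linear (\<psi> \<circ> snd :: 'a \<times> 'b \<Rightarrow> real)"
  from linear_compose[OF linear_inr this] show "linear \<psi>" by (simp add: comp_def)
qed (rule linear_comp_snd)

lemma wedge_map:
  assumes "linear f"
  shows "wedge (map f vs) \<theta>s =
    (if \<forall>\<theta>\<in>set \<theta>s. linear \<theta> then wedge vs (map (\<lambda>\<theta>. \<theta> \<circ> f) \<theta>s) else 0)"
proof (cases "length \<theta>s = length vs \<and> (\<forall>\<theta>\<in>set \<theta>s. linear \<theta>)")
  case True
  then have "\<forall>\<theta>\<in>set \<theta>s. linear (\<theta> \<circ> f)" using linear_compose[OF assms] by auto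
  moreover have "(map f vs ! \<pi> i) = f (vs ! \<pi> i)" if "\<pi> permutes {..<length vs}" "i < length vs" for \<pi> i
    using permutes_in_image[OF that(1), of i] that(2) by simp
  ultimately show ?thesis using True
    by (auto simp: wedge_def intro!: sum.cong prod.cong)
qed (auto simp: wedge_def)

text \<open>A block diagonal determinant: forms of one factor vanish on vectors of the other. It
  also holds when the block lengths do not match, both sides then being 0. This formula is what
  makes wedges on a product into tensors.\<close>

lemma wedge_product:
  "wedge (map inl xs @ map inr ys) (fst_forms \<phi>s @ snd_forms \<psi>s) = wedge xs \<phi>s * wedge ys \<psi>s"
proof (cases "(\<forall>\<phi>\<in>set \<phi>s. linear \<phi>) \<and> (\<forall>\<psi>\<in>set \<psi>s. linear \<psi>)")
  case False
  then have "wedge xs \<phi>s * wedge ys \<psi>s = 0" by (auto simp: wedge_def)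
  moreover have "\<exists>\<theta>\<in>set (fst_forms \<phi>s @ snd_forms \<psi>s :: ('a \<times> 'b \<Rightarrow> real) list). \<not> linear \<theta>"
  proof -
    from False consider \<phi> where "\<phi> \<in> set \<phi>s" "\<not> linear \<phi>" | \<psi> where "\<psi> \<in> set \<psi>s" "\<not> linear \<psi>" by blast
    then show ?thesis
    proof cases
      case 1
      then show ?thesis by (intro bexI[of _ "\<phi> \<circ> fst"]) (simp_all add: linear_comp_fst_iff)
    next
      case 2
      then show ?thesis by (intro bexI[of _ "\<psi> \<circ> snd"]) (simp_all add: linear_comp_snd_iff)
    qed
  qed
  ultimately show ?thesis by (simp only: wedge_eq_0_nonlinear)
next
  case True
  then have "\<forall>\<phi>\<in>set \<phi>s. linear \<phi>" and \<psi>: "\<forall>\<psi>\<in>set \<psi>s. linear \<psi>" by auto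
  from this(1) show ?thesis
  proof (induction \<phi>s arbitrary: xs)
    case Nil
    show ?case
    proof (cases xs)
      case Nil
      have m: "map (\<lambda>\<theta>. \<theta> \<circ> inr) (snd_forms \<psi>s :: ('a \<times> 'b \<Rightarrow> real) list) = \<psi>s"
        by (simp add: comp_def)
      have l: "\<forall>\<theta>\<in>set (snd_forms \<psi>s :: ('a \<times> 'b \<Rightarrow> real) list). linear \<theta>" using \<psi> by (auto intro: linear_comp_snd)
      have "wedge (map inr ys) (snd_forms \<psi>s :: ('a \<times> 'b \<Rightarrow> real) list) = wedge ys \<psi>s"
        by (simp only: wedge_map[OF linear_inr] if_P[OF l] m)
      then show ?thesis using Nil by (simp add: wedge_Nil comp_def)
    next
      case (Cons x xs')
      have l: "\<forall>\<theta>\<in>set (snd_forms \<psi>s :: ('a \<times> 'b \<Rightarrow> real) list). linear \<theta>" using \<psi> by (auto intro: linear_comp_snd)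
      have "(snd_forms \<psi>s ! i) (inl x) = 0" if "i < length \<psi>s" for i
        using \<psi> that by (simp add: linear_0)
      then have "wedge (inl x # map inl xs' @ map inr ys) (snd_forms \<psi>s :: ('a \<times> 'b \<Rightarrow> real) list) = 0"
        unfolding wedge_Cons_col[OF l] by (intro sum.neutral) simp
      then show ?thesis using Cons by (simp add: wedge_Nil_right comp_def)
    qed
  next
    case (Cons \<phi> \<phi>s)
    have l: "linear \<phi>" and lf: "linear (\<phi> \<circ> fst :: 'a \<times> 'b \<Rightarrow> real)"
      using Cons.prems by (auto intro: linear_comp_fst)
    let ?vs = "map inl xs @ map inr ys :: ('a \<times> 'b) list" and ?\<theta>s = "fst_forms \<phi>s @ snd_forms \<psi>s :: ('a \<times> 'b \<Rightarrow> real) list"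
    let ?f = "\<lambda>i. (-1) ^ i * (\<phi> \<circ> fst) (?vs ! i) * wedge (remove_nth i ?vs) ?\<theta>s"
    have "wedge ?vs (fst_forms (\<phi> # \<phi>s) @ snd_forms \<psi>s) = (\<Sum>i<length ?vs. ?f i)"
      using wedge_Cons_row[OF lf, of ?vs ?\<theta>s] by simp
    also have "\<dots> = (\<Sum>i<length xs. ?f i) + (\<Sum>i<length ys. ?f (length xs + i))"
      by (simp add: sum_lessThan_add)
    also have "(\<Sum>i<length ys. ?f (length xs + i)) = 0"
      using l by (intro sum.neutral) (auto simp: nth_append linear_0)
    also have "(\<Sum>i<length xs. ?f i) = (\<Sum>i<length xs. (-1) ^ i * \<phi> (xs ! i) * (wedge (remove_nth i xs) \<phi>s * wedge ys \<psi>s))"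
    proof (intro sum.cong refl)
      fix i assume "i \<in> {..<length xs}"
      then have i: "i < length xs" by simp
      have "remove_nth i ?vs = map inl (remove_nth i xs) @ map inr ys"
        using i by (simp add: remove_nth_append map_remove_nth)
      then have "wedge (remove_nth i ?vs) ?\<theta>s = wedge (remove_nth i xs) \<phi>s * wedge ys \<psi>s"
        using Cons.IH[of "remove_nth i xs"] Cons.prems by (simp add: comp_def)
      then show "?f i = (-1) ^ i * \<phi> (xs ! i) * (wedge (remove_nth i xs) \<phi>s * wedge ys \<psi>s)"
        using i by (simp add: nth_append)
    qed
    finally show ?case by (simp add: wedge_Cons_row[OF l] sum_distrib_right mult.assoc)
  qed
qed

lemma wedge_col_block_move:
  "wedge (us @ ws) \<phi>s = (-1) ^ (length us * length ws) * wedge (ws @ us) \<phi>s"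
proof (induction us arbitrary: ws)
  case (Cons u us)
  have "wedge ((u # us) @ ws) \<phi>s = (-1) ^ length (us @ ws) * wedge ((us @ ws) @ [u]) \<phi>s"
    using wedge_col_move[of "[]" "us @ ws" u "[]" \<phi>s] by (simp flip: power_add mult_2)
  also have "wedge ((us @ ws) @ [u]) \<phi>s = (-1) ^ (length us * length (ws @ [u])) * wedge ((ws @ [u]) @ us) \<phi>s"
    using Cons.IH[of "ws @ [u]"] by simp
  also have "(-1) ^ length (us @ ws) * ((-1) ^ (length us * length (ws @ [u])) * wedge ((ws @ [u]) @ us) \<phi>s) =
      (-1) ^ (length (u # us) * length ws) * wedge (ws @ u # us) \<phi>s"
    by (simp add: power_add mult.assoc flip: power_mult_distrib)
  finally show ?case .
qed simp

lemma wedge_append_right_scale: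
  assumes "\<And>\<phi>s. wedge vs \<phi>s = c * wedge ws \<phi>s" "length vs = length ws"
  shows "wedge (vs @ us) \<phi>s = c * wedge (ws @ us) \<phi>s"
  using wedge_append_Cons_scale[OF assms(1), of us] wedge_col_block_move[of vs us] wedge_col_block_move[of ws us]
  by (simp add: assms(2))

lemma wedge_map_scale:
  assumes "linear f" "\<And>\<phi>s. wedge vs \<phi>s = c * wedge ws \<phi>s"
  shows "wedge (map f vs) \<theta>s = c * wedge (map f ws) \<theta>s"
  using assms by (simp add: wedge_map)

section \<open>Incidence numbers of products\<close>

text \<open>The frame of a product cone is chosen without regard to the frames of its factors, so
  its wedge equals the product of their wedges only up to this sign.\<close>

definition product_sign ::
  "'a::euclidean_space set \<Rightarrow> 'b::euclidean_space set \<Rightarrow> 'a set \<Rightarrow> 'b set \<Rightarrow> real" where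
  "product_sign N N' \<sigma> \<sigma>' = (SOME s. (s = 1 \<or> s = -1) \<and>
     (\<forall>\<theta>s. orientation (N \<times> N') (\<sigma> \<times> \<sigma>') \<theta>s = s * wedge (map inl (frame N \<sigma>) @ map inr (frame N' \<sigma>')) \<theta>s))"

lemma product_sign_properties:
  assumes "lattice_subgroup N" "lattice_subgroup N'" "0 \<in> \<sigma>" "0 \<in> \<sigma>'"
  shows "product_sign N N' \<sigma> \<sigma>' = 1 \<or> product_sign N N' \<sigma> \<sigma>' = -1"
    "orientation (N \<times> N') (\<sigma> \<times> \<sigma>') \<theta>s =
       product_sign N N' \<sigma> \<sigma>' * wedge (map inl (frame N \<sigma>) @ map inr (frame N' \<sigma>')) \<theta>s"
proof -
  have "lattice_basis (map inl (frame N \<sigma>) @ map inr (frame N' \<sigma>')) (sublattice (N \<times> N') (\<sigma> \<times> \<sigma>'))"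
    unfolding sublattice_Times[OF assms(3,4)]
    by (intro lattice_basis_Times lattice_basis_frame assms)
  from wedge_basis_change[OF this lattice_basis_frame[OF lattice_subgroup_Times[OF assms(1,2)]]]
  obtain s :: int where "s = 1 \<or> s = -1" "\<And>\<theta>s. wedge (frame (N \<times> N') (\<sigma> \<times> \<sigma>')) \<theta>s =
      of_int s * wedge (map inl (frame N \<sigma>) @ map inr (frame N' \<sigma>')) \<theta>s" by metis
  then have "\<exists>s::real. (s = 1 \<or> s = -1) \<and>
     (\<forall>\<theta>s. orientation (N \<times> N') (\<sigma> \<times> \<sigma>') \<theta>s = s * wedge (map inl (frame N \<sigma>) @ map inr (frame N' \<sigma>')) \<theta>s)"
    by (intro exI[of _ "of_int s"]) (auto simp: orientation_def)
  from someI_ex[OF this, folded product_sign_def]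
  show "product_sign N N' \<sigma> \<sigma>' = 1 \<or> product_sign N N' \<sigma> \<sigma>' = -1"
    "orientation (N \<times> N') (\<sigma> \<times> \<sigma>') \<theta>s =
       product_sign N N' \<sigma> \<sigma>' * wedge (map inl (frame N \<sigma>) @ map inr (frame N' \<sigma>')) \<theta>s"
    by auto
qed

lemma face_eq_of_dim_eq:
  assumes "cone_complex N \<Sigma>" "\<tau> \<in> \<Sigma>" "\<sigma> \<in> \<Sigma>" "\<tau> face_of \<sigma>" "dim \<tau> = dim \<sigma>"
  shows "\<tau> = \<sigma>"
proof -
  have "\<tau> = span \<tau> \<inter> \<sigma>"
    using face_eq_span_Int[OF rational_cone_convex assms(4)] cone_complex_rational[OF assms(1)]
      cone_complex_0[OF assms(1)] assms by blast
  moreover have "span \<tau> = span \<sigma>"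
    using face_of_imp_subset[OF assms(4)] assms(5) by (intro dim_eq_span_subset) (auto intro: span_base)
  ultimately show ?thesis using span_superset[of \<sigma>] by blast
qed

text \<open>Modulo \<sigma>' the second factor projects to 0, so the quotient lattice is that of the
  first factor on its axis.\<close>

lemma normal_gen_Times_left:
  assumes f: "facet_pair N \<tau> \<sigma>" and fP: "facet_pair (N \<times> N') (\<tau> \<times> \<sigma>') (\<sigma> \<times> \<sigma>')" and z: "0 \<in> \<tau>" "0 \<in> \<sigma>" "0 \<in> \<sigma>'"
    and N': "lattice_subgroup N'"
  shows "normal_gen (N \<times> N') (\<tau> \<times> \<sigma>') (\<sigma> \<times> \<sigma>') = (normal_gen N \<tau> \<sigma>, 0)"
proof (rule normal_gen_eqI[OF fP])
  note e = normal_gen_properties[OF f]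
  have q0: "quot \<sigma>' x = 0" if "x \<in> \<sigma>' \<or> x \<in> sublattice N' \<sigma>'" for x
    using that by (auto simp: quot_eq_0_iff sublattice_def span_base)
  show "(normal_gen N \<tau> \<sigma>, 0) \<noteq> 0" using e by (simp add: zero_prod_def)
  have "0 \<in> quot \<sigma>' ` \<sigma>'" using z q0 by (auto intro!: image_eqI[of _ _ 0])
  then show "(normal_gen N \<tau> \<sigma>, 0) \<in> quot (\<tau> \<times> \<sigma>') ` (\<sigma> \<times> \<sigma>')"
    using e z by (simp add: quot_Times_image)
  have "0 \<in> sublattice N' \<sigma>'" by (intro add_subgroup_zero add_subgroup_sublattice N')
  then have "quot \<sigma>' ` sublattice N' \<sigma>' = {0}" using q0 by force
  then have "quot (\<tau> \<times> \<sigma>') ` sublattice (N \<times> N') (\<sigma> \<times> \<sigma>') = inl ` group_closure {normal_gen N \<tau> \<sigma>}"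
    using z e by (auto simp: quot_Times_image sublattice_Times)
  also have "\<dots> = group_closure (inl ` {normal_gen N \<tau> \<sigma>})" by (rule group_closure_image) simp
  finally show "group_closure {(normal_gen N \<tau> \<sigma>, 0)} = quot (\<tau> \<times> \<sigma>') ` sublattice (N \<times> N') (\<sigma> \<times> \<sigma>')" by simp
qed

lemma normal_gen_Times_right:
  assumes f: "facet_pair N' \<tau>' \<sigma>'" and fP: "facet_pair (N \<times> N') (\<sigma> \<times> \<tau>') (\<sigma> \<times> \<sigma>')" and z: "0 \<in> \<sigma>" "0 \<in> \<tau>'" "0 \<in> \<sigma>'"
    and N: "lattice_subgroup N"
  shows "normal_gen (N \<times> N') (\<sigma> \<times> \<tau>') (\<sigma> \<times> \<sigma>') = (0, normal_gen N' \<tau>' \<sigma>')"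
proof (rule normal_gen_eqI[OF fP])
  note e = normal_gen_properties[OF f]
  have q0: "quot \<sigma> x = 0" if "x \<in> \<sigma> \<or> x \<in> sublattice N \<sigma>" for x
    using that by (auto simp: quot_eq_0_iff sublattice_def span_base)
  show "(0, normal_gen N' \<tau>' \<sigma>') \<noteq> 0" using e by (simp add: zero_prod_def)
  have "0 \<in> quot \<sigma> ` \<sigma>" using z q0 by (auto intro!: image_eqI[of _ _ 0])
  then show "(0, normal_gen N' \<tau>' \<sigma>') \<in> quot (\<sigma> \<times> \<tau>') ` (\<sigma> \<times> \<sigma>')"
    using e z by (simp add: quot_Times_image)
  have "0 \<in> sublattice N \<sigma>" by (intro add_subgroup_zero add_subgroup_sublattice N)
  then have "quot \<sigma> ` sublattice N \<sigma> = {0}" using q0 by force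
  then have "quot (\<sigma> \<times> \<tau>') ` sublattice (N \<times> N') (\<sigma> \<times> \<sigma>') = inr ` group_closure {normal_gen N' \<tau>' \<sigma>'}"
    using z e by (auto simp: quot_Times_image sublattice_Times)
  also have "\<dots> = group_closure (inr ` {normal_gen N' \<tau>' \<sigma>'})" by (rule group_closure_image) simp
  finally show "group_closure {(0, normal_gen N' \<tau>' \<sigma>')} = quot (\<sigma> \<times> \<tau>') ` sublattice (N \<times> N') (\<sigma> \<times> \<sigma>')" by simp
qed

lemma normal_gen_lift:
  assumes "facet_pair N \<tau> \<sigma>"
  obtains n where "quot \<tau> n = normal_gen N \<tau> \<sigma>"
  using normal_gen_properties(2)[OF assms] by auto

text \<open>The wedge of (n, 0) with the frame of \<tau> \<times> \<sigma>' is compared with the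
  product of frames in two ways, directly and through the first factor. Evaluation at the dual list
  of the product frame, where its wedge is 1, extracts the coefficients.\<close>

lemma cone_sign_Times_left:
  assumes f: "facet_pair N \<tau> \<sigma>" and fP: "facet_pair (N \<times> N') (\<tau> \<times> \<sigma>') (\<sigma> \<times> \<sigma>')" and N': "lattice_subgroup N'" and z': "0 \<in> \<sigma>'"
  shows "of_int (cone_sign (N \<times> N') (\<tau> \<times> \<sigma>') (\<sigma> \<times> \<sigma>')) =
    product_sign N N' \<tau> \<sigma>' * product_sign N N' \<sigma> \<sigma>' * of_int (cone_sign N \<tau> \<sigma>)"
proof -
  have N: "lattice_subgroup N" and r: "rational_cone N \<tau>" "rational_cone N \<sigma>" and d: "dim \<sigma> = Suc (dim \<tau>)"
    using f by (auto simp: facet_pair_def)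
  have z: "0 \<in> \<tau>" "0 \<in> \<sigma>" using r rational_cone_0 by auto
  note ps = product_sign_properties[OF N N' z(1) z'] and ps' = product_sign_properties[OF N N' z(2) z']
  obtain n where n: "quot \<tau> n = normal_gen N \<tau> \<sigma>" using normal_gen_lift[OF f] .
  let ?W = "map inl (frame N \<sigma>) @ map inr (frame N' \<sigma>')"
  obtain Ls where "dual_lists (frame N \<sigma>) Ls" using lattice_basis_dual[OF lattice_basis_frame[OF N]] .
  moreover obtain Ls' where "dual_lists (frame N' \<sigma>') Ls'" using lattice_basis_dual[OF lattice_basis_frame[OF N']] .
  ultimately obtain \<theta>s where \<theta>s: "wedge ?W \<theta>s = 1" using wedge_dual[OF dual_lists_Times] by blast
  have "quot (\<tau> \<times> \<sigma>') (n, 0) = 1 *\<^sub>R normal_gen (N \<times> N') (\<tau> \<times> \<sigma>') (\<sigma> \<times> \<sigma>')"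
    using normal_gen_Times_left[OF f fP z z' N'] z z' n by (simp add: quot_Times quot_0)
  from cone_sign_vector[OF fP this, of \<theta>s]
  have 1: "wedge ((n, 0) # frame (N \<times> N') (\<tau> \<times> \<sigma>')) \<theta>s =
      of_int (cone_sign (N \<times> N') (\<tau> \<times> \<sigma>') (\<sigma> \<times> \<sigma>')) * product_sign N N' \<sigma> \<sigma>'"
    by (simp add: ps'(2) \<theta>s)
  have "wedge ((n, 0) # frame (N \<times> N') (\<tau> \<times> \<sigma>')) \<theta>s =
      product_sign N N' \<tau> \<sigma>' * wedge ((n, 0) # map inl (frame N \<tau>) @ map inr (frame N' \<sigma>')) \<theta>s"
    by (rule wedge_Cons_scale) (use ps(2) in \<open>simp add: orientation_def\<close>)
  also have "wedge ((n, 0) # map inl (frame N \<tau>) @ map inr (frame N' \<sigma>')) \<theta>s =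
      wedge (map inl (n # frame N \<tau>) @ map inr (frame N' \<sigma>')) \<theta>s" by simp
  also have "\<dots> = of_int (cone_sign N \<tau> \<sigma>) * wedge ?W \<theta>s"
  proof (rule wedge_append_right_scale[OF wedge_map_scale[OF linear_inl]])
    show "wedge (n # frame N \<tau>) \<phi>s = of_int (cone_sign N \<tau> \<sigma>) * wedge (frame N \<sigma>) \<phi>s" for \<phi>s
      using cone_sign_vector[OF f, of n 1 \<phi>s] n by (simp add: orientation_def)
    show "length (map inl (n # frame N \<tau>) :: ('a \<times> 'b) list) = length (map inl (frame N \<sigma>) :: ('a \<times> 'b) list)"
      using d by (simp add: length_frame[OF N r(1)] length_frame[OF N r(2)])
  qed
  finally show ?thesis using 1 \<theta>s ps(1) ps'(1) by auto
qed

text \<open>Here the new vector has to pass the dim \<sigma> vectors of the first frame; this is the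
  Koszul sign of the tensor product.\<close>

lemma cone_sign_Times_right:
  assumes f: "facet_pair N' \<tau>' \<sigma>'" and fP: "facet_pair (N \<times> N') (\<sigma> \<times> \<tau>') (\<sigma> \<times> \<sigma>')" and N: "lattice_subgroup N" and r: "rational_cone N \<sigma>"
  shows "of_int (cone_sign (N \<times> N') (\<sigma> \<times> \<tau>') (\<sigma> \<times> \<sigma>')) =
    product_sign N N' \<sigma> \<tau>' * product_sign N N' \<sigma> \<sigma>' * ((-1) ^ dim \<sigma> * of_int (cone_sign N' \<tau>' \<sigma>'))"
proof -
  have N': "lattice_subgroup N'" and r': "rational_cone N' \<tau>'" "rational_cone N' \<sigma>'"
    using f by (auto simp: facet_pair_def)
  have z: "0 \<in> \<tau>'" "0 \<in> \<sigma>'" and z': "0 \<in> \<sigma>" using r r' rational_cone_0 by auto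
  note ps = product_sign_properties[OF N N' z' z(1)] and ps' = product_sign_properties[OF N N' z' z(2)]
  obtain n where n: "quot \<tau>' n = normal_gen N' \<tau>' \<sigma>'" using normal_gen_lift[OF f] .
  let ?W = "map inl (frame N \<sigma>) @ map inr (frame N' \<sigma>')"
  obtain Ls where "dual_lists (frame N \<sigma>) Ls" using lattice_basis_dual[OF lattice_basis_frame[OF N]] .
  moreover obtain Ls' where "dual_lists (frame N' \<sigma>') Ls'" using lattice_basis_dual[OF lattice_basis_frame[OF N']] .
  ultimately obtain \<theta>s where \<theta>s: "wedge ?W \<theta>s = 1" using wedge_dual[OF dual_lists_Times] by blast
  have "quot (\<sigma> \<times> \<tau>') (0, n) = 1 *\<^sub>R normal_gen (N \<times> N') (\<sigma> \<times> \<tau>') (\<sigma> \<times> \<sigma>')"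
    using normal_gen_Times_right[OF f fP z' z N] z z' n by (simp add: quot_Times quot_0)
  from cone_sign_vector[OF fP this, of \<theta>s]
  have 1: "wedge ((0, n) # frame (N \<times> N') (\<sigma> \<times> \<tau>')) \<theta>s =
      of_int (cone_sign (N \<times> N') (\<sigma> \<times> \<tau>') (\<sigma> \<times> \<sigma>')) * product_sign N N' \<sigma> \<sigma>'"
    by (simp add: ps'(2) \<theta>s)
  have "wedge ((0, n) # frame (N \<times> N') (\<sigma> \<times> \<tau>')) \<theta>s =
      product_sign N N' \<sigma> \<tau>' * wedge ((0, n) # map inl (frame N \<sigma>) @ map inr (frame N' \<tau>')) \<theta>s"
    by (rule wedge_Cons_scale) (use ps(2) in \<open>simp add: orientation_def\<close>)
  also have "wedge ((0, n) # map inl (frame N \<sigma>) @ map inr (frame N' \<tau>')) \<theta>s =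
      (-1) ^ dim \<sigma> * wedge (map inl (frame N \<sigma>) @ map inr (n # frame N' \<tau>')) \<theta>s"
    using wedge_col_move[of "[]" "map inl (frame N \<sigma>)" "(0, n)" "map inr (frame N' \<tau>')" \<theta>s]
    by (simp add: length_frame[OF N r])
  also have "wedge (map inl (frame N \<sigma>) @ map inr (n # frame N' \<tau>')) \<theta>s =
      of_int (cone_sign N' \<tau>' \<sigma>') * wedge ?W \<theta>s"
  proof (rule wedge_append_Cons_scale[OF wedge_map_scale[OF linear_inr]])
    show "wedge (n # frame N' \<tau>') \<phi>s = of_int (cone_sign N' \<tau>' \<sigma>') * wedge (frame N' \<sigma>') \<phi>s" for \<phi>s
      using cone_sign_vector[OF f, of n 1 \<phi>s] n by (simp add: orientation_def)
  qed
  finally show ?thesis using 1 \<theta>s ps(1) ps'(1) by auto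
qed

text \<open>Conjugation by the diagonal matrix of product signs turns the incidence matrix into that
  of a tensor product. No dimension grows when passing to a face, so a total drop of one occurs in
  exactly one factor while the other cone stays the same.\<close>

lemma incidence_Times:
  assumes \<Sigma>: "cone_complex N \<Sigma>" and \<Sigma>': "cone_complex N' \<Sigma>'"
    and mem: "\<tau> \<in> \<Sigma>" "\<sigma> \<in> \<Sigma>" "\<tau>' \<in> \<Sigma>'" "\<sigma>' \<in> \<Sigma>'"
  shows "incidence (N \<times> N') (product_fan \<Sigma> \<Sigma>') (\<tau> \<times> \<tau>') (\<sigma> \<times> \<sigma>') =
    product_sign N N' \<tau> \<tau>' * product_sign N N' \<sigma> \<sigma>' *
      ((if \<tau>' = \<sigma>' then incidence N \<Sigma> \<tau> \<sigma> else 0) +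
       (if \<tau> = \<sigma> then (-1) ^ dim \<sigma> * incidence N' \<Sigma>' \<tau>' \<sigma>' else 0))"
proof -
  note C = cone_complex_Times[OF \<Sigma> \<Sigma>']
  note N = cone_complex_lattice[OF \<Sigma>] and N' = cone_complex_lattice[OF \<Sigma>']
  have z: "0 \<in> \<tau>" "0 \<in> \<sigma>" "0 \<in> \<tau>'" "0 \<in> \<sigma>'" using mem cone_complex_0[OF \<Sigma>] cone_complex_0[OF \<Sigma>'] by auto
  have memP: "\<tau> \<times> \<tau>' \<in> product_fan \<Sigma> \<Sigma>'" "\<sigma> \<times> \<sigma>' \<in> product_fan \<Sigma> \<Sigma>'" using mem by (auto simp: product_fan_def)
  have face: "\<tau> \<times> \<tau>' face_of \<sigma> \<times> \<sigma>' \<longleftrightarrow> \<tau> face_of \<sigma> \<and> \<tau>' face_of \<sigma>'"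
    using z by (auto simp: face_of_Times_eq)
  have refl: "\<sigma> face_of \<sigma>" "\<sigma>' face_of \<sigma>'"
    using mem cone_complex_rational[OF \<Sigma>] cone_complex_rational[OF \<Sigma>'] rational_cone_convex by (blast intro: face_of_refl)+
  consider (left) "\<tau>' = \<sigma>'" "\<tau> face_of \<sigma>" "dim \<sigma> = Suc (dim \<tau>)"
    | (right) "\<tau> = \<sigma>" "\<tau>' face_of \<sigma>'" "dim \<sigma>' = Suc (dim \<tau>')"
    | (none) "\<not> (\<tau>' = \<sigma>' \<and> \<tau> face_of \<sigma> \<and> dim \<sigma> = Suc (dim \<tau>))"
        "\<not> (\<tau> = \<sigma> \<and> \<tau>' face_of \<sigma>' \<and> dim \<sigma>' = Suc (dim \<tau>'))" by blast
  then show ?thesis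
  proof cases
    case left
    have f: "facet_pair N \<tau> \<sigma>" using cone_complex_facet_pair[OF \<Sigma>] mem left by blast
    have fP: "facet_pair (N \<times> N') (\<tau> \<times> \<sigma>') (\<sigma> \<times> \<sigma>')"
      using cone_complex_facet_pair[OF C(1)] memP left face refl z by (simp add: dim_Times')
    have "\<tau> \<noteq> \<sigma>" using left by auto
    then show ?thesis
      using cone_sign_Times_left[OF f fP N' z(4)] left memP mem face refl z
      by (simp add: incidence_def dim_Times')
  next
    case right
    have f: "facet_pair N' \<tau>' \<sigma>'" using cone_complex_facet_pair[OF \<Sigma>'] mem right by blast
    have fP: "facet_pair (N \<times> N') (\<sigma> \<times> \<tau>') (\<sigma> \<times> \<sigma>')"
      using cone_complex_facet_pair[OF C(1)] memP right face refl z by (simp add: dim_Times')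
    have "\<tau>' \<noteq> \<sigma>'" using right by auto
    then show ?thesis
      using cone_sign_Times_right[OF f fP N cone_complex_rational[OF \<Sigma> mem(2)]] right memP mem face refl z
      by (simp add: incidence_def dim_Times')
  next
    case none
    have "\<not> (\<tau> face_of \<sigma> \<and> \<tau>' face_of \<sigma>' \<and> dim \<sigma> + dim \<sigma>' = Suc (dim \<tau> + dim \<tau>'))"
    proof
      assume a: "\<tau> face_of \<sigma> \<and> \<tau>' face_of \<sigma>' \<and> dim \<sigma> + dim \<sigma>' = Suc (dim \<tau> + dim \<tau>')"
      have "dim \<tau> \<le> dim \<sigma>" "dim \<tau>' \<le> dim \<sigma>'" using a by (auto intro!: dim_subset face_of_imp_subset)
      then consider "dim \<sigma> = Suc (dim \<tau>)" "dim \<tau>' = dim \<sigma>'" | "dim \<sigma>' = Suc (dim \<tau>')" "dim \<tau> = dim \<sigma>"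
        using a by linarith
      then show False
        using none a face_eq_of_dim_eq[OF \<Sigma> mem(1,2)] face_eq_of_dim_eq[OF \<Sigma>' mem(3,4)] by cases auto
    qed
    then have "incidence (N \<times> N') (product_fan \<Sigma> \<Sigma>') (\<tau> \<times> \<tau>') (\<sigma> \<times> \<sigma>') = 0"
      unfolding incidence_def using face z by (auto simp: dim_Times')
    moreover have "(if \<tau>' = \<sigma>' then incidence N \<Sigma> \<tau> \<sigma> else 0) = 0"
      "(if \<tau> = \<sigma> then (-1) ^ dim \<sigma> * incidence N' \<Sigma>' \<tau>' \<sigma>' else 0) = 0"
      using none by (auto simp: incidence_def)
    ultimately show ?thesis by simp
  qed
qed

section \<open>Chains and Poincare duality\<close>

interpretation real_fun: real_space "\<lambda>(r :: real) (f :: 'x \<Rightarrow> real) x. r * f x"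
  by unfold_locales (auto simp: fun_eq_iff algebra_simps)

lemma sum_fun_apply: "(\<Sum>i\<in>I. f i) x = (\<Sum>i\<in>I. f i x :: 'b::comm_monoid_add)"
  by (induction I rule: infinite_finite_induct) auto

text \<open>The chain whose class is \<open>cap_product\<close> for q = 0. There are no boundaries
  in top degree, so this class is a singleton.\<close>

definition cap_chain ::
  "'a::euclidean_space set \<Rightarrow> 'a set set \<Rightarrow> int \<Rightarrow> ('a multivector \<Rightarrow> int) \<Rightarrow> 'a set \<Rightarrow> 'a multivector" where
  "cap_chain N \<Sigma> p \<alpha> = (\<lambda>\<sigma>. if \<sigma> \<in> cones \<Sigma> (fan_dim \<Sigma>) then contract_orientation N p \<alpha> \<sigma> else 0)"

text \<open>\<open>BM_boundary\<close> for all degrees at once; since \<open>incidence\<close>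
  vanishes off facets, no degree has to be carried along.\<close>

definition boundary ::
  "'a::euclidean_space set \<Rightarrow> 'a set set \<Rightarrow> ('a set \<Rightarrow> 'a multivector) \<Rightarrow> 'a set \<Rightarrow> 'a multivector" where
  "boundary N \<Sigma> c = (\<lambda>\<tau> \<phi>s. \<Sum>\<sigma>\<in>\<Sigma>. incidence N \<Sigma> \<tau> \<sigma> * c \<sigma> \<phi>s)"

lemma add_subgroup_F_lower: "add_subgroup (F_lower N \<Sigma> p \<sigma>)"
  by (simp add: F_lower_def add_subgroup_group_closure)

lemma F_lower_subset_exterior_power: "F_lower N \<Sigma> p \<sigma> \<subseteq> exterior_power p N"
  unfolding F_lower_def
proof (rule group_closure_minimal[OF _ add_subgroup_exterior_power])
  show "(\<Union>\<eta>\<in>{\<eta> \<in> \<Sigma>. \<sigma> \<subseteq> \<eta>}. exterior_power p (sublattice N \<eta>)) \<subseteq> exterior_power p N"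
    using exterior_power_mono[of "sublattice N _" N p] by (auto simp: sublattice_def)
qed

lemma F_lower_antimono: "\<tau> \<subseteq> \<sigma> \<Longrightarrow> F_lower N \<Sigma> p \<sigma> \<subseteq> F_lower N \<Sigma> p \<tau>"
  unfolding F_lower_def by (rule group_closure_mono) auto

lemma exterior_power_subset_F_lower:
  "\<eta> \<in> \<Sigma> \<Longrightarrow> \<sigma> \<subseteq> \<eta> \<Longrightarrow> exterior_power p (sublattice N \<eta>) \<subseteq> F_lower N \<Sigma> p \<sigma>"
  unfolding F_lower_def by (rule subset_trans[OF _ group_closure_superset]) auto

lemma add_subgroup_BM_chains: "add_subgroup (BM_chains N \<Sigma> p q)"
  unfolding add_subgroup_def BM_chains_def
  by (auto intro: add_subgroup_diff[OF add_subgroup_F_lower] add_subgroup_zero[OF add_subgroup_F_lower])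

lemma BM_chains_above: 
  assumes "finite \<Sigma>" "q > fan_dim \<Sigma>"
  shows "BM_chains N \<Sigma> p q = {0}"
proof -
  have "cones \<Sigma> q = {}" using dim_le_fan_dim[OF assms(1)] assms(2) by (force simp: cones_def)
  then show ?thesis by (auto simp: BM_chains_def fun_eq_iff)
qed

lemma BM_chains_support:
  assumes "c \<in> BM_chains N \<Sigma> p q" "c \<sigma> \<phi>s \<noteq> 0"
  shows "\<sigma> \<in> \<Sigma>" "int (dim \<sigma>) = q" "int (length \<phi>s) = p" "\<forall>\<phi>\<in>set \<phi>s. linear \<phi>"
proof -
  have s: "\<sigma> \<in> cones \<Sigma> q" using assms by (auto simp: BM_chains_def)
  then show "\<sigma> \<in> \<Sigma>" "int (dim \<sigma>) = q" by (auto simp: cones_def)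
  have "c \<sigma> \<in> F_lower N \<Sigma> p \<sigma>" using s assms(1) by (simp add: BM_chains_def)
  then have "c \<sigma> \<in> exterior_power p N" using F_lower_subset_exterior_power by blast
  then show "int (length \<phi>s) = p" "\<forall>\<phi>\<in>set \<phi>s. linear \<phi>" using exterior_power_eq_0 assms(2) by blast+
qed

lemma BM_boundary_eq_boundary:
  assumes "finite \<Sigma>" "c \<in> BM_chains N \<Sigma> p q"
  shows "BM_boundary N \<Sigma> q c = boundary N \<Sigma> c"
proof (intro ext)
  fix \<tau> \<phi>s
  have c0: "c \<sigma> = 0" if "\<sigma> \<notin> cones \<Sigma> q" for \<sigma> using assms(2) that by (simp add: BM_chains_def)
  show "BM_boundary N \<Sigma> q c \<tau> \<phi>s = boundary N \<Sigma> c \<tau> \<phi>s"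
  proof (cases "\<tau> \<in> cones \<Sigma> (q - 1)")
    case True
    have "BM_boundary N \<Sigma> q c \<tau> \<phi>s =
        (\<Sum>\<sigma>\<in>{\<sigma> \<in> cones \<Sigma> q. \<tau> face_of \<sigma>}. of_int (cone_sign N \<tau> \<sigma>) * c \<sigma> \<phi>s)"
      using True by (simp add: BM_boundary_def sum_fun_apply mv_scale_def)
    also have "\<dots> = boundary N \<Sigma> c \<tau> \<phi>s"
      unfolding boundary_def
    proof (rule sum.mono_neutral_cong_left[OF assms(1)])
      show "\<forall>\<sigma>\<in>\<Sigma> - {\<sigma> \<in> cones \<Sigma> q. \<tau> face_of \<sigma>}. incidence N \<Sigma> \<tau> \<sigma> * c \<sigma> \<phi>s = 0"
      proof
        fix \<sigma> assume "\<sigma> \<in> \<Sigma> - {\<sigma> \<in> cones \<Sigma> q. \<tau> face_of \<sigma>}"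
        then have "\<not> \<tau> face_of \<sigma> \<or> c \<sigma> = 0" using c0[of \<sigma>] by blast
        then show "incidence N \<Sigma> \<tau> \<sigma> * c \<sigma> \<phi>s = 0" by (auto simp: incidence_def)
      qed
    qed (use True in \<open>auto simp: cones_def incidence_def\<close>)
    finally show ?thesis .
  next
    case False
    have "incidence N \<Sigma> \<tau> \<sigma> * c \<sigma> \<phi>s = 0" if "\<sigma> \<in> \<Sigma>" for \<sigma>
      using c0[of \<sigma>] False by (auto simp: incidence_def cones_def)
    then have "(\<Sum>\<sigma>\<in>\<Sigma>. incidence N \<Sigma> \<tau> \<sigma> * c \<sigma> \<phi>s) = 0" by (rule sum.neutral[OF ballI])
    then show ?thesis using False by (simp add: BM_boundary_def boundary_def)
  qed
qed

lemma boundary_BM_chains: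
  assumes "finite \<Sigma>" "c \<in> BM_chains N \<Sigma> p q"
  shows "boundary N \<Sigma> c \<in> BM_chains N \<Sigma> p (q - 1)"
  unfolding BM_chains_def
proof (intro CollectI conjI ballI allI impI)
  fix \<tau> assume "\<tau> \<in> cones \<Sigma> (q - 1)"
  have "(\<Sum>\<sigma>\<in>\<Sigma>. (\<lambda>\<phi>s. incidence N \<Sigma> \<tau> \<sigma> * c \<sigma> \<phi>s)) \<in> F_lower N \<Sigma> p \<tau>"
  proof (rule add_subgroup_sum[OF add_subgroup_F_lower])
    fix \<sigma> assume \<sigma>: "\<sigma> \<in> \<Sigma>"
    show "(\<lambda>\<phi>s. incidence N \<Sigma> \<tau> \<sigma> * c \<sigma> \<phi>s) \<in> F_lower N \<Sigma> p \<tau>"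
    proof (cases "\<tau> face_of \<sigma> \<and> \<sigma> \<in> cones \<Sigma> q")
      case True
      then have "c \<sigma> \<in> F_lower N \<Sigma> p \<tau>"
        using assms(2) F_lower_antimono[of \<tau> \<sigma> N \<Sigma> p] by (auto simp: BM_chains_def dest: face_of_imp_subset)
      then have "(\<lambda>\<phi>s. of_int k * c \<sigma> \<phi>s) \<in> F_lower N \<Sigma> p \<tau>" for k
        by (rule real_fun.add_subgroup_scale_int[OF add_subgroup_F_lower])
      from this[of "cone_sign N \<tau> \<sigma>"] this[of 0] show ?thesis by (simp add: incidence_def)
    next
      case False
      then have "(\<lambda>\<phi>s. incidence N \<Sigma> \<tau> \<sigma> * c \<sigma> \<phi>s) = 0"
        using assms(2) by (auto simp: incidence_def BM_chains_def fun_eq_iff)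
      then show ?thesis using add_subgroup_zero[OF add_subgroup_F_lower, of N \<Sigma> p \<tau>] by (simp only:)
    qed
  qed
  then show "boundary N \<Sigma> c \<tau> \<in> F_lower N \<Sigma> p \<tau>"
    by (simp add: boundary_def sum_fun_apply[abs_def] fun_eq_iff)
next
  fix \<tau> assume \<tau>: "\<tau> \<notin> cones \<Sigma> (q - 1)"
  have "incidence N \<Sigma> \<tau> \<sigma> * c \<sigma> \<phi>s = 0" for \<sigma> \<phi>s
    using BM_chains_support[OF assms(2), of \<sigma> \<phi>s] \<tau> by (auto simp: incidence_def cones_def)
  then have "(\<Sum>\<sigma>\<in>\<Sigma>. incidence N \<Sigma> \<tau> \<sigma> * c \<sigma> \<phi>s) = 0" for \<phi>s by (intro sum.neutral ballI)
  then show "boundary N \<Sigma> c \<tau> = 0" by (simp add: boundary_def fun_eq_iff)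
qed

lemma boundary_boundary:
  assumes "cone_complex N \<Sigma>"
  shows "boundary N \<Sigma> (boundary N \<Sigma> c) = 0"
proof (intro ext)
  fix \<tau> \<phi>s
  have "boundary N \<Sigma> (boundary N \<Sigma> c) \<tau> \<phi>s =
      (\<Sum>\<rho>\<in>\<Sigma>. \<Sum>\<sigma>\<in>\<Sigma>. incidence N \<Sigma> \<tau> \<rho> * incidence N \<Sigma> \<rho> \<sigma> * c \<sigma> \<phi>s)"
    by (simp add: boundary_def sum_distrib_left mult.assoc)
  also have "\<dots> = (\<Sum>\<sigma>\<in>\<Sigma>. (\<Sum>\<rho>\<in>\<Sigma>. incidence N \<Sigma> \<tau> \<rho> * incidence N \<Sigma> \<rho> \<sigma>) * c \<sigma> \<phi>s)"
    by (subst sum.swap) (simp add: sum_distrib_right)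
  finally show "boundary N \<Sigma> (boundary N \<Sigma> c) \<tau> \<phi>s = 0 \<tau> \<phi>s"
    by (simp add: incidence_square[OF assms])
qed

lemma BM_cycles_eq:
  "finite \<Sigma> \<Longrightarrow> BM_cycles N \<Sigma> p q = {c \<in> BM_chains N \<Sigma> p q. boundary N \<Sigma> c = 0}"
  by (auto simp: BM_cycles_def BM_boundary_eq_boundary)

lemma BM_boundaries_eq:
  "finite \<Sigma> \<Longrightarrow> BM_boundaries N \<Sigma> p q = boundary N \<Sigma> ` BM_chains N \<Sigma> p (q + 1)"
  by (auto simp: BM_boundaries_def BM_boundary_eq_boundary intro!: image_eqI)

lemma boundary_diff: "boundary N \<Sigma> (c - c') = boundary N \<Sigma> c - boundary N \<Sigma> c'"
  by (auto simp: boundary_def fun_eq_iff right_diff_distrib sum_subtractf)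

lemma boundary_0: "boundary N \<Sigma> 0 = 0"
  using boundary_diff[of N \<Sigma> 0 0] by simp

lemma add_subgroup_BM_boundaries: "finite \<Sigma> \<Longrightarrow> add_subgroup (BM_boundaries N \<Sigma> p q)"
  by (simp add: BM_boundaries_eq add_subgroup_image add_subgroup_BM_chains boundary_diff)

lemma zero_in_BM_cycles: "finite \<Sigma> \<Longrightarrow> 0 \<in> BM_cycles N \<Sigma> p q"
  by (simp add: BM_cycles_eq boundary_0 add_subgroup_zero[OF add_subgroup_BM_chains])

lemma BM_boundaries_top: "finite \<Sigma> \<Longrightarrow> BM_boundaries N \<Sigma> p (fan_dim \<Sigma>) = {0}"
  by (simp add: BM_boundaries_eq BM_chains_above boundary_0)

section \<open>Poincare duality in terms of chains\<close>

lemma r_coset_add_group: "B #>\<^bsub>add_group A\<^esub> x = (\<lambda>b. b + x) ` B"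
  by (auto simp: r_coset_def add_group_def)

lemma int_dual_add: "\<alpha> \<in> int_dual A \<Longrightarrow> x \<in> A \<Longrightarrow> y \<in> A \<Longrightarrow> \<alpha> (x + y) = \<alpha> x + \<alpha> y"
  by (auto simp: int_dual_def hom_def add_group_def)

lemma int_dualI:
  "(\<And>x y. x \<in> A \<Longrightarrow> y \<in> A \<Longrightarrow> \<alpha> (x + y) = \<alpha> x + \<alpha> y) \<Longrightarrow> (\<And>x. x \<notin> A \<Longrightarrow> \<alpha> x = 0) \<Longrightarrow> \<alpha> \<in> int_dual A"
  by (auto simp: int_dual_def hom_def add_group_def)

lemma int_dual_outside: "\<alpha> \<in> int_dual A \<Longrightarrow> x \<notin> A \<Longrightarrow> \<alpha> x = 0"
  by (auto simp: int_dual_def)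

lemma int_dual_0: "\<alpha> \<in> int_dual A \<Longrightarrow> add_subgroup A \<Longrightarrow> \<alpha> 0 = 0"
  using int_dual_add[of \<alpha> A 0 0] add_subgroup_zero[of A] by simp

lemma int_dual_diff:
  assumes "\<alpha> \<in> int_dual A" "add_subgroup A" "x \<in> A" "y \<in> A"
  shows "\<alpha> (x - y) = \<alpha> x - \<alpha> y"
  using int_dual_add[OF assms(1) add_subgroup_diff[OF assms(2-4)] assms(4)] by simp

lemma add_subgroup_int_dual: "add_subgroup (int_dual A)"
  unfolding add_subgroup_def
proof (intro conjI ballI)
  fix \<alpha> \<beta> assume "\<alpha> \<in> int_dual A" "\<beta> \<in> int_dual A"
  then show "\<alpha> - \<beta> \<in> int_dual A"
    by (intro int_dualI) (auto simp: int_dual_add int_dual_outside)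
qed (auto intro: int_dualI)

lemma contract_orientation_add:
  "contract_orientation N p (\<alpha> + \<beta>) \<sigma> = contract_orientation N p \<alpha> \<sigma> + contract_orientation N p \<beta> \<sigma>"
  by (auto simp: contract_orientation_def Let_def fun_eq_iff sum_fun_apply mv_scale_def algebra_simps sum.distrib)

lemma cap_chain_add: "cap_chain N \<Sigma> p (\<alpha> + \<beta>) = cap_chain N \<Sigma> p \<alpha> + cap_chain N \<Sigma> p \<beta>"
  by (auto simp: cap_chain_def fun_eq_iff contract_orientation_add)

lemma cap_chain_diff: "cap_chain N \<Sigma> p (\<alpha> - \<beta>) = cap_chain N \<Sigma> p \<alpha> - cap_chain N \<Sigma> p \<beta>"
  using cap_chain_add[of N \<Sigma> p "\<alpha> - \<beta>" \<beta>] by (simp add: algebra_simps)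

lemma cap_product_top:
  "finite \<Sigma> \<Longrightarrow> cap_product N \<Sigma> p 0 \<alpha> = {cap_chain N \<Sigma> p \<alpha>}"
  by (simp add: cap_product_def Let_def BM_boundaries_top r_coset_add_group cap_chain_def)

text \<open>All cosets are singletons in top degree, and additivity of \<open>cap_chain\<close>
  supplies the homomorphism property once its values are known to be cycles.\<close>

lemma iso_top_iff:
  assumes "finite \<Sigma>"
  shows "cap_product N \<Sigma> p 0 \<in> iso (trop_cohomology N \<Sigma> p 0) (BM_homology N \<Sigma> (fan_dim \<Sigma> - p) (fan_dim \<Sigma> - 0)) \<longleftrightarrow>
    bij_betw (cap_chain N \<Sigma> p) (F_upper N \<Sigma> p {0}) (BM_cycles N \<Sigma> (fan_dim \<Sigma> - p) (fan_dim \<Sigma>))"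
proof -
  let ?Z = "BM_cycles N \<Sigma> (fan_dim \<Sigma> - p) (fan_dim \<Sigma>)" and ?F = "F_upper N \<Sigma> p {0}"
  let ?c = "cap_chain N \<Sigma> p"
  have car: "carrier (BM_homology N \<Sigma> (fan_dim \<Sigma> - p) (fan_dim \<Sigma> - 0)) = (\<lambda>z. {z}) ` ?Z"
    by (auto simp: BM_homology_def FactGroup_def RCOSETS_def BM_boundaries_top[OF assms] r_coset_add_group)
       (auto simp: add_group_def)
  have carF: "carrier (trop_cohomology N \<Sigma> p 0) = ?F" by (simp add: trop_cohomology_def add_group_def)
  have cap: "cap_product N \<Sigma> p 0 = (\<lambda>\<alpha>. {?c \<alpha>})" by (simp add: fun_eq_iff cap_product_top[OF assms])
  have bij: "bij_betw (\<lambda>\<alpha>. {?c \<alpha>}) ?F ((\<lambda>z. {z}) ` ?Z) \<longleftrightarrow> bij_betw ?c ?F ?Z"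
  proof
    assume b: "bij_betw (\<lambda>\<alpha>. {?c \<alpha>}) ?F ((\<lambda>z. {z}) ` ?Z)"
    have "inj_on ?c ?F" using b by (auto simp: bij_betw_def inj_on_def)
    moreover have "(\<lambda>z. {z}) ` ?c ` ?F = (\<lambda>z. {z}) ` ?Z" using b by (simp add: bij_betw_def image_image)
    then have "?c ` ?F = ?Z" by (subst (asm) inj_image_eq_iff) (auto simp: inj_on_def)
    ultimately show "bij_betw ?c ?F ?Z" by (simp add: bij_betw_def)
  next
    assume b: "bij_betw ?c ?F ?Z"
    then have "?Z = ?c ` ?F" by (simp add: bij_betw_def)
    then show "bij_betw (\<lambda>\<alpha>. {?c \<alpha>}) ?F ((\<lambda>z. {z}) ` ?Z)"
      using b by (auto simp: bij_betw_def inj_on_def)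
  qed
  have hom: "cap_product N \<Sigma> p 0 \<in> hom (trop_cohomology N \<Sigma> p 0) (BM_homology N \<Sigma> (fan_dim \<Sigma> - p) (fan_dim \<Sigma> - 0))"
    if "bij_betw ?c ?F ?Z"
  proof -
    have m: "?c \<alpha> \<in> ?Z" if "\<alpha> \<in> ?F" for \<alpha> using that \<open>bij_betw ?c ?F ?Z\<close> by (auto simp: bij_betw_def)
    show ?thesis
    proof (rule homI)
      fix \<alpha> assume "\<alpha> \<in> carrier (trop_cohomology N \<Sigma> p 0)"
      then show "cap_product N \<Sigma> p 0 \<alpha> \<in> carrier (BM_homology N \<Sigma> (fan_dim \<Sigma> - p) (fan_dim \<Sigma> - 0))"
        using m unfolding car carF cap by blast
    next
      fix \<alpha> \<beta>
      show "cap_product N \<Sigma> p 0 (\<alpha> \<otimes>\<^bsub>trop_cohomology N \<Sigma> p 0\<^esub> \<beta>) =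
        cap_product N \<Sigma> p 0 \<alpha> \<otimes>\<^bsub>BM_homology N \<Sigma> (fan_dim \<Sigma> - p) (fan_dim \<Sigma> - 0)\<^esub> cap_product N \<Sigma> p 0 \<beta>"
        by (simp add: cap trop_cohomology_def BM_homology_def add_group_def FactGroup_def set_mult_def cap_chain_add)
    qed
  qed
  show ?thesis
    unfolding iso_def mem_Collect_eq car carF using hom bij unfolding cap by blast
qed

lemma image_eq_singleton_iff: "Z \<noteq> {} \<Longrightarrow> f ` Z = {b} \<longleftrightarrow> (\<forall>z\<in>Z. f z = b)"
  by auto

text \<open>The cohomology is trivial, so an isomorphism means that the group of boundaries is the
  only coset.\<close>

lemma iso_lower_iff:
  assumes fin: "finite \<Sigma>" and q: "q \<noteq> 0"
  shows "cap_product N \<Sigma> p q \<in> iso (trop_cohomology N \<Sigma> p q) (BM_homology N \<Sigma> (fan_dim \<Sigma> - p) (fan_dim \<Sigma> - q)) \<longleftrightarrow>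
    BM_cycles N \<Sigma> (fan_dim \<Sigma> - p) (fan_dim \<Sigma> - q) \<subseteq> BM_boundaries N \<Sigma> (fan_dim \<Sigma> - p) (fan_dim \<Sigma> - q)"
proof -
  let ?Z = "BM_cycles N \<Sigma> (fan_dim \<Sigma> - p) (fan_dim \<Sigma> - q)"
  let ?B = "BM_boundaries N \<Sigma> (fan_dim \<Sigma> - p) (fan_dim \<Sigma> - q)"
  have B: "add_subgroup ?B" by (rule add_subgroup_BM_boundaries[OF fin])
  have car: "carrier (BM_homology N \<Sigma> (fan_dim \<Sigma> - p) (fan_dim \<Sigma> - q)) = (\<lambda>z. (\<lambda>b. b + z) ` ?B) ` ?Z"
    by (auto simp: BM_homology_def FactGroup_def RCOSETS_def r_coset_add_group) (auto simp: add_group_def)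
  have carF: "carrier (trop_cohomology N \<Sigma> p q) = {0}" using q by (simp add: trop_cohomology_def add_group_def)
  have cap: "cap_product N \<Sigma> p q \<alpha> = ?B" for \<alpha>
    using q by (simp add: cap_product_def Let_def r_coset_add_group)
  have coset: "(\<lambda>b. b + z) ` ?B = ?B \<longleftrightarrow> z \<in> ?B" for z
  proof
    assume "(\<lambda>b. b + z) ` ?B = ?B"
    moreover have "0 + z \<in> (\<lambda>b. b + z) ` ?B" using add_subgroup_zero[OF B] by blast
    ultimately show "z \<in> ?B" by simp
  next
    assume z: "z \<in> ?B"
    have "b \<in> (\<lambda>b. b + z) ` ?B" if "b \<in> ?B" for b
      by (rule image_eqI[of _ _ "b - z"]) (use add_subgroup_diff[OF B that z] in auto)
    then show "(\<lambda>b. b + z) ` ?B = ?B" using add_subgroup_add[OF B _ z] by auto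
  qed
  have bij: "bij_betw (cap_product N \<Sigma> p q) {0} ((\<lambda>z. (\<lambda>b. b + z) ` ?B) ` ?Z) \<longleftrightarrow> ?Z \<subseteq> ?B"
  proof -
    have "bij_betw (cap_product N \<Sigma> p q) {0} ((\<lambda>z. (\<lambda>b. b + z) ` ?B) ` ?Z) \<longleftrightarrow> (\<lambda>z. (\<lambda>b. b + z) ` ?B) ` ?Z = {?B}"
    proof -
      have "cap_product N \<Sigma> p q ` {0} = {?B}" "inj_on (cap_product N \<Sigma> p q) {0}" by (simp_all add: cap)
      then show ?thesis unfolding bij_betw_def by metis
    qed
    also have "\<dots> \<longleftrightarrow> (\<forall>z\<in>?Z. (\<lambda>b. b + z) ` ?B = ?B)"
      by (rule image_eq_singleton_iff) (use zero_in_BM_cycles[OF fin] in blast)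
    finally show ?thesis using coset by blast
  qed
  have hom: "cap_product N \<Sigma> p q \<in> hom (trop_cohomology N \<Sigma> p q) (BM_homology N \<Sigma> (fan_dim \<Sigma> - p) (fan_dim \<Sigma> - q))"
  proof (rule homI)
    fix \<alpha>
    have "(\<lambda>b. b + 0) ` ?B = ?B" by simp
    then show "cap_product N \<Sigma> p q \<alpha> \<in> carrier (BM_homology N \<Sigma> (fan_dim \<Sigma> - p) (fan_dim \<Sigma> - q))"
      using zero_in_BM_cycles[OF fin] unfolding car cap by blast
  next
    fix \<alpha> \<beta>
    have "(\<Union>h\<in>?B. \<Union>k\<in>?B. {h + k}) = ?B"
    proof (intro equalityI subsetI)
      fix b assume "b \<in> ?B"
      then show "b \<in> (\<Union>h\<in>?B. \<Union>k\<in>?B. {h + k})" using add_subgroup_zero[OF B] by force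
    qed (use add_subgroup_add[OF B] in auto)
    then show "cap_product N \<Sigma> p q (\<alpha> \<otimes>\<^bsub>trop_cohomology N \<Sigma> p q\<^esub> \<beta>) =
        cap_product N \<Sigma> p q \<alpha> \<otimes>\<^bsub>BM_homology N \<Sigma> (fan_dim \<Sigma> - p) (fan_dim \<Sigma> - q)\<^esub> cap_product N \<Sigma> p q \<beta>"
      unfolding cap by (simp add: BM_homology_def FactGroup_def set_mult_def) (simp add: add_group_def)
  qed
  show ?thesis unfolding iso_def mem_Collect_eq car carF using hom bij by blast
qed

lemma poincare_duality_iff:
  assumes "finite \<Sigma>"
  shows "poincare_duality N \<Sigma> \<longleftrightarrow>
    (\<forall>p q. q \<noteq> fan_dim \<Sigma> \<longrightarrow> BM_cycles N \<Sigma> p q \<subseteq> BM_boundaries N \<Sigma> p q) \<and>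
    (\<forall>p. bij_betw (cap_chain N \<Sigma> p) (F_upper N \<Sigma> p {0}) (BM_cycles N \<Sigma> (fan_dim \<Sigma> - p) (fan_dim \<Sigma>)))"
proof -
  have "poincare_duality N \<Sigma> \<longleftrightarrow>
    (\<forall>p q. q \<noteq> 0 \<longrightarrow> BM_cycles N \<Sigma> (fan_dim \<Sigma> - p) (fan_dim \<Sigma> - q) \<subseteq> BM_boundaries N \<Sigma> (fan_dim \<Sigma> - p) (fan_dim \<Sigma> - q)) \<and>
    (\<forall>p. bij_betw (cap_chain N \<Sigma> p) (F_upper N \<Sigma> p {0}) (BM_cycles N \<Sigma> (fan_dim \<Sigma> - p) (fan_dim \<Sigma>)))"
    unfolding poincare_duality_def using iso_top_iff[OF assms] iso_lower_iff[OF assms] by metis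
  moreover have "(\<forall>p q. q \<noteq> 0 \<longrightarrow> BM_cycles N \<Sigma> (fan_dim \<Sigma> - p) (fan_dim \<Sigma> - q) \<subseteq> BM_boundaries N \<Sigma> (fan_dim \<Sigma> - p) (fan_dim \<Sigma> - q))
    \<longleftrightarrow> (\<forall>p q. q \<noteq> fan_dim \<Sigma> \<longrightarrow> BM_cycles N \<Sigma> p q \<subseteq> BM_boundaries N \<Sigma> p q)" (is "?L \<longleftrightarrow> ?R")
  proof
    assume L: ?L
    show ?R
    proof (intro allI impI)
      fix p q assume "q \<noteq> fan_dim \<Sigma>"
      then show "BM_cycles N \<Sigma> p q \<subseteq> BM_boundaries N \<Sigma> p q"
        using L[rule_format, of "fan_dim \<Sigma> - q" "fan_dim \<Sigma> - p"] by simp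
    qed
  qed simp
  ultimately show ?thesis by simp
qed

section \<open>Cap products\<close>

lemma subgroup_basis_points:
  fixes H :: "('x \<Rightarrow> real) set"
  assumes "finite S" "add_subgroup H" "\<And>x h. x \<in> S \<Longrightarrow> h \<in> H \<Longrightarrow> h x \<in> \<int>"
    "\<And>h. h \<in> H \<Longrightarrow> (\<And>x. x \<in> S \<Longrightarrow> h x = 0) \<Longrightarrow> h = 0"
  shows "\<exists>B. finite B \<and> real_fun.independent B \<and> group_closure B = H"
proof (rule real_fun.subgroup_basis[of "(\<lambda>x h. h x) ` S"])
  show "h = 0" if h: "h \<in> H" "\<And>f. f \<in> (\<lambda>x h. h x) ` S \<Longrightarrow> f h = 0" for h
    by (rule assms(4)[OF h(1)]) (rule h(2)[OF imageI])
qed (use assms in auto)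

lemma real_fun_construct:
  fixes f :: "('x \<Rightarrow> real) \<Rightarrow> ('y \<Rightarrow> real)"
  assumes "real_fun.independent B"
  obtains g where "\<And>u v. g (u + v) = g u + g v" "\<And>r u. g (\<lambda>x. r * u x) = (\<lambda>y. r * g u y)"
    "\<And>b. b \<in> B \<Longrightarrow> g b = f b"
proof -
  interpret vector_space_pair "\<lambda>(r :: real) (f :: 'x \<Rightarrow> real) x. r * f x" "\<lambda>(r :: real) (f :: 'y \<Rightarrow> real) x. r * f x" ..
  interpret l: Vector_Spaces.linear "\<lambda>(r :: real) (f :: 'x \<Rightarrow> real) x. r * f x"
    "\<lambda>(r :: real) (f :: 'y \<Rightarrow> real) x. r * f x" "construct B f"
    by (rule linear_construct[OF assms])
  show ?thesis
    using construct_basis[OF assms, of _ f] by (intro that[of "construct B f"]) (auto simp: l.add l.scale)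
qed

lemma nths_linear: "\<forall>L\<in>set Ls. linear L \<Longrightarrow> \<forall>L\<in>set (nths Ls I). linear L"
  by (rule set_nths_subset')

lemma dual_nths_Ints:
  assumes "dual_lists bs Ls" "x \<in> exterior_power p (group_closure (set bs))"
  shows "x (nths Ls I) \<in> \<int>"
  by (rule exterior_power_Ints[OF assms(2)])
     (use dual_lists_set_Ints[OF assms(1)] set_nths_subset[of Ls I] in blast)

lemma exterior_power_eq_0I:
  assumes "dual_lists bs Ls" "x \<in> exterior_power p (group_closure (set bs))"
    "\<And>I. I \<subseteq> {..<length bs} \<Longrightarrow> x (nths Ls I) = 0"
  shows "x = 0"
  using exterior_power_expand[OF assms(1,2)] assms(3) by (auto simp: fun_eq_iff)

text \<open>The group \<open>A\<close> need not be saturated, so the coefficients \<open>c\<close> are only real: a basis of \<open>A\<close> is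
  linearly independent over \<open>\<real>\<close>, and \<open>\<alpha>\<close> extends to a linear functional on its span.\<close>

lemma int_dual_evaluation:
  assumes d: "dual_lists bs Ls" and A: "add_subgroup A" "A \<subseteq> exterior_power p (group_closure (set bs))"
    and \<alpha>: "\<alpha> \<in> int_dual A"
  obtains c where "\<And>x. x \<in> A \<Longrightarrow>
    of_int (\<alpha> x) = (\<Sum>I | I \<subseteq> {..<length bs} \<and> int (card I) = p. c I * x (nths Ls I))"
proof -
  have "\<exists>B. finite B \<and> real_fun.independent B \<and> group_closure B = A"
    by (rule subgroup_basis_points[of "(\<lambda>I. nths Ls I) ` Pow {..<length bs}", OF _ A(1)])
       (use A(2) dual_nths_Ints[OF d] exterior_power_eq_0I[OF d] in auto)
  then obtain B where B: "real_fun.independent B" "group_closure B = A" by auto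
  \<comment> \<open>Functions on the one-point type \<open>unit\<close> stand for the reals, so that
    the extension of maps between function spaces yields a functional.\<close>
  obtain g where g: "\<And>u v. g (u + v) = g u + g v" "\<And>r u. g (\<lambda>x. r * u x) = (\<lambda>y :: unit. r * g u y)"
    "\<And>b. b \<in> B \<Longrightarrow> g b = (\<lambda>y. of_int (\<alpha> b))"
    by (rule real_fun_construct[OF B(1), of "\<lambda>b y. of_int (\<alpha> b)"]) (rule that)
  have gd: "g (u - v) = g u - g v" for u v using g(1)[of "u - v" v] by simp
  have g0: "g 0 = 0" using gd[of 0 0] by simp
  have gs: "g (\<Sum>i\<in>S. f i) = (\<Sum>i\<in>S. g (f i))" for f :: "nat set \<Rightarrow> _" and S
    by (induction S rule: infinite_finite_induct)
       (simp_all only: sum.infinite sum.empty sum.insert g0 g(1) if_False not_False_eq_True)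
  have "g x () = of_int (\<alpha> x)" if "x \<in> group_closure B" for x
    using that
  proof induction
    case (base b)
    then consider "b = 0" | "b \<in> B" by blast
    then show ?case
    proof cases
      case 1
      show ?thesis unfolding 1 g0 int_dual_0[OF \<alpha> A(1)] by simp
    next
      case 2
      show ?thesis unfolding g(3)[OF 2] by (rule refl)
    qed
  next
    case (diff x y)
    then have xy: "x \<in> A" "y \<in> A" using B(2) by auto
    show ?case unfolding gd int_dual_diff[OF \<alpha> A(1) xy] using diff.IH by simp
  qed
  then have gA: "of_int (\<alpha> x) = g x ()" if "x \<in> A" for x using B(2) that by simp
  show ?thesis
  proof (rule that)
    fix x assume x: "x \<in> A"
    have "x = (\<Sum>I | I \<subseteq> {..<length bs} \<and> int (card I) = p. (\<lambda>\<phi>s. x (nths Ls I) * wedge (nths bs I) \<phi>s))"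
      using exterior_power_expand[OF d, of x p] x A(2) by (auto simp: fun_eq_iff sum_fun_apply)
    then have "g x = g (\<Sum>I | I \<subseteq> {..<length bs} \<and> int (card I) = p. (\<lambda>\<phi>s. x (nths Ls I) * wedge (nths bs I) \<phi>s))"
      by (rule arg_cong)
    also have "\<dots> = (\<Sum>I | I \<subseteq> {..<length bs} \<and> int (card I) = p. (\<lambda>y. x (nths Ls I) * g (wedge (nths bs I)) y))"
      by (simp only: gs g(2))
    finally show "of_int (\<alpha> x) = (\<Sum>I | I \<subseteq> {..<length bs} \<and> int (card I) = p. g (wedge (nths bs I)) () * x (nths Ls I))"
      using gA[OF x] by (simp add: sum_fun_apply mult.commute)
  qed
qed

text \<open>Contraction fills the first slots: the recursion of \<open>contract\<close> is the
  expansion along the first row. The forms \<open>ls\<close> may be non-linear outside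
  \<open>V\<close>; the linear \<open>Ls\<close> replace them on the vectors that occur.\<close>

lemma contract_eq_wedge:
  assumes "length ls = length Ls" "\<forall>L\<in>set Ls. linear L" "set vs \<subseteq> V"
    "\<And>i v. i < length ls \<Longrightarrow> v \<in> V \<Longrightarrow> (ls ! i) v = (Ls ! i) v"
  shows "contract ls vs \<phi>s = wedge vs (Ls @ \<phi>s)"
  using assms
proof (induction ls Ls arbitrary: vs rule: list_induct2)
  case Nil
  then show ?case by simp
next
  case (Cons l ls L Ls)
  have L: "linear L" using Cons.prems by simp
  have "contract ls (remove_nth i vs) \<phi>s = wedge (remove_nth i vs) (Ls @ \<phi>s)" for i
    by (rule Cons.IH) (use Cons.prems(1,2) Cons.prems(3)[of "Suc _"] set_remove_nth_subset[of i vs] in auto)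
  moreover have "l (vs ! i) = L (vs ! i)" if "i < length vs" for i
    using Cons.prems(2) Cons.prems(3)[of 0 "vs ! i"] nth_mem[OF that] by auto
  ultimately show ?case
    by (simp add: wedge_Cons_row[OF L] sum_fun_apply mv_scale_def flip: remove_nth_def)
qed

lemma dual_frame_eq:
  assumes b: "lattice_basis bs M" and d: "dual_lists bs Ls" and i: "i < length bs" and v: "v \<in> span (set bs)"
  shows "(dual_frame bs ! i) v = (Ls ! i) v"
proof -
  have ind: "independent (set bs)" and dist: "distinct bs" using b by (auto simp: lattice_basis_def)
  have l: "linear (Ls ! i)" using dual_lists_linear[OF d i] .
  have "(Ls ! i) v = (Ls ! i) (\<Sum>b\<in>set bs. representation (set bs) v b *\<^sub>R b)"
    using sum_representation_eq[OF ind v, of "set bs"] by simp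
  also have "\<dots> = (\<Sum>b\<in>set bs. representation (set bs) v b * (Ls ! i) b)"
    using l by (simp add: linear_sum linear_scale)
  also have "\<dots> = (\<Sum>b\<in>set bs. if b = bs ! i then representation (set bs) v b else 0)"
  proof (intro sum.cong refl)
    fix b assume "b \<in> set bs"
    then obtain j where "j < length bs" "b = bs ! j" by (auto simp: in_set_conv_nth)
    then show "representation (set bs) v b * (Ls ! i) b = (if b = bs ! i then representation (set bs) v b else 0)"
      using d i nth_eq_iff_index_eq[OF dist, of i j] by (auto simp: dual_lists_def)
  qed
  also have "\<dots> = representation (set bs) v (bs ! i)" using i by simp
  finally show ?thesis using i by (simp add: dual_frame_def)
qed

lemma nths_pointwise:
  assumes "length xs = length ys" "\<And>i. i < length xs \<Longrightarrow> P (xs ! i) (ys ! i)" "i < length (nths xs I)"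
  shows "P (nths xs I ! i) (nths ys I ! i)"
proof -
  have "list_all2 P xs ys" using assms(1,2) by (simp add: list_all2_conv_all_nth)
  then have "list_all2 P (nths xs I) (nths ys I)"
    by (induction arbitrary: I rule: list_all2_induct) (auto simp: nths_Cons)
  then show ?thesis using assms(3) by (simp add: list_all2_conv_all_nth)
qed

lemma length_nths_cong: "length xs = length ys \<Longrightarrow> length (nths xs I) = length (nths ys I)"
  by (simp add: length_nths)

lemma contract_orientation_eq:
  assumes N: "lattice_subgroup N" and d: "dual_lists (frame N \<sigma>) Ls"
  shows "contract_orientation N p \<alpha> \<sigma> \<phi>s =
    (\<Sum>I | I \<subseteq> {..<length (frame N \<sigma>)} \<and> int (card I) = p.
       of_int (\<alpha> (wedge (nths (frame N \<sigma>) I))) * orientation N \<sigma> (nths Ls I @ \<phi>s))"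
proof -
  let ?bs = "frame N \<sigma>"
  note b = lattice_basis_frame[OF N, of \<sigma>]
  have len: "length (dual_frame ?bs) = length Ls" "length ?bs = length Ls"
    using d by (auto simp: dual_frame_def dual_lists_def)
  have "contract (nths (dual_frame ?bs) I) ?bs \<phi>s = wedge ?bs (nths Ls I @ \<phi>s)" for I
  proof (rule contract_eq_wedge[where V = "span (set ?bs)"])
    show "length (nths (dual_frame ?bs) I) = length (nths Ls I)" using len(1) by (rule length_nths_cong)
    show "\<forall>L\<in>set (nths Ls I). linear L" using d by (intro nths_linear) (simp add: dual_lists_def)
    show "set ?bs \<subseteq> span (set ?bs)" by (rule span_superset)
    fix i v assume i: "i < length (nths (dual_frame ?bs) I)" "v \<in> span (set ?bs)"
    show "(nths (dual_frame ?bs) I ! i) v = (nths Ls I ! i) v"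
      by (rule nths_pointwise[OF len(1) _ i(1), where P = "\<lambda>f g. f v = g v"])
         (use dual_frame_eq[OF b d _ i(2)] len in auto)
  qed
  then show ?thesis
    by (simp add: contract_orientation_def Let_def sum_fun_apply mv_scale_def orientation_def)
qed

lemma set_frame_subset: "lattice_subgroup N \<Longrightarrow> set (frame N \<sigma>) \<subseteq> sublattice N \<sigma>"
  using lattice_basis_frame[of N \<sigma>] group_closure_superset[of "set (frame N \<sigma>)"] by (simp add: lattice_basis_def)

lemma wedge_frame_mem:
  assumes "lattice_subgroup N" "I \<subseteq> {..<length (frame N \<sigma>)}" "int (card I) = p"
  shows "wedge (nths (frame N \<sigma>) I) \<in> exterior_power p (sublattice N \<sigma>)"
  using assms set_frame_subset[OF assms(1), of \<sigma>] set_nths_subset[of "frame N \<sigma>" I]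
  by (intro wedge_in_exterior_power) (auto simp: length_nths_lessThan)

text \<open>Cauchy--Binet read backwards removes the frame of \<sigma> from the definition of the
  contraction. One and the same family of evaluation points then describes the cap product at all
  cones.\<close>

lemma contract_orientation_evaluation:
  assumes N: "lattice_subgroup N"
    and \<theta>: "\<And>k. k \<in> K \<Longrightarrow> int (length (\<theta> k)) = p \<and> (\<forall>L\<in>set (\<theta> k). linear L)"
    and \<alpha>: "\<And>x. x \<in> exterior_power p (sublattice N \<sigma>) \<Longrightarrow> of_int (\<alpha> x) = (\<Sum>k\<in>K. c k * x (\<theta> k))"
  shows "contract_orientation N p \<alpha> \<sigma> \<phi>s = (\<Sum>k\<in>K. c k * orientation N \<sigma> (\<theta> k @ \<phi>s))"
proof -
  let ?bs = "frame N \<sigma>"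
  let ?J = "{I. I \<subseteq> {..<length ?bs} \<and> int (card I) = p}"
  obtain Ls where d: "dual_lists ?bs Ls" by (rule lattice_basis_dual[OF lattice_basis_frame[OF N]])
  have "contract_orientation N p \<alpha> \<sigma> \<phi>s =
      (\<Sum>I\<in>?J. (\<Sum>k\<in>K. c k * wedge (nths ?bs I) (\<theta> k)) * orientation N \<sigma> (nths Ls I @ \<phi>s))"
    unfolding contract_orientation_eq[OF N d] using wedge_frame_mem[OF N] by (intro sum.cong refl) (simp add: \<alpha>)
  also have "\<dots> = (\<Sum>k\<in>K. c k * (\<Sum>I\<in>?J. wedge (nths ?bs I) (\<theta> k) * orientation N \<sigma> (nths Ls I @ \<phi>s)))"
    by (simp add: sum_distrib_right sum_distrib_left mult.assoc) (rule sum.swap)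
  also have "\<dots> = (\<Sum>k\<in>K. c k * orientation N \<sigma> (\<theta> k @ \<phi>s))"
  proof (intro sum.cong refl)
    fix k assume k: "k \<in> K"
    have "?J = {I. I \<subseteq> {..<length ?bs} \<and> card I = length (\<theta> k)}" using \<theta>[OF k] by auto
    then show "c k * (\<Sum>I\<in>?J. wedge (nths ?bs I) (\<theta> k) * orientation N \<sigma> (nths Ls I @ \<phi>s)) = c k * orientation N \<sigma> (\<theta> k @ \<phi>s)"
      using wedge_expand[OF d span_superset, of "\<theta> k" \<phi>s] \<theta>[OF k] by (simp add: orientation_def)
  qed
  finally show ?thesis .
qed

section \<open>Injectivity of the cap product\<close>

lemma wedge_not_distinct: "\<not> distinct \<phi>s \<Longrightarrow> wedge vs \<phi>s = 0"
  unfolding distinct_conv_nth using wedge_identical_rows by blast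

text \<open>The arguments are a rearrangement of the dual basis, so the value is a sign.\<close>

lemma wedge_dual_complement:
  assumes "dual_lists bs Ls" "I \<subseteq> {..<length bs}"
  shows "\<bar>wedge bs (nths Ls I @ nths Ls (- I))\<bar> = 1"
  using assms
proof (induction bs arbitrary: Ls I)
  case Nil
  then show ?case by (simp add: dual_lists_def wedge_Nil)
next
  case (Cons b bs)
  then obtain L Ls' where Ls: "Ls = L # Ls'" by (cases Ls) (auto simp: dual_lists_def)
  note d = dual_lists_Cons[OF Cons.prems(1)[unfolded Ls]]
  let ?I = "{i. Suc i \<in> I}"
  have I: "?I \<subseteq> {..<length bs}" using Cons.prems(2) by auto
  have c: "- ?I = {i. Suc i \<notin> I}" by auto
  have "wedge (b # bs) (L # nths Ls' ?I @ nths Ls' (- ?I)) = wedge bs (nths Ls' ?I @ nths Ls' (- ?I))"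
    unfolding wedge_Cons_row[OF d(5)] by (simp add: sum.lessThan_Suc_shift d(2,3) del: sum.lessThan_Suc)
  then have *: "\<bar>wedge (b # bs) (L # nths Ls' ?I @ nths Ls' (- ?I))\<bar> = 1" using Cons.IH[OF d(1) I] by simp
  show ?case
  proof (cases "0 \<in> I")
    case True
    then show ?thesis using * by (simp add: Ls nths_Cons c)
  next
    case False
    have "\<forall>\<alpha>\<in>set (nths Ls' ?I). linear \<alpha>" using d(1) by (intro nths_linear) (simp add: dual_lists_def)
    from wedge_row_move[OF d(5) this, of "b # bs" "[]" "nths Ls' (- ?I)"]
    show ?thesis using False * by (simp add: Ls nths_Cons c abs_mult)
  qed
qed

lemma nths_Int_mem: "i < length xs \<Longrightarrow> i \<in> I \<Longrightarrow> xs ! i \<in> set (nths xs I)"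
  by (auto simp: set_nths)

text \<open>The contraction is evaluated at the dual forms complementary to \<open>I\<close>.
  Another index set of the same size meets the complement, so its summand has a repeated form; only
  the coefficient of \<open>I\<close> remains, times a sign.\<close>

lemma contract_orientation_inj:
  assumes N: "lattice_subgroup N" and eq: "contract_orientation N p \<alpha> \<sigma> = 0" and p: "I \<subseteq> {..<length (frame N \<sigma>)}" "int (card I) = p"
  shows "\<alpha> (wedge (nths (frame N \<sigma>) I)) = 0"
proof -
  let ?bs = "frame N \<sigma>"
  obtain Ls where d: "dual_lists ?bs Ls" by (rule lattice_basis_dual[OF lattice_basis_frame[OF N]])
  let ?J = "{I. I \<subseteq> {..<length ?bs} \<and> int (card I) = p}"
  have z: "wedge ?bs (nths Ls J @ nths Ls (- I)) = 0" if J: "J \<in> ?J" "J \<noteq> I" for J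
  proof -
    have "\<not> J \<subseteq> I"
    proof
      assume "J \<subseteq> I"
      moreover have "finite I" using p(1) by (rule finite_subset) simp
      moreover have "card J = card I" using J(1) p(2) by simp
      ultimately show False using card_subset_eq[of I J] J(2) by blast
    qed
    then obtain j where j: "j \<in> J" "j \<notin> I" by blast
    then have "j < length Ls" using J d by (auto simp: dual_lists_def)
    then have "Ls ! j \<in> set (nths Ls J) \<inter> set (nths Ls (- I))" using j nths_Int_mem by blast
    then show ?thesis by (intro wedge_not_distinct) auto
  qed
  have "0 = contract_orientation N p \<alpha> \<sigma> (nths Ls (- I))" by (simp add: eq)
  also have "\<dots> = (\<Sum>J\<in>?J. if J = I then of_int (\<alpha> (wedge (nths ?bs I))) * wedge ?bs (nths Ls I @ nths Ls (- I)) else 0)"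
    unfolding contract_orientation_eq[OF N d] by (intro sum.cong refl) (auto simp: orientation_def z)
  also have "\<dots> = of_int (\<alpha> (wedge (nths ?bs I))) * wedge ?bs (nths Ls I @ nths Ls (- I))"
    using p finite_subset[of ?J "Pow {..<length ?bs}"] by (subst sum.delta) auto
  finally show ?thesis using wedge_dual_complement[OF d p(1)] by auto
qed

lemma F_upper_evaluation:
  assumes \<alpha>: "\<alpha> \<in> F_upper N \<Sigma> p \<sigma>" and b: "lattice_basis bs N" and d: "dual_lists bs Ls"
  obtains c where "\<And>x. x \<in> F_lower N \<Sigma> p \<sigma> \<Longrightarrow>
    of_int (\<alpha> x) = (\<Sum>I | I \<subseteq> {..<length bs} \<and> int (card I) = p. c I * x (nths Ls I))"
proof (rule int_dual_evaluation[OF d add_subgroup_F_lower])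
  show "F_lower N \<Sigma> p \<sigma> \<subseteq> exterior_power p (group_closure (set bs))"
    using F_lower_subset_exterior_power b by (simp add: lattice_basis_def)
  show "\<alpha> \<in> int_dual (F_lower N \<Sigma> p \<sigma>)" using \<alpha> by (simp add: F_upper_def)
qed (rule that)

lemma nths_evaluation_points:
  assumes "dual_lists bs Ls" "I \<in> {I. I \<subseteq> {..<length bs} \<and> int (card I) = p}"
  shows "int (length (nths Ls I)) = p \<and> (\<forall>L\<in>set (nths Ls I). linear L)"
  using assms nths_linear[of Ls I] length_nths_lessThan[of I Ls] by (auto simp: dual_lists_def)

lemma cone_complex_exterior_power_F_lower:
  "cone_complex N \<Sigma> \<Longrightarrow> \<sigma> \<in> \<Sigma> \<Longrightarrow> exterior_power p (sublattice N \<sigma>) \<subseteq> F_lower N \<Sigma> p {0}"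
  by (intro exterior_power_subset_F_lower) (auto dest: cone_complex_0)

text \<open>By purity every cone lies in a top cone \<sigma>, and vanishing of the contraction at
  \<sigma> kills \<open>\<alpha>\<close> on a basis of the exterior power there. Such elements
  generate the group on which \<open>\<alpha>\<close> lives.\<close>

lemma cap_chain_inj:
  assumes \<Sigma>: "cone_complex N \<Sigma>" and \<alpha>: "\<alpha> \<in> F_upper N \<Sigma> p {0}" and eq: "cap_chain N \<Sigma> p \<alpha> = 0"
  shows "\<alpha> = 0"
proof
  fix x
  note N = cone_complex_lattice[OF \<Sigma>]
  have \<alpha>': "\<alpha> \<in> int_dual (F_lower N \<Sigma> p {0})" using \<alpha> by (simp add: F_upper_def)
  obtain bs where bs: "lattice_basis bs N" using N by (auto simp: lattice_subgroup_def)
  obtain Ls where Ls: "dual_lists bs Ls" by (rule lattice_basis_dual[OF bs])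
  obtain c where c: "\<And>x. x \<in> F_lower N \<Sigma> p {0} \<Longrightarrow>
    of_int (\<alpha> x) = (\<Sum>I | I \<subseteq> {..<length bs} \<and> int (card I) = p. c I * x (nths Ls I))"
    by (rule F_upper_evaluation[OF \<alpha> bs Ls]) (rule that)
  have z: "\<alpha> y = 0" if y: "y \<in> exterior_power p (sublattice N \<eta>)" and \<eta>: "\<eta> \<in> \<Sigma>" for y \<eta>
  proof -
    obtain \<sigma> where \<sigma>: "\<sigma> \<in> \<Sigma>" "int (dim \<sigma>) = fan_dim \<Sigma>" "\<eta> \<subseteq> \<sigma>" using cone_complex_top[OF \<Sigma> \<eta>] .
    note sub = cone_complex_exterior_power_F_lower[OF \<Sigma> \<sigma>(1), of p]
    have "cap_chain N \<Sigma> p \<alpha> \<sigma> = contract_orientation N p \<alpha> \<sigma>" using \<sigma> by (simp add: cap_chain_def cones_def)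
    then have "contract_orientation N p \<alpha> \<sigma> = 0" using eq by simp
    from contract_orientation_inj[OF N this]
    have w: "\<alpha> (wedge (nths (frame N \<sigma>) J)) = 0" if "J \<subseteq> {..<length (frame N \<sigma>)}" "int (card J) = p" for J
      using that by blast
    have y': "y \<in> exterior_power p (sublattice N \<sigma>)"
      using y exterior_power_mono[of "sublattice N \<eta>" "sublattice N \<sigma>"] span_mono[OF \<sigma>(3)] by (auto simp: sublattice_def)
    obtain Ms where Ms: "dual_lists (frame N \<sigma>) Ms" by (rule lattice_basis_dual[OF lattice_basis_frame[OF N]])
    let ?J = "{J. J \<subseteq> {..<length (frame N \<sigma>)} \<and> int (card J) = p}"
    have ex: "y \<phi>s = (\<Sum>J\<in>?J. y (nths Ms J) * wedge (nths (frame N \<sigma>) J) \<phi>s)" for \<phi>s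
      using exterior_power_expand[OF Ms, of y p \<phi>s] y' lattice_basis_frame[OF N, of \<sigma>] by (simp add: lattice_basis_def)
    \<comment> \<open>Additivity of \<open>\<alpha>\<close> alone does not see the real-valued
      coordinates of \<open>y\<close>; its expression through evaluations commutes with
      them.\<close>
    have "of_int (\<alpha> y) = (\<Sum>I | I \<subseteq> {..<length bs} \<and> int (card I) = p. \<Sum>J\<in>?J. y (nths Ms J) * (c I * wedge (nths (frame N \<sigma>) J) (nths Ls I)))"
    proof -
      have "y \<in> F_lower N \<Sigma> p {0}" using sub y' by blast
      from c[OF this] show ?thesis
        by (rule trans) (intro sum.cong refl, subst ex, simp add: sum_distrib_left mult_ac)
    qed
    also have "\<dots> = (\<Sum>J\<in>?J. y (nths Ms J) * of_int (\<alpha> (wedge (nths (frame N \<sigma>) J))))"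
    proof (subst sum.swap, intro sum.cong refl)
      fix J assume "J \<in> ?J"
      then have "wedge (nths (frame N \<sigma>) J) \<in> F_lower N \<Sigma> p {0}"
        using wedge_frame_mem[OF N] sub by blast
      from c[OF this] show "(\<Sum>I | I \<subseteq> {..<length bs} \<and> int (card I) = p. y (nths Ms J) * (c I * wedge (nths (frame N \<sigma>) J) (nths Ls I))) =
          y (nths Ms J) * of_int (\<alpha> (wedge (nths (frame N \<sigma>) J)))"
        by (simp only: sum_distrib_left)
    qed
    also have "\<dots> = 0" using w by (intro sum.neutral) auto
    finally show ?thesis by simp
  qed
  show "\<alpha> x = 0 x"
  proof (cases "x \<in> F_lower N \<Sigma> p {0}")
    case True
    have "F_lower N \<Sigma> p {0} \<subseteq> {x \<in> F_lower N \<Sigma> p {0}. \<alpha> x = 0}"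
    proof (subst F_lower_def, rule group_closure_minimal)
      show "(\<Union>\<eta>\<in>{\<eta> \<in> \<Sigma>. {0} \<subseteq> \<eta>}. exterior_power p (sublattice N \<eta>)) \<subseteq> {x \<in> F_lower N \<Sigma> p {0}. \<alpha> x = 0}"
        using z cone_complex_exterior_power_F_lower[OF \<Sigma>] by blast
      show "add_subgroup {x \<in> F_lower N \<Sigma> p {0}. \<alpha> x = 0}"
        using add_subgroup_F_lower[of N \<Sigma> p "{0}"] int_dual_diff[OF \<alpha>' add_subgroup_F_lower] int_dual_0[OF \<alpha>' add_subgroup_F_lower]
        by (auto simp: add_subgroup_def)
    qed
    then show ?thesis using True by auto
  next
    case False
    then show ?thesis using int_dual_outside[OF \<alpha>'] by simp
  qed
qed

lemma cap_chain_inj_on: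
  assumes "cone_complex N \<Sigma>"
  shows "inj_on (cap_chain N \<Sigma> p) (F_upper N \<Sigma> p {0})"
proof (rule inj_onI)
  fix \<alpha> \<beta> assume *: "\<alpha> \<in> F_upper N \<Sigma> p {0}" "\<beta> \<in> F_upper N \<Sigma> p {0}" "cap_chain N \<Sigma> p \<alpha> = cap_chain N \<Sigma> p \<beta>"
  have "\<alpha> - \<beta> \<in> F_upper N \<Sigma> p {0}"
    using * by (auto simp: F_upper_def intro: add_subgroup_diff add_subgroup_int_dual)
  then show "\<alpha> = \<beta>" using cap_chain_inj[OF assms, of "\<alpha> - \<beta>" p] * by (simp add: cap_chain_diff)
qed

section \<open>A Kuenneth theorem for complexes of functions\<close>

definition lin_op :: "(('x \<Rightarrow> real) \<Rightarrow> 'y \<Rightarrow> real) \<Rightarrow> bool" where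
  "lin_op f \<longleftrightarrow> (\<forall>a b u v y. f (\<lambda>x. a * u x + b * v x) y = a * f u y + b * f v y)"

lemma lin_opD: "lin_op f \<Longrightarrow> f (\<lambda>x. a * u x + b * v x) y = a * f u y + b * f v y"
  by (simp add: lin_op_def)

lemma lin_op_zero: "lin_op f \<Longrightarrow> f (\<lambda>x. 0) y = 0"
  using lin_opD[of f 0 "\<lambda>x. 0" 0 "\<lambda>x. 0" y] by simp

lemma lin_op_scale: "lin_op f \<Longrightarrow> f (\<lambda>x. a * u x) y = a * f u y"
  using lin_opD[of f a u 0 u y] by simp

lemma lin_op_scale_right: "lin_op f \<Longrightarrow> f (\<lambda>x. u x * a) y = f u y * a"
  using lin_op_scale[of f a u y] by (simp add: mult.commute)

lemma lin_op_add: "lin_op f \<Longrightarrow> f (\<lambda>x. u x + v x) y = f u y + f v y"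
  using lin_opD[of f 1 u 1 v y] by simp

lemma lin_op_minus: "lin_op f \<Longrightarrow> f (\<lambda>x. u x - v x) y = f u y - f v y"
  using lin_opD[of f 1 u "-1" v y] by simp

lemma lin_op_compose:
  assumes "lin_op f" "lin_op g"
  shows "lin_op (\<lambda>u. f (g u))"
  unfolding lin_op_def
proof (intro allI)
  fix a b u v y
  have "g (\<lambda>x. a * u x + b * v x) = (\<lambda>y. a * g u y + b * g v y)"
    by (rule ext) (rule lin_opD[OF assms(2)])
  then show "f (g (\<lambda>x. a * u x + b * v x)) y = a * f (g u) y + b * f (g v) y"
    by (simp only: lin_opD[OF assms(1)])
qed

definition diff_op :: "('a::ab_group_add \<Rightarrow> 'b::ab_group_add) \<Rightarrow> bool" where
  "diff_op F \<longleftrightarrow> (\<forall>u v. F (u - v) = F u - F v)"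

lemma diff_opD: "diff_op F \<Longrightarrow> F (u - v) = F u - F v"
  by (simp add: diff_op_def)

lemma diff_op_zero: "diff_op F \<Longrightarrow> F 0 = 0"
  using diff_opD[of F 0 0] by (simp only: diff_self)

lemma diff_op_id: "diff_op (\<lambda>u. u)"
  by (simp add: diff_op_def)

lemma diff_op_compose: "diff_op F \<Longrightarrow> diff_op G \<Longrightarrow> diff_op (\<lambda>u. F (G u))"
  unfolding diff_op_def by (simp only:) blast

lemma diff_op_diff: "diff_op F \<Longrightarrow> diff_op G \<Longrightarrow> diff_op (\<lambda>u. F u - G u)"
  unfolding diff_op_def by (simp only: diff_diff_eq add_diff_eq diff_diff_eq2 diff_add_eq add_ac) blast

lemma lin_op_diff_op: "lin_op f \<Longrightarrow> diff_op f"
  unfolding diff_op_def fun_diff_def by (auto simp: fun_eq_iff lin_op_minus)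

text \<open>The pattern of most later arguments: with H = {0} identities between additive operators
  are checked on generators, with H a chain group memberships are.\<close>

lemma group_closure_diff_op:
  assumes "w \<in> group_closure G" "diff_op F" "add_subgroup H" "\<And>g. g \<in> G \<Longrightarrow> F g \<in> H"
  shows "F w \<in> H"
  using assms(1)
proof induction
  case (base s)
  then show ?case using assms(4) diff_op_zero[OF assms(2)] add_subgroup_zero[OF assms(3)] by (metis insertE)
next
  case (diff s t)
  then show ?case using diff_opD[OF assms(2)] add_subgroup_diff[OF assms(3)] by metis
qed

lemma add_subgroup_singleton: "add_subgroup {0}"
  by (simp add: add_subgroup_def)

section \<open>Tensor products as groups of functions of two variables\<close>

definition tensor :: "('x \<Rightarrow> real) \<Rightarrow> ('y \<Rightarrow> real) \<Rightarrow> 'x \<times> 'y \<Rightarrow> real" where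
  "tensor a b = (\<lambda>(x, y). a x * b y)"

text \<open>It stands for the part of bidegree (p, q) of a tensor product. Being a group of
  functions it needs no universal property: maps out of it are operators on functions, checked on
  elementary products.\<close>

definition tensor_group ::
  "(int \<Rightarrow> int \<Rightarrow> ('x \<Rightarrow> real) set) \<Rightarrow> (int \<Rightarrow> int \<Rightarrow> ('y \<Rightarrow> real) set) \<Rightarrow> int \<Rightarrow> int \<Rightarrow> ('x \<times> 'y \<Rightarrow> real) set" where
  "tensor_group A B p q = group_closure
     {tensor a b |a b p1 p2 q1 q2. a \<in> A p1 q1 \<and> b \<in> B p2 q2 \<and> p1 + p2 = p \<and> q1 + q2 = q}"

definition parity_sign :: "int \<Rightarrow> real" where
  "parity_sign q = (if even q then 1 else -1)"

definition left_op :: "('k \<Rightarrow> ('x \<Rightarrow> real) \<Rightarrow> 'z \<Rightarrow> real) \<Rightarrow> ('y \<Rightarrow> 'k) \<Rightarrow> ('x \<times> 'y \<Rightarrow> real) \<Rightarrow> 'z \<times> 'y \<Rightarrow> real" where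
  "left_op f deg w = (\<lambda>(z, y). f (deg y) (\<lambda>x. w (x, y)) z)"

definition right_op :: "('k \<Rightarrow> ('y \<Rightarrow> real) \<Rightarrow> 'z \<Rightarrow> real) \<Rightarrow> ('x \<Rightarrow> 'k) \<Rightarrow> ('x \<times> 'y \<Rightarrow> real) \<Rightarrow> 'x \<times> 'z \<Rightarrow> real" where
  "right_op f deg w = (\<lambda>(x, z). f (deg x) (\<lambda>y. w (x, y)) z)"

lemma lin_op_left_op: "(\<And>k. lin_op (f k)) \<Longrightarrow> lin_op (left_op f deg)"
  by (auto simp: lin_op_def left_op_def)

lemma lin_op_right_op: "(\<And>k. lin_op (f k)) \<Longrightarrow> lin_op (right_op f deg)"
  by (auto simp: lin_op_def right_op_def)

lemma left_op_tensor:
  assumes "\<And>k. lin_op (f k)" "\<And>y. b y \<noteq> 0 \<Longrightarrow> deg y = k"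
  shows "left_op f deg (tensor a b) = tensor (f k a) b"
proof (intro ext, clarify)
  fix z y
  show "left_op f deg (tensor a b) (z, y) = tensor (f k a) b (z, y)"
    using assms(2)[of y] lin_op_zero[OF assms(1)]
    by (cases "b y = 0") (auto simp: left_op_def tensor_def lin_op_scale_right[OF assms(1)])
qed

lemma right_op_tensor:
  assumes "\<And>k. lin_op (f k)" "\<And>x. a x \<noteq> 0 \<Longrightarrow> deg x = k"
  shows "right_op f deg (tensor a b) = tensor a (f k b)"
proof (intro ext, clarify)
  fix x z
  show "right_op f deg (tensor a b) (x, z) = tensor a (f k b) (x, z)"
    using assms(2)[of x] lin_op_zero[OF assms(1)]
    by (cases "a x = 0") (auto simp: right_op_def tensor_def lin_op_scale[OF assms(1)])
qed

lemma tensor_in_tensor_group: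
  "a \<in> A p1 q1 \<Longrightarrow> b \<in> B p2 q2 \<Longrightarrow> p1 + p2 = p \<Longrightarrow> q1 + q2 = q \<Longrightarrow> tensor a b \<in> tensor_group A B p q"
  unfolding tensor_group_def by (rule group_closure.base) blast

lemma add_subgroup_tensor_group: "add_subgroup (tensor_group A B p q)"
  by (simp add: tensor_group_def add_subgroup_group_closure)

lemma tensor_group_diff_op:
  assumes "w \<in> tensor_group A B p q" "diff_op F" "add_subgroup H"
    "\<And>a b p1 p2 q1 q2. a \<in> A p1 q1 \<Longrightarrow> b \<in> B p2 q2 \<Longrightarrow> p1 + p2 = p \<Longrightarrow> q1 + q2 = q \<Longrightarrow> F (tensor a b) \<in> H"
  shows "F w \<in> H"
  using assms(1) unfolding tensor_group_def
  by (rule group_closure_diff_op[OF _ assms(2,3)]) (use assms(4) in blast)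

lemma tensor_zero_left: "tensor 0 b = 0" and tensor_zero_right: "tensor a 0 = 0"
  by (auto simp: tensor_def fun_eq_iff)

lemma add_subgroup_sign:
  assumes "add_subgroup (H :: ('x \<Rightarrow> real) set)" "h \<in> H"
  shows "(\<lambda>x. parity_sign q * h x) \<in> H"
proof (cases "even q")
  case True
  then show ?thesis using assms(2) by (simp add: parity_sign_def)
next
  case False
  have "(\<lambda>x. parity_sign q * h x) = - h" using False by (simp add: parity_sign_def fun_eq_iff)
  then show ?thesis using add_subgroup_minus[OF assms] by (simp only:)
qed

text \<open>The finitely many evaluations in \<open>points\<close> make each \<open>A p q\<close> free of finite rank with a basis that is
  linearly independent over \<open>\<real>\<close>, so that homomorphisms out of it extend to \<open>\<real>\<close>-linear operators on all
  functions; these can be applied to one variable of a function of two variables.\<close>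

locale function_complex =
  fixes A :: "int \<Rightarrow> int \<Rightarrow> ('x \<Rightarrow> real) set" and d :: "('x \<Rightarrow> real) \<Rightarrow> 'x \<Rightarrow> real"
    and top :: int and deg :: "'x \<Rightarrow> int \<times> int"
  assumes subgroup: "add_subgroup (A p q)"
    and points: "\<exists>S. finite S \<and> (\<forall>x\<in>S. \<forall>h\<in>A p q. h x \<in> \<int>) \<and> (\<forall>h\<in>A p q. (\<forall>x\<in>S. h x = 0) \<longrightarrow> h = 0)"
    and lin_d: "lin_op d"
    and d_mem: "h \<in> A p q \<Longrightarrow> d h \<in> A p (q - 1)"
    and d_d: "h \<in> A p q \<Longrightarrow> d (d h) = 0"
    and support: "h \<in> A p q \<Longrightarrow> h x \<noteq> 0 \<Longrightarrow> deg x = (p, q)"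
    and above: "q > top \<Longrightarrow> A p q = {0}"
begin

definition exact :: bool where
  "exact \<longleftrightarrow> (\<forall>p q z. q \<noteq> top \<longrightarrow> z \<in> A p q \<longrightarrow> d z = 0 \<longrightarrow> (\<exists>c\<in>A p (q + 1). d c = z))"

text \<open>The condition on \<open>q\<close> makes the set empty in all other degrees, so that
  their tensor group has no generators off the total top degree.\<close>

definition top_cycles :: "int \<Rightarrow> int \<Rightarrow> ('x \<Rightarrow> real) set" where
  "top_cycles p q = {z \<in> A p q. d z = 0 \<and> q = top}"

lemma diff_d: "diff_op d"
  by (rule lin_op_diff_op[OF lin_d])

text \<open>The cycles form a free group; preimages are chosen on a basis and extended linearly. As
  the basis is independent over \<real>, the extension acts on all functions.\<close>

lemma cycle_section:
  assumes exact "q \<noteq> top"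
  shows "\<exists>r. lin_op r \<and> (\<forall>z\<in>A p q. d z = 0 \<longrightarrow> r z \<in> A p (q + 1) \<and> d (r z) = z)"
proof -
  let ?Z = "{z \<in> A p q. d z = 0}"
  have Z: "add_subgroup ?Z"
    using subgroup[of p q] diff_op_zero[OF diff_d] unfolding add_subgroup_def
    by (auto simp only: diff_opD[OF diff_d] diff_self mem_Collect_eq)
  obtain S where S: "finite S" "\<forall>x\<in>S. \<forall>h\<in>A p q. h x \<in> \<int>" "\<forall>h\<in>A p q. (\<forall>x\<in>S. h x = 0) \<longrightarrow> h = 0"
    using points[of p q] by (elim exE conjE) (rule that)
  have "\<exists>B. finite B \<and> real_fun.independent B \<and> group_closure B = ?Z"
    by (rule subgroup_basis_points[OF S(1) Z]) (use S(2,3) in blast)+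
  then obtain B where B: "real_fun.independent B" "group_closure B = ?Z" by blast
  have "\<forall>b\<in>?Z. \<exists>c. c \<in> A p (q + 1) \<and> d c = b" using assms unfolding exact_def by blast
  then obtain c where c: "\<And>b. b \<in> ?Z \<Longrightarrow> c b \<in> A p (q + 1) \<and> d (c b) = b" by metis
  obtain r where r: "\<And>u v. r (u + v) = r u + r v" "\<And>a u. r (\<lambda>x. a * u x) = (\<lambda>y. a * r u y)"
    "\<And>b. b \<in> B \<Longrightarrow> r b = c b" by (rule real_fun_construct[OF B(1), of c]) (rule that)
  have lin: "lin_op r"
    unfolding lin_op_def
  proof (intro allI)
    fix a b u v y
    have "r (\<lambda>x. a * u x + b * v x) = r ((\<lambda>x. a * u x) + (\<lambda>x. b * v x))" by (simp add: plus_fun_def)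
    also have "\<dots> = (\<lambda>y. a * r u y) + (\<lambda>y. b * r v y)" by (simp only: r)
    finally show "r (\<lambda>x. a * u x + b * v x) y = a * r u y + b * r v y" by simp
  qed
  have BZ: "B \<subseteq> ?Z" using B(2) group_closure_superset by blast
  have "r z \<in> A p (q + 1)" if z: "z \<in> ?Z" for z
  proof (rule group_closure_diff_op[of z B, OF _ lin_op_diff_op[OF lin] subgroup])
    show "z \<in> group_closure B" using z B(2) by (simp only:)
    show "r b \<in> A p (q + 1)" if "b \<in> B" for b using r(3)[OF that] c BZ that by (metis subsetD)
  qed
  moreover have "d (r z) = z" if z: "z \<in> ?Z" for z
  proof -
    have "d (r z) - z \<in> {0}"
    proof (rule group_closure_diff_op[of z B])
      show "z \<in> group_closure B" using z B(2) by (simp only:)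
      show "diff_op (\<lambda>z. d (r z) - z)"
        by (intro diff_op_diff diff_op_compose[OF diff_d] diff_op_id lin_op_diff_op lin)
      show "d (r b) - b \<in> {0}" if "b \<in> B" for b
        using r(3)[OF that] c[of b] BZ that by (metis diff_self singletonI subsetD)
    qed (rule add_subgroup_singleton)
    then show ?thesis by (metis eq_iff_diff_eq_0 singletonD)
  qed
  ultimately show ?thesis using lin by blast
qed

text \<open>Below the top, \<open>s\<close> is the section \<open>r\<close> applied to the cycle h -
  r(d h); from the top on it is 0. The defect h - d s h - s d h then vanishes off the top, and in
  top degree it is the cycle h - r(d h).\<close>

lemma homotopy:
  assumes exact
  obtains s where "\<And>p q. lin_op (s p q)" "\<And>p q h. h \<in> A p q \<Longrightarrow> s p q h \<in> A p (q + 1)"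
    "\<And>p q h. h \<in> A p q \<Longrightarrow> q \<noteq> top \<Longrightarrow> h - d (s p q h) - s p (q - 1) (d h) = 0"
    "\<And>p q h. h \<in> A p q \<Longrightarrow> q = top \<Longrightarrow> h - d (s p q h) - s p (q - 1) (d h) \<in> top_cycles p q"
proof -
  have "\<forall>p q. \<exists>r. q \<noteq> top \<longrightarrow> lin_op r \<and> (\<forall>z\<in>A p q. d z = 0 \<longrightarrow> r z \<in> A p (q + 1) \<and> d (r z) = z)"
    using cycle_section[OF assms] by blast
  then obtain r where r0: "\<And>p q. q \<noteq> top \<longrightarrow> lin_op (r p q) \<and>
      (\<forall>z\<in>A p q. d z = 0 \<longrightarrow> r p q z \<in> A p (q + 1) \<and> d (r p q z) = z)" by metis
  have rlin: "lin_op (r p q)" if "q \<noteq> top" for p q using r0 that by blast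
  have r: "r p q z \<in> A p (q + 1)" "d (r p q z) = z" if "q \<noteq> top" "z \<in> A p q" "d z = 0" for p q z
    using r0 that by blast+
  define s where "s p q = (if q < top then (\<lambda>h. r p q (h - r p (q - 1) (d h))) else (\<lambda>h. 0))" for p q
  have slin: "lin_op (s p q)" for p q
  proof (cases "q < top")
    case True
    have "lin_op (\<lambda>h. h - r p (q - 1) (d h))"
      unfolding lin_op_def
    proof (intro allI)
      fix a b u v y
      have dl: "d (\<lambda>x. a * u x + b * v x) = (\<lambda>y. a * d u y + b * d v y)"
        by (rule ext) (rule lin_opD[OF lin_d])
      have rl: "r p (q - 1) (\<lambda>x. a * u' x + b * v' x) y = a * r p (q - 1) u' y + b * r p (q - 1) v' y" for u' v'
        using lin_opD[OF rlin[of "q - 1" p]] True by simp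
      show "((\<lambda>x. a * u x + b * v x) - r p (q - 1) (d (\<lambda>x. a * u x + b * v x))) y =
          a * (u - r p (q - 1) (d u)) y + b * (v - r p (q - 1) (d v)) y"
        unfolding dl by (simp add: rl algebra_simps)
    qed
    then show ?thesis using True lin_op_compose[OF rlin[of q p]] by (simp add: s_def)
  next
    case False
    then show ?thesis by (simp add: s_def lin_op_def)
  qed
  have corr: "h - r p (q - 1) (d h) \<in> A p q" "d (h - r p (q - 1) (d h)) = 0" if "h \<in> A p q" "q \<le> top" for p q h
  proof -
    have *: "r p (q - 1) (d h) \<in> A p (q - 1 + 1)" "d (r p (q - 1) (d h)) = d h"
      using r[of "q - 1" "d h" p] d_mem[OF that(1)] d_d[OF that(1)] that(2) by auto
    then show "h - r p (q - 1) (d h) \<in> A p q" using add_subgroup_diff[OF subgroup that(1)] by simp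
    show "d (h - r p (q - 1) (d h)) = 0" using * diff_opD[OF diff_d] by (metis diff_self)
  qed
  have smem: "s p q h \<in> A p (q + 1)" if "h \<in> A p q" for p q h
    using r(1)[OF _ corr[OF that]] add_subgroup_zero[OF subgroup] by (simp add: s_def)
  \<comment> \<open>On a boundary the correction term of \<open>s\<close> drops out because
    \<open>d (d h) = 0\<close>.\<close>
  have sd: "s p (q - 1) (d h) = r p (q - 1) (d h)" if "h \<in> A p q" "q \<le> top" for p q h
  proof -
    have "r p (q - 1 - 1) (d (d h)) = 0"
      using d_d[OF that(1)] diff_op_zero[OF lin_op_diff_op[OF rlin[of "q - 1 - 1" p]]] that(2) by (simp only:)
    moreover have "q - 1 < top" using that(2) by simp
    ultimately show ?thesis unfolding s_def by (simp only: if_True diff_zero)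
  qed
  have low: "h - d (s p q h) - s p (q - 1) (d h) = 0" if h: "h \<in> A p q" and q: "q \<noteq> top" for p q h
  proof (cases "q < top")
    case True
    have "d (s p q h) = h - r p (q - 1) (d h)"
      using r(2)[OF _ corr[OF h]] True by (simp add: s_def)
    moreover have "s p (q - 1) (d h) = r p (q - 1) (d h)" using sd[OF h] True by simp
    ultimately show ?thesis by (metis diff_diff_eq2 add_diff_cancel_left' diff_self)
  next
    case False
    then have h0: "h = 0" using above[of q p] h q by auto
    show ?thesis
      unfolding h0 diff_op_zero[OF diff_d] diff_op_zero[OF lin_op_diff_op[OF slin]] by (simp only: diff_self)
  qed
  have high: "h - d (s p q h) - s p (q - 1) (d h) \<in> top_cycles p q" if h: "h \<in> A p q" and q: "q = top" for p q h
  proof -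
    have "d (s p q h) = 0" using q diff_op_zero[OF diff_d] by (simp only: s_def) simp
    then have "h - d (s p q h) - s p (q - 1) (d h) = h - r p (q - 1) (d h)" using sd[OF h] q by (metis diff_zero order_refl)
    then show ?thesis using corr[OF h] q by (simp only: top_cycles_def mem_Collect_eq)
  qed
  show ?thesis using slin smem low high by (rule that)
qed

end

locale tensor_complex = X: function_complex A dA topA degA + Y: function_complex B dB topB degB
  for A dA topA degA and B dB topB degB
begin

definition K :: "int \<Rightarrow> int \<Rightarrow> ('a \<times> 'b \<Rightarrow> real) set" where
  "K = tensor_group A B"

text \<open>The Koszul sign is taken from the degree of the point \<open>x\<close>, at which only
  elements of that degree can be nonzero. In this way D is defined on all functions, homogeneous or
  not.\<close>

definition D :: "('a \<times> 'b \<Rightarrow> real) \<Rightarrow> 'a \<times> 'b \<Rightarrow> real" where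
  "D w = (\<lambda>(x, y). dA (\<lambda>x'. w (x', y)) x + parity_sign (snd (degA x)) * dB (\<lambda>y'. w (x, y')) y)"

lemma lin_D: "lin_op D"
  using X.lin_d Y.lin_d by (auto simp: lin_op_def D_def algebra_simps)

lemma diff_D: "diff_op D"
  by (rule lin_op_diff_op[OF lin_D])

lemma D_tensor:
  assumes "a \<in> A p q"
  shows "D (tensor a b) (x, y) = tensor (dA a) b (x, y) + parity_sign q * tensor a (dB b) (x, y)"
  using X.support[OF assms, of x]
  by (cases "a x = 0")
     (auto simp: D_def tensor_def lin_op_scale[OF Y.lin_d] lin_op_scale_right[OF X.lin_d] lin_op_zero[OF Y.lin_d])

lemma D_D:
  assumes "w \<in> K p q"
  shows "D (D w) = 0"
proof -
  have "D (D w) \<in> {0}"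
    using assms unfolding K_def
  proof (rule tensor_group_diff_op[OF _ diff_op_compose[OF diff_D diff_D] add_subgroup_singleton])
    fix a b p1 p2 q1 q2
    assume ab: "a \<in> A p1 q1" "b \<in> B p2 q2" "p1 + p2 = p" "q1 + q2 = q"
    have 1: "D (tensor a b) = (\<lambda>z. tensor (dA a) b z + parity_sign q1 * tensor a (dB b) z)"
      using D_tensor[OF ab(1), of b] by (auto simp: fun_eq_iff)
    have sg: "parity_sign (q1 - 1) = - parity_sign q1" by (simp add: parity_sign_def)
    have z: "dA (dA a) = (\<lambda>x. 0)" "dB (dB b) = (\<lambda>x. 0)"
      using X.d_d[OF ab(1)] Y.d_d[OF ab(2)] by (auto simp: fun_eq_iff)
    have "D (D (tensor a b)) (x, y) = 0" for x y
      unfolding 1 lin_op_add[OF lin_D] lin_op_scale[OF lin_D] D_tensor[OF X.d_mem[OF ab(1)]] D_tensor[OF ab(1)]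
      by (simp add: sg tensor_def z)
    then show "D (D (tensor a b)) \<in> {0}" by (auto simp: fun_eq_iff)
  qed
  then show ?thesis by simp
qed

lemma K_above:
  assumes "q > topA + topB"
  shows "K p q = {0}"
proof -
  have "K p q \<subseteq> {0}"
    unfolding K_def tensor_group_def
  proof (rule group_closure_minimal[OF _ add_subgroup_singleton], clarify)
    fix a b p1 p2 q1 q2
    assume ab: "a \<in> A p1 q1" "b \<in> B p2 q2" "q = q1 + q2"
    then have "q1 > topA \<or> q2 > topB" using assms by linarith
    then have "a = 0 \<or> b = 0" using ab X.above[of q1 p1] Y.above[of q2 p2] by auto
    then show "tensor a b = 0" using tensor_zero_left tensor_zero_right by metis
  qed
  then show ?thesis using add_subgroup_zero[OF add_subgroup_tensor_group, of A B p q] unfolding K_def by blast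
qed

text \<open>The homotopy of the first factor, applied to slices, moves a cycle into
  \<open>Z \<otimes> B\<close> with \<open>Z\<close> the top cycles, where only the differential of \<open>B\<close> remains; the homotopy of the
  second factor then moves it into the product of the groups of top cycles.\<close>

lemma kunneth_reduction:
  assumes "X.exact" "Y.exact" "w \<in> K p q" "D w = 0"
  obtains u v where "u \<in> K p (q + 1)" "v \<in> tensor_group X.top_cycles Y.top_cycles p q" "w = D u + v"
proof -
  obtain s where s: "\<And>p q. lin_op (s p q)" "\<And>p q h. h \<in> A p q \<Longrightarrow> s p q h \<in> A p (q + 1)"
    "\<And>p q h. h \<in> A p q \<Longrightarrow> q \<noteq> topA \<Longrightarrow> h - dA (s p q h) - s p (q - 1) (dA h) = 0"
    "\<And>p q h. h \<in> A p q \<Longrightarrow> q = topA \<Longrightarrow> h - dA (s p q h) - s p (q - 1) (dA h) \<in> X.top_cycles p q"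
    by (rule X.homotopy[OF assms(1)]) (rule that)
  obtain t where t: "\<And>p q. lin_op (t p q)" "\<And>p q h. h \<in> B p q \<Longrightarrow> t p q h \<in> B p (q + 1)"
    "\<And>p q h. h \<in> B p q \<Longrightarrow> q \<noteq> topB \<Longrightarrow> h - dB (t p q h) - t p (q - 1) (dB h) = 0"
    "\<And>p q h. h \<in> B p q \<Longrightarrow> q = topB \<Longrightarrow> h - dB (t p q h) - t p (q - 1) (dB h) \<in> Y.top_cycles p q"
    by (rule Y.homotopy[OF assms(2)]) (rule that)
  \<comment> \<open>In total degree (p, q), a second factor of degree \<open>k\<close> leaves the
    degree (p, q) minus \<open>k\<close> to the first; this selects the homotopy.\<close>
  define S where "S q = left_op (\<lambda>k. s (p - fst k) (q - snd k)) degB" for q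
  define T where "T q = right_op (\<lambda>k. t (p - fst k) (q - snd k)) degA" for q
  \<comment> \<open>The differential of the second factor without the Koszul sign.\<close>
  define R where "R = right_op (\<lambda>k :: unit. dB) (\<lambda>x :: 'a. ())"
  have linS: "lin_op (S q)" for q unfolding S_def by (rule lin_op_left_op[OF s(1)])
  have linT: "lin_op (T q)" for q unfolding T_def by (rule lin_op_right_op[OF t(1)])
  have linR: "lin_op R" unfolding R_def by (rule lin_op_right_op[OF Y.lin_d])
  note diffS = lin_op_diff_op[OF linS] and diffT = lin_op_diff_op[OF linT] and diffR = lin_op_diff_op[OF linR]
  have S_tensor: "S q (tensor a b) = tensor (s (p - p2) (q - q2) a) b" if "b \<in> B p2 q2" for q a b p2 q2
    unfolding S_def by (subst left_op_tensor[where k = "(p2, q2)"]) (use s(1) Y.support[OF that] in auto)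
  have T_tensor: "T q (tensor a b) = tensor a (t (p - p1) (q - q1) b)" if "a \<in> A p1 q1" for q a b p1 q1
    unfolding T_def by (subst right_op_tensor[where k = "(p1, q1)"]) (use t(1) X.support[OF that] in auto)
  have R_tensor: "R (tensor a b) = tensor a (dB b)" for a b
    unfolding R_def by (rule right_op_tensor[OF Y.lin_d]) simp
  let ?K1 = "tensor_group X.top_cycles B" and ?K2 = "tensor_group X.top_cycles Y.top_cycles"
  have ZA: "a \<in> A p1 q1" "dA a = 0" "q1 = topA" if "a \<in> X.top_cycles p1 q1" for a p1 q1
    using that by (auto simp: X.top_cycles_def)
  have S_mem: "S q w \<in> K p (q + 1)"
    using assms(3) unfolding K_def
  proof (rule tensor_group_diff_op[OF _ diffS add_subgroup_tensor_group])
    fix a b p1 p2 q1 q2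
    assume ab: "a \<in> A p1 q1" "b \<in> B p2 q2" "p1 + p2 = p" "q1 + q2 = q"
    then have "p - p2 = p1" "q - q2 = q1" by auto
    then show "S q (tensor a b) \<in> tensor_group A B p (q + 1)"
      unfolding S_tensor[OF ab(2)] using ab by (intro tensor_in_tensor_group[where A = A and B = B, OF s(2) ab(2)]) auto
  qed
  define w1 where "w1 = w - D (S q w) - S (q - 1) (D w)"
  have w1_mem: "w1 \<in> ?K1 p q"
    using assms(3) unfolding K_def w1_def
  proof (rule tensor_group_diff_op[OF _ _ add_subgroup_tensor_group])
    show "diff_op (\<lambda>w. w - D (S q w) - S (q - 1) (D w))"
      by (intro diff_op_diff diff_op_id diff_op_compose[OF diff_D] diff_op_compose[OF diffS] diffS diff_D)
    fix a b p1 p2 q1 q2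
    assume ab: "a \<in> A p1 q1" "b \<in> B p2 q2" "p1 + p2 = p" "q1 + q2 = q"
    let ?P = "a - dA (s p1 q1 a) - s p1 (q1 - 1) (dA a)"
    have e: "p - p2 = p1" "q - q2 = q1" "q - 1 - q2 = q1 - 1" "q - 1 - (q2 - 1) = q1" using ab by auto
    have 1: "D (tensor a b) = (\<lambda>z. tensor (dA a) b z + parity_sign q1 * tensor a (dB b) z)"
      using D_tensor[OF ab(1), of b] by (auto simp: fun_eq_iff)
    have 2: "S (q - 1) (D (tensor a b)) z = tensor (s p1 (q1 - 1) (dA a)) b z + parity_sign q1 * tensor (s p1 q1 a) (dB b) z" for z
      unfolding 1 lin_op_add[OF linS] lin_op_scale[OF linS] S_tensor[OF ab(2)] S_tensor[OF Y.d_mem[OF ab(2)]] e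
      by (rule refl)
    have 3: "S q (tensor a b) = tensor (s p1 q1 a) b" unfolding S_tensor[OF ab(2)] e by (rule refl)
    \<comment> \<open>\<open>s\<close> raises the first degree by one, so the terms with
      \<open>s a\<close> and \<open>dB b\<close> coming from D S and from S D have opposite signs
      and cancel.\<close>
    have sg: "parity_sign (1 + q1) = - parity_sign q1" by (simp add: parity_sign_def)
    have "tensor a b - D (S q (tensor a b)) - S (q - 1) (D (tensor a b)) = tensor ?P b"
    proof (intro ext, clarify)
      fix x y
      show "(tensor a b - D (S q (tensor a b)) - S (q - 1) (D (tensor a b))) (x, y) = tensor ?P b (x, y)"
        unfolding 3 fun_diff_def 2 D_tensor[OF s(2)[OF ab(1)]] by (simp add: tensor_def add.commute[of q1 1] sg algebra_simps)
    qed
    moreover have "tensor ?P b \<in> ?K1 p q"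
    proof (cases "q1 = topA")
      case True
      show ?thesis by (rule tensor_in_tensor_group[where A = X.top_cycles and B = B, OF s(4)[OF ab(1) True] ab(2-4)])
    next
      case False
      show ?thesis unfolding s(3)[OF ab(1) False] tensor_zero_left by (rule add_subgroup_zero[OF add_subgroup_tensor_group])
    qed
    ultimately show "tensor a b - D (S q (tensor a b)) - S (q - 1) (D (tensor a b)) \<in> ?K1 p q" by (simp only:)
  qed
  have "S (q - 1) (D w) = 0" unfolding assms(4) by (rule diff_op_zero[OF diffS])
  then have w: "w = D (S q w) + w1" unfolding w1_def by (simp only: diff_zero add_diff_eq) (simp only: add_diff_cancel_left')
  \<comment> \<open>On products with a top cycle on the left, only the second differential survives
    in D, and its sign is constant because all left degrees are \<open>topA\<close>.\<close>
  have DR: "D z - (\<lambda>k. parity_sign topA * R z k) \<in> {0}" if "z \<in> ?K1 p q'" for z q'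
    using that
  proof (rule tensor_group_diff_op[OF _ _ add_subgroup_singleton])
    have "diff_op (\<lambda>z. (\<lambda>k. parity_sign topA * R z k))"
      using diffR unfolding diff_op_def by (simp only: fun_diff_def) (simp add: right_diff_distrib fun_eq_iff)
    then show "diff_op (\<lambda>z. D z - (\<lambda>k. parity_sign topA * R z k))" by (rule diff_op_diff[OF diff_D])
    fix a b p1 p2 q1 q2
    assume ab: "a \<in> X.top_cycles p1 q1" "b \<in> B p2 q2"
    have "D (tensor a b) k = parity_sign topA * R (tensor a b) k" for k
      unfolding R_tensor using D_tensor[OF ZA(1)[OF ab(1)], of b] ZA[OF ab(1)]
      by (cases k) (simp add: tensor_def)
    then show "D (tensor a b) - (\<lambda>k. parity_sign topA * R (tensor a b) k) \<in> {0}" by (simp add: fun_eq_iff)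
  qed
  have "D w1 = D w - D (D (S q w))" using w diff_opD[OF diff_D] by (metis add_diff_cancel_left')
  then have "D w1 = 0" using D_D[OF S_mem] assms(4) by simp
  then have "R w1 = 0" using DR[OF w1_mem] by (auto simp: fun_eq_iff parity_sign_def split: if_splits)
  \<comment> \<open>The constant sign is put in front because its square is 1, so that
    \<open>D u1 = R (T q w1)\<close>.\<close>
  define u1 where "u1 = (\<lambda>k. parity_sign topA * T q w1 k)"
  have T_mem: "T q w1 \<in> ?K1 p (q + 1)"
    using w1_mem
  proof (rule tensor_group_diff_op[OF _ diffT add_subgroup_tensor_group])
    fix a b p1 p2 q1 q2
    assume ab: "a \<in> X.top_cycles p1 q1" "b \<in> B p2 q2" "p1 + p2 = p" "q1 + q2 = q"
    then have e: "p - p1 = p2" "q - q1 = q2" by auto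
    show "T q (tensor a b) \<in> ?K1 p (q + 1)"
      unfolding T_tensor[OF ZA(1)[OF ab(1)]] e using ab by (intro tensor_in_tensor_group[where A = X.top_cycles and B = B, OF ab(1) t(2)[OF ab(2)]]) auto
  qed
  have K1_sub: "?K1 p' q' \<subseteq> K p' q'" for p' q'
    unfolding K_def
    by (subst tensor_group_def, rule group_closure_minimal[OF _ add_subgroup_tensor_group])
       (use ZA in \<open>auto intro!: tensor_in_tensor_group[where A = A and B = B]\<close>)
  have u1_mem: "u1 \<in> K p (q + 1)"
    unfolding u1_def using K1_sub T_mem by (intro add_subgroup_sign) (auto simp: K_def add_subgroup_tensor_group)
  define v where "v = w1 - R (T q w1) - T (q - 1) (R w1)"
  have v_mem: "v \<in> ?K2 p q"
    using w1_mem unfolding v_def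
  proof (rule tensor_group_diff_op[OF _ _ add_subgroup_tensor_group])
    show "diff_op (\<lambda>w. w - R (T q w) - T (q - 1) (R w))"
      by (intro diff_op_diff diff_op_id diff_op_compose[OF diffR] diff_op_compose[OF diffT] diffT diffR)
    fix a b p1 p2 q1 q2
    assume ab: "a \<in> X.top_cycles p1 q1" "b \<in> B p2 q2" "p1 + p2 = p" "q1 + q2 = q"
    let ?P = "b - dB (t p2 q2 b) - t p2 (q2 - 1) (dB b)"
    have e: "p - p1 = p2" "q - q1 = q2" "q - 1 - q1 = q2 - 1" using ab by auto
    have "tensor a b - R (T q (tensor a b)) - T (q - 1) (R (tensor a b)) = tensor a ?P"
      unfolding T_tensor[OF ZA(1)[OF ab(1)]] R_tensor e by (auto simp: fun_eq_iff tensor_def algebra_simps)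
    moreover have "tensor a ?P \<in> ?K2 p q"
    proof (cases "q2 = topB")
      case True
      show ?thesis by (rule tensor_in_tensor_group[where A = X.top_cycles and B = Y.top_cycles, OF ab(1) t(4)[OF ab(2) True] ab(3,4)])
    next
      case False
      show ?thesis unfolding t(3)[OF ab(2) False] tensor_zero_right by (rule add_subgroup_zero[OF add_subgroup_tensor_group])
    qed
    ultimately show "tensor a b - R (T q (tensor a b)) - T (q - 1) (R (tensor a b)) \<in> ?K2 p q" by (simp only:)
  qed
  have "D u1 = R (T q w1)"
  proof (intro ext)
    fix k
    have "D (T q w1) k = parity_sign topA * R (T q w1) k" using DR[OF T_mem] by (cases k) (simp add: fun_eq_iff)
    then show "D u1 k = R (T q w1) k"
      unfolding u1_def lin_op_scale[OF lin_D] by (simp add: parity_sign_def)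
  qed
  moreover have "T (q - 1) (R w1) = 0" unfolding \<open>R w1 = 0\<close> by (rule diff_op_zero[OF diffT])
  ultimately have "w1 = D u1 + v" unfolding v_def by (simp only: diff_zero add_diff_eq) (simp only: add_diff_cancel_left')
  moreover have "D (S q w + u1) = D (S q w) + D u1"
    using diff_opD[OF diff_D, of "S q w + u1" u1] by (metis add_diff_cancel_right' diff_eq_eq)
  ultimately have "w = D (S q w + u1) + v" using w by (simp only: add.assoc) 
  moreover have "S q w + u1 \<in> K p (q + 1)"
    using add_subgroup_add[OF add_subgroup_tensor_group] S_mem u1_mem unfolding K_def by blast
  ultimately show ?thesis using v_mem by (intro that)
qed

text \<open>In these degrees there are no products of top cycles, so the remainder \<open>v\<close>
  is 0.\<close>

theorem kunneth_lower:
  assumes "X.exact" "Y.exact" "w \<in> K p q" "D w = 0" "q \<noteq> topA + topB"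
  shows "\<exists>u\<in>K p (q + 1). D u = w"
proof -
  obtain u v where uv: "u \<in> K p (q + 1)" "v \<in> tensor_group X.top_cycles Y.top_cycles p q" "w = D u + v"
    by (rule kunneth_reduction[OF assms(1-4)]) (rule that)
  have "{tensor a b |a b p1 p2 q1 q2. a \<in> X.top_cycles p1 q1 \<and> b \<in> Y.top_cycles p2 q2 \<and> p1 + p2 = p \<and> q1 + q2 = q} = {}"
    using assms(5) by (auto simp: X.top_cycles_def Y.top_cycles_def)
  then have "v = 0" using uv(2) unfolding tensor_group_def by (metis group_closure_empty singletonD)
  then show ?thesis using uv by (intro bexI[of _ u]) simp_all
qed

text \<open>There is nothing above the total top degree, so the bounding element \<open>u\<close> is
  0.\<close>

theorem kunneth_top:
  assumes "X.exact" "Y.exact" "w \<in> K p q" "D w = 0" "q = topA + topB"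
  shows "w \<in> tensor_group X.top_cycles Y.top_cycles p q"
proof -
  obtain u v where uv: "u \<in> K p (q + 1)" "v \<in> tensor_group X.top_cycles Y.top_cycles p q" "w = D u + v"
    by (rule kunneth_reduction[OF assms(1-4)]) (rule that)
  have "u = 0" using uv(1) K_above[of "q + 1" p] assms(5) by simp
  then have "D u = 0" using diff_op_zero[OF diff_D] by (simp only:)
  then show ?thesis using uv by simp
qed

text \<open>At a point where boundaries vanish, the second term of D disappears and evaluation there
  is a chain map. Integral values at the point keep the slice inside \<open>A\<close>, and the
  support condition fixes its degree.\<close>

lemma slice_left:
  assumes "w \<in> K p q" "degB y0 = (p0, q0)" "\<And>p q b. b \<in> B p q \<Longrightarrow> b y0 \<in> \<int>" "\<And>p q b. b \<in> B p q \<Longrightarrow> dB b y0 = 0"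
  shows "(\<lambda>x. w (x, y0)) \<in> A (p - p0) (q - q0)" "(\<lambda>x. D w (x, y0)) = dA (\<lambda>x. w (x, y0))"
proof -
  have sl: "diff_op (\<lambda>w :: 'a \<times> 'b \<Rightarrow> real. \<lambda>x. w (x, y0))" by (simp add: diff_op_def fun_eq_iff)
  show "(\<lambda>x. w (x, y0)) \<in> A (p - p0) (q - q0)"
    using assms(1) unfolding K_def
  proof (rule tensor_group_diff_op[OF _ sl X.subgroup])
    fix a b p1 p2 q1 q2
    assume ab: "a \<in> A p1 q1" "b \<in> B p2 q2" "p1 + p2 = p" "q1 + q2 = q"
    show "(\<lambda>x. tensor a b (x, y0)) \<in> A (p - p0) (q - q0)"
    proof (cases "b y0 = 0")
      case True
      then have "(\<lambda>x. tensor a b (x, y0)) = 0" by (auto simp: tensor_def fun_eq_iff)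
      then show ?thesis using add_subgroup_zero[OF X.subgroup] by (simp only:)
    next
      case False
      then have "p2 = p0" "q2 = q0" using Y.support[OF ab(2)] assms(2) by auto
      moreover obtain m :: int where "b y0 = of_int m" using assms(3)[OF ab(2)] by (auto elim: Ints_cases)
      ultimately show ?thesis
        using real_fun.add_subgroup_scale_int[OF X.subgroup ab(1), of m] ab by (auto simp: tensor_def mult.commute)
    qed
  qed
  have "(\<lambda>x. D w (x, y0)) - dA (\<lambda>x. w (x, y0)) \<in> {0}"
    using assms(1) unfolding K_def
  proof (rule tensor_group_diff_op[OF _ _ add_subgroup_singleton])
    show "diff_op (\<lambda>w. (\<lambda>x. D w (x, y0)) - dA (\<lambda>x. w (x, y0)))"
      by (intro diff_op_diff diff_op_compose[OF sl diff_D] diff_op_compose[OF X.diff_d sl])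
    fix a b p1 p2 q1 q2
    assume ab: "a \<in> A p1 q1" "b \<in> B p2 q2"
    have "D (tensor a b) (x, y0) = dA (\<lambda>x. tensor a b (x, y0)) x" for x
      unfolding D_tensor[OF ab(1)] using assms(4)[OF ab(2)] by (simp add: tensor_def lin_op_scale_right[OF X.lin_d])
    then show "(\<lambda>x. D (tensor a b) (x, y0)) - dA (\<lambda>x. tensor a b (x, y0)) \<in> {0}" by (simp add: fun_eq_iff)
  qed
  then show "(\<lambda>x. D w (x, y0)) = dA (\<lambda>x. w (x, y0))" by (simp add: fun_eq_iff)
qed

text \<open>Mirror image of \<open>slice_left\<close>, except that the surviving differential
  carries the Koszul sign of the point.\<close>

lemma slice_right:
  assumes "w \<in> K p q" "degA x0 = (p0, q0)" "\<And>p q a. a \<in> A p q \<Longrightarrow> a x0 \<in> \<int>" "\<And>p q a. a \<in> A p q \<Longrightarrow> dA a x0 = 0"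
  shows "(\<lambda>y. w (x0, y)) \<in> B (p - p0) (q - q0)"
    "(\<lambda>y. D w (x0, y)) = (\<lambda>y. parity_sign q0 * dB (\<lambda>y. w (x0, y)) y)"
proof -
  have sl: "diff_op (\<lambda>w :: 'a \<times> 'b \<Rightarrow> real. \<lambda>y. w (x0, y))" by (simp add: diff_op_def fun_eq_iff)
  show "(\<lambda>y. w (x0, y)) \<in> B (p - p0) (q - q0)"
    using assms(1) unfolding K_def
  proof (rule tensor_group_diff_op[OF _ sl Y.subgroup])
    fix a b p1 p2 q1 q2
    assume ab: "a \<in> A p1 q1" "b \<in> B p2 q2" "p1 + p2 = p" "q1 + q2 = q"
    show "(\<lambda>y. tensor a b (x0, y)) \<in> B (p - p0) (q - q0)"
    proof (cases "a x0 = 0")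
      case True
      then have "(\<lambda>y. tensor a b (x0, y)) = 0" by (auto simp: tensor_def fun_eq_iff)
      then show ?thesis using add_subgroup_zero[OF Y.subgroup] by (simp only:)
    next
      case False
      then have "p1 = p0" "q1 = q0" using X.support[OF ab(1)] assms(2) by auto
      moreover obtain m :: int where "a x0 = of_int m" using assms(3)[OF ab(1)] by (auto elim: Ints_cases)
      ultimately show ?thesis
        using real_fun.add_subgroup_scale_int[OF Y.subgroup ab(2), of m] ab by (auto simp: tensor_def)
    qed
  qed
  have "(\<lambda>y. D w (x0, y)) - (\<lambda>y. parity_sign q0 * dB (\<lambda>y. w (x0, y)) y) \<in> {0}"
    using assms(1) unfolding K_def
  proof (rule tensor_group_diff_op[OF _ _ add_subgroup_singleton])
    have "diff_op (\<lambda>w :: 'a \<times> 'b \<Rightarrow> real. \<lambda>y. parity_sign q0 * dB (\<lambda>y. w (x0, y)) y)"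
      unfolding diff_op_def fun_diff_def
      by (simp add: lin_op_minus[OF Y.lin_d] right_diff_distrib)
    then show "diff_op (\<lambda>w. (\<lambda>y. D w (x0, y)) - (\<lambda>y. parity_sign q0 * dB (\<lambda>y. w (x0, y)) y))"
      by (intro diff_op_diff diff_op_compose[OF sl diff_D])
    fix a b p1 p2 q1 q2
    assume ab: "a \<in> A p1 q1" "b \<in> B p2 q2"
    have "D (tensor a b) (x0, y) = parity_sign q0 * dB (\<lambda>y. tensor a b (x0, y)) y" for y
      unfolding D_def
      by (simp add: tensor_def assms(2) lin_op_scale_right[OF X.lin_d] assms(4)[OF ab(1)])
    then show "(\<lambda>y. D (tensor a b) (x0, y)) - (\<lambda>y. parity_sign q0 * dB (\<lambda>y. tensor a b (x0, y)) y) \<in> {0}"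
      by (simp add: fun_eq_iff)
  qed
  then show "(\<lambda>y. D w (x0, y)) = (\<lambda>y. parity_sign q0 * dB (\<lambda>y. w (x0, y)) y)" by (simp add: fun_eq_iff)
qed

end

section \<open>The chain complex of a product\<close>

text \<open>Uncurried chains: functions on pairs of a cone and a list of forms, to which the theory
  of function complexes applies.\<close>

definition chain_fun :: "'a::euclidean_space set \<Rightarrow> 'a set set \<Rightarrow> int \<Rightarrow> int \<Rightarrow> ('a set \<times> ('a \<Rightarrow> real) list \<Rightarrow> real) set" where
  "chain_fun N \<Sigma> p q = case_prod ` BM_chains N \<Sigma> p q"

definition boundary_fun ::
  "'a::euclidean_space set \<Rightarrow> 'a set set \<Rightarrow> ('a set \<times> ('a \<Rightarrow> real) list \<Rightarrow> real) \<Rightarrow> 'a set \<times> ('a \<Rightarrow> real) list \<Rightarrow> real" where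
  "boundary_fun N \<Sigma> h = (\<lambda>(\<tau>, \<phi>s). \<Sum>\<sigma>\<in>\<Sigma>. incidence N \<Sigma> \<tau> \<sigma> * h (\<sigma>, \<phi>s))"

text \<open>A nonzero value fixes the bidegree of a chain: \<open>p\<close> is the number of forms,
  \<open>q\<close> the dimension of the cone.\<close>

definition chain_degree :: "'a::euclidean_space set \<times> ('a \<Rightarrow> real) list \<Rightarrow> int \<times> int" where
  "chain_degree = (\<lambda>(\<sigma>, \<phi>s). (int (length \<phi>s), int (dim \<sigma>)))"

lemma boundary_fun_case_prod: "boundary_fun N \<Sigma> (case_prod c) = case_prod (boundary N \<Sigma> c)"
  by (simp add: boundary_fun_def boundary_def)

lemma case_prod_diff: "case_prod (c - c') = case_prod c - (case_prod c' :: 'x \<times> 'y \<Rightarrow> real)"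
  by (auto simp: fun_eq_iff)

lemma case_prod_eq_0_iff: "case_prod c = (0 :: 'x \<times> 'y \<Rightarrow> real) \<longleftrightarrow> c = 0"
  by (auto simp: fun_eq_iff)

lemma case_prod_inject: "case_prod c = case_prod c' \<longleftrightarrow> c = c'"
  by (metis curry_case_prod)

lemma function_complex_chain_fun:
  assumes \<Sigma>: "cone_complex N \<Sigma>"
  shows "function_complex (chain_fun N \<Sigma>) (boundary_fun N \<Sigma>) (fan_dim \<Sigma>) chain_degree"
proof
  note N = cone_complex_lattice[OF \<Sigma>] and fin = cone_complex_finite[OF \<Sigma>]
  fix p q
  show "add_subgroup (chain_fun N \<Sigma> p q)"
    unfolding chain_fun_def by (rule add_subgroup_image[OF add_subgroup_BM_chains]) (rule case_prod_diff)
  obtain bs where bs: "lattice_basis bs N" using N by (auto simp: lattice_subgroup_def)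
  obtain Ls where Ls: "dual_lists bs Ls" by (rule lattice_basis_dual[OF bs])
  \<comment> \<open>The value of a chain at each cone is determined by integers, its values on the
    sublists of a dual basis of \<open>N\<close>.\<close>
  let ?S = "\<Sigma> \<times> (\<lambda>I. nths Ls I) ` Pow {..<length bs}"
  have ex: "c \<sigma> \<in> exterior_power p (group_closure (set bs))" if "c \<in> BM_chains N \<Sigma> p q" for c \<sigma>
  proof (cases "\<sigma> \<in> cones \<Sigma> q")
    case True
    then show ?thesis using that F_lower_subset_exterior_power[of N \<Sigma> p \<sigma>] bs
      by (auto simp: BM_chains_def lattice_basis_def)
  next
    case False
    then show ?thesis using that add_subgroup_zero[OF add_subgroup_exterior_power] by (simp add: BM_chains_def)
  qed
  show "\<exists>S. finite S \<and> (\<forall>x\<in>S. \<forall>h\<in>chain_fun N \<Sigma> p q. h x \<in> \<int>) \<and>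
      (\<forall>h\<in>chain_fun N \<Sigma> p q. (\<forall>x\<in>S. h x = 0) \<longrightarrow> h = 0)"
  proof (intro exI[of _ ?S] conjI ballI impI)
    show "finite ?S" using fin by simp
    fix h assume "h \<in> chain_fun N \<Sigma> p q"
    then obtain c where c: "c \<in> BM_chains N \<Sigma> p q" "h = case_prod c" by (auto simp: chain_fun_def)
    show "h x \<in> \<int>" if "x \<in> ?S" for x
      using that dual_nths_Ints[OF Ls ex[OF c(1)]] by (auto simp: c(2))
    assume z: "\<forall>x\<in>?S. h x = 0"
    have "c \<sigma> = 0" for \<sigma>
    proof (cases "\<sigma> \<in> \<Sigma>")
      case True
      show ?thesis by (rule exterior_power_eq_0I[OF Ls ex[OF c(1)]]) (use z True c(2) in auto)
    next
      case False
      then show ?thesis using c(1) by (auto simp: BM_chains_def cones_def)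
    qed
    then show "h = 0" unfolding c(2) case_prod_eq_0_iff by (simp add: fun_eq_iff)
  qed
  show "h \<in> chain_fun N \<Sigma> p q \<Longrightarrow> boundary_fun N \<Sigma> h \<in> chain_fun N \<Sigma> p (q - 1)" for h
    using boundary_BM_chains[OF fin] by (auto simp: chain_fun_def boundary_fun_case_prod)
  show "h \<in> chain_fun N \<Sigma> p q \<Longrightarrow> boundary_fun N \<Sigma> (boundary_fun N \<Sigma> h) = 0" for h
    unfolding chain_fun_def using boundary_boundary[OF \<Sigma>]
    by (auto simp only: boundary_fun_case_prod case_prod_eq_0_iff)
  show "h \<in> chain_fun N \<Sigma> p q \<Longrightarrow> h x \<noteq> 0 \<Longrightarrow> chain_degree x = (p, q)" for h x
    using BM_chains_support[of _ N \<Sigma> p q] by (cases x) (auto simp: chain_fun_def chain_degree_def)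
  show "q > fan_dim \<Sigma> \<Longrightarrow> chain_fun N \<Sigma> p q = {0}"
    unfolding chain_fun_def by (simp only: BM_chains_above[OF fin] image_insert image_empty) (simp add: fun_eq_iff)
next
  show "lin_op (boundary_fun N \<Sigma>)"
    by (auto simp: lin_op_def boundary_fun_def sum_distrib_left sum.distrib[symmetric] algebra_simps)
qed

text \<open>Multilinearity: each vector is the sum of its parts on the two axes. The induction
  consumes the unsorted tail \<open>ws\<close>; a part on the first axis moves past
  \<open>ys\<close> to join \<open>xs\<close>, at the cost of a sign that \<open>H\<close>
  absorbs.\<close>

lemma wedge_split:
  assumes F: "diff_op F" and H: "add_subgroup H" and vs: "set vs \<subseteq> M \<times> M'"
    and gen: "\<And>xs ys. set xs \<subseteq> M \<Longrightarrow> set ys \<subseteq> M' \<Longrightarrow> length xs + length ys = length vs \<Longrightarrow>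
      F (wedge (map inl xs @ map inr ys)) \<in> H"
  shows "F (wedge vs) \<in> H"
proof -
  have F_add: "F (u + v) = F u + F v" for u v
    using diff_opD[OF F, of "u + v" v] by (metis add_diff_cancel_right' diff_eq_eq)
  have F_minus: "F (- u) = - F u" for u
    using diff_opD[OF F, of 0 u] diff_op_zero[OF F] by (metis diff_0)
  have "F (wedge (map inl xs @ map inr ys @ ws)) \<in> H"
    if "set xs \<subseteq> M" "set ys \<subseteq> M'" "set ws \<subseteq> M \<times> M'" "length xs + length ys + length ws = length vs" for xs ys ws
    using that
  proof (induction ws arbitrary: xs ys)
    case Nil
    then show ?case using gen[of xs ys] by simp
  next
    case (Cons w ws)
    obtain u u' where w: "w = (u, u')" "u \<in> M" "u' \<in> M'" using Cons.prems(3) by auto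
    let ?x = "wedge (map inl (xs @ [u]) @ map inr ys @ ws)" and ?y = "wedge (map inl xs @ map inr (ys @ [u']) @ ws)"
    have 1: "F ?x \<in> H" using Cons.prems w by (intro Cons.IH) auto
    have 2: "F ?y \<in> H" using Cons.prems w by (intro Cons.IH) auto
    have w': "w = inl u + inr u'" by (simp add: w)
    have e: "wedge (map inl xs @ map inr ys @ w # ws) \<theta>s = (-1) ^ length ys * ?x \<theta>s + ?y \<theta>s" for \<theta>s
      unfolding w'
      using wedge_col_add[of "map inl xs @ map inr ys" "inl u" "inr u'" ws \<theta>s]
        wedge_col_move[of "map inl xs" "map inr ys" "inl u" ws \<theta>s] by simp
    show ?case
    proof (cases "even (length ys)")
      case True
      then have "wedge (map inl xs @ map inr ys @ w # ws) = ?x + ?y" using e by (simp add: fun_eq_iff)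
      then show ?thesis using add_subgroup_add[OF H 1 2] by (simp only: F_add)
    next
      case False
      then have "wedge (map inl xs @ map inr ys @ w # ws) = - ?x + ?y" using e by (simp add: fun_eq_iff)
      then show ?thesis using add_subgroup_add[OF H add_subgroup_minus[OF H 1] 2] by (simp only: F_add F_minus)
    qed
  qed
  from this[of "[]" "[]" vs] vs show ?thesis by simp
qed

lemma F_lower_diff_op:
  assumes "w \<in> F_lower N \<Sigma> p \<sigma>" "diff_op F" "add_subgroup H"
    "\<And>\<eta> vs. \<eta> \<in> \<Sigma> \<Longrightarrow> \<sigma> \<subseteq> \<eta> \<Longrightarrow> set vs \<subseteq> sublattice N \<eta> \<Longrightarrow> int (length vs) = p \<Longrightarrow> F (wedge vs) \<in> H"
  shows "F w \<in> H"
  using assms(1) unfolding F_lower_def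
proof (rule group_closure_diff_op[OF _ assms(2,3)])
  fix g assume "g \<in> (\<Union>\<eta>\<in>{\<eta> \<in> \<Sigma>. \<sigma> \<subseteq> \<eta>}. exterior_power p (sublattice N \<eta>))"
  then obtain \<eta> where \<eta>: "\<eta> \<in> \<Sigma>" "\<sigma> \<subseteq> \<eta>" "g \<in> exterior_power p (sublattice N \<eta>)" by auto
  show "F g \<in> H"
    using \<eta>(3) unfolding exterior_power_def
    by (rule group_closure_diff_op[OF _ assms(2,3)]) (use assms(4) \<eta>(1,2) in auto)
qed

lemma wedge_in_F_lower:
  "\<eta> \<in> \<Sigma> \<Longrightarrow> \<sigma> \<subseteq> \<eta> \<Longrightarrow> set vs \<subseteq> sublattice N \<eta> \<Longrightarrow> int (length vs) = p \<Longrightarrow> wedge vs \<in> F_lower N \<Sigma> p \<sigma>"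
  using exterior_power_subset_F_lower wedge_in_exterior_power by blast

definition delta_chain :: "'a::euclidean_space set \<Rightarrow> 'a multivector \<Rightarrow> 'a set \<Rightarrow> 'a multivector" where
  "delta_chain \<sigma> x = (\<lambda>s. if s = \<sigma> then x else 0)"

lemma delta_chain_mem:
  "x \<in> F_lower N \<Sigma> p \<sigma> \<Longrightarrow> \<sigma> \<in> \<Sigma> \<Longrightarrow> delta_chain \<sigma> x \<in> BM_chains N \<Sigma> p (int (dim \<sigma>))"
  using add_subgroup_zero[OF add_subgroup_F_lower]
  by (auto simp: BM_chains_def delta_chain_def cones_def)

lemma nths_map: "nths (map f xs) I = map f (nths xs I)"
  by (induction xs arbitrary: I) (auto simp: nths_Cons)

locale product_complex =
  fixes N :: "'a::euclidean_space set" and \<Sigma> :: "'a set set" and N' :: "'b::euclidean_space set" and \<Sigma>' :: "'b set set"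
  assumes \<Sigma>: "cone_complex N \<Sigma>" and \<Sigma>': "cone_complex N' \<Sigma>'"
begin

abbreviation "NP \<equiv> N \<times> N'"
abbreviation "\<Sigma>P \<equiv> product_fan \<Sigma> \<Sigma>'"

lemmas \<Sigma>P = cone_complex_Times(1)[OF \<Sigma> \<Sigma>'] and fan_dim_P = cone_complex_Times(2)[OF \<Sigma> \<Sigma>']
lemmas N = cone_complex_lattice[OF \<Sigma>] and N' = cone_complex_lattice[OF \<Sigma>'] and NP = cone_complex_lattice[OF \<Sigma>P]
lemmas fin = cone_complex_finite[OF \<Sigma>] and fin' = cone_complex_finite[OF \<Sigma>'] and finP = cone_complex_finite[OF \<Sigma>P]
lemmas zero = cone_complex_0[OF \<Sigma>] and zero' = cone_complex_0[OF \<Sigma>']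

sublocale tensor_complex "chain_fun N \<Sigma>" "boundary_fun N \<Sigma>" "fan_dim \<Sigma>" chain_degree
    "chain_fun N' \<Sigma>'" "boundary_fun N' \<Sigma>'" "fan_dim \<Sigma>'" chain_degree
  by (intro tensor_complex.intro function_complex_chain_fun \<Sigma> \<Sigma>')

lemma Times_mem_iff: "\<sigma> \<times> \<sigma>' \<in> \<Sigma>P \<longleftrightarrow> \<sigma> \<in> \<Sigma> \<and> \<sigma>' \<in> \<Sigma>'"
proof
  assume "\<sigma> \<times> \<sigma>' \<in> \<Sigma>P"
  then obtain \<eta> \<eta>' where \<eta>: "\<eta> \<in> \<Sigma>" "\<eta>' \<in> \<Sigma>'" "\<sigma> \<times> \<sigma>' = \<eta> \<times> \<eta>'" by (auto simp: product_fan_def)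
  then have "\<eta> \<noteq> {}" "\<eta>' \<noteq> {}" using zero zero' by blast+
  then show "\<sigma> \<in> \<Sigma> \<and> \<sigma>' \<in> \<Sigma>'" using \<eta> by (metis times_eq_iff)
qed (auto simp: product_fan_def)

lemma Times_inject: "\<sigma> \<in> \<Sigma> \<Longrightarrow> \<sigma>' \<in> \<Sigma>' \<Longrightarrow> \<sigma> \<times> \<sigma>' = \<tau> \<times> \<tau>' \<longleftrightarrow> \<sigma> = \<tau> \<and> \<sigma>' = \<tau>'"
  using zero[of \<sigma>] zero'[of \<sigma>'] by (auto simp: times_eq_iff)

lemma dim_P: "\<sigma> \<in> \<Sigma> \<Longrightarrow> \<sigma>' \<in> \<Sigma>' \<Longrightarrow> dim (\<sigma> \<times> \<sigma>') = dim \<sigma> + dim \<sigma>'"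
  by (simp add: dim_Times' zero zero')

abbreviation ps :: "'a set \<Rightarrow> 'b set \<Rightarrow> real" where "ps \<equiv> product_sign N N'"

lemma ps_cases: "\<sigma> \<in> \<Sigma> \<Longrightarrow> \<sigma>' \<in> \<Sigma>' \<Longrightarrow> ps \<sigma> \<sigma>' = 1 \<or> ps \<sigma> \<sigma>' = -1"
  by (rule product_sign_properties(1)[OF N N' zero zero'])

lemma ps_square: "\<sigma> \<in> \<Sigma> \<Longrightarrow> \<sigma>' \<in> \<Sigma>' \<Longrightarrow> ps \<sigma> \<sigma>' * (ps \<sigma> \<sigma>' * x) = x"
  using ps_cases[of \<sigma> \<sigma>'] by auto

lemma orientation_P:
  "\<sigma> \<in> \<Sigma> \<Longrightarrow> \<sigma>' \<in> \<Sigma>' \<Longrightarrow> orientation NP (\<sigma> \<times> \<sigma>') \<theta>s = ps \<sigma> \<sigma>' * wedge (map inl (frame N \<sigma>) @ map inr (frame N' \<sigma>')) \<theta>s"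
  by (rule product_sign_properties(2)[OF N N' zero zero'])

text \<open>The sign compares the chosen orientation of \<open>\<sigma> \<times> \<sigma>'\<close> with the product of the chosen
  orientations of \<open>\<sigma>\<close> and \<open>\<sigma>'\<close>.\<close>

definition \<Psi> :: "(('a \<times> 'b) set \<Rightarrow> ('a \<times> 'b) multivector) \<Rightarrow>
    ('a set \<times> ('a \<Rightarrow> real) list) \<times> ('b set \<times> ('b \<Rightarrow> real) list) \<Rightarrow> real" where
  "\<Psi> c = (\<lambda>((\<sigma>, \<phi>s), (\<sigma>', \<psi>s)). ps \<sigma> \<sigma>' * c (\<sigma> \<times> \<sigma>') (fst_forms \<phi>s @ snd_forms \<psi>s))"

lemma diff_\<Psi>: "diff_op \<Psi>"
  unfolding diff_op_def by (auto simp: \<Psi>_def fun_eq_iff algebra_simps)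

text \<open>The component of \<open>\<Psi>\<close> at a single pair of cones, before the
  sign.\<close>

definition \<Delta> :: "'a set \<Rightarrow> 'b set \<Rightarrow> ('a \<times> 'b) multivector \<Rightarrow>
    ('a set \<times> ('a \<Rightarrow> real) list) \<times> ('b set \<times> ('b \<Rightarrow> real) list) \<Rightarrow> real" where
  "\<Delta> \<sigma> \<sigma>' w = (\<lambda>((s, \<phi>s), (s', \<psi>s)). if s = \<sigma> \<and> s' = \<sigma>' then w (fst_forms \<phi>s @ snd_forms \<psi>s) else 0)"

lemma diff_\<Delta>: "diff_op (\<Delta> \<sigma> \<sigma>')"
  unfolding diff_op_def by (auto simp: \<Delta>_def fun_eq_iff)

lemma sub_P: "\<sigma> \<in> \<Sigma> \<Longrightarrow> \<sigma>' \<in> \<Sigma>' \<Longrightarrow> \<sigma> \<times> \<sigma>' \<subseteq> \<eta> \<times> \<eta>' \<longleftrightarrow> \<sigma> \<subseteq> \<eta> \<and> \<sigma>' \<subseteq> \<eta>'"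
  using zero[of \<sigma>] zero'[of \<sigma>'] by auto

text \<open>After sorting by \<open>wedge_split\<close>, a generator becomes a tensor of two chains,
  each concentrated on one cone.\<close>

lemma \<Delta>_mem:
  assumes \<sigma>: "\<sigma> \<in> \<Sigma>" "\<sigma>' \<in> \<Sigma>'" and w: "w \<in> F_lower NP \<Sigma>P p (\<sigma> \<times> \<sigma>')"
  shows "\<Delta> \<sigma> \<sigma>' w \<in> K p (int (dim \<sigma>) + int (dim \<sigma>'))"
  unfolding K_def
proof (rule F_lower_diff_op[OF w diff_\<Delta> add_subgroup_tensor_group])
  fix T vs assume T: "T \<in> \<Sigma>P" "\<sigma> \<times> \<sigma>' \<subseteq> T" "set vs \<subseteq> sublattice NP T" "int (length vs) = p"
  then obtain \<eta> \<eta>' where \<eta>: "\<eta> \<in> \<Sigma>" "\<eta>' \<in> \<Sigma>'" "T = \<eta> \<times> \<eta>'" by (auto simp: product_fan_def)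
  have vs: "set vs \<subseteq> sublattice N \<eta> \<times> sublattice N' \<eta>'"
    using T(3) \<eta> by (simp add: sublattice_Times zero zero')
  show "\<Delta> \<sigma> \<sigma>' (wedge vs) \<in> tensor_group (chain_fun N \<Sigma>) (chain_fun N' \<Sigma>') p (int (dim \<sigma>) + int (dim \<sigma>'))"
  proof (rule wedge_split[OF diff_\<Delta> add_subgroup_tensor_group vs])
    fix xs ys assume xy: "set xs \<subseteq> sublattice N \<eta>" "set ys \<subseteq> sublattice N' \<eta>'" "length xs + length ys = length vs"
    have sub: "\<sigma> \<subseteq> \<eta>" "\<sigma>' \<subseteq> \<eta>'" using T(2) sub_P[OF \<sigma>] \<eta>(3) by auto
    have "\<Delta> \<sigma> \<sigma>' (wedge (map inl xs @ map inr ys)) =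
        tensor (case_prod (delta_chain \<sigma> (wedge xs))) (case_prod (delta_chain \<sigma>' (wedge ys)))"
      by (auto simp: \<Delta>_def tensor_def delta_chain_def fun_eq_iff wedge_product)
    moreover have "case_prod (delta_chain \<sigma> (wedge xs)) \<in> chain_fun N \<Sigma> (int (length xs)) (int (dim \<sigma>))"
      unfolding chain_fun_def by (intro imageI delta_chain_mem wedge_in_F_lower[OF \<eta>(1) sub(1) xy(1)] \<sigma> refl)
    moreover have "case_prod (delta_chain \<sigma>' (wedge ys)) \<in> chain_fun N' \<Sigma>' (int (length ys)) (int (dim \<sigma>'))"
      unfolding chain_fun_def by (intro imageI delta_chain_mem wedge_in_F_lower[OF \<eta>(2) sub(2) xy(2)] \<sigma> refl)
    ultimately show "\<Delta> \<sigma> \<sigma>' (wedge (map inl xs @ map inr ys)) \<in>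
        tensor_group (chain_fun N \<Sigma>) (chain_fun N' \<Sigma>') p (int (dim \<sigma>) + int (dim \<sigma>'))"
      using xy(3) T(4)
      by (simp only:) (rule tensor_in_tensor_group[where A = "chain_fun N \<Sigma>" and B = "chain_fun N' \<Sigma>'"], auto)
  qed
qed

text \<open>\<open>\<Psi> c\<close> is a finite signed sum of its components
  \<open>\<Delta>\<close>, and a pair of cones of the wrong total dimension contributes 0.\<close>

lemma \<Psi>_mem:
  assumes c: "c \<in> BM_chains NP \<Sigma>P p q"
  shows "\<Psi> c \<in> K p q"
proof -
  let ?t = "\<lambda>\<sigma> \<sigma>'. (\<lambda>z. ps \<sigma> \<sigma>' * \<Delta> \<sigma> \<sigma>' (c (\<sigma> \<times> \<sigma>')) z)"
  have c0: "c (\<sigma> \<times> \<sigma>') = 0" if "\<sigma> \<notin> \<Sigma> \<or> \<sigma>' \<notin> \<Sigma>'" for \<sigma> \<sigma>'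
    using c that Times_mem_iff by (auto simp: BM_chains_def cones_def)
  have "?t \<sigma> \<sigma>' \<in> K p q" if \<sigma>: "\<sigma> \<in> \<Sigma>" "\<sigma>' \<in> \<Sigma>'" for \<sigma> \<sigma>'
  proof (cases "int (dim \<sigma>) + int (dim \<sigma>') = q")
    case True
    then have "\<sigma> \<times> \<sigma>' \<in> cones \<Sigma>P q" using \<sigma> by (simp add: cones_def Times_mem_iff dim_P)
    then have "c (\<sigma> \<times> \<sigma>') \<in> F_lower NP \<Sigma>P p (\<sigma> \<times> \<sigma>')" using c by (simp add: BM_chains_def)
    from \<Delta>_mem[OF \<sigma> this] True have *: "\<Delta> \<sigma> \<sigma>' (c (\<sigma> \<times> \<sigma>')) \<in> K p q" by simp
    from add_subgroup_minus[OF add_subgroup_tensor_group this[unfolded K_def]]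
    have "- \<Delta> \<sigma> \<sigma>' (c (\<sigma> \<times> \<sigma>')) \<in> K p q" by (simp only: K_def)
    then show ?thesis using * ps_cases[OF \<sigma>] by (auto simp: fun_Compl_def)
  next
    case False
    then have "c (\<sigma> \<times> \<sigma>') = 0" using c \<sigma> by (auto simp: BM_chains_def cones_def dim_P)
    then have "?t \<sigma> \<sigma>' = 0" by (auto simp: \<Delta>_def fun_eq_iff)
    then show ?thesis using add_subgroup_zero[OF add_subgroup_tensor_group] unfolding K_def by (simp only:)
  qed
  then have "(\<Sum>\<sigma>\<in>\<Sigma>. \<Sum>\<sigma>'\<in>\<Sigma>'. ?t \<sigma> \<sigma>') \<in> K p q"
    unfolding K_def by (intro add_subgroup_sum[OF add_subgroup_tensor_group])
  moreover have "\<Psi> c = (\<Sum>\<sigma>\<in>\<Sigma>. \<Sum>\<sigma>'\<in>\<Sigma>'. ?t \<sigma> \<sigma>')"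
  proof (intro ext, clarify)
    fix s \<phi>s s' \<psi>s
    have "(\<Sum>\<sigma>\<in>\<Sigma>. \<Sum>\<sigma>'\<in>\<Sigma>'. ?t \<sigma> \<sigma>') ((s, \<phi>s), (s', \<psi>s)) =
        (\<Sum>\<sigma>\<in>\<Sigma>. if s = \<sigma> then (\<Sum>\<sigma>'\<in>\<Sigma>'. if s' = \<sigma>' then ps \<sigma> \<sigma>' * c (\<sigma> \<times> \<sigma>') (fst_forms \<phi>s @ snd_forms \<psi>s) else 0) else 0)"
      by (simp only: sum_fun_apply, intro sum.cong refl) (auto simp: \<Delta>_def intro!: sum.cong)
    also have "\<dots> = \<Psi> c ((s, \<phi>s), (s', \<psi>s))"
      using c0[of s s'] fin fin' by (auto simp: \<Psi>_def)
    finally show "\<Psi> c ((s, \<phi>s), (s', \<psi>s)) = (\<Sum>\<sigma>\<in>\<Sigma>. \<Sum>\<sigma>'\<in>\<Sigma>'. ?t \<sigma> \<sigma>') ((s, \<phi>s), (s', \<psi>s))" by simp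
  qed
  ultimately show ?thesis by (simp only:)
qed

text \<open>The cross product of multivectors is obtained by existence only: for fixed
  \<open>y\<close>, the \<open>x\<close> that admit a partner form a subgroup, and likewise with the
  roles exchanged, so wedges on both sides suffice.\<close>

lemma cross_exists:
  assumes \<sigma>: "\<sigma> \<in> \<Sigma>" "\<sigma>' \<in> \<Sigma>'" and x: "x \<in> F_lower N \<Sigma> a \<sigma>" and y: "y \<in> F_lower N' \<Sigma>' b \<sigma>'"
  shows "\<exists>w\<in>F_lower NP \<Sigma>P (a + b) (\<sigma> \<times> \<sigma>'). \<forall>\<phi>s \<psi>s. w (fst_forms \<phi>s @ snd_forms \<psi>s) = x \<phi>s * y \<psi>s"
proof -
  let ?G = "F_lower NP \<Sigma>P (a + b) (\<sigma> \<times> \<sigma>')"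
  let ?R = "\<lambda>x y. \<exists>w\<in>?G. \<forall>\<phi>s \<psi>s. w (fst_forms \<phi>s @ snd_forms \<psi>s) = x \<phi>s * y \<psi>s"
  have zero_l: "?R 0 y" and zero_r: "?R x 0" for x y
    using add_subgroup_zero[OF add_subgroup_F_lower[of NP \<Sigma>P "a + b" "\<sigma> \<times> \<sigma>'"]] by (auto intro!: bexI[of _ 0])
  have diff_l: "?R (x - x') y" if "?R x y" "?R x' y" for x x' y
  proof -
    obtain w w' where "w \<in> ?G" "w' \<in> ?G" "\<And>\<phi>s \<psi>s. w (fst_forms \<phi>s @ snd_forms \<psi>s) = x \<phi>s * y \<psi>s"
      "\<And>\<phi>s \<psi>s. w' (fst_forms \<phi>s @ snd_forms \<psi>s) = x' \<phi>s * y \<psi>s" using \<open>?R x y\<close> \<open>?R x' y\<close> by blast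
    then show ?thesis
      by (intro bexI[of _ "w - w'"]) (auto simp: left_diff_distrib intro: add_subgroup_diff[OF add_subgroup_F_lower])
  qed
  have diff_r: "?R x (y - y')" if "?R x y" "?R x y'" for x y y'
  proof -
    obtain w w' where "w \<in> ?G" "w' \<in> ?G" "\<And>\<phi>s \<psi>s. w (fst_forms \<phi>s @ snd_forms \<psi>s) = x \<phi>s * y \<psi>s"
      "\<And>\<phi>s \<psi>s. w' (fst_forms \<phi>s @ snd_forms \<psi>s) = x \<phi>s * y' \<psi>s" using \<open>?R x y\<close> \<open>?R x y'\<close> by blast
    then show ?thesis
      by (intro bexI[of _ "w - w'"]) (auto simp: right_diff_distrib intro: add_subgroup_diff[OF add_subgroup_F_lower])
  qed
  have sub_l: "add_subgroup {x. ?R x y}" for y unfolding add_subgroup_def using zero_l diff_l by blast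
  have sub_r: "add_subgroup {y. ?R x y}" for x unfolding add_subgroup_def using zero_r diff_r by blast
  have "x \<in> {x. ?R x y}"
  proof (rule F_lower_diff_op[OF x diff_op_id sub_l])
    fix \<eta> xs assume \<eta>: "\<eta> \<in> \<Sigma>" "\<sigma> \<subseteq> \<eta>" "set xs \<subseteq> sublattice N \<eta>" "int (length xs) = a"
    have "y \<in> {y. ?R (wedge xs) y}"
    proof (rule F_lower_diff_op[OF y diff_op_id sub_r])
      fix \<eta>' ys assume \<eta>': "\<eta>' \<in> \<Sigma>'" "\<sigma>' \<subseteq> \<eta>'" "set ys \<subseteq> sublattice N' \<eta>'" "int (length ys) = b"
      have "set (map inl xs @ map inr ys) \<subseteq> sublattice NP (\<eta> \<times> \<eta>')"
        using \<eta>(3) \<eta>'(3) add_subgroup_zero[OF add_subgroup_sublattice[OF N, of \<eta>]]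
          add_subgroup_zero[OF add_subgroup_sublattice[OF N', of \<eta>']]
        by (auto simp: sublattice_Times[OF zero[OF \<eta>(1)] zero'[OF \<eta>'(1)]])
      then have "wedge (map inl xs @ map inr ys) \<in> ?G"
        using \<eta> \<eta>' sub_P[OF \<sigma>] by (intro wedge_in_F_lower[of "\<eta> \<times> \<eta>'"]) (auto simp: Times_mem_iff)
      then show "wedge ys \<in> {y. ?R (wedge xs) y}" using wedge_product by blast
    qed
    then show "wedge xs \<in> {x. ?R x y}" by simp
  qed
  then show ?thesis by simp
qed

lemma \<Psi>_surj:
  assumes "w \<in> K p q"
  shows "\<exists>c\<in>BM_chains NP \<Sigma>P p q. \<Psi> c = w"
proof -
  have H: "add_subgroup (\<Psi> ` BM_chains NP \<Sigma>P p q)"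
    by (rule add_subgroup_image[OF add_subgroup_BM_chains]) (rule diff_opD[OF diff_\<Psi>])
  have "w \<in> \<Psi> ` BM_chains NP \<Sigma>P p q"
    using assms unfolding K_def
  proof (rule tensor_group_diff_op[OF _ diff_op_id H])
    fix a b p1 p2 q1 q2
    assume ab: "a \<in> chain_fun N \<Sigma> p1 q1" "b \<in> chain_fun N' \<Sigma>' p2 q2" and pq: "p1 + p2 = p" "q1 + q2 = q"
    obtain x where x: "x \<in> BM_chains N \<Sigma> p1 q1" "a = case_prod x" using ab(1) by (auto simp: chain_fun_def)
    obtain y where y: "y \<in> BM_chains N' \<Sigma>' p2 q2" "b = case_prod y" using ab(2) by (auto simp: chain_fun_def)
    have "\<forall>\<sigma>\<in>cones \<Sigma> q1. \<forall>\<sigma>'\<in>cones \<Sigma>' q2. \<exists>w\<in>F_lower NP \<Sigma>P p (\<sigma> \<times> \<sigma>').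
        \<forall>\<phi>s \<psi>s. w (fst_forms \<phi>s @ snd_forms \<psi>s) = x \<sigma> \<phi>s * y \<sigma>' \<psi>s"
    proof (intro ballI)
      fix \<sigma> \<sigma>' assume "\<sigma> \<in> cones \<Sigma> q1" "\<sigma>' \<in> cones \<Sigma>' q2"
      then show "\<exists>w\<in>F_lower NP \<Sigma>P p (\<sigma> \<times> \<sigma>'). \<forall>\<phi>s \<psi>s. w (fst_forms \<phi>s @ snd_forms \<psi>s) = x \<sigma> \<phi>s * y \<sigma>' \<psi>s"
        using cross_exists[of \<sigma> \<sigma>' "x \<sigma>" p1 "y \<sigma>'" p2] x(1) y(1) pq by (auto simp: BM_chains_def cones_def)
    qed
    then obtain w where w: "\<And>\<sigma> \<sigma>'. \<sigma> \<in> cones \<Sigma> q1 \<Longrightarrow> \<sigma>' \<in> cones \<Sigma>' q2 \<Longrightarrow> w \<sigma> \<sigma>' \<in> F_lower NP \<Sigma>P p (\<sigma> \<times> \<sigma>') \<and>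
        (\<forall>\<phi>s \<psi>s. w \<sigma> \<sigma>' (fst_forms \<phi>s @ snd_forms \<psi>s) = x \<sigma> \<phi>s * y \<sigma>' \<psi>s)" by metis
    \<comment> \<open>The factors of a product cone are recovered as its projections; the guard
      excludes sets that are not products.\<close>
    define c where "c T = (if fst ` T \<in> cones \<Sigma> q1 \<and> snd ` T \<in> cones \<Sigma>' q2 \<and> T = fst ` T \<times> snd ` T
      then (\<lambda>\<theta>s. ps (fst ` T) (snd ` T) * w (fst ` T) (snd ` T) \<theta>s) else 0)" for T
    have proj: "fst ` (\<sigma> \<times> \<sigma>') = \<sigma>" "snd ` (\<sigma> \<times> \<sigma>') = \<sigma>'" if "\<sigma> \<in> \<Sigma>" "\<sigma>' \<in> \<Sigma>'" for \<sigma> \<sigma>'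
      using zero[OF that(1)] zero'[OF that(2)] by (auto simp: image_iff)
    have "c \<in> BM_chains NP \<Sigma>P p q"
      unfolding BM_chains_def
    proof (intro CollectI conjI ballI allI impI)
      fix T assume "T \<in> cones \<Sigma>P q"
      show "c T \<in> F_lower NP \<Sigma>P p T"
      proof (cases "fst ` T \<in> cones \<Sigma> q1 \<and> snd ` T \<in> cones \<Sigma>' q2 \<and> T = fst ` T \<times> snd ` T")
        case True
        then have "w (fst ` T) (snd ` T) \<in> F_lower NP \<Sigma>P p T" using w[of "fst ` T" "snd ` T"] by simp
        from this add_subgroup_minus[OF add_subgroup_F_lower this] show ?thesis
          using True ps_cases[of "fst ` T" "snd ` T"] by (auto simp: c_def cones_def fun_Compl_def)
      next
        case False
        then have "c T = 0" unfolding c_def by (rule if_not_P)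
        then show ?thesis using add_subgroup_zero[OF add_subgroup_F_lower] by (simp only:)
      qed
    next
      fix T assume T: "T \<notin> cones \<Sigma>P q"
      have "\<not> (fst ` T \<in> cones \<Sigma> q1 \<and> snd ` T \<in> cones \<Sigma>' q2 \<and> T = fst ` T \<times> snd ` T)"
      proof
        assume a: "fst ` T \<in> cones \<Sigma> q1 \<and> snd ` T \<in> cones \<Sigma>' q2 \<and> T = fst ` T \<times> snd ` T"
        then obtain \<sigma> \<sigma>' where m: "\<sigma> \<in> cones \<Sigma> q1" "\<sigma>' \<in> cones \<Sigma>' q2" "T = \<sigma> \<times> \<sigma>'" by blast
        then have "T \<in> cones \<Sigma>P q" using pq by (simp add: cones_def Times_mem_iff dim_P)
        then show False using T by simp
      qed
      then show "c T = 0" unfolding c_def by (rule if_not_P)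
    qed
    moreover have "\<Psi> c = tensor a b"
    proof (intro ext, clarify)
      fix \<sigma> \<phi>s \<sigma>' \<psi>s
      show "\<Psi> c ((\<sigma>, \<phi>s), (\<sigma>', \<psi>s)) = tensor a b ((\<sigma>, \<phi>s), (\<sigma>', \<psi>s))"
      proof (cases "\<sigma> \<in> cones \<Sigma> q1 \<and> \<sigma>' \<in> cones \<Sigma>' q2")
        case True
        then have m: "\<sigma> \<in> \<Sigma>" "\<sigma>' \<in> \<Sigma>'" by (auto simp: cones_def)
        have "c (\<sigma> \<times> \<sigma>') = (\<lambda>\<theta>s. ps \<sigma> \<sigma>' * w \<sigma> \<sigma>' \<theta>s)"
          unfolding c_def proj[OF m] using True by simp
        then have "\<Psi> c ((\<sigma>, \<phi>s), (\<sigma>', \<psi>s)) = w \<sigma> \<sigma>' (fst_forms \<phi>s @ snd_forms \<psi>s)"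
          using ps_square[OF m] by (simp add: \<Psi>_def)
        then show ?thesis using True w[of \<sigma> \<sigma>'] by (simp add: tensor_def x y)
      next
        case False
        have "c (\<sigma> \<times> \<sigma>') = 0"
        proof (rule ccontr)
          assume "c (\<sigma> \<times> \<sigma>') \<noteq> 0"
          then have a: "fst ` (\<sigma> \<times> \<sigma>') \<in> cones \<Sigma> q1" "snd ` (\<sigma> \<times> \<sigma>') \<in> cones \<Sigma>' q2"
            by (auto simp: c_def split: if_splits)
          \<comment> \<open>The projections of a product return its factors only if neither factor
            is empty, which holds here because cones contain 0.\<close>
          have "0 \<in> fst ` (\<sigma> \<times> \<sigma>')" using a(1) by (intro zero) (simp only: cones_def mem_Collect_eq)
          then have "\<sigma> \<noteq> {}" "\<sigma>' \<noteq> {}" by auto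
          then have "fst ` (\<sigma> \<times> \<sigma>') = \<sigma>" "snd ` (\<sigma> \<times> \<sigma>') = \<sigma>'" by simp_all
          then show False using a False by simp
        qed
        moreover have "x \<sigma> = 0 \<or> y \<sigma>' = 0" using False x(1) y(1) by (auto simp: BM_chains_def)
        ultimately show ?thesis by (auto simp: \<Psi>_def tensor_def x y)
      qed
    qed
    ultimately show "tensor a b \<in> \<Psi> ` BM_chains NP \<Sigma>P p q" by (metis imageI)
  qed
  then show ?thesis by blast
qed

text \<open>Multivectors are determined on sublists of the dual basis of the product lattice, and
  each such sublist consists of forms from the first factor followed by forms from the
  second.\<close>

lemma \<Psi>_inj:
  assumes c: "c \<in> BM_chains NP \<Sigma>P p q" and z: "\<Psi> c = 0"
  shows "c = 0"
proof
  fix T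
  show "c T = 0 T"
  proof (cases "T \<in> cones \<Sigma>P q")
    case True
    then obtain \<sigma> \<sigma>' where T: "\<sigma> \<in> \<Sigma>" "\<sigma>' \<in> \<Sigma>'" "T = \<sigma> \<times> \<sigma>'" by (auto simp: cones_def product_fan_def)
    obtain bs where bs: "lattice_basis bs N" using N by (auto simp: lattice_subgroup_def)
    obtain Ls where Ls: "dual_lists bs Ls" by (rule lattice_basis_dual[OF bs])
    obtain bs' where bs': "lattice_basis bs' N'" using N' by (auto simp: lattice_subgroup_def)
    obtain Ls' where Ls': "dual_lists bs' Ls'" by (rule lattice_basis_dual[OF bs'])
    note B = lattice_basis_Times[OF bs bs'] and L = dual_lists_Times[OF Ls Ls']
    have "c T \<in> F_lower NP \<Sigma>P p T" using c True by (simp add: BM_chains_def)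
    then have e: "c T \<in> exterior_power p (group_closure (set (map inl bs @ map inr bs')))"
      using F_lower_subset_exterior_power[of NP \<Sigma>P p T] B by (auto simp: lattice_basis_def)
    have "c T = 0"
    proof (rule exterior_power_eq_0I[OF L e])
      fix I
      have n: "nths (fst_forms Ls @ snd_forms Ls') I =
          (fst_forms (nths Ls I) @ snd_forms (nths Ls' {j. j + length Ls \<in> I}) :: ('a \<times> 'b \<Rightarrow> real) list)"
        by (simp add: nths_append nths_map)
      have "ps \<sigma> \<sigma>' * c T (fst_forms (nths Ls I) @ snd_forms (nths Ls' {j. j + length Ls \<in> I})) = 0"
        using fun_cong[OF z, of "((\<sigma>, nths Ls I), (\<sigma>', nths Ls' {j. j + length Ls \<in> I}))"] T(3) by (simp add: \<Psi>_def)
      then show "c T (nths (fst_forms Ls @ snd_forms Ls') I) = 0"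
        unfolding n using ps_cases[OF T(1,2)] by auto
    qed
    then show ?thesis by simp
  next
    case False
    then show ?thesis using c by (simp add: BM_chains_def)
  qed
qed

lemma sum_\<Sigma>P: "(\<Sum>T\<in>\<Sigma>P. f T) = (\<Sum>\<sigma>\<in>\<Sigma>. \<Sum>\<sigma>'\<in>\<Sigma>'. f (\<sigma> \<times> \<sigma>'))"
proof -
  have "inj_on (\<lambda>(\<sigma>, \<sigma>'). \<sigma> \<times> \<sigma>') (\<Sigma> \<times> \<Sigma>')" by (auto simp: inj_on_def Times_inject)
  then show ?thesis unfolding product_fan_def by (subst sum.reindex) (auto simp: sum.cartesian_product intro!: sum.cong)
qed

text \<open>In \<open>incidence_Times\<close> the sign of the smaller cone meets the one in
  \<open>\<Psi>\<close> and squares to 1, the sign of the larger cone becomes the one inside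
  \<open>\<Psi> c\<close>, and the equality conditions collapse the double sum to the two terms of
  D.\<close>

lemma D_\<Psi>:
  assumes c: "c \<in> BM_chains NP \<Sigma>P p q"
  shows "D (\<Psi> c) = \<Psi> (boundary NP \<Sigma>P c)"
proof (intro ext, clarify)
  fix \<tau> \<phi>s \<tau>' \<psi>s
  let ?\<theta> = "fst_forms \<phi>s @ snd_forms \<psi>s :: ('a \<times> 'b \<Rightarrow> real) list"
  have c0: "c (\<sigma> \<times> \<sigma>') = 0" if "\<sigma> \<notin> \<Sigma> \<or> \<sigma>' \<notin> \<Sigma>'" for \<sigma> \<sigma>'
    using c that Times_mem_iff by (auto simp: BM_chains_def cones_def)
  have sg: "parity_sign (int n) = (-1) ^ n" for n by (simp add: parity_sign_def)
  have D: "D (\<Psi> c) ((\<tau>, \<phi>s), (\<tau>', \<psi>s)) =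
      (\<Sum>\<sigma>\<in>\<Sigma>. incidence N \<Sigma> \<tau> \<sigma> * (ps \<sigma> \<tau>' * c (\<sigma> \<times> \<tau>') ?\<theta>)) +
      (-1) ^ dim \<tau> * (\<Sum>\<sigma>'\<in>\<Sigma>'. incidence N' \<Sigma>' \<tau>' \<sigma>' * (ps \<tau> \<sigma>' * c (\<tau> \<times> \<sigma>') ?\<theta>))"
    unfolding D_def by (simp add: boundary_fun_def \<Psi>_def chain_degree_def sg)
  have B: "\<Psi> (boundary NP \<Sigma>P c) ((\<tau>, \<phi>s), (\<tau>', \<psi>s)) =
      ps \<tau> \<tau>' * (\<Sum>\<sigma>\<in>\<Sigma>. \<Sum>\<sigma>'\<in>\<Sigma>'. incidence NP \<Sigma>P (\<tau> \<times> \<tau>') (\<sigma> \<times> \<sigma>') * c (\<sigma> \<times> \<sigma>') ?\<theta>)"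
    by (simp add: \<Psi>_def boundary_def sum_\<Sigma>P)
  show "D (\<Psi> c) ((\<tau>, \<phi>s), (\<tau>', \<psi>s)) = \<Psi> (boundary NP \<Sigma>P c) ((\<tau>, \<phi>s), (\<tau>', \<psi>s))"
  proof (cases "\<tau> \<in> \<Sigma> \<and> \<tau>' \<in> \<Sigma>'")
    case False
    have "incidence N \<Sigma> \<tau> \<sigma> * (ps \<sigma> \<tau>' * c (\<sigma> \<times> \<tau>') ?\<theta>) = 0" for \<sigma>
      using False c0[of \<sigma> \<tau>'] by (auto simp: incidence_def)
    moreover have "incidence N' \<Sigma>' \<tau>' \<sigma>' * (ps \<tau> \<sigma>' * c (\<tau> \<times> \<sigma>') ?\<theta>) = 0" for \<sigma>'
      using False c0[of \<tau> \<sigma>'] by (auto simp: incidence_def)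
    moreover have "incidence NP \<Sigma>P (\<tau> \<times> \<tau>') T = 0" for T
      using False by (auto simp: incidence_def Times_mem_iff)
    ultimately show ?thesis unfolding D B by (simp only: sum.neutral_const mult_zero_left mult_zero_right add_0)
  next
    case True
    have "\<Psi> (boundary NP \<Sigma>P c) ((\<tau>, \<phi>s), (\<tau>', \<psi>s)) =
      (\<Sum>\<sigma>\<in>\<Sigma>. \<Sum>\<sigma>'\<in>\<Sigma>'. (if \<tau>' = \<sigma>' then incidence N \<Sigma> \<tau> \<sigma> * (ps \<sigma> \<sigma>' * c (\<sigma> \<times> \<sigma>') ?\<theta>) else 0) +
        (if \<tau> = \<sigma> then (-1) ^ dim \<sigma> * (incidence N' \<Sigma>' \<tau>' \<sigma>' * (ps \<sigma> \<sigma>' * c (\<sigma> \<times> \<sigma>') ?\<theta>)) else 0))"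
      unfolding B sum_distrib_left
    proof (intro sum.cong refl)
      fix \<sigma> \<sigma>' assume m: "\<sigma> \<in> \<Sigma>" "\<sigma>' \<in> \<Sigma>'"
      have "ps \<tau> \<tau>' * (incidence NP \<Sigma>P (\<tau> \<times> \<tau>') (\<sigma> \<times> \<sigma>') * c (\<sigma> \<times> \<sigma>') ?\<theta>) =
          ps \<tau> \<tau>' * (ps \<tau> \<tau>' * (ps \<sigma> \<sigma>' * ((if \<tau>' = \<sigma>' then incidence N \<Sigma> \<tau> \<sigma> else 0) +
            (if \<tau> = \<sigma> then (-1) ^ dim \<sigma> * incidence N' \<Sigma>' \<tau>' \<sigma>' else 0)) * c (\<sigma> \<times> \<sigma>') ?\<theta>))"
        using incidence_Times[OF \<Sigma> \<Sigma>'] True m by (simp only: mult.assoc)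
      also have "\<dots> = ps \<sigma> \<sigma>' * ((if \<tau>' = \<sigma>' then incidence N \<Sigma> \<tau> \<sigma> else 0) +
            (if \<tau> = \<sigma> then (-1) ^ dim \<sigma> * incidence N' \<Sigma>' \<tau>' \<sigma>' else 0)) * c (\<sigma> \<times> \<sigma>') ?\<theta>"
        using ps_square True by blast
      finally show "ps \<tau> \<tau>' * (incidence NP \<Sigma>P (\<tau> \<times> \<tau>') (\<sigma> \<times> \<sigma>') * c (\<sigma> \<times> \<sigma>') ?\<theta>) =
        (if \<tau>' = \<sigma>' then incidence N \<Sigma> \<tau> \<sigma> * (ps \<sigma> \<sigma>' * c (\<sigma> \<times> \<sigma>') ?\<theta>) else 0) +
        (if \<tau> = \<sigma> then (-1) ^ dim \<sigma> * (incidence N' \<Sigma>' \<tau>' \<sigma>' * (ps \<sigma> \<sigma>' * c (\<sigma> \<times> \<sigma>') ?\<theta>)) else 0)"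
        by (simp add: algebra_simps)
    qed
    also have "\<dots> = (\<Sum>\<sigma>\<in>\<Sigma>. incidence N \<Sigma> \<tau> \<sigma> * (ps \<sigma> \<tau>' * c (\<sigma> \<times> \<tau>') ?\<theta>)) +
        (\<Sum>\<sigma>\<in>\<Sigma>. if \<tau> = \<sigma> then (\<Sum>\<sigma>'\<in>\<Sigma>'. (-1) ^ dim \<sigma> * (incidence N' \<Sigma>' \<tau>' \<sigma>' * (ps \<sigma> \<sigma>' * c (\<sigma> \<times> \<sigma>') ?\<theta>))) else 0)"
      unfolding sum.distrib
    proof (intro arg_cong2[where f = "(+)"] sum.cong refl)
      fix \<sigma>
      show "(\<Sum>\<sigma>'\<in>\<Sigma>'. if \<tau>' = \<sigma>' then incidence N \<Sigma> \<tau> \<sigma> * (ps \<sigma> \<sigma>' * c (\<sigma> \<times> \<sigma>') ?\<theta>) else 0) =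
          incidence N \<Sigma> \<tau> \<sigma> * (ps \<sigma> \<tau>' * c (\<sigma> \<times> \<tau>') ?\<theta>)"
        using True fin' by simp
    qed simp
    also have "\<dots> = D (\<Psi> c) ((\<tau>, \<phi>s), (\<tau>', \<psi>s))"
      unfolding D using True fin by (simp add: sum_distrib_left)
    finally show ?thesis by simp
  qed
qed

end

section \<open>The fundamental class\<close>

definition fundamental_chain :: "'a::euclidean_space set \<Rightarrow> 'a set set \<Rightarrow> 'a set \<Rightarrow> 'a multivector" where
  "fundamental_chain N \<Sigma> = (\<lambda>\<sigma>. if \<sigma> \<in> cones \<Sigma> (fan_dim \<Sigma>) then orientation N \<sigma> else 0)"

lemma mv_scale_int_mem: "add_subgroup H \<Longrightarrow> x \<in> H \<Longrightarrow> r \<in> \<int> \<Longrightarrow> mv_scale r x \<in> H"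
  unfolding mv_scale_def by (auto elim!: Ints_cases intro: real_fun.add_subgroup_scale_int)

lemma contract_mem:
  assumes "set vs \<subseteq> M" "\<And>l v. l \<in> set ls \<Longrightarrow> v \<in> set vs \<Longrightarrow> l v \<in> \<int>"
  shows "contract ls vs \<in> exterior_power (int (length vs) - int (length ls)) M"
  using assms
proof (induction ls arbitrary: vs)
  case Nil
  then show ?case by (simp add: wedge_in_exterior_power)
next
  case (Cons l ls)
  have "mv_scale ((-1) ^ i * l (vs ! i)) (contract ls (remove_nth i vs)) \<in>
      exterior_power (int (length vs) - int (length (l # ls))) M" if i: "i < length vs" for i
  proof (rule mv_scale_int_mem[OF add_subgroup_exterior_power])
    have sub: "set (remove_nth i vs) \<subseteq> set vs" by (rule set_remove_nth_subset)
    have "contract ls (remove_nth i vs) \<in> exterior_power (int (length (remove_nth i vs)) - int (length ls)) M"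
      by (rule Cons.IH) (use sub Cons.prems in auto)
    moreover have "int (length (remove_nth i vs)) - int (length ls) = int (length vs) - int (length (l # ls))"
      using i by (simp add: length_remove_nth of_nat_diff)
    ultimately show "contract ls (remove_nth i vs) \<in> exterior_power (int (length vs) - int (length (l # ls))) M" by simp
    show "(-1) ^ i * l (vs ! i) \<in> \<int>" using Cons.prems(2) i by (intro Ints_mult) (auto simp: Ints_power)
  qed
  then show ?case
    by (simp only: contract.simps flip: remove_nth_def) (rule add_subgroup_sum[OF add_subgroup_exterior_power], simp)
qed

lemma contract_orientation_mem:
  assumes N: "lattice_subgroup N" and \<sigma>: "rational_cone N \<sigma>"
  shows "contract_orientation N p \<alpha> \<sigma> \<in> exterior_power (int (dim \<sigma>) - p) (sublattice N \<sigma>)"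
  unfolding contract_orientation_def Let_def
proof (rule add_subgroup_sum[OF add_subgroup_exterior_power])
  let ?bs = "frame N \<sigma>"
  note b = lattice_basis_frame[OF N, of \<sigma>]
  obtain Ls where d: "dual_lists ?bs Ls" by (rule lattice_basis_dual[OF b])
  fix I assume I: "I \<in> {I. I \<subseteq> {..<length ?bs} \<and> int (card I) = p}"
  have len: "length (dual_frame ?bs) = length ?bs" by (simp add: dual_frame_def)
  have "contract (nths (dual_frame ?bs) I) ?bs \<in>
      exterior_power (int (length ?bs) - int (length (nths (dual_frame ?bs) I))) (sublattice N \<sigma>)"
  proof (rule contract_mem[OF set_frame_subset[OF N]])
    fix l v assume l: "l \<in> set (nths (dual_frame ?bs) I)" and v: "v \<in> set ?bs"
    then obtain i where i: "i < length ?bs" "l = dual_frame ?bs ! i"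
      using set_nths_subset[of "dual_frame ?bs" I] len by (metis in_set_conv_nth subsetD)
    have "v \<in> span (set ?bs)" "v \<in> group_closure (set ?bs)"
      using v by (auto intro: span_base group_closure.base)
    then show "l v \<in> \<int>" using dual_frame_eq[OF b d i(1)] dual_lists_Ints[OF d _ i(1)] i(2) by simp
  qed
  moreover have "int (length ?bs) - int (length (nths (dual_frame ?bs) I)) = int (dim \<sigma>) - p"
    using I len by (simp add: length_frame[OF N \<sigma>] length_nths_lessThan)
  ultimately show "mv_scale (of_int (\<alpha> (wedge (nths ?bs I)))) (contract (nths (dual_frame ?bs) I) ?bs)
      \<in> exterior_power (int (dim \<sigma>) - p) (sublattice N \<sigma>)"
    by (intro mv_scale_int_mem[OF add_subgroup_exterior_power]) simp_all
qed

lemma cap_chain_mem: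
  assumes \<Sigma>: "cone_complex N \<Sigma>"
  shows "cap_chain N \<Sigma> p \<alpha> \<in> BM_chains N \<Sigma> (fan_dim \<Sigma> - p) (fan_dim \<Sigma>)"
  unfolding BM_chains_def
proof (intro CollectI conjI ballI allI impI)
  fix \<sigma> assume \<sigma>: "\<sigma> \<in> cones \<Sigma> (fan_dim \<Sigma>)"
  then have m: "\<sigma> \<in> \<Sigma>" and d: "int (dim \<sigma>) = fan_dim \<Sigma>" by (auto simp: cones_def)
  have "contract_orientation N p \<alpha> \<sigma> \<in> exterior_power (fan_dim \<Sigma> - p) (sublattice N \<sigma>)"
    using contract_orientation_mem[OF cone_complex_lattice[OF \<Sigma>] cone_complex_rational[OF \<Sigma> m], of p \<alpha>] d by simp
  then have "contract_orientation N p \<alpha> \<sigma> \<in> F_lower N \<Sigma> (fan_dim \<Sigma> - p) \<sigma>"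
    using exterior_power_subset_F_lower[OF m order_refl] by blast
  then show "cap_chain N \<Sigma> p \<alpha> \<sigma> \<in> F_lower N \<Sigma> (fan_dim \<Sigma> - p) \<sigma>" using \<sigma> by (simp add: cap_chain_def)
qed (simp add: cap_chain_def)

text \<open>Capping is a fixed combination of slot fillings applied to the fundamental chain,
  uniformly in the cone.\<close>

lemma cap_chain_evaluation:
  assumes \<Sigma>: "cone_complex N \<Sigma>"
    and \<theta>: "\<And>k. k \<in> K \<Longrightarrow> int (length (\<theta> k)) = p \<and> (\<forall>L\<in>set (\<theta> k). linear L)"
    and \<alpha>: "\<And>x. x \<in> F_lower N \<Sigma> p {0} \<Longrightarrow> of_int (\<alpha> x) = (\<Sum>k\<in>K. c k * x (\<theta> k))"
  shows "cap_chain N \<Sigma> p \<alpha> \<sigma> \<phi>s = (\<Sum>k\<in>K. c k * fundamental_chain N \<Sigma> \<sigma> (\<theta> k @ \<phi>s))"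
proof (cases "\<sigma> \<in> cones \<Sigma> (fan_dim \<Sigma>)")
  case True
  then have m: "\<sigma> \<in> \<Sigma>" by (simp add: cones_def)
  have "contract_orientation N p \<alpha> \<sigma> \<phi>s = (\<Sum>k\<in>K. c k * orientation N \<sigma> (\<theta> k @ \<phi>s))"
    by (rule contract_orientation_evaluation[OF cone_complex_lattice[OF \<Sigma>] \<theta>])
       (use \<alpha> cone_complex_exterior_power_F_lower[OF \<Sigma> m] in auto)
  then show ?thesis using True by (simp add: cap_chain_def fundamental_chain_def)
qed (simp add: cap_chain_def fundamental_chain_def)

text \<open>The boundary acts on the cone variable only and so commutes with filling slots of
  forms.\<close>

lemma cap_chain_cycle:
  assumes \<Sigma>: "cone_complex N \<Sigma>" and \<nu>: "boundary N \<Sigma> (fundamental_chain N \<Sigma>) = 0"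
    and \<alpha>: "\<alpha> \<in> F_upper N \<Sigma> p {0}"
  shows "cap_chain N \<Sigma> p \<alpha> \<in> BM_cycles N \<Sigma> (fan_dim \<Sigma> - p) (fan_dim \<Sigma>)"
proof -
  obtain bs where bs: "lattice_basis bs N" using cone_complex_lattice[OF \<Sigma>] by (auto simp: lattice_subgroup_def)
  obtain Ls where Ls: "dual_lists bs Ls" by (rule lattice_basis_dual[OF bs])
  let ?I = "{I. I \<subseteq> {..<length bs} \<and> int (card I) = p}"
  obtain c where c: "\<And>x. x \<in> F_lower N \<Sigma> p {0} \<Longrightarrow> of_int (\<alpha> x) = (\<Sum>I\<in>?I. c I * x (nths Ls I))"
    by (rule F_upper_evaluation[OF \<alpha> bs Ls]) (rule that)
  have cap: "cap_chain N \<Sigma> p \<alpha> \<sigma> \<phi>s = (\<Sum>I\<in>?I. c I * fundamental_chain N \<Sigma> \<sigma> (nths Ls I @ \<phi>s))" for \<sigma> \<phi>s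
    by (rule cap_chain_evaluation[where \<theta> = "nths Ls" and c = c and K = ?I and \<alpha> = \<alpha>, OF \<Sigma>])
       (use nths_evaluation_points[OF Ls] c in auto)
  have "boundary N \<Sigma> (cap_chain N \<Sigma> p \<alpha>) \<tau> \<phi>s = 0" for \<tau> \<phi>s
  proof -
    have "boundary N \<Sigma> (cap_chain N \<Sigma> p \<alpha>) \<tau> \<phi>s =
        (\<Sum>I\<in>?I. c I * boundary N \<Sigma> (fundamental_chain N \<Sigma>) \<tau> (nths Ls I @ \<phi>s))"
      unfolding boundary_def cap sum_distrib_left by (subst sum.swap) (simp add: mult_ac)
    then show ?thesis by (simp add: \<nu>)
  qed
  then have "boundary N \<Sigma> (cap_chain N \<Sigma> p \<alpha>) = 0" by (simp add: fun_eq_iff)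
  then show ?thesis using cap_chain_mem[OF \<Sigma>] by (simp add: BM_cycles_eq[OF cone_complex_finite[OF \<Sigma>]])
qed

text \<open>The functional is evaluation at the empty list, the unit in degree 0, which fills no
  slot. The floor merely changes the type of an integral value.\<close>

lemma fundamental_chain_eq_cap:
  assumes \<Sigma>: "cone_complex N \<Sigma>"
  obtains \<alpha> where "\<alpha> \<in> F_upper N \<Sigma> 0 {0}" "cap_chain N \<Sigma> 0 \<alpha> = fundamental_chain N \<Sigma>"
proof -
  define \<alpha> where "\<alpha> x = (if x \<in> F_lower N \<Sigma> 0 {0} then \<lfloor>x []\<rfloor> else 0)" for x
  have int: "x [] \<in> \<int>" if "x \<in> F_lower N \<Sigma> 0 {0}" for x
    using that F_lower_subset_exterior_power[of N \<Sigma> 0 "{0}"] by (auto intro: exterior_power_Ints)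
  then have eq: "of_int (\<alpha> x) = (\<Sum>k\<in>{()}. 1 * x [])" if "x \<in> F_lower N \<Sigma> 0 {0}" for x
    using that by (simp add: \<alpha>_def)
  have "\<alpha> \<in> F_upper N \<Sigma> 0 {0}"
    unfolding F_upper_def
  proof (rule int_dualI)
    fix x y assume xy: "x \<in> F_lower N \<Sigma> 0 {0}" "y \<in> F_lower N \<Sigma> 0 {0}"
    have "real_of_int (\<alpha> (x + y)) = of_int (\<alpha> x + \<alpha> y)"
      using eq[OF xy(1)] eq[OF xy(2)] eq[OF add_subgroup_add[OF add_subgroup_F_lower xy]] by simp
    then show "\<alpha> (x + y) = \<alpha> x + \<alpha> y" by (simp only: of_int_eq_iff)
  qed (simp add: \<alpha>_def)
  moreover have "cap_chain N \<Sigma> 0 \<alpha> = fundamental_chain N \<Sigma>"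
  proof (intro ext)
    fix \<sigma> \<phi>s
    have "cap_chain N \<Sigma> 0 \<alpha> \<sigma> \<phi>s = (\<Sum>k\<in>{()}. 1 * fundamental_chain N \<Sigma> \<sigma> ([] @ \<phi>s))"
      by (rule cap_chain_evaluation[where \<theta> = "\<lambda>_. []" and c = "\<lambda>_. 1" and K = "{()}" and p = 0 and \<alpha> = \<alpha>, OF \<Sigma>])
         (simp, rule eq)
    then show "cap_chain N \<Sigma> 0 \<alpha> \<sigma> \<phi>s = fundamental_chain N \<Sigma> \<sigma> \<phi>s" by simp
  qed
  ultimately show ?thesis by (rule that)
qed

lemma fundamental_chain_mem:
  assumes "cone_complex N \<Sigma>"
  shows "fundamental_chain N \<Sigma> \<in> BM_chains N \<Sigma> (fan_dim \<Sigma>) (fan_dim \<Sigma>)"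
proof -
  obtain \<alpha> where "cap_chain N \<Sigma> 0 \<alpha> = fundamental_chain N \<Sigma>"
    by (rule fundamental_chain_eq_cap[OF assms]) (rule that)
  then show ?thesis using cap_chain_mem[OF assms, of 0 \<alpha>] by simp
qed

lemma poincare_duality_exact:
  assumes \<Sigma>: "cone_complex N \<Sigma>" and pd: "poincare_duality N \<Sigma>"
  shows "function_complex.exact (chain_fun N \<Sigma>) (boundary_fun N \<Sigma>) (fan_dim \<Sigma>)"
proof -
  interpret function_complex "chain_fun N \<Sigma>" "boundary_fun N \<Sigma>" "fan_dim \<Sigma>" chain_degree
    by (rule function_complex_chain_fun[OF \<Sigma>])
  note fin = cone_complex_finite[OF \<Sigma>]
  show ?thesis
    unfolding exact_def
  proof (intro allI impI)
    fix p q z assume q: "q \<noteq> fan_dim \<Sigma>" and z: "z \<in> chain_fun N \<Sigma> p q" "boundary_fun N \<Sigma> z = 0"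
    obtain c where c: "c \<in> BM_chains N \<Sigma> p q" "z = case_prod c" using z(1) by (auto simp: chain_fun_def)
    have "boundary N \<Sigma> c = 0" using z(2) unfolding c(2) boundary_fun_case_prod case_prod_eq_0_iff .
    then have "c \<in> BM_cycles N \<Sigma> p q" using c(1) by (simp add: BM_cycles_eq[OF fin])
    then have "c \<in> BM_boundaries N \<Sigma> p q" using pd q unfolding poincare_duality_iff[OF fin] by blast
    then obtain b where "b \<in> BM_chains N \<Sigma> p (q + 1)" "c = boundary N \<Sigma> b" by (auto simp: BM_boundaries_eq[OF fin])
    then show "\<exists>c\<in>chain_fun N \<Sigma> p (q + 1). boundary_fun N \<Sigma> c = z"
      by (intro bexI[of _ "case_prod b"]) (auto simp: chain_fun_def boundary_fun_case_prod c(2))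
  qed
qed

text \<open>The fundamental chain is the cap with the unit, and duality sends functionals to
  cycles.\<close>

lemma poincare_duality_fundamental_cycle:
  assumes \<Sigma>: "cone_complex N \<Sigma>" and pd: "poincare_duality N \<Sigma>"
  shows "boundary N \<Sigma> (fundamental_chain N \<Sigma>) = 0"
proof -
  note fin = cone_complex_finite[OF \<Sigma>]
  obtain \<alpha> where \<alpha>: "\<alpha> \<in> F_upper N \<Sigma> 0 {0}" "cap_chain N \<Sigma> 0 \<alpha> = fundamental_chain N \<Sigma>"
    by (rule fundamental_chain_eq_cap[OF \<Sigma>]) (rule that)
  have "bij_betw (cap_chain N \<Sigma> 0) (F_upper N \<Sigma> 0 {0}) (BM_cycles N \<Sigma> (fan_dim \<Sigma> - 0) (fan_dim \<Sigma>))"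
    using pd unfolding poincare_duality_iff[OF fin] by blast
  then have "fundamental_chain N \<Sigma> \<in> BM_cycles N \<Sigma> (fan_dim \<Sigma> - 0) (fan_dim \<Sigma>)"
    using bij_betw_apply[OF _ \<alpha>(1)] by (simp only: \<alpha>(2)[symmetric])
  then show ?thesis by (simp add: BM_cycles_eq[OF fin])
qed

text \<open>A cone containing a top cone has the same span, hence the same lattice.\<close>

lemma F_lower_top:
  assumes \<Sigma>: "cone_complex N \<Sigma>" and \<sigma>: "\<sigma> \<in> cones \<Sigma> (fan_dim \<Sigma>)"
  shows "F_lower N \<Sigma> p \<sigma> \<subseteq> exterior_power p (sublattice N \<sigma>)"
  unfolding F_lower_def
proof (rule group_closure_minimal[OF UN_least add_subgroup_exterior_power])
  fix \<eta> assume "\<eta> \<in> {\<eta> \<in> \<Sigma>. \<sigma> \<subseteq> \<eta>}"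
  then have \<eta>: "\<eta> \<in> \<Sigma>" "\<sigma> \<subseteq> \<eta>" by auto
  have "int (dim \<eta>) \<le> int (dim \<sigma>)" using dim_le_fan_dim[OF cone_complex_finite[OF \<Sigma>] \<eta>(1)] \<sigma> by (simp add: cones_def)
  then have "span \<sigma> = span \<eta>" using \<eta>(2) by (intro dim_eq_span_subset) (auto intro: span_base)
  then show "exterior_power p (sublattice N \<eta>) \<subseteq> exterior_power p (sublattice N \<sigma>)" by (simp add: sublattice_def)
qed

text \<open>The two conditions under which slicing is a chain map: integral values at the point, and
  vanishing of boundaries because no cone lies above a top cone.\<close>

lemma chain_fun_top_point:
  assumes \<Sigma>: "cone_complex N \<Sigma>" and \<sigma>: "\<sigma> \<in> cones \<Sigma> (fan_dim \<Sigma>)" and d: "dual_lists (frame N \<sigma>) Ls" and b: "b \<in> chain_fun N \<Sigma> p q"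
  shows "b (\<sigma>, Ls) \<in> \<int>" "boundary_fun N \<Sigma> b (\<sigma>, Ls) = 0"
proof -
  note N = cone_complex_lattice[OF \<Sigma>]
  obtain c where c: "c \<in> BM_chains N \<Sigma> p q" "b = case_prod c" using b by (auto simp: chain_fun_def)
  show "b (\<sigma>, Ls) \<in> \<int>"
  proof (cases "\<sigma> \<in> cones \<Sigma> q")
    case True
    then have "c \<sigma> \<in> exterior_power p (group_closure (set (frame N \<sigma>)))"
      using c(1) F_lower_top[OF \<Sigma> \<sigma>, of p] lattice_basis_frame[OF N, of \<sigma>]
      by (auto simp: BM_chains_def lattice_basis_def)
    then have "c \<sigma> Ls \<in> \<int>" by (rule exterior_power_Ints) (rule dual_lists_set_Ints[OF d])
    then show ?thesis by (simp add: c(2))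
  next
    case False
    then show ?thesis using c by (simp add: BM_chains_def)
  qed
  have "incidence N \<Sigma> \<sigma> \<eta> = 0" for \<eta>
    using dim_le_fan_dim[OF cone_complex_finite[OF \<Sigma>], of \<eta>] \<sigma> by (auto simp: incidence_def cones_def)
  then show "boundary_fun N \<Sigma> b (\<sigma>, Ls) = 0" by (simp add: boundary_fun_def)
qed

lemma top_cone_exists:
  assumes "cone_complex N \<Sigma>"
  obtains \<sigma> Ls where "\<sigma> \<in> cones \<Sigma> (fan_dim \<Sigma>)" "dual_lists (frame N \<sigma>) Ls"
    "chain_degree (\<sigma>, Ls) = (fan_dim \<Sigma>, fan_dim \<Sigma>)" "fundamental_chain N \<Sigma> \<sigma> Ls = 1"
proof -
  note N = cone_complex_lattice[OF assms]
  obtain \<tau> where "\<tau> \<in> \<Sigma>" using assms by (auto simp: cone_complex_def)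
  then obtain \<sigma> where \<sigma>: "\<sigma> \<in> \<Sigma>" "int (dim \<sigma>) = fan_dim \<Sigma>" using cone_complex_top[OF assms] by metis
  obtain Ls where Ls: "dual_lists (frame N \<sigma>) Ls" by (rule lattice_basis_dual[OF lattice_basis_frame[OF N]])
  have "length Ls = dim \<sigma>" using Ls length_frame[OF N cone_complex_rational[OF assms \<sigma>(1)]] by (simp add: dual_lists_def)
  then show ?thesis
    using \<sigma> Ls wedge_dual[OF Ls]
    by (intro that[of \<sigma> Ls]) (auto simp: cones_def chain_degree_def fundamental_chain_def orientation_def)
qed

section \<open>Cap products on a product\<close>

text \<open>Only \<theta>s is expanded, in the product dual basis. Index sets reaching into the
  second block repeat a form of \<open>Ls'\<close>, so \<theta>s acts through its restriction to the
  first axis.\<close>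

lemma wedge_absorb_right:
  fixes bs :: "'a::euclidean_space list" and bs' :: "'b::euclidean_space list"
  assumes d: "dual_lists bs Ls" and d': "dual_lists bs' Ls'" and \<theta>: "\<forall>\<theta>\<in>set \<theta>s. linear \<theta>"
  shows "wedge (map inl bs @ map inr bs') (\<theta>s @ fst_forms \<phi>s @ snd_forms Ls') =
    wedge bs (map (\<lambda>\<theta>. \<theta> \<circ> inl) \<theta>s @ \<phi>s)"
proof -
  let ?vs = "map inl bs @ map inr bs' :: ('a \<times> 'b) list"
  let ?L = "fst_forms Ls @ snd_forms Ls' :: ('a \<times> 'b \<Rightarrow> real) list"
  note dP = dual_lists_Times[OF d d']
  have len: "length Ls = length bs" "length Ls' = length bs'" using d d' by (auto simp: dual_lists_def)
  have z: "wedge ?vs (nths ?L I @ fst_forms \<phi>s @ snd_forms Ls') = 0"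
    if I: "I \<subseteq> {..<length ?vs}" "\<not> I \<subseteq> {..<length bs}" for I
  proof -
    obtain i where i: "i \<in> I" "i \<ge> length bs" using I(2) by (meson lessThan_iff not_less subsetI)
    then have "i < length ?L" using I(1) len by auto
    from nths_Int_mem[OF this i(1)] have "?L ! i \<in> set (nths ?L I)" .
    moreover have "?L ! i = Ls' ! (i - length bs) \<circ> snd" using i len \<open>i < length ?L\<close> by (simp add: nth_append)
    then have "?L ! i \<in> set (snd_forms Ls' :: ('a \<times> 'b \<Rightarrow> real) list)" using i len \<open>i < length ?L\<close> by auto
    ultimately show ?thesis by (intro wedge_not_distinct) auto
  qed
  have t: "wedge (nths ?vs I) \<theta>s * wedge ?vs (nths ?L I @ fst_forms \<phi>s @ snd_forms Ls') =
      wedge (nths bs I) (map (\<lambda>\<theta>. \<theta> \<circ> inl) \<theta>s) * wedge bs (nths Ls I @ \<phi>s)"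
    if I: "I \<subseteq> {..<length bs}" for I
  proof -
    have e: "{j. j + length bs \<in> I} = {}" using I by auto
    have "nths ?vs I = map inl (nths bs I)" "nths ?L I = fst_forms (nths Ls I)"
      by (simp_all add: nths_append nths_map len e)
    moreover have "wedge ?vs (fst_forms (nths Ls I) @ fst_forms \<phi>s @ snd_forms Ls') = wedge bs (nths Ls I @ \<phi>s)"
      using wedge_product[of bs bs' "nths Ls I @ \<phi>s" Ls'] wedge_dual[OF d'] by simp
    ultimately show ?thesis using \<theta> by (simp add: wedge_map[OF linear_inl])
  qed
  have \<theta>': "\<forall>\<theta>\<in>set (map (\<lambda>\<theta>. \<theta> \<circ> inl) \<theta>s). linear \<theta>" using \<theta> linear_compose[OF linear_inl] by auto
  have "wedge ?vs (\<theta>s @ fst_forms \<phi>s @ snd_forms Ls') =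
      (\<Sum>I | I \<subseteq> {..<length ?vs} \<and> card I = length \<theta>s. wedge (nths ?vs I) \<theta>s * wedge ?vs (nths ?L I @ fst_forms \<phi>s @ snd_forms Ls'))"
    by (rule wedge_expand[OF dP span_superset \<theta>])
  also have "\<dots> = (\<Sum>I | I \<subseteq> {..<length bs} \<and> card I = length \<theta>s. wedge (nths bs I) (map (\<lambda>\<theta>. \<theta> \<circ> inl) \<theta>s) * wedge bs (nths Ls I @ \<phi>s))"
  proof (rule sum.mono_neutral_cong_right)
    show "finite {I. I \<subseteq> {..<length ?vs} \<and> card I = length \<theta>s}" by (rule finite_subset[of _ "Pow {..<length ?vs}"]) auto
    show "\<forall>I\<in>{I. I \<subseteq> {..<length ?vs} \<and> card I = length \<theta>s} - {I. I \<subseteq> {..<length bs} \<and> card I = length \<theta>s}.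
        wedge (nths ?vs I) \<theta>s * wedge ?vs (nths ?L I @ fst_forms \<phi>s @ snd_forms Ls') = 0"
      using z by auto
  qed (use t in \<open>auto simp: subset_iff\<close>)
  also have "\<dots> = wedge bs (map (\<lambda>\<theta>. \<theta> \<circ> inl) \<theta>s @ \<phi>s)"
    using wedge_expand[OF d span_superset \<theta>', of \<phi>s] by simp
  finally show ?thesis .
qed

text \<open>As on the right, but the surviving forms of the second factor must first pass the whole
  list \<open>Ls\<close>; this is the exponent.\<close>

lemma wedge_absorb_left:
  fixes bs :: "'a::euclidean_space list" and bs' :: "'b::euclidean_space list"
  assumes d: "dual_lists bs Ls" and d': "dual_lists bs' Ls'" and \<theta>: "\<forall>\<theta>\<in>set \<theta>s. linear \<theta>"
  shows "wedge (map inl bs @ map inr bs') (\<theta>s @ fst_forms Ls @ snd_forms \<psi>s) =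
    (-1) ^ (length \<theta>s * length bs) * wedge bs' (map (\<lambda>\<theta>. \<theta> \<circ> inr) \<theta>s @ \<psi>s)"
proof -
  let ?vs = "map inl bs @ map inr bs' :: ('a \<times> 'b) list"
  let ?L = "fst_forms Ls @ snd_forms Ls' :: ('a \<times> 'b \<Rightarrow> real) list"
  \<comment> \<open>Index sets of the second block are shifted by the length of the first; these are
    the only ones to survive.\<close>
  let ?sh = "\<lambda>J. (\<lambda>j. j + length bs) ` J"
  note dP = dual_lists_Times[OF d d']
  have len: "length Ls = length bs" "length Ls' = length bs'" using d d' by (auto simp: dual_lists_def)
  have linL: "\<forall>L\<in>set Ls. linear L" "\<forall>L\<in>set Ls'. linear L" using d d' by (auto simp: dual_lists_def)
  have z: "wedge ?vs (nths ?L I @ fst_forms Ls @ snd_forms \<psi>s) = 0" if i: "i \<in> I" "i < length bs" for I i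
  proof -
    have "i < length ?L" using i len by simp
    from nths_Int_mem[OF this i(1)] have "?L ! i \<in> set (nths ?L I)" .
    moreover have "?L ! i = Ls ! i \<circ> fst" using i len by (simp add: nth_append)
    then have "?L ! i \<in> set (fst_forms Ls :: ('a \<times> 'b \<Rightarrow> real) list)" using i len by auto
    ultimately show ?thesis by (intro wedge_not_distinct) auto
  qed
  have t: "wedge (nths ?vs (?sh J)) \<theta>s * wedge ?vs (nths ?L (?sh J) @ fst_forms Ls @ snd_forms \<psi>s) =
      (-1) ^ (length \<theta>s * length bs) * (wedge (nths bs' J) (map (\<lambda>\<theta>. \<theta> \<circ> inr) \<theta>s) * wedge bs' (nths Ls' J @ \<psi>s))"
    if J: "J \<subseteq> {..<length bs'}" "card J = length \<theta>s" for J
  proof -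
    have e: "{j. j + length bs \<in> ?sh J} = J" by auto
    have e': "nths bs (?sh J) = []" "nths Ls (?sh J) = []"
      using len by (auto simp flip: set_empty simp: set_nths)
    have n: "nths ?vs (?sh J) = map inr (nths bs' J)" "nths ?L (?sh J) = snd_forms (nths Ls' J)"
      using e' by (simp_all add: nths_append nths_map len e)
    have lin: "\<forall>\<alpha>\<in>set (snd_forms (nths Ls' J) :: ('a \<times> 'b \<Rightarrow> real) list). linear \<alpha>"
      "\<forall>\<alpha>\<in>set (fst_forms Ls :: ('a \<times> 'b \<Rightarrow> real) list). linear \<alpha>"
      using nths_linear[OF linL(2)] linL(1) by (auto intro: linear_comp_fst linear_comp_snd)
    have "wedge ?vs (snd_forms (nths Ls' J) @ fst_forms Ls @ snd_forms \<psi>s) =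
        (-1) ^ (length \<theta>s * length bs) * wedge ?vs (fst_forms Ls @ snd_forms (nths Ls' J) @ snd_forms \<psi>s)"
      using wedge_row_block_move[OF lin, of ?vs "[]" "snd_forms \<psi>s"] J len by (simp add: length_nths_lessThan)
    also have "wedge ?vs (fst_forms Ls @ snd_forms (nths Ls' J) @ snd_forms \<psi>s) = wedge bs' (nths Ls' J @ \<psi>s)"
      using wedge_product[of bs bs' Ls "nths Ls' J @ \<psi>s"] wedge_dual[OF d] by simp
    finally have f: "wedge ?vs (snd_forms (nths Ls' J) @ fst_forms Ls @ snd_forms \<psi>s) =
        (-1) ^ (length \<theta>s * length bs) * wedge bs' (nths Ls' J @ \<psi>s)" .
    show ?thesis by (simp only: n wedge_map[OF linear_inr] if_P[OF \<theta>] f mult.left_commute)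
  qed
  have \<theta>': "\<forall>\<theta>\<in>set (map (\<lambda>\<theta>. \<theta> \<circ> inr) \<theta>s). linear \<theta>" using \<theta> linear_compose[OF linear_inr] by auto
  let ?A = "{I. I \<subseteq> {..<length ?vs} \<and> card I = length \<theta>s}" and ?B = "{J. J \<subseteq> {..<length bs'} \<and> card J = length \<theta>s}"
  have "wedge ?vs (\<theta>s @ fst_forms Ls @ snd_forms \<psi>s) =
      (\<Sum>I\<in>?A. wedge (nths ?vs I) \<theta>s * wedge ?vs (nths ?L I @ fst_forms Ls @ snd_forms \<psi>s))"
    by (rule wedge_expand[OF dP span_superset \<theta>])
  also have "\<dots> = (\<Sum>I\<in>?sh ` ?B. wedge (nths ?vs I) \<theta>s * wedge ?vs (nths ?L I @ fst_forms Ls @ snd_forms \<psi>s))"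
  proof (rule sum.mono_neutral_right)
    show "finite ?A" by (rule finite_subset[of _ "Pow {..<length ?vs}"]) auto
    show "?sh ` ?B \<subseteq> ?A" by (auto simp: card_image)
    show "\<forall>I\<in>?A - ?sh ` ?B. wedge (nths ?vs I) \<theta>s * wedge ?vs (nths ?L I @ fst_forms Ls @ snd_forms \<psi>s) = 0"
    proof
      fix I assume I: "I \<in> ?A - ?sh ` ?B"
      have "\<exists>i\<in>I. i < length bs"
      proof (rule ccontr)
        assume "\<not> (\<exists>i\<in>I. i < length bs)"
        then have ge: "i \<ge> length bs" if "i \<in> I" for i using that by force
        let ?J = "(\<lambda>i. i - length bs) ` I"
        have "?sh ?J = I" using ge by (force simp: image_image)
        moreover have "?J \<in> ?B"
        proof -
          have "card ?J = card I" using ge by (intro card_image inj_onI) (metis le_add_diff_inverse2)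
          moreover have "?J \<subseteq> {..<length bs'}" using I ge by fastforce
          ultimately show ?thesis using I by auto
        qed
        ultimately have "I \<in> ?sh ` ?B" by (intro image_eqI[of _ _ ?J]) simp_all
        then show False using I by blast
      qed
      then show "wedge (nths ?vs I) \<theta>s * wedge ?vs (nths ?L I @ fst_forms Ls @ snd_forms \<psi>s) = 0" using z by auto
    qed
  qed
  also have "\<dots> = (\<Sum>J\<in>?B. wedge (nths ?vs (?sh J)) \<theta>s * wedge ?vs (nths ?L (?sh J) @ fst_forms Ls @ snd_forms \<psi>s))"
    by (rule sum.reindex[unfolded comp_def]) (auto intro!: inj_onI simp: inj_image_eq_iff)
  also have "\<dots> = (\<Sum>J\<in>?B. (-1) ^ (length \<theta>s * length bs) * (wedge (nths bs' J) (map (\<lambda>\<theta>. \<theta> \<circ> inr) \<theta>s) * wedge bs' (nths Ls' J @ \<psi>s)))"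
    using t by (intro sum.cong refl) auto
  also have "\<dots> = (-1) ^ (length \<theta>s * length bs) * wedge bs' (map (\<lambda>\<theta>. \<theta> \<circ> inr) \<theta>s @ \<psi>s)"
    using wedge_expand[OF d' span_superset \<theta>', of \<psi>s] by (simp only: sum_distrib_left length_map)
  finally show ?thesis .
qed

text \<open>Passage from real-valued functionals with integral values on \<open>A\<close> to the
  integral dual.\<close>

lemma floor_int_dual:
  assumes A: "add_subgroup A" and g: "\<And>x y. g (x + y) = g x + g y" and int: "\<And>x. x \<in> A \<Longrightarrow> g x \<in> \<int>"
  obtains \<alpha> where "\<alpha> \<in> int_dual A" "\<And>x. x \<in> A \<Longrightarrow> of_int (\<alpha> x) = (g x :: real)"
proof -
  define \<alpha> where "\<alpha> x = (if x \<in> A then \<lfloor>g x\<rfloor> else 0)" for x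
  have eq: "of_int (\<alpha> x) = g x" if "x \<in> A" for x using that int by (simp add: \<alpha>_def)
  have "\<alpha> \<in> int_dual A"
  proof (rule int_dualI)
    fix x y assume xy: "x \<in> A" "y \<in> A"
    have "real_of_int (\<alpha> (x + y)) = of_int (\<alpha> x + \<alpha> y)"
      using eq[OF xy(1)] eq[OF xy(2)] eq[OF add_subgroup_add[OF A xy]] g by simp
    then show "\<alpha> (x + y) = \<alpha> x + \<alpha> y" by (simp only: of_int_eq_iff)
  qed (simp add: \<alpha>_def)
  then show ?thesis using eq by (rule that)
qed

section \<open>Poincare duality of a product\<close>

context product_complex
begin

abbreviation "d \<equiv> fan_dim \<Sigma>"
abbreviation "d' \<equiv> fan_dim \<Sigma>'"
abbreviation "\<nu> \<equiv> case_prod (fundamental_chain N \<Sigma>)"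
abbreviation "\<nu>' \<equiv> case_prod (fundamental_chain N' \<Sigma>')"

lemma top_cone_P: "\<sigma> \<times> \<sigma>' \<in> cones \<Sigma>P (fan_dim \<Sigma>P) \<longleftrightarrow> \<sigma> \<in> cones \<Sigma> d \<and> \<sigma>' \<in> cones \<Sigma>' d'"
proof
  assume a: "\<sigma> \<times> \<sigma>' \<in> cones \<Sigma>P (fan_dim \<Sigma>P)"
  then have m: "\<sigma> \<in> \<Sigma>" "\<sigma>' \<in> \<Sigma>'" by (auto simp: cones_def Times_mem_iff)
  then have "int (dim \<sigma>) + int (dim \<sigma>') = d + d'" using a by (simp add: cones_def dim_P fan_dim_P)
  then show "\<sigma> \<in> cones \<Sigma> d \<and> \<sigma>' \<in> cones \<Sigma>' d'"
    using dim_le_fan_dim[OF fin m(1)] dim_le_fan_dim[OF fin' m(2)] m by (simp add: cones_def)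
next
  assume "\<sigma> \<in> cones \<Sigma> d \<and> \<sigma>' \<in> cones \<Sigma>' d'"
  then show "\<sigma> \<times> \<sigma>' \<in> cones \<Sigma>P (fan_dim \<Sigma>P)" by (auto simp: cones_def Times_mem_iff dim_P fan_dim_P)
qed

lemma fundamental_chain_P:
  assumes "\<sigma> \<in> cones \<Sigma> d" "\<sigma>' \<in> cones \<Sigma>' d'"
  shows "ps \<sigma> \<sigma>' * fundamental_chain NP \<Sigma>P (\<sigma> \<times> \<sigma>') \<theta>s = wedge (map inl (frame N \<sigma>) @ map inr (frame N' \<sigma>')) \<theta>s"
proof -
  have m: "\<sigma> \<in> \<Sigma>" "\<sigma>' \<in> \<Sigma>'" using assms by (auto simp: cones_def)
  have "\<sigma> \<times> \<sigma>' \<in> cones \<Sigma>P (fan_dim \<Sigma>P)" using assms top_cone_P by blast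
  then show ?thesis using orientation_P[OF m, of \<theta>s] ps_square[OF m] by (simp add: fundamental_chain_def)
qed

lemma fundamental_chain_P_eq_0:
  "\<not> (\<sigma> \<in> cones \<Sigma> d \<and> \<sigma>' \<in> cones \<Sigma>' d') \<Longrightarrow> fundamental_chain NP \<Sigma>P (\<sigma> \<times> \<sigma>') \<theta>s = 0"
  unfolding fundamental_chain_def top_cone_P by (simp only: if_False zero_fun_def)

lemma fundamental_chain_top: "\<sigma> \<in> cones \<Sigma> d \<Longrightarrow> fundamental_chain N \<Sigma> \<sigma> \<phi>s = wedge (frame N \<sigma>) \<phi>s"
  and fundamental_chain_top': "\<sigma>' \<in> cones \<Sigma>' d' \<Longrightarrow> fundamental_chain N' \<Sigma>' \<sigma>' \<psi>s = wedge (frame N' \<sigma>') \<psi>s"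
  by (simp_all add: fundamental_chain_def orientation_def)

lemma \<Psi>_fundamental_chain: "\<Psi> (fundamental_chain NP \<Sigma>P) = tensor \<nu> \<nu>'"
proof (intro ext, clarify)
  fix \<sigma> \<phi>s \<sigma>' \<psi>s
  show "\<Psi> (fundamental_chain NP \<Sigma>P) ((\<sigma>, \<phi>s), (\<sigma>', \<psi>s)) = tensor \<nu> \<nu>' ((\<sigma>, \<phi>s), (\<sigma>', \<psi>s))"
  proof (cases "\<sigma> \<in> cones \<Sigma> d \<and> \<sigma>' \<in> cones \<Sigma>' d'")
    case True
    then have t: "\<sigma> \<in> cones \<Sigma> d" "\<sigma>' \<in> cones \<Sigma>' d'" by auto
    have "\<Psi> (fundamental_chain NP \<Sigma>P) ((\<sigma>, \<phi>s), (\<sigma>', \<psi>s)) = wedge (frame N \<sigma>) \<phi>s * wedge (frame N' \<sigma>') \<psi>s"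
      unfolding \<Psi>_def split_conv fundamental_chain_P[OF t] by (rule wedge_product)
    then show ?thesis using t by (simp add: tensor_def fundamental_chain_top fundamental_chain_top')
  next
    case False
    then show ?thesis using fundamental_chain_P_eq_0[OF False]
      by (auto simp: \<Psi>_def tensor_def fundamental_chain_def)
  qed
qed

lemma \<Psi>_cycle_iff:
  assumes "c \<in> BM_chains NP \<Sigma>P p q"
  shows "D (\<Psi> c) = 0 \<longleftrightarrow> boundary NP \<Sigma>P c = 0"
proof
  assume "D (\<Psi> c) = 0"
  then have "\<Psi> (boundary NP \<Sigma>P c) = 0" by (simp only: D_\<Psi>[OF assms])
  then show "boundary NP \<Sigma>P c = 0" by (rule \<Psi>_inj[OF boundary_BM_chains[OF finP assms]])
next
  assume "boundary NP \<Sigma>P c = 0"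
  then show "D (\<Psi> c) = 0" unfolding D_\<Psi>[OF assms] using diff_op_zero[OF diff_\<Psi>] by (simp only:)
qed

lemma \<Psi>_eqD:
  assumes "c \<in> BM_chains NP \<Sigma>P p q" "c' \<in> BM_chains NP \<Sigma>P p q" "\<Psi> c = \<Psi> c'"
  shows "c = c'"
proof -
  have "\<Psi> (c - c') = 0" using diff_opD[OF diff_\<Psi>, of c c'] assms(3) by (simp only: diff_self)
  then have "c - c' = 0" by (rule \<Psi>_inj[OF add_subgroup_diff[OF add_subgroup_BM_chains assms(1,2)]])
  then show ?thesis by (simp only: right_minus_eq)
qed

lemma \<nu>_mem: "\<nu> \<in> chain_fun N \<Sigma> d d" and \<nu>'_mem: "\<nu>' \<in> chain_fun N' \<Sigma>' d' d'"
  using fundamental_chain_mem[OF \<Sigma>] fundamental_chain_mem[OF \<Sigma>'] by (auto simp: chain_fun_def)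

lemma parity_sign_mult: "parity_sign (int m * int n) = (-1) ^ (m * n)"
  by (simp add: parity_sign_def)

text \<open>\<gamma> evaluates at the concatenations of evaluation points for \<alpha> and \<beta>.
  It is integral because on sorted wedges it is the product of the two values. The sign comes from
  the b forms of \<beta>, which must pass the d - a remaining forms of the first factor.\<close>

lemma cap_tensor:
  assumes \<alpha>: "\<alpha> \<in> F_upper N \<Sigma> a {0}" and \<beta>: "\<beta> \<in> F_upper N' \<Sigma>' b {0}"
  obtains \<gamma> where "\<gamma> \<in> F_upper NP \<Sigma>P (a + b) {0}"
    "\<Psi> (cap_chain NP \<Sigma>P (a + b) \<gamma>) = (\<lambda>z. parity_sign (b * (d - a)) *
       tensor (case_prod (cap_chain N \<Sigma> a \<alpha>)) (case_prod (cap_chain N' \<Sigma>' b \<beta>)) z)"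
proof -
  obtain bs where bs: "lattice_basis bs N" using N by (auto simp: lattice_subgroup_def)
  obtain Ls where Ls: "dual_lists bs Ls" by (rule lattice_basis_dual[OF bs])
  obtain bs' where bs': "lattice_basis bs' N'" using N' by (auto simp: lattice_subgroup_def)
  obtain Ls' where Ls': "dual_lists bs' Ls'" by (rule lattice_basis_dual[OF bs'])
  let ?I = "{I. I \<subseteq> {..<length bs} \<and> int (card I) = a}" and ?J = "{J. J \<subseteq> {..<length bs'} \<and> int (card J) = b}"
  obtain c where c: "\<And>x. x \<in> F_lower N \<Sigma> a {0} \<Longrightarrow> of_int (\<alpha> x) = (\<Sum>I\<in>?I. c I * x (nths Ls I))"
    by (rule F_upper_evaluation[OF \<alpha> bs Ls]) (rule that)
  obtain c' where c': "\<And>x. x \<in> F_lower N' \<Sigma>' b {0} \<Longrightarrow> of_int (\<beta> x) = (\<Sum>J\<in>?J. c' J * x (nths Ls' J))"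
    by (rule F_upper_evaluation[OF \<beta> bs' Ls']) (rule that)
  note pts = nths_evaluation_points[OF Ls] and pts' = nths_evaluation_points[OF Ls']
  define \<theta> :: "nat set \<times> nat set \<Rightarrow> ('a \<times> 'b \<Rightarrow> real) list" where
    "\<theta> = (\<lambda>(I, J). fst_forms (nths Ls I) @ snd_forms (nths Ls' J))"
  define e where "e = (\<lambda>(I, J). c I * c' J)"
  define g where "g w = (\<Sum>k\<in>?I \<times> ?J. e k * w (\<theta> k))" for w :: "('a \<times> 'b) multivector"
  have split: "(\<Sum>k\<in>?I \<times> ?J. e k * (u (fst k) * v (snd k))) = (\<Sum>I\<in>?I. c I * u I) * (\<Sum>J\<in>?J. c' J * v J)" for u v
    unfolding sum_product sum.cartesian_product e_def by (intro sum.cong refl) auto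
  have g_add: "g (x + y) = g x + g y" for x y by (simp add: g_def distrib_left sum.distrib)
  have g_diff: "diff_op g" unfolding diff_op_def by (simp add: g_def right_diff_distrib sum_subtractf)
  have Z: "add_subgroup (\<int> :: real set)" by (auto simp: add_subgroup_def)
  have g_int: "g w \<in> \<int>" if w: "w \<in> F_lower NP \<Sigma>P (a + b) {0}" for w
  proof (rule F_lower_diff_op[OF w g_diff Z])
    fix T vs assume T: "T \<in> \<Sigma>P" "set vs \<subseteq> sublattice NP T" "int (length vs) = a + b"
    then obtain \<eta> \<eta>' where \<eta>: "\<eta> \<in> \<Sigma>" "\<eta>' \<in> \<Sigma>'" "T = \<eta> \<times> \<eta>'" by (auto simp: product_fan_def)
    have vs: "set vs \<subseteq> sublattice N \<eta> \<times> sublattice N' \<eta>'"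
      using T(2) \<eta> by (simp add: sublattice_Times zero zero')
    show "g (wedge vs) \<in> \<int>"
    proof (rule wedge_split[OF g_diff Z vs])
      fix xs ys assume xy: "set xs \<subseteq> sublattice N \<eta>" "set ys \<subseteq> sublattice N' \<eta>'" "length xs + length ys = length vs"
      have "g (wedge (map inl xs @ map inr ys)) = (\<Sum>k\<in>?I \<times> ?J. e k * (wedge xs (nths Ls (fst k)) * wedge ys (nths Ls' (snd k))))"
        unfolding g_def by (intro sum.cong refl) (auto simp only: \<theta>_def split_conv wedge_product fst_conv snd_conv)
      also have "\<dots> = (\<Sum>I\<in>?I. c I * wedge xs (nths Ls I)) * (\<Sum>J\<in>?J. c' J * wedge ys (nths Ls' J))"
        by (rule split)
      finally have eq: "g (wedge (map inl xs @ map inr ys)) = \<dots>" .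
      show "g (wedge (map inl xs @ map inr ys)) \<in> \<int>"
      proof (cases "int (length xs) = a")
        case True
        then have "int (length ys) = b" using xy(3) T(3) by linarith
        then have mem: "wedge xs \<in> F_lower N \<Sigma> a {0}" "wedge ys \<in> F_lower N' \<Sigma>' b {0}"
          using True xy \<eta> zero zero' by (auto intro!: wedge_in_F_lower)
        show ?thesis unfolding eq c[OF mem(1), symmetric] c'[OF mem(2), symmetric] by (intro Ints_mult Ints_of_int)
      next
        \<comment> \<open>A wedge with the wrong number of vectors in the first factor is killed by
          every evaluation point of \<alpha>.\<close>
        case False
        have "wedge xs (nths Ls I) = 0" if "I \<in> ?I" for I
          using pts[OF that] False by (intro wedge_eq_0_length) auto
        then show ?thesis unfolding eq by simp
      qed
    qed
  qed
  obtain \<gamma> where \<gamma>: "\<gamma> \<in> int_dual (F_lower NP \<Sigma>P (a + b) {0})"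
      "\<And>w. w \<in> F_lower NP \<Sigma>P (a + b) {0} \<Longrightarrow> of_int (\<gamma> w) = g w"
    by (rule floor_int_dual[where g = g, OF add_subgroup_F_lower g_add]) (erule g_int, rule that)
  have cap: "cap_chain NP \<Sigma>P (a + b) \<gamma> T \<Theta> = (\<Sum>k\<in>?I \<times> ?J. e k * fundamental_chain NP \<Sigma>P T (\<theta> k @ \<Theta>))" for T \<Theta>
  proof (rule cap_chain_evaluation[OF \<Sigma>P])
    fix k assume "k \<in> ?I \<times> ?J"
    then show "int (length (\<theta> k)) = a + b \<and> (\<forall>L\<in>set (\<theta> k). linear L)"
      using pts[of "fst k" a] pts'[of "snd k" b]
      by (auto simp: \<theta>_def intro!: linear_comp_fst[unfolded comp_def] linear_comp_snd[unfolded comp_def])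
  next
    fix x assume "x \<in> F_lower NP \<Sigma>P (a + b) {0}"
    show "of_int (\<gamma> x) = (\<Sum>k\<in>?I \<times> ?J. e k * x (\<theta> k))" unfolding \<gamma>(2)[OF \<open>x \<in> _\<close>] g_def by (rule refl)
  qed
  have cap1: "cap_chain N \<Sigma> a \<alpha> \<sigma> \<phi>s = (\<Sum>I\<in>?I. c I * fundamental_chain N \<Sigma> \<sigma> (nths Ls I @ \<phi>s))" for \<sigma> \<phi>s
    by (rule cap_chain_evaluation[OF \<Sigma>]) (use pts c in auto)
  have cap2: "cap_chain N' \<Sigma>' b \<beta> \<sigma>' \<psi>s = (\<Sum>J\<in>?J. c' J * fundamental_chain N' \<Sigma>' \<sigma>' (nths Ls' J @ \<psi>s))" for \<sigma>' \<psi>s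
    by (rule cap_chain_evaluation[OF \<Sigma>']) (use pts' c' in auto)
  have "\<Psi> (cap_chain NP \<Sigma>P (a + b) \<gamma>) ((\<sigma>, \<phi>s), (\<sigma>', \<psi>s)) =
      parity_sign (b * (d - a)) * (cap_chain N \<Sigma> a \<alpha> \<sigma> \<phi>s * cap_chain N' \<Sigma>' b \<beta> \<sigma>' \<psi>s)" for \<sigma> \<phi>s \<sigma>' \<psi>s
  proof (cases "\<sigma> \<in> cones \<Sigma> d \<and> \<sigma>' \<in> cones \<Sigma>' d'")
    case False
    then have "cap_chain N \<Sigma> a \<alpha> \<sigma> \<phi>s = 0 \<or> cap_chain N' \<Sigma>' b \<beta> \<sigma>' \<psi>s = 0" by (auto simp: cap_chain_def)
    then show ?thesis using fundamental_chain_P_eq_0[OF False] by (auto simp: \<Psi>_def cap)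
  next
    case True
    then have t: "\<sigma> \<in> cones \<Sigma> d" "\<sigma>' \<in> cones \<Sigma>' d'" by auto
    let ?W = "map inl (frame N \<sigma>) @ map inr (frame N' \<sigma>') :: ('a \<times> 'b) list"
    have lhs: "\<Psi> (cap_chain NP \<Sigma>P (a + b) \<gamma>) ((\<sigma>, \<phi>s), (\<sigma>', \<psi>s)) =
        (\<Sum>k\<in>?I \<times> ?J. e k * wedge ?W (\<theta> k @ fst_forms \<phi>s @ snd_forms \<psi>s))"
      unfolding \<Psi>_def split_conv cap sum_distrib_left mult.left_commute[of "ps \<sigma> \<sigma>'"] fundamental_chain_P[OF t]
      by (rule refl)
    show ?thesis
    proof (cases "\<forall>\<phi>\<in>set \<phi>s. linear \<phi>")
      case False
      have "\<exists>L\<in>set (\<theta> k @ fst_forms \<phi>s @ snd_forms \<psi>s). \<not> linear L" for k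
        using False linear_comp_fst_iff by fastforce
      then have "wedge ?W (\<theta> k @ fst_forms \<phi>s @ snd_forms \<psi>s) = 0" for k by (rule wedge_eq_0_nonlinear)
      moreover have "cap_chain N \<Sigma> a \<alpha> \<sigma> \<phi>s = 0"
        using BM_chains_support(4)[OF cap_chain_mem[OF \<Sigma>]] False by blast
      ultimately show ?thesis unfolding lhs by simp
    next
      case lin: True
      have w: "wedge ?W (\<theta> k @ fst_forms \<phi>s @ snd_forms \<psi>s) = (-1) ^ (nat b * length \<phi>s) *
          (wedge (frame N \<sigma>) (nths Ls (fst k) @ \<phi>s) * wedge (frame N' \<sigma>') (nths Ls' (snd k) @ \<psi>s))"
        if k: "k \<in> ?I \<times> ?J" for k
      proof -
        obtain I J where IJ: "k = (I, J)" "I \<in> ?I" "J \<in> ?J" using k by auto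
        have l1: "\<forall>L\<in>set (snd_forms (nths Ls' J) :: ('a \<times> 'b \<Rightarrow> real) list). linear L"
          using pts'[OF IJ(3)] by (auto intro: linear_comp_snd)
        have l2: "\<forall>L\<in>set (fst_forms \<phi>s :: ('a \<times> 'b \<Rightarrow> real) list). linear L"
          using lin by (auto intro: linear_comp_fst)
        have len: "length (nths Ls' J) = nat b" using pts'[OF IJ(3)] by auto
        have "wedge ?W (\<theta> k @ fst_forms \<phi>s @ snd_forms \<psi>s) =
            wedge ?W (fst_forms (nths Ls I) @ snd_forms (nths Ls' J) @ fst_forms \<phi>s @ snd_forms \<psi>s)"
          by (simp only: IJ(1) \<theta>_def split_conv append_assoc)
        also have "\<dots> = (-1) ^ (nat b * length \<phi>s) *
            wedge ?W (fst_forms (nths Ls I) @ fst_forms \<phi>s @ snd_forms (nths Ls' J) @ snd_forms \<psi>s)"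
          using wedge_row_block_move[OF l1 l2] by (simp only: length_map len)
        also have "wedge ?W (fst_forms (nths Ls I) @ fst_forms \<phi>s @ snd_forms (nths Ls' J) @ snd_forms \<psi>s) =
            wedge (frame N \<sigma>) (nths Ls I @ \<phi>s) * wedge (frame N' \<sigma>') (nths Ls' J @ \<psi>s)"
          using wedge_product[of "frame N \<sigma>" "frame N' \<sigma>'" "nths Ls I @ \<phi>s" "nths Ls' J @ \<psi>s"]
          by (simp only: map_append append_assoc)
        finally show ?thesis by (simp only: IJ(1) fst_conv snd_conv)
      qed
      have "\<Psi> (cap_chain NP \<Sigma>P (a + b) \<gamma>) ((\<sigma>, \<phi>s), (\<sigma>', \<psi>s)) =
          (\<Sum>k\<in>?I \<times> ?J. (-1) ^ (nat b * length \<phi>s) * (e k *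
            (wedge (frame N \<sigma>) (nths Ls (fst k) @ \<phi>s) * wedge (frame N' \<sigma>') (nths Ls' (snd k) @ \<psi>s))))"
        unfolding lhs using w by (intro sum.cong refl) (simp only: mult.left_commute)
      also have "\<dots> = (-1) ^ (nat b * length \<phi>s) *
          ((\<Sum>I\<in>?I. c I * wedge (frame N \<sigma>) (nths Ls I @ \<phi>s)) * (\<Sum>J\<in>?J. c' J * wedge (frame N' \<sigma>') (nths Ls' J @ \<psi>s)))"
        by (simp only: sum_distrib_left[symmetric]
          split[of "\<lambda>I. wedge (frame N \<sigma>) (nths Ls I @ \<phi>s)" "\<lambda>J. wedge (frame N' \<sigma>') (nths Ls' J @ \<psi>s)"])
      also have "\<dots> = (-1) ^ (nat b * length \<phi>s) * (cap_chain N \<Sigma> a \<alpha> \<sigma> \<phi>s * cap_chain N' \<Sigma>' b \<beta> \<sigma>' \<psi>s)"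
        unfolding cap1 cap2 fundamental_chain_top[OF t(1)] fundamental_chain_top'[OF t(2)] by (rule refl)
      finally have val: "\<Psi> (cap_chain NP \<Sigma>P (a + b) \<gamma>) ((\<sigma>, \<phi>s), (\<sigma>', \<psi>s)) = \<dots>" .
      show ?thesis
      \<comment> \<open>Where the value is nonzero, the degrees force \<open>length \<phi>s\<close>
        to be d - a and b to be nonnegative, so the power over \<open>nat\<close> is the parity
        sign.\<close>
      proof (cases "cap_chain N \<Sigma> a \<alpha> \<sigma> \<phi>s * cap_chain N' \<Sigma>' b \<beta> \<sigma>' \<psi>s = 0")
        case False
        then have "int (length \<phi>s) = d - a" using BM_chains_support(3)[OF cap_chain_mem[OF \<Sigma>]] by fastforce
        moreover have "?J \<noteq> {}"
        proof
          assume "?J = {}"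
          then have "cap_chain N' \<Sigma>' b \<beta> \<sigma>' \<psi>s = 0" unfolding cap2 by (simp only: sum.empty)
          then show False using False by simp
        qed
        then have "int (nat b) = b" by auto
        ultimately have "parity_sign (b * (d - a)) = (-1) ^ (nat b * length \<phi>s)"
          using parity_sign_mult[of "nat b" "length \<phi>s"] by simp
        then show ?thesis unfolding val by simp
      qed (simp add: val)
    qed
  qed
  then have "\<Psi> (cap_chain NP \<Sigma>P (a + b) \<gamma>) = (\<lambda>z. parity_sign (b * (d - a)) *
       tensor (case_prod (cap_chain N \<Sigma> a \<alpha>)) (case_prod (cap_chain N' \<Sigma>' b \<beta>)) z)"
    by (auto simp: fun_eq_iff tensor_def)
  then show ?thesis using \<gamma>(1) by (intro that[of \<gamma>]) (simp add: F_upper_def)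
qed

lemma cap_restrict:
  assumes \<gamma>: "\<gamma> \<in> F_upper NP \<Sigma>P a {0}"
  obtains c :: "nat set \<Rightarrow> real" and S and \<theta> where
    "\<And>w. w \<in> F_lower NP \<Sigma>P a {0} \<Longrightarrow> of_int (\<gamma> w) = (\<Sum>k\<in>S. c k * w (\<theta> k))"
    "\<And>k. k \<in> S \<Longrightarrow> int (length (\<theta> k)) = a \<and> (\<forall>L\<in>set (\<theta> k). linear L)"
    "\<And>T \<Theta>. cap_chain NP \<Sigma>P a \<gamma> T \<Theta> = (\<Sum>k\<in>S. c k * fundamental_chain NP \<Sigma>P T (\<theta> k @ \<Theta>))"
proof -
  obtain bs where bs: "lattice_basis bs NP" using NP by (auto simp: lattice_subgroup_def)
  obtain Ls where Ls: "dual_lists bs Ls" by (rule lattice_basis_dual[OF bs])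
  let ?I = "{I. I \<subseteq> {..<length bs} \<and> int (card I) = a}"
  obtain c where c: "\<And>x. x \<in> F_lower NP \<Sigma>P a {0} \<Longrightarrow> of_int (\<gamma> x) = (\<Sum>I\<in>?I. c I * x (nths Ls I))"
    by (rule F_upper_evaluation[OF \<gamma> bs Ls]) (rule that)
  have cap: "cap_chain NP \<Sigma>P a \<gamma> T \<Theta> = (\<Sum>k\<in>?I. c k * fundamental_chain NP \<Sigma>P T (nths Ls k @ \<Theta>))" for T \<Theta>
    by (rule cap_chain_evaluation[OF \<Sigma>P]) (use nths_evaluation_points[OF Ls] c in auto)
  show ?thesis by (rule that[OF c nths_evaluation_points[OF Ls] cap])
qed

text \<open>\<alpha> is \<gamma> restricted to the first axis. The list \<open>Ls'\<close> fills all
  slots of the second factor, so \<open>wedge_absorb_right\<close> leaves the contraction by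
  \<alpha>.\<close>

lemma cap_restrict_left:
  assumes \<gamma>: "\<gamma> \<in> F_upper NP \<Sigma>P a {0}" and \<sigma>': "\<sigma>' \<in> cones \<Sigma>' d'" and d': "dual_lists (frame N' \<sigma>') Ls'"
  obtains \<alpha> where "\<alpha> \<in> F_upper N \<Sigma> a {0}"
    "\<And>\<sigma> \<phi>s. \<Psi> (cap_chain NP \<Sigma>P a \<gamma>) ((\<sigma>, \<phi>s), (\<sigma>', Ls')) = cap_chain N \<Sigma> a \<alpha> \<sigma> \<phi>s"
proof -
  obtain c :: "nat set \<Rightarrow> real" and S \<theta> where
    c: "\<And>w. w \<in> F_lower NP \<Sigma>P a {0} \<Longrightarrow> of_int (\<gamma> w) = (\<Sum>k\<in>S. c k * w (\<theta> k))"
    and \<theta>: "\<And>k. k \<in> S \<Longrightarrow> int (length (\<theta> k)) = a \<and> (\<forall>L\<in>set (\<theta> k). linear L)"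
    and cap: "\<And>T \<Theta>. cap_chain NP \<Sigma>P a \<gamma> T \<Theta> = (\<Sum>k\<in>S. c k * fundamental_chain NP \<Sigma>P T (\<theta> k @ \<Theta>))"
    by (rule cap_restrict[OF \<gamma>]) (rule that)
  define \<theta>1 where "\<theta>1 k = map (\<lambda>L. L \<circ> inl) (\<theta> k)" for k
  have \<theta>1: "int (length (\<theta>1 k)) = a \<and> (\<forall>L\<in>set (\<theta>1 k). linear L)" if "k \<in> S" for k
    using \<theta>[OF that] linear_compose[OF linear_inl] by (auto simp: \<theta>1_def)
  define g where "g x = (\<Sum>k\<in>S. c k * x (\<theta>1 k))" for x :: "'a multivector"
  have g_add: "g (x + y) = g x + g y" for x y by (simp add: g_def distrib_left sum.distrib)
  have g_diff: "diff_op g" unfolding diff_op_def by (simp add: g_def right_diff_distrib sum_subtractf)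
  have Z: "add_subgroup (\<int> :: real set)" by (auto simp: add_subgroup_def)
  have g_int: "g x \<in> \<int>" if x: "x \<in> F_lower N \<Sigma> a {0}" for x
  proof (rule F_lower_diff_op[OF x g_diff Z])
    fix \<eta> vs assume \<eta>: "\<eta> \<in> \<Sigma>" "set vs \<subseteq> sublattice N \<eta>" "int (length vs) = a"
    have m': "\<sigma>' \<in> \<Sigma>'" using \<sigma>' by (simp add: cones_def)
    have "set (map inl vs) \<subseteq> sublattice NP (\<eta> \<times> \<sigma>')"
      using \<eta>(2) add_subgroup_zero[OF add_subgroup_sublattice[OF N', of \<sigma>']]
      by (auto simp: sublattice_Times[OF zero[OF \<eta>(1)] zero'[OF m']])
    then have "wedge (map inl vs) \<in> F_lower NP \<Sigma>P a {0}"
      using \<eta> m' zero zero' by (intro wedge_in_F_lower[of "\<eta> \<times> \<sigma>'"]) (auto simp: Times_mem_iff zero_prod_def)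
    from c[OF this] have "of_int (\<gamma> (wedge (map inl vs))) = g (wedge vs)"
      unfolding g_def using \<theta> by (simp add: wedge_map[OF linear_inl] \<theta>1_def)
    then show "g (wedge vs) \<in> \<int>" by (metis Ints_of_int)
  qed
  obtain \<alpha> where \<alpha>: "\<alpha> \<in> int_dual (F_lower N \<Sigma> a {0})" "\<And>x. x \<in> F_lower N \<Sigma> a {0} \<Longrightarrow> of_int (\<alpha> x) = g x"
    by (rule floor_int_dual[where g = g, OF add_subgroup_F_lower g_add]) (erule g_int, rule that)
  have cap1: "cap_chain N \<Sigma> a \<alpha> \<sigma> \<phi>s = (\<Sum>k\<in>S. c k * fundamental_chain N \<Sigma> \<sigma> (\<theta>1 k @ \<phi>s))" for \<sigma> \<phi>s
    by (rule cap_chain_evaluation[OF \<Sigma>]) (use \<theta>1 \<alpha>(2) in \<open>auto simp: g_def\<close>)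
  have "\<Psi> (cap_chain NP \<Sigma>P a \<gamma>) ((\<sigma>, \<phi>s), (\<sigma>', Ls')) = cap_chain N \<Sigma> a \<alpha> \<sigma> \<phi>s" for \<sigma> \<phi>s
  proof (cases "\<sigma> \<in> cones \<Sigma> d")
    case True
    obtain Ms where Ms: "dual_lists (frame N \<sigma>) Ms" by (rule lattice_basis_dual[OF lattice_basis_frame[OF N]])
    have "\<Psi> (cap_chain NP \<Sigma>P a \<gamma>) ((\<sigma>, \<phi>s), (\<sigma>', Ls')) =
        (\<Sum>k\<in>S. c k * wedge (map inl (frame N \<sigma>) @ map inr (frame N' \<sigma>')) (\<theta> k @ fst_forms \<phi>s @ snd_forms Ls'))"
      unfolding \<Psi>_def split_conv cap sum_distrib_left mult.left_commute[of "ps \<sigma> \<sigma>'"] fundamental_chain_P[OF True \<sigma>']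
      by (rule refl)
    also have "\<dots> = cap_chain N \<Sigma> a \<alpha> \<sigma> \<phi>s"
      unfolding cap1 fundamental_chain_top[OF True] \<theta>1_def
      using wedge_absorb_right[OF Ms d'] \<theta> by (intro sum.cong refl arg_cong2[where f = "(*)"]) blast
    finally show ?thesis .
  next
    case False
    then have "fundamental_chain NP \<Sigma>P (\<sigma> \<times> \<sigma>') \<Theta> = 0" for \<Theta> using fundamental_chain_P_eq_0 by blast
    then have "\<Psi> (cap_chain NP \<Sigma>P a \<gamma>) ((\<sigma>, \<phi>s), (\<sigma>', Ls')) = 0" unfolding \<Psi>_def split_conv cap by simp
    then show ?thesis using False by (simp add: cap_chain_def)
  qed
  then show ?thesis using \<alpha>(1) by (intro that[of \<alpha>]) (simp_all add: F_upper_def)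
qed

text \<open>The forms of \<gamma> pass the full dual list of the first frame, hence the sign of
  \<open>wedge_absorb_left\<close>.\<close>

lemma cap_restrict_right:
  assumes \<gamma>: "\<gamma> \<in> F_upper NP \<Sigma>P a {0}" and \<sigma>: "\<sigma> \<in> cones \<Sigma> d" and d: "dual_lists (frame N \<sigma>) Ls"
  obtains \<alpha> where "\<alpha> \<in> F_upper N' \<Sigma>' a {0}"
    "\<And>\<sigma>' \<psi>s. \<Psi> (cap_chain NP \<Sigma>P a \<gamma>) ((\<sigma>, Ls), (\<sigma>', \<psi>s)) = (-1) ^ (nat a * length (frame N \<sigma>)) * cap_chain N' \<Sigma>' a \<alpha> \<sigma>' \<psi>s"
proof -
  obtain c :: "nat set \<Rightarrow> real" and S \<theta> where
    c: "\<And>w. w \<in> F_lower NP \<Sigma>P a {0} \<Longrightarrow> of_int (\<gamma> w) = (\<Sum>k\<in>S. c k * w (\<theta> k))"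
    and \<theta>: "\<And>k. k \<in> S \<Longrightarrow> int (length (\<theta> k)) = a \<and> (\<forall>L\<in>set (\<theta> k). linear L)"
    and cap: "\<And>T \<Theta>. cap_chain NP \<Sigma>P a \<gamma> T \<Theta> = (\<Sum>k\<in>S. c k * fundamental_chain NP \<Sigma>P T (\<theta> k @ \<Theta>))"
    by (rule cap_restrict[OF \<gamma>]) (rule that)
  define \<theta>1 where "\<theta>1 k = map (\<lambda>L. L \<circ> inr) (\<theta> k)" for k
  have \<theta>1: "int (length (\<theta>1 k)) = a \<and> (\<forall>L\<in>set (\<theta>1 k). linear L)" if "k \<in> S" for k
    using \<theta>[OF that] linear_compose[OF linear_inr] by (auto simp: \<theta>1_def)
  define g where "g x = (\<Sum>k\<in>S. c k * x (\<theta>1 k))" for x :: "'b multivector"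
  have g_add: "g (x + y) = g x + g y" for x y by (simp add: g_def distrib_left sum.distrib)
  have g_diff: "diff_op g" unfolding diff_op_def by (simp add: g_def right_diff_distrib sum_subtractf)
  have Z: "add_subgroup (\<int> :: real set)" by (auto simp: add_subgroup_def)
  have m: "\<sigma> \<in> \<Sigma>" using \<sigma> by (simp add: cones_def)
  have g_int: "g x \<in> \<int>" if x: "x \<in> F_lower N' \<Sigma>' a {0}" for x
  proof (rule F_lower_diff_op[OF x g_diff Z])
    fix \<eta> vs assume \<eta>: "\<eta> \<in> \<Sigma>'" "set vs \<subseteq> sublattice N' \<eta>" "int (length vs) = a"
    have "set (map inr vs) \<subseteq> sublattice NP (\<sigma> \<times> \<eta>)"
      using \<eta>(2) add_subgroup_zero[OF add_subgroup_sublattice[OF N, of \<sigma>]]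
      by (auto simp: sublattice_Times[OF zero[OF m] zero'[OF \<eta>(1)]])
    then have "wedge (map inr vs) \<in> F_lower NP \<Sigma>P a {0}"
      using \<eta> m zero zero' by (intro wedge_in_F_lower[of "\<sigma> \<times> \<eta>"]) (auto simp: Times_mem_iff zero_prod_def)
    from c[OF this] have "of_int (\<gamma> (wedge (map inr vs))) = g (wedge vs)"
      unfolding g_def using \<theta> by (simp add: wedge_map[OF linear_inr] \<theta>1_def)
    then show "g (wedge vs) \<in> \<int>" by (metis Ints_of_int)
  qed
  obtain \<alpha> where \<alpha>: "\<alpha> \<in> int_dual (F_lower N' \<Sigma>' a {0})" "\<And>x. x \<in> F_lower N' \<Sigma>' a {0} \<Longrightarrow> of_int (\<alpha> x) = g x"
    by (rule floor_int_dual[where g = g, OF add_subgroup_F_lower g_add]) (erule g_int, rule that)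
  have cap1: "cap_chain N' \<Sigma>' a \<alpha> \<sigma>' \<psi>s = (\<Sum>k\<in>S. c k * fundamental_chain N' \<Sigma>' \<sigma>' (\<theta>1 k @ \<psi>s))" for \<sigma>' \<psi>s
    by (rule cap_chain_evaluation[OF \<Sigma>']) (use \<theta>1 \<alpha>(2) in \<open>auto simp: g_def\<close>)
  have "\<Psi> (cap_chain NP \<Sigma>P a \<gamma>) ((\<sigma>, Ls), (\<sigma>', \<psi>s)) = (-1) ^ (nat a * length (frame N \<sigma>)) * cap_chain N' \<Sigma>' a \<alpha> \<sigma>' \<psi>s" for \<sigma>' \<psi>s
  proof (cases "\<sigma>' \<in> cones \<Sigma>' d'")
    case True
    obtain Ms where Ms: "dual_lists (frame N' \<sigma>') Ms" by (rule lattice_basis_dual[OF lattice_basis_frame[OF N']])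
    have "\<Psi> (cap_chain NP \<Sigma>P a \<gamma>) ((\<sigma>, Ls), (\<sigma>', \<psi>s)) =
        (\<Sum>k\<in>S. c k * wedge (map inl (frame N \<sigma>) @ map inr (frame N' \<sigma>')) (\<theta> k @ fst_forms Ls @ snd_forms \<psi>s))"
      unfolding \<Psi>_def split_conv cap sum_distrib_left mult.left_commute[of "ps \<sigma> \<sigma>'"] fundamental_chain_P[OF \<sigma> True]
      by (rule refl)
    also have "\<dots> = (-1) ^ (nat a * length (frame N \<sigma>)) * cap_chain N' \<Sigma>' a \<alpha> \<sigma>' \<psi>s"
      unfolding cap1 fundamental_chain_top'[OF True] \<theta>1_def sum_distrib_left
    proof (intro sum.cong refl)
      fix k assume k: "k \<in> S"
      have "length (\<theta> k) = nat a" using \<theta>[OF k] by auto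
      then show "c k * wedge (map inl (frame N \<sigma>) @ map inr (frame N' \<sigma>')) (\<theta> k @ fst_forms Ls @ snd_forms \<psi>s) =
          (-1) ^ (nat a * length (frame N \<sigma>)) * (c k * wedge (frame N' \<sigma>') (map (\<lambda>L. L \<circ> inr) (\<theta> k) @ \<psi>s))"
        using wedge_absorb_left[OF d Ms conjunct2[OF \<theta>[OF k]], of \<psi>s] by (simp only: mult.left_commute)
    qed
    finally show ?thesis .
  next
    case False
    then have "fundamental_chain NP \<Sigma>P (\<sigma> \<times> \<sigma>') \<Theta> = 0" for \<Theta> using fundamental_chain_P_eq_0 by blast
    then have "\<Psi> (cap_chain NP \<Sigma>P a \<gamma>) ((\<sigma>, Ls), (\<sigma>', \<psi>s)) = 0" unfolding \<Psi>_def split_conv cap by simp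
    then show ?thesis using False by (simp add: cap_chain_def)
  qed
  then show ?thesis using \<alpha>(1) by (intro that[of \<alpha>]) (simp_all add: F_upper_def)
qed

end

lemma poincare_duality_cycleD:
  assumes "cone_complex N \<Sigma>" "poincare_duality N \<Sigma>" "q \<noteq> fan_dim \<Sigma>" "c \<in> BM_chains N \<Sigma> p q" "boundary N \<Sigma> c = 0"
  shows "\<exists>b\<in>BM_chains N \<Sigma> p (q + 1). boundary N \<Sigma> b = c"
proof -
  note fin = cone_complex_finite[OF assms(1)]
  have "c \<in> BM_cycles N \<Sigma> p q" using assms by (simp add: BM_cycles_eq fin)
  then have "c \<in> BM_boundaries N \<Sigma> p q" using assms(2,3) unfolding poincare_duality_iff[OF fin] by blast
  then show ?thesis unfolding BM_boundaries_eq[OF fin] by blast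
qed

lemma poincare_duality_capD:
  assumes "cone_complex N \<Sigma>" "poincare_duality N \<Sigma>" "z \<in> BM_chains N \<Sigma> p (fan_dim \<Sigma>)" "boundary N \<Sigma> z = 0"
  shows "\<exists>\<alpha>\<in>F_upper N \<Sigma> (fan_dim \<Sigma> - p) {0}. cap_chain N \<Sigma> (fan_dim \<Sigma> - p) \<alpha> = z"
proof -
  note fin = cone_complex_finite[OF assms(1)]
  let ?a = "fan_dim \<Sigma> - p"
  have "z \<in> BM_cycles N \<Sigma> (fan_dim \<Sigma> - ?a) (fan_dim \<Sigma>)" using assms by (simp add: BM_cycles_eq fin)
  moreover have "bij_betw (cap_chain N \<Sigma> ?a) (F_upper N \<Sigma> ?a {0}) (BM_cycles N \<Sigma> (fan_dim \<Sigma> - ?a) (fan_dim \<Sigma>))"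
    using assms(2) unfolding poincare_duality_iff[OF fin] by blast
  ultimately have "z \<in> cap_chain N \<Sigma> ?a ` F_upper N \<Sigma> ?a {0}" by (simp only: bij_betw_def)
  then show ?thesis by blast
qed

text \<open>Injectivity in top degree is \<open>cap_chain_inj_on\<close>, and caps are cycles
  because the fundamental chain is one; surjectivity and exactness below are what has to be
  supplied.\<close>

lemma poincare_dualityI:
  assumes \<Sigma>: "cone_complex N \<Sigma>"
    and ex: "\<And>p q c. q \<noteq> fan_dim \<Sigma> \<Longrightarrow> c \<in> BM_chains N \<Sigma> p q \<Longrightarrow> boundary N \<Sigma> c = 0 \<Longrightarrow>
      \<exists>b\<in>BM_chains N \<Sigma> p (q + 1). boundary N \<Sigma> b = c"
    and \<nu>: "boundary N \<Sigma> (fundamental_chain N \<Sigma>) = 0"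
    and cap: "\<And>p z. z \<in> BM_chains N \<Sigma> p (fan_dim \<Sigma>) \<Longrightarrow> boundary N \<Sigma> z = 0 \<Longrightarrow>
      \<exists>\<alpha>\<in>F_upper N \<Sigma> (fan_dim \<Sigma> - p) {0}. cap_chain N \<Sigma> (fan_dim \<Sigma> - p) \<alpha> = z"
  shows "poincare_duality N \<Sigma>"
  unfolding poincare_duality_iff[OF cone_complex_finite[OF \<Sigma>]]
proof (intro conjI allI impI)
  note fin = cone_complex_finite[OF \<Sigma>]
  fix p q assume q: "q \<noteq> fan_dim \<Sigma>"
  show "BM_cycles N \<Sigma> p q \<subseteq> BM_boundaries N \<Sigma> p q"
    unfolding BM_boundaries_eq[OF fin] BM_cycles_eq[OF fin]
  proof
    fix c assume "c \<in> {c \<in> BM_chains N \<Sigma> p q. boundary N \<Sigma> c = 0}"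
    then have "\<exists>b\<in>BM_chains N \<Sigma> p (q + 1). boundary N \<Sigma> b = c" using ex[OF q] by blast
    then show "c \<in> boundary N \<Sigma> ` BM_chains N \<Sigma> p (q + 1)" by blast
  qed
next
  note fin = cone_complex_finite[OF \<Sigma>]
  fix p
  show "bij_betw (cap_chain N \<Sigma> p) (F_upper N \<Sigma> p {0}) (BM_cycles N \<Sigma> (fan_dim \<Sigma> - p) (fan_dim \<Sigma>))"
    unfolding bij_betw_def
  proof (intro conjI equalityI subsetI)
    show "inj_on (cap_chain N \<Sigma> p) (F_upper N \<Sigma> p {0})" by (rule cap_chain_inj_on[OF \<Sigma>])
    fix z assume "z \<in> cap_chain N \<Sigma> p ` F_upper N \<Sigma> p {0}"
    then show "z \<in> BM_cycles N \<Sigma> (fan_dim \<Sigma> - p) (fan_dim \<Sigma>)" using cap_chain_cycle[OF \<Sigma> \<nu>] by blast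
  next
    fix z assume "z \<in> BM_cycles N \<Sigma> (fan_dim \<Sigma> - p) (fan_dim \<Sigma>)"
    then have "\<exists>\<alpha>\<in>F_upper N \<Sigma> (fan_dim \<Sigma> - (fan_dim \<Sigma> - p)) {0}. cap_chain N \<Sigma> (fan_dim \<Sigma> - (fan_dim \<Sigma> - p)) \<alpha> = z"
      by (intro cap) (simp_all add: BM_cycles_eq[OF fin])
    moreover have "fan_dim \<Sigma> - (fan_dim \<Sigma> - p) = p" by simp
    ultimately show "z \<in> cap_chain N \<Sigma> p ` F_upper N \<Sigma> p {0}" by auto
  qed
qed

lemma F_upper_minus: "\<alpha> \<in> F_upper N \<Sigma> p \<sigma> \<Longrightarrow> - \<alpha> \<in> F_upper N \<Sigma> p \<sigma>"
  unfolding F_upper_def by (rule add_subgroup_minus[OF add_subgroup_int_dual])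

lemma cap_chain_minus: "cap_chain N \<Sigma> p (- \<alpha>) = - cap_chain N \<Sigma> p \<alpha>"
proof -
  have "cap_chain N \<Sigma> p (0 - \<alpha>) = cap_chain N \<Sigma> p 0 - cap_chain N \<Sigma> p \<alpha>" by (rule cap_chain_diff)
  moreover have "cap_chain N \<Sigma> p 0 = 0" using cap_chain_diff[of N \<Sigma> p 0 0] by (simp only: diff_self)
  ultimately show ?thesis by (simp only: diff_0)
qed

lemma tensor_cancel: "b y = 1 \<Longrightarrow> (\<lambda>x. tensor a b (x, y)) = a"
  and tensor_cancel': "a x = 1 \<Longrightarrow> (\<lambda>y. tensor a b (x, y)) = b"
  by (simp_all add: tensor_def)

context product_complex
begin

lemma slice_left_top:
  assumes top: "\<sigma>' \<in> cones \<Sigma>' d'" "dual_lists (frame N' \<sigma>') Ls'" "chain_degree (\<sigma>', Ls') = (d', d')" and w: "w \<in> K p q"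
  shows "(\<lambda>x. w (x, (\<sigma>', Ls'))) \<in> chain_fun N \<Sigma> (p - d') (q - d')"
    "(\<lambda>x. D w (x, (\<sigma>', Ls'))) = boundary_fun N \<Sigma> (\<lambda>x. w (x, (\<sigma>', Ls')))"
  by (rule slice_left[where ?y0.0 = "(\<sigma>', Ls')"], rule w, rule top(3), erule chain_fun_top_point(1)[OF \<Sigma>' top(1,2)],
      erule chain_fun_top_point(2)[OF \<Sigma>' top(1,2)])+

lemma slice_right_top:
  assumes top: "\<sigma> \<in> cones \<Sigma> d" "dual_lists (frame N \<sigma>) Ls" "chain_degree (\<sigma>, Ls) = (d, d)" and w: "w \<in> K p q"
  shows "(\<lambda>y. w ((\<sigma>, Ls), y)) \<in> chain_fun N' \<Sigma>' (p - d) (q - d)"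
    "(\<lambda>y. D w ((\<sigma>, Ls), y)) = (\<lambda>y. parity_sign d * boundary_fun N' \<Sigma>' (\<lambda>y. w ((\<sigma>, Ls), y)) y)"
  by (rule slice_right[where ?x0.0 = "(\<sigma>, Ls)"], rule w, rule top(3), erule chain_fun_top_point(1)[OF \<Sigma> top(1,2)],
      erule chain_fun_top_point(2)[OF \<Sigma> top(1,2)])+

lemma tensor_cycle:
  assumes "c \<in> BM_chains N \<Sigma> p q" "boundary N \<Sigma> c = 0" "boundary N' \<Sigma>' c' = 0"
  shows "D (tensor (case_prod c) (case_prod c')) = 0"
proof -
  have "case_prod c \<in> chain_fun N \<Sigma> p q" using assms(1) by (auto simp: chain_fun_def)
  moreover have "boundary_fun N \<Sigma> (case_prod c) = 0" "boundary_fun N' \<Sigma>' (case_prod c') = 0"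
    unfolding boundary_fun_case_prod case_prod_eq_0_iff using assms by auto
  ultimately have "D (tensor (case_prod c) (case_prod c')) (x, y) = 0" for x y
    using D_tensor[of "case_prod c" p q "case_prod c'" x y]
    by (simp only: tensor_zero_left tensor_zero_right zero_fun_apply mult_zero_right add_0)
  then show ?thesis by (auto simp: fun_eq_iff)
qed

lemma tensor_chain:
  assumes "c \<in> BM_chains N \<Sigma> p q" "c' \<in> BM_chains N' \<Sigma>' p' q'" "p + p' = r" "q + q' = s"
  obtains e where "e \<in> BM_chains NP \<Sigma>P r s" "\<Psi> e = tensor (case_prod c) (case_prod c')"
proof -
  have "tensor (case_prod c) (case_prod c') \<in> K r s"
    unfolding K_def using assms by (intro tensor_in_tensor_group[of _ _ p q _ _ p' q']) (auto simp: chain_fun_def)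
  from \<Psi>_surj[OF this] that show thesis by blast
qed

lemma fundamental_cycle_P:
  assumes "boundary N \<Sigma> (fundamental_chain N \<Sigma>) = 0" "boundary N' \<Sigma>' (fundamental_chain N' \<Sigma>') = 0"
  shows "boundary NP \<Sigma>P (fundamental_chain NP \<Sigma>P) = 0"
  unfolding \<Psi>_cycle_iff[OF fundamental_chain_mem[OF \<Sigma>P], symmetric] \<Psi>_fundamental_chain
  by (rule tensor_cycle[OF fundamental_chain_mem[OF \<Sigma>] assms])

lemma poincare_duality_TimesI:
  assumes pd: "poincare_duality N \<Sigma>" and pd': "poincare_duality N' \<Sigma>'"
  shows "poincare_duality NP \<Sigma>P"
proof (rule poincare_dualityI[OF \<Sigma>P])
  note ex = poincare_duality_exact[OF \<Sigma> pd] and ex' = poincare_duality_exact[OF \<Sigma>' pd']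
  show \<nu>P: "boundary NP \<Sigma>P (fundamental_chain NP \<Sigma>P) = 0"
    by (rule fundamental_cycle_P[OF poincare_duality_fundamental_cycle[OF \<Sigma> pd] poincare_duality_fundamental_cycle[OF \<Sigma>' pd']])
  fix p q c assume q: "q \<noteq> fan_dim \<Sigma>P" and c: "c \<in> BM_chains NP \<Sigma>P p q" "boundary NP \<Sigma>P c = 0"
  have "D (\<Psi> c) = 0" using c(2) unfolding \<Psi>_cycle_iff[OF c(1)] .
  moreover have "q \<noteq> d + d'" using q fan_dim_P by simp
  ultimately obtain u where u: "u \<in> K p (q + 1)" "D u = \<Psi> c"
    using kunneth_lower[OF ex ex' \<Psi>_mem[OF c(1)]] by blast
  obtain b where b: "b \<in> BM_chains NP \<Sigma>P p (q + 1)" "\<Psi> b = u" using \<Psi>_surj[OF u(1)] by blast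
  have "boundary NP \<Sigma>P b \<in> BM_chains NP \<Sigma>P p q" using boundary_BM_chains[OF finP b(1)] by simp
  moreover have "\<Psi> (boundary NP \<Sigma>P b) = \<Psi> c" unfolding D_\<Psi>[OF b(1), symmetric] b(2) by (rule u(2))
  ultimately have "boundary NP \<Sigma>P b = c" using \<Psi>_eqD[OF _ c(1)] by blast
  then show "\<exists>b\<in>BM_chains NP \<Sigma>P p (q + 1). boundary NP \<Sigma>P b = c" using b(1) by blast
next
  note ex = poincare_duality_exact[OF \<Sigma> pd] and ex' = poincare_duality_exact[OF \<Sigma>' pd']
  fix p z assume z: "z \<in> BM_chains NP \<Sigma>P p (fan_dim \<Sigma>P)" "boundary NP \<Sigma>P z = 0"
  let ?a = "fan_dim \<Sigma>P - p"
  \<comment> \<open>The images of cap products form a group, so only elementary products of top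
    cycles have to be realised.\<close>
  define H where "H = (\<lambda>\<gamma>. \<Psi> (cap_chain NP \<Sigma>P ?a \<gamma>)) ` F_upper NP \<Sigma>P ?a {0}"
  have H: "add_subgroup H"
    unfolding H_def
  proof (rule add_subgroup_image)
    show "add_subgroup (F_upper NP \<Sigma>P ?a {0})" unfolding F_upper_def by (rule add_subgroup_int_dual)
    show "\<Psi> (cap_chain NP \<Sigma>P ?a (x - y)) = \<Psi> (cap_chain NP \<Sigma>P ?a x) - \<Psi> (cap_chain NP \<Sigma>P ?a y)" for x y
      unfolding cap_chain_diff by (rule diff_opD[OF diff_\<Psi>])
  qed
  have "D (\<Psi> z) = 0" using z(2) unfolding \<Psi>_cycle_iff[OF z(1)] .
  then have "\<Psi> z \<in> tensor_group X.top_cycles Y.top_cycles p (fan_dim \<Sigma>P)"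
    using kunneth_top[OF ex ex' \<Psi>_mem[OF z(1)]] fan_dim_P by blast
  then have "id (\<Psi> z) \<in> H"
  proof (rule tensor_group_diff_op[OF _ _ H])
    show "diff_op id" by (simp add: diff_op_def)
    fix x y p1 p2 q1 q2 assume xy: "x \<in> X.top_cycles p1 q1" "y \<in> Y.top_cycles p2 q2" "p1 + p2 = p"
    obtain c where c: "c \<in> BM_chains N \<Sigma> p1 d" "x = case_prod c" "boundary N \<Sigma> c = 0"
      using xy(1) unfolding X.top_cycles_def chain_fun_def by (auto simp only: mem_Collect_eq boundary_fun_case_prod case_prod_eq_0_iff)
    obtain c' where c': "c' \<in> BM_chains N' \<Sigma>' p2 d'" "y = case_prod c'" "boundary N' \<Sigma>' c' = 0"
      using xy(2) unfolding Y.top_cycles_def chain_fun_def by (auto simp only: mem_Collect_eq boundary_fun_case_prod case_prod_eq_0_iff)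
    obtain \<alpha> where \<alpha>: "\<alpha> \<in> F_upper N \<Sigma> (d - p1) {0}" "cap_chain N \<Sigma> (d - p1) \<alpha> = c"
      using poincare_duality_capD[OF \<Sigma> pd c(1,3)] by blast
    obtain \<beta> where \<beta>: "\<beta> \<in> F_upper N' \<Sigma>' (d' - p2) {0}" "cap_chain N' \<Sigma>' (d' - p2) \<beta> = c'"
      using poincare_duality_capD[OF \<Sigma>' pd' c'(1,3)] by blast
    have a: "(d - p1) + (d' - p2) = ?a" using xy(3) fan_dim_P by simp
    obtain \<gamma> where \<gamma>: "\<gamma> \<in> F_upper NP \<Sigma>P ?a {0}"
      "\<Psi> (cap_chain NP \<Sigma>P ?a \<gamma>) = (\<lambda>z. parity_sign ((d' - p2) * (d - (d - p1))) * tensor x y z)"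
      using cap_tensor[OF \<alpha>(1) \<beta>(1)] unfolding a \<alpha>(2) \<beta>(2) c(2) c'(2) by blast
    have "\<Psi> (cap_chain NP \<Sigma>P ?a \<gamma>) \<in> H" unfolding H_def using \<gamma>(1) by blast
    \<comment> \<open>\<open>cap_tensor\<close> realises the product up to sign; \<open>H\<close> is
      closed under signs, and the two signs cancel.\<close>
    from add_subgroup_sign[OF H this, of "(d' - p2) * (d - (d - p1))"]
    have "(\<lambda>z. parity_sign ((d' - p2) * (d - (d - p1))) * (parity_sign ((d' - p2) * (d - (d - p1))) * tensor x y z)) \<in> H"
      unfolding \<gamma>(2) .
    moreover have "(\<lambda>z. parity_sign k * (parity_sign k * tensor x y z)) = tensor x y" for k
      by (simp add: parity_sign_def)
    ultimately show "id (tensor x y) \<in> H" by (simp only: id_apply)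
  qed
  then obtain \<gamma> where \<gamma>: "\<gamma> \<in> F_upper NP \<Sigma>P ?a {0}" "\<Psi> z = \<Psi> (cap_chain NP \<Sigma>P ?a \<gamma>)" by (auto simp: H_def)
  have "cap_chain NP \<Sigma>P ?a \<gamma> \<in> BM_chains NP \<Sigma>P p (fan_dim \<Sigma>P)" using cap_chain_mem[OF \<Sigma>P, of ?a \<gamma>] by simp
  from \<Psi>_eqD[OF this z(1)] \<gamma> show "\<exists>\<alpha>\<in>F_upper NP \<Sigma>P ?a {0}. cap_chain NP \<Sigma>P ?a \<alpha> = z" by metis
qed

text \<open>The fundamental chain of the product corresponds to the tensor of those of the factors;
  slicing its boundary at a point where the second one is 1 leaves the boundary of the
  first.\<close>

lemma poincare_duality_Times_leftD:
  assumes pd: "poincare_duality NP \<Sigma>P"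
  shows "boundary N \<Sigma> (fundamental_chain N \<Sigma>) = 0"
proof -
  obtain \<sigma>' Ls' where top: "\<sigma>' \<in> cones \<Sigma>' d'" "dual_lists (frame N' \<sigma>') Ls'"
      "chain_degree (\<sigma>', Ls') = (d', d')" "fundamental_chain N' \<Sigma>' \<sigma>' Ls' = 1"
    by (rule top_cone_exists[OF \<Sigma>']) (rule that)
  let ?y = "(\<sigma>', Ls')"
  have "D (tensor \<nu> \<nu>') = 0"
    using poincare_duality_fundamental_cycle[OF \<Sigma>P pd]
    unfolding \<Psi>_cycle_iff[OF fundamental_chain_mem[OF \<Sigma>P], symmetric] \<Psi>_fundamental_chain .
  moreover have "tensor \<nu> \<nu>' \<in> K (d + d') (d + d')"
    unfolding K_def using \<nu>_mem \<nu>'_mem by (rule tensor_in_tensor_group) (rule refl)+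
  from slice_left_top(2)[OF top(1-3) this] have "(\<lambda>x. D (tensor \<nu> \<nu>') (x, ?y)) = boundary_fun N \<Sigma> \<nu>"
    by (simp add: tensor_def top(4))
  ultimately have "boundary_fun N \<Sigma> \<nu> = 0" by (simp add: fun_eq_iff)
  then show ?thesis by (simp only: boundary_fun_case_prod case_prod_eq_0_iff)
qed

lemma poincare_duality_Times_rightD:
  assumes pd: "poincare_duality NP \<Sigma>P"
  shows "boundary N' \<Sigma>' (fundamental_chain N' \<Sigma>') = 0"
proof -
  obtain \<sigma> Ls where top: "\<sigma> \<in> cones \<Sigma> d" "dual_lists (frame N \<sigma>) Ls"
      "chain_degree (\<sigma>, Ls) = (d, d)" "fundamental_chain N \<Sigma> \<sigma> Ls = 1"
    by (rule top_cone_exists[OF \<Sigma>]) (rule that)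
  let ?x = "(\<sigma>, Ls)"
  have "D (tensor \<nu> \<nu>') = 0"
    using poincare_duality_fundamental_cycle[OF \<Sigma>P pd]
    unfolding \<Psi>_cycle_iff[OF fundamental_chain_mem[OF \<Sigma>P], symmetric] \<Psi>_fundamental_chain .
  moreover have "tensor \<nu> \<nu>' \<in> K (d + d') (d + d')"
    unfolding K_def using \<nu>_mem \<nu>'_mem by (rule tensor_in_tensor_group) (rule refl)+
  from slice_right_top(2)[OF top(1-3) this] have "(\<lambda>y. D (tensor \<nu> \<nu>') (?x, y)) = (\<lambda>y. parity_sign d * boundary_fun N' \<Sigma>' \<nu>' y)"
    by (simp add: tensor_def top(4))
  ultimately have "boundary_fun N' \<Sigma>' \<nu>' = 0" by (simp add: fun_eq_iff parity_sign_def split: if_splits)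
  then show ?thesis by (simp only: boundary_fun_case_prod case_prod_eq_0_iff)
qed

lemma poincare_duality_Times_left:
  assumes pd: "poincare_duality NP \<Sigma>P"
  shows "poincare_duality N \<Sigma>"
proof -
  obtain \<sigma>' Ls' where top: "\<sigma>' \<in> cones \<Sigma>' d'" "dual_lists (frame N' \<sigma>') Ls'"
      "chain_degree (\<sigma>', Ls') = (d', d')" "fundamental_chain N' \<Sigma>' \<sigma>' Ls' = 1"
    by (rule top_cone_exists[OF \<Sigma>']) (rule that)
  let ?y = "(\<sigma>', Ls')"
  have cancel: "(\<lambda>x. tensor (case_prod c) \<nu>' (x, ?y)) = case_prod c" for c :: "'a set \<Rightarrow> 'a multivector"
    using top(4) by (intro tensor_cancel) simp
  note cyc' = poincare_duality_Times_rightD[OF pd]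
  show ?thesis
  proof (rule poincare_dualityI[OF \<Sigma> _ poincare_duality_Times_leftD[OF pd]])
    fix p q c assume q: "q \<noteq> d" and c: "c \<in> BM_chains N \<Sigma> p q" "boundary N \<Sigma> c = 0"
    obtain e where e: "e \<in> BM_chains NP \<Sigma>P (p + d') (q + d')" "\<Psi> e = tensor (case_prod c) \<nu>'"
      by (rule tensor_chain[OF c(1) fundamental_chain_mem[OF \<Sigma>'] refl refl]) (rule that)
    have "boundary NP \<Sigma>P e = 0"
      unfolding \<Psi>_cycle_iff[OF e(1), symmetric] e(2) by (rule tensor_cycle[OF c cyc'])
    moreover have "q + d' \<noteq> fan_dim \<Sigma>P" using q fan_dim_P by simp
    ultimately obtain b where b: "b \<in> BM_chains NP \<Sigma>P (p + d') (q + d' + 1)" "boundary NP \<Sigma>P b = e"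
      using poincare_duality_cycleD[OF \<Sigma>P pd _ e(1)] by blast
    have Db: "D (\<Psi> b) = tensor (case_prod c) \<nu>'" unfolding D_\<Psi>[OF b(1)] b(2) by (rule e(2))
    \<comment> \<open>The slice of a chain bounding the product of \<open>c\<close> with \<nu>'
      bounds \<open>c\<close>; the degree shift by \<open>d'\<close> is undone.\<close>
    have "(\<lambda>x. \<Psi> b (x, ?y)) \<in> chain_fun N \<Sigma> (p + d' - d') (q + d' + 1 - d')"
      by (rule slice_left_top(1)[OF top(1-3) \<Psi>_mem[OF b(1)]])
    then obtain g where g: "g \<in> BM_chains N \<Sigma> p (q + 1)" "(\<lambda>x. \<Psi> b (x, ?y)) = case_prod g"
      by (auto simp: chain_fun_def)
    have "case_prod c = boundary_fun N \<Sigma> (\<lambda>x. \<Psi> b (x, ?y))"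
      using slice_left_top(2)[OF top(1-3) \<Psi>_mem[OF b(1)]] unfolding Db cancel .
    then have "boundary N \<Sigma> g = c" unfolding g(2) boundary_fun_case_prod case_prod_inject by (rule sym)
    then show "\<exists>b\<in>BM_chains N \<Sigma> p (q + 1). boundary N \<Sigma> b = c" using g(1) by blast
  next
    fix p c assume c: "c \<in> BM_chains N \<Sigma> p d" "boundary N \<Sigma> c = 0"
    obtain e where e: "e \<in> BM_chains NP \<Sigma>P (p + d') (fan_dim \<Sigma>P)" "\<Psi> e = tensor (case_prod c) \<nu>'"
      by (rule tensor_chain[OF c(1) fundamental_chain_mem[OF \<Sigma>'] refl fan_dim_P[symmetric]]) (rule that)
    have "boundary NP \<Sigma>P e = 0"
      unfolding \<Psi>_cycle_iff[OF e(1), symmetric] e(2) by (rule tensor_cycle[OF c cyc'])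
    moreover have a: "fan_dim \<Sigma>P - (p + d') = d - p" using fan_dim_P by simp
    ultimately obtain \<gamma> where \<gamma>: "\<gamma> \<in> F_upper NP \<Sigma>P (d - p) {0}" "cap_chain NP \<Sigma>P (d - p) \<gamma> = e"
      using poincare_duality_capD[OF \<Sigma>P pd e(1)] unfolding a by blast
    obtain \<alpha> where \<alpha>: "\<alpha> \<in> F_upper N \<Sigma> (d - p) {0}"
      "\<And>\<sigma> \<phi>s. \<Psi> (cap_chain NP \<Sigma>P (d - p) \<gamma>) ((\<sigma>, \<phi>s), ?y) = cap_chain N \<Sigma> (d - p) \<alpha> \<sigma> \<phi>s"
      by (rule cap_restrict_left[OF \<gamma>(1) top(1,2)]) (rule that)
    have "cap_chain N \<Sigma> (d - p) \<alpha> \<sigma> \<phi>s = c \<sigma> \<phi>s" for \<sigma> \<phi>s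
      unfolding \<alpha>(2)[symmetric] \<gamma>(2) e(2) using fun_cong[OF cancel[of c], of "(\<sigma>, \<phi>s)"] by simp
    then show "\<exists>\<alpha>\<in>F_upper N \<Sigma> (d - p) {0}. cap_chain N \<Sigma> (d - p) \<alpha> = c" using \<alpha>(1) by (auto simp: fun_eq_iff)
  qed
qed

lemma poincare_duality_Times_right:
  assumes pd: "poincare_duality NP \<Sigma>P"
  shows "poincare_duality N' \<Sigma>'"
proof -
  obtain \<sigma> Ls where top: "\<sigma> \<in> cones \<Sigma> d" "dual_lists (frame N \<sigma>) Ls"
      "chain_degree (\<sigma>, Ls) = (d, d)" "fundamental_chain N \<Sigma> \<sigma> Ls = 1"
    by (rule top_cone_exists[OF \<Sigma>]) (rule that)
  let ?x = "(\<sigma>, Ls)"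
  have cancel: "(\<lambda>y. tensor \<nu> (case_prod c) (?x, y)) = case_prod c" for c :: "'b set \<Rightarrow> 'b multivector"
    using top(4) by (intro tensor_cancel') simp
  note cyc = poincare_duality_Times_leftD[OF pd]
  show ?thesis
  proof (rule poincare_dualityI[OF \<Sigma>' _ poincare_duality_Times_rightD[OF pd]])
    fix p q c assume q: "q \<noteq> d'" and c: "c \<in> BM_chains N' \<Sigma>' p q" "boundary N' \<Sigma>' c = 0"
    obtain e where e: "e \<in> BM_chains NP \<Sigma>P (d + p) (d + q)" "\<Psi> e = tensor \<nu> (case_prod c)"
      by (rule tensor_chain[OF fundamental_chain_mem[OF \<Sigma>] c(1) refl refl]) (rule that)
    have "boundary NP \<Sigma>P e = 0"
      unfolding \<Psi>_cycle_iff[OF e(1), symmetric] e(2) by (rule tensor_cycle[OF fundamental_chain_mem[OF \<Sigma>] cyc c(2)])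
    moreover have "d + q \<noteq> fan_dim \<Sigma>P" using q fan_dim_P by simp
    ultimately obtain b where b: "b \<in> BM_chains NP \<Sigma>P (d + p) (d + q + 1)" "boundary NP \<Sigma>P b = e"
      using poincare_duality_cycleD[OF \<Sigma>P pd _ e(1)] by blast
    have Db: "D (\<Psi> b) = tensor \<nu> (case_prod c)" unfolding D_\<Psi>[OF b(1)] b(2) by (rule e(2))
    let ?s = "\<lambda>y. \<Psi> b (?x, y)"
    have "?s \<in> chain_fun N' \<Sigma>' (d + p - d) (d + q + 1 - d)"
      by (rule slice_right_top(1)[OF top(1-3) \<Psi>_mem[OF b(1)]])
    then have "?s \<in> chain_fun N' \<Sigma>' p (q + 1)" by (simp add: algebra_simps)
    \<comment> \<open>On the right the slice bounds \<open>c\<close> only up to the Koszul sign,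
      which is moved into the chain.\<close>
    from add_subgroup_sign[OF Y.subgroup this, of d]
    obtain g where g: "g \<in> BM_chains N' \<Sigma>' p (q + 1)" "(\<lambda>y. parity_sign d * ?s y) = case_prod g"
      by (auto simp: chain_fun_def)
    have "case_prod c = (\<lambda>y. parity_sign d * boundary_fun N' \<Sigma>' ?s y)"
      using slice_right_top(2)[OF top(1-3) \<Psi>_mem[OF b(1)]] unfolding Db cancel .
    also have "\<dots> = boundary_fun N' \<Sigma>' (case_prod g)"
      unfolding g(2)[symmetric] using lin_op_scale[OF Y.lin_d, of "parity_sign d" ?s] by (intro ext) (rule sym)
    finally have "boundary N' \<Sigma>' g = c" unfolding boundary_fun_case_prod case_prod_inject by (rule sym)
    then show "\<exists>b\<in>BM_chains N' \<Sigma>' p (q + 1). boundary N' \<Sigma>' b = c" using g(1) by blast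
  next
    fix p c assume c: "c \<in> BM_chains N' \<Sigma>' p d'" "boundary N' \<Sigma>' c = 0"
    obtain e where e: "e \<in> BM_chains NP \<Sigma>P (d + p) (fan_dim \<Sigma>P)" "\<Psi> e = tensor \<nu> (case_prod c)"
      by (rule tensor_chain[OF fundamental_chain_mem[OF \<Sigma>] c(1) refl fan_dim_P[symmetric]]) (rule that)
    have "boundary NP \<Sigma>P e = 0"
      unfolding \<Psi>_cycle_iff[OF e(1), symmetric] e(2) by (rule tensor_cycle[OF fundamental_chain_mem[OF \<Sigma>] cyc c(2)])
    moreover have a: "fan_dim \<Sigma>P - (d + p) = d' - p" using fan_dim_P by simp
    ultimately obtain \<gamma> where \<gamma>: "\<gamma> \<in> F_upper NP \<Sigma>P (d' - p) {0}" "cap_chain NP \<Sigma>P (d' - p) \<gamma> = e"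
      using poincare_duality_capD[OF \<Sigma>P pd e(1)] unfolding a by blast
    let ?n = "nat (d' - p) * length (frame N \<sigma>)"
    obtain \<alpha> where \<alpha>: "\<alpha> \<in> F_upper N' \<Sigma>' (d' - p) {0}"
      "\<And>\<sigma>' \<psi>s. \<Psi> (cap_chain NP \<Sigma>P (d' - p) \<gamma>) (?x, (\<sigma>', \<psi>s)) = (-1) ^ ?n * cap_chain N' \<Sigma>' (d' - p) \<alpha> \<sigma>' \<psi>s"
      by (rule cap_restrict_right[OF \<gamma>(1) top(1,2)]) (rule that)
    have *: "(-1) ^ ?n * cap_chain N' \<Sigma>' (d' - p) \<alpha> \<sigma>' \<psi>s = c \<sigma>' \<psi>s" for \<sigma>' \<psi>s
      unfolding \<alpha>(2)[symmetric] \<gamma>(2) e(2) using fun_cong[OF cancel[of c], of "(\<sigma>', \<psi>s)"] by simp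
    show "\<exists>\<alpha>\<in>F_upper N' \<Sigma>' (d' - p) {0}. cap_chain N' \<Sigma>' (d' - p) \<alpha> = c"
    \<comment> \<open>The sign from \<open>cap_restrict_right\<close> is absorbed by replacing
      \<alpha> with its negative.\<close>
    proof (cases "even ?n")
      case True
      then have "cap_chain N' \<Sigma>' (d' - p) \<alpha> = c" using * by (simp add: fun_eq_iff)
      then show ?thesis using \<alpha>(1) by blast
    next
      case False
      then have "cap_chain N' \<Sigma>' (d' - p) (- \<alpha>) = c" unfolding cap_chain_minus using * by (simp add: fun_eq_iff)
      then show ?thesis using F_upper_minus[OF \<alpha>(1)] by blast
    qed
  qed
qed

lemma poincare_duality_Times: "poincare_duality NP \<Sigma>P \<longleftrightarrow> poincare_duality N \<Sigma> \<and> poincare_duality N' \<Sigma>'"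
  using poincare_duality_TimesI poincare_duality_Times_left poincare_duality_Times_right by blast

end

section \<open>Products of tropical fans\<close>

lemma tropical_fan_cone_complex: "tropical_fan N \<Sigma> \<Longrightarrow> cone_complex N \<Sigma>"
  by (auto simp: tropical_fan_def rational_fan_def cone_complex_def)

lemma strongly_convex_Times:
  assumes "strongly_convex A" "strongly_convex B"
  shows "strongly_convex (A \<times> B)"
proof -
  have "uminus ` (A \<times> B) = uminus ` A \<times> uminus ` B" by force
  then show ?thesis using assms by (simp add: strongly_convex_def Times_Int_Times zero_prod_def)
qed

lemma rational_fan_Times:
  assumes \<Sigma>: "rational_fan N \<Sigma>" and \<Sigma>': "rational_fan N' \<Sigma>'"
  shows "rational_fan (N \<times> N') (product_fan \<Sigma> \<Sigma>')"
  unfolding rational_fan_def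
proof (intro conjI ballI allI impI)
  have N: "lattice_subgroup N" "lattice_subgroup N'" using assms by (auto simp: rational_fan_def)
  then show "lattice_subgroup (N \<times> N')" by (rule lattice_subgroup_Times)
  show "finite (product_fan \<Sigma> \<Sigma>')" "product_fan \<Sigma> \<Sigma>' \<noteq> {}"
    using assms by (auto simp: rational_fan_def product_fan_def)
  fix S assume "S \<in> product_fan \<Sigma> \<Sigma>'"
  then obtain \<sigma> \<sigma>' where S: "\<sigma> \<in> \<Sigma>" "\<sigma>' \<in> \<Sigma>'" "S = \<sigma> \<times> \<sigma>'" by (auto simp: product_fan_def)
  show "rational_cone (N \<times> N') S" "strongly_convex S"
    unfolding S(3) using S assms lattice_subgroup_0[OF N(1)] lattice_subgroup_0[OF N(2)]
    by (auto simp: rational_fan_def intro!: rational_cone_Times strongly_convex_Times)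
  show "T \<in> product_fan \<Sigma> \<Sigma>'" if T: "T \<noteq> {} \<and> T face_of S" for T
  proof -
    obtain F F' where F: "F face_of \<sigma>" "F' face_of \<sigma>'" "T = F \<times> F'"
      using T unfolding S(3) face_of_Times_decomp by blast
    have "F \<noteq> {}" "F' \<noteq> {}" using T F(3) by auto
    then have "F \<in> \<Sigma>" "F' \<in> \<Sigma>'" using S(1,2) F(1,2) assms by (simp_all add: rational_fan_def)
    then show ?thesis unfolding F(3) product_fan_def by blast
  qed
  fix T assume "T \<in> product_fan \<Sigma> \<Sigma>'"
  then obtain \<tau> \<tau>' where T: "\<tau> \<in> \<Sigma>" "\<tau>' \<in> \<Sigma>'" "T = \<tau> \<times> \<tau>'" by (auto simp: product_fan_def)
  show "S \<inter> T face_of S" "S \<inter> T face_of T"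
    unfolding S(3) T(3) Times_Int_Times
    by (intro face_of_Times; use S(1,2) T(1,2) assms in \<open>simp add: rational_fan_def\<close>)+
qed

text \<open>Balancing sums over cones containing \<tau>, whereas the facet lemmas ask for faces; the
  intersection axiom of a fan connects the two.\<close>

lemma rational_fan_subset_face:
  assumes "rational_fan N \<Sigma>" "\<tau> \<in> \<Sigma>" "\<sigma> \<in> \<Sigma>" "\<tau> \<subseteq> \<sigma>"
  shows "\<tau> face_of \<sigma>"
proof -
  have "\<sigma> \<inter> \<tau> face_of \<sigma>" using assms by (simp add: rational_fan_def)
  moreover have "\<sigma> \<inter> \<tau> = \<tau>" using assms(4) by blast
  ultimately show ?thesis by simp
qed

lemma sum_Pair_left: "(\<Sum>x\<in>A. (f x, 0)) = (sum f A, 0)" and sum_Pair_right: "(\<Sum>x\<in>A. (0, f x)) = (0, sum f A)"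
  by (simp_all add: prod_eq_iff fst_sum snd_sum)

text \<open>A cone of codimension one in the product has a top cone as one factor and one of
  codimension one as the other. A top cone is contained only in itself, so the sum of normal vectors
  is the balancing sum of one factor, placed on its axis.\<close>

lemma tropical_fan_Times:
  assumes trop: "tropical_fan N \<Sigma>" and trop': "tropical_fan N' \<Sigma>'"
  shows "tropical_fan (N \<times> N') (product_fan \<Sigma> \<Sigma>')"
  unfolding tropical_fan_def
proof (intro conjI ballI)
  note cc = tropical_fan_cone_complex[OF trop] and cc' = tropical_fan_cone_complex[OF trop']
  interpret product_complex N \<Sigma> N' \<Sigma>' using cc cc' by unfold_locales
  have rf: "rational_fan N \<Sigma>" and rf': "rational_fan N' \<Sigma>'" using assms by (auto simp: tropical_fan_def)
  show rfP: "rational_fan NP \<Sigma>P" by (rule rational_fan_Times[OF rf rf'])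
  show "pure_dimensional \<Sigma>P" using \<Sigma>P by (simp add: cone_complex_def)
  have eqI: "\<tau> = \<sigma>" if "\<tau> \<in> \<Sigma>" "\<sigma> \<in> \<Sigma>" "\<tau> \<subseteq> \<sigma>" "dim \<tau> = dim \<sigma>" for \<tau> \<sigma>
    using face_eq_of_dim_eq[OF cc that(1,2) rational_fan_subset_face[OF rf that(1-3)] that(4)] .
  have eqI': "\<tau> = \<sigma>" if "\<tau> \<in> \<Sigma>'" "\<sigma> \<in> \<Sigma>'" "\<tau> \<subseteq> \<sigma>" "dim \<tau> = dim \<sigma>" for \<tau> \<sigma>
    using face_eq_of_dim_eq[OF cc' that(1,2) rational_fan_subset_face[OF rf' that(1-3)] that(4)] .
  fix T assume T: "T \<in> cones \<Sigma>P (fan_dim \<Sigma>P - 1)"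
  then obtain \<tau> \<tau>' where \<tau>: "\<tau> \<in> \<Sigma>" "\<tau>' \<in> \<Sigma>'" "T = \<tau> \<times> \<tau>'" by (auto simp: product_fan_def cones_def)
  have dims: "int (dim \<tau>) + int (dim \<tau>') = d + d' - 1" using T \<tau> by (simp add: cones_def dim_P fan_dim_P)
  have memP: "S \<in> cones \<Sigma>P (fan_dim \<Sigma>P) \<Longrightarrow> \<exists>\<sigma> \<sigma>'. S = \<sigma> \<times> \<sigma>' \<and> \<sigma> \<in> cones \<Sigma> d \<and> \<sigma>' \<in> cones \<Sigma>' d'" for S
  proof -
    assume S: "S \<in> cones \<Sigma>P (fan_dim \<Sigma>P)"
    then obtain \<sigma> \<sigma>' where "S = \<sigma> \<times> \<sigma>'" by (auto simp: cones_def product_fan_def)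
    then show ?thesis using S top_cone_P by blast
  qed
  have facetP: "facet_pair NP (\<tau> \<times> \<tau>') (\<sigma> \<times> \<sigma>')"
    if "\<sigma> \<in> cones \<Sigma> d" "\<sigma>' \<in> cones \<Sigma>' d'" "\<tau> \<subseteq> \<sigma>" "\<tau>' \<subseteq> \<sigma>'" for \<sigma> \<sigma>'
  proof (rule cone_complex_facet_pair[OF \<Sigma>P])
    have m: "\<sigma> \<in> \<Sigma>" "\<sigma>' \<in> \<Sigma>'" using that by (auto simp: cones_def)
    show "\<tau> \<times> \<tau>' \<in> \<Sigma>P" "\<sigma> \<times> \<sigma>' \<in> \<Sigma>P" using \<tau> m by (auto simp: Times_mem_iff)
    then show "\<tau> \<times> \<tau>' face_of \<sigma> \<times> \<sigma>'" using that by (intro rational_fan_subset_face[OF rfP]) auto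
    show "dim (\<sigma> \<times> \<sigma>') = Suc (dim (\<tau> \<times> \<tau>'))" using that \<tau> m dims by (simp add: dim_P cones_def)
  qed
  show "(\<Sum>S\<in>{S \<in> cones \<Sigma>P (fan_dim \<Sigma>P). T \<subseteq> S}. normal_gen NP T S) = 0"
  proof (cases "int (dim \<tau>') = d'")
    case True
    then have \<tau>'t: "\<tau>' \<in> cones \<Sigma>' d'" and \<tau>c: "\<tau> \<in> cones \<Sigma> (d - 1)" using dims \<tau> by (auto simp: cones_def)
    let ?A = "{\<sigma> \<in> cones \<Sigma> d. \<tau> \<subseteq> \<sigma>}"
    have img: "{S \<in> cones \<Sigma>P (fan_dim \<Sigma>P). T \<subseteq> S} = (\<lambda>\<sigma>. \<sigma> \<times> \<tau>') ` ?A"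
    proof (intro equalityI subsetI)
      fix S assume "S \<in> {S \<in> cones \<Sigma>P (fan_dim \<Sigma>P). T \<subseteq> S}"
      then have S0: "S \<in> cones \<Sigma>P (fan_dim \<Sigma>P)" "T \<subseteq> S" by simp_all
      obtain \<sigma> \<sigma>' where S: "S = \<sigma> \<times> \<sigma>'" "\<sigma> \<in> cones \<Sigma> d" "\<sigma>' \<in> cones \<Sigma>' d'"
        using memP[OF S0(1)] by (elim exE conjE)
      have "\<tau> \<subseteq> \<sigma>" "\<tau>' \<subseteq> \<sigma>'" using S0(2) unfolding S(1) \<tau>(3) sub_P[OF \<tau>(1,2)] by simp_all
      then show "S \<in> (\<lambda>\<sigma>. \<sigma> \<times> \<tau>') ` ?A" using S eqI'[OF \<tau>(2), of \<sigma>'] True by (auto simp: cones_def)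
    next
      fix S assume "S \<in> (\<lambda>\<sigma>. \<sigma> \<times> \<tau>') ` ?A"
      then show "S \<in> {S \<in> cones \<Sigma>P (fan_dim \<Sigma>P). T \<subseteq> S}" using \<tau>'t \<tau>(3) by (auto simp: top_cone_P)
    qed
    have inj: "inj_on (\<lambda>\<sigma>. \<sigma> \<times> \<tau>') ?A" using zero'[OF \<tau>(2)] by (auto simp: inj_on_def times_eq_iff)
    have ng: "normal_gen NP T (\<sigma> \<times> \<tau>') = (normal_gen N \<tau> \<sigma>, 0)" if "\<sigma> \<in> ?A" for \<sigma>
    proof -
      have m: "\<sigma> \<in> \<Sigma>" using that by (auto simp: cones_def)
      have "facet_pair N \<tau> \<sigma>"
        using that \<tau>c m by (intro cone_complex_facet_pair[OF cc \<tau>(1) m] rational_fan_subset_face[OF rf \<tau>(1) m]) (auto simp: cones_def)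
      then show ?thesis unfolding \<tau>(3)
        using normal_gen_Times_left[OF _ facetP zero[OF \<tau>(1)] zero[OF m] zero'[OF \<tau>(2)] N'] that \<tau>'t by simp
    qed
    have "(\<Sum>\<sigma>\<in>?A. normal_gen N \<tau> \<sigma>) = 0" using trop \<tau>c by (simp add: tropical_fan_def)
    moreover have "(\<Sum>\<sigma>\<in>?A. normal_gen NP T (\<sigma> \<times> \<tau>')) = (\<Sum>\<sigma>\<in>?A. (normal_gen N \<tau> \<sigma>, 0))"
      using ng by (intro sum.cong refl)
    ultimately show ?thesis unfolding img sum.reindex[OF inj] comp_def by (simp only: sum_Pair_left zero_prod_def)
  next
    case False
    then have dt: "int (dim \<tau>) = d" "int (dim \<tau>') = d' - 1"
      using dims dim_le_fan_dim[OF fin \<tau>(1)] dim_le_fan_dim[OF fin' \<tau>(2)] by auto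
    then have \<tau>t: "\<tau> \<in> cones \<Sigma> d" and \<tau>'c: "\<tau>' \<in> cones \<Sigma>' (d' - 1)" using \<tau> by (auto simp: cones_def)
    let ?A = "{\<sigma> \<in> cones \<Sigma>' d'. \<tau>' \<subseteq> \<sigma>}"
    have img: "{S \<in> cones \<Sigma>P (fan_dim \<Sigma>P). T \<subseteq> S} = (\<lambda>\<sigma>. \<tau> \<times> \<sigma>) ` ?A"
    proof (intro equalityI subsetI)
      fix S assume "S \<in> {S \<in> cones \<Sigma>P (fan_dim \<Sigma>P). T \<subseteq> S}"
      then have S0: "S \<in> cones \<Sigma>P (fan_dim \<Sigma>P)" "T \<subseteq> S" by simp_all
      obtain \<sigma> \<sigma>' where S: "S = \<sigma> \<times> \<sigma>'" "\<sigma> \<in> cones \<Sigma> d" "\<sigma>' \<in> cones \<Sigma>' d'"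
        using memP[OF S0(1)] by (elim exE conjE)
      have "\<tau> \<subseteq> \<sigma>" "\<tau>' \<subseteq> \<sigma>'" using S0(2) unfolding S(1) \<tau>(3) sub_P[OF \<tau>(1,2)] by simp_all
      then show "S \<in> (\<lambda>\<sigma>. \<tau> \<times> \<sigma>) ` ?A" using S eqI[OF \<tau>(1), of \<sigma>] dt by (auto simp: cones_def)
    next
      fix S assume "S \<in> (\<lambda>\<sigma>. \<tau> \<times> \<sigma>) ` ?A"
      then show "S \<in> {S \<in> cones \<Sigma>P (fan_dim \<Sigma>P). T \<subseteq> S}" using \<tau>t \<tau>(3) by (auto simp: top_cone_P)
    qed
    have inj: "inj_on (\<lambda>\<sigma>. \<tau> \<times> \<sigma>) ?A" using zero[OF \<tau>(1)] by (auto simp: inj_on_def times_eq_iff)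
    have ng: "normal_gen NP T (\<tau> \<times> \<sigma>) = (0, normal_gen N' \<tau>' \<sigma>)" if "\<sigma> \<in> ?A" for \<sigma>
    proof -
      have m: "\<sigma> \<in> \<Sigma>'" using that by (auto simp: cones_def)
      have "facet_pair N' \<tau>' \<sigma>"
        using that \<tau>'c m by (intro cone_complex_facet_pair[OF cc' \<tau>(2) m] rational_fan_subset_face[OF rf' \<tau>(2) m]) (auto simp: cones_def)
      then show ?thesis unfolding \<tau>(3)
        using normal_gen_Times_right[OF _ facetP zero[OF \<tau>(1)] zero'[OF \<tau>(2)] zero'[OF m] N] that \<tau>t by simp
    qed
    have "(\<Sum>\<sigma>\<in>?A. normal_gen N' \<tau>' \<sigma>) = 0" using trop' \<tau>'c by (simp add: tropical_fan_def)
    moreover have "(\<Sum>\<sigma>\<in>?A. normal_gen NP T (\<tau> \<times> \<sigma>)) = (\<Sum>\<sigma>\<in>?A. (0, normal_gen N' \<tau>' \<sigma>))"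
      using ng by (intro sum.cong refl)
    ultimately show ?thesis unfolding img sum.reindex[OF inj] comp_def by (simp only: sum_Pair_right zero_prod_def)
  qed
qed

text \<open>Stars of product cones are products of stars, so smoothness is compared cone by cone
  with \<open>poincare_duality_Times\<close>.\<close>

lemma smooth_fan_Times:
  assumes \<Sigma>: "cone_complex N \<Sigma>" and \<Sigma>': "cone_complex N' \<Sigma>'"
  shows "smooth_fan (N \<times> N') (product_fan \<Sigma> \<Sigma>') \<longleftrightarrow> smooth_fan N \<Sigma> \<and> smooth_fan N' \<Sigma>'"
proof -
  have star: "poincare_duality (quot (\<sigma> \<times> \<sigma>') ` (N \<times> N')) (star_fan (product_fan \<Sigma> \<Sigma>') (\<sigma> \<times> \<sigma>')) \<longleftrightarrow>
      poincare_duality (quot \<sigma> ` N) (star_fan \<Sigma> \<sigma>) \<and> poincare_duality (quot \<sigma>' ` N') (star_fan \<Sigma>' \<sigma>')"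
    if \<sigma>: "\<sigma> \<in> \<Sigma>" "\<sigma>' \<in> \<Sigma>'" for \<sigma> \<sigma>'
  proof -
    note z = cone_complex_0[OF \<Sigma> \<sigma>(1)] cone_complex_0[OF \<Sigma>' \<sigma>(2)]
    interpret product_complex "quot \<sigma> ` N" "star_fan \<Sigma> \<sigma>" "quot \<sigma>' ` N'" "star_fan \<Sigma>' \<sigma>'"
      using cone_complex_star[OF \<Sigma> \<sigma>(1)] cone_complex_star[OF \<Sigma>' \<sigma>(2)] by unfold_locales
    show ?thesis
      unfolding quot_Times_image[OF z] star_fan_Times[OF z] by (rule poincare_duality_Times)
  qed
  \<comment> \<open>Nonempty fans allow a statement about all pairs of cones to be split into one
    about each factor.\<close>
  have "\<Sigma> \<noteq> {}" "\<Sigma>' \<noteq> {}" using assms by (auto simp: cone_complex_def)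
  moreover have "smooth_fan (N \<times> N') (product_fan \<Sigma> \<Sigma>') \<longleftrightarrow> (\<forall>\<sigma>\<in>\<Sigma>. \<forall>\<sigma>'\<in>\<Sigma>'.
      poincare_duality (quot \<sigma> ` N) (star_fan \<Sigma> \<sigma>) \<and> poincare_duality (quot \<sigma>' ` N') (star_fan \<Sigma>' \<sigma>'))"
    unfolding smooth_fan_def using star by (simp add: product_fan_def)
  ultimately show ?thesis unfolding smooth_fan_def by blast
qed

theorem proposition3p21:
  fixes N :: "'a::euclidean_space set" and \<Sigma> :: "'a set set"
    and N' :: "'b::euclidean_space set" and \<Sigma>' :: "'b set set"
  assumes "tropical_fan N \<Sigma>" and "tropical_fan N' \<Sigma>'"
  shows "(smooth_fan (N \<times> N') (product_fan \<Sigma> \<Sigma>') \<longleftrightarrow> smooth_fan N \<Sigma> \<and> smooth_fan N' \<Sigma>') \<and>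
    (smooth_fan N \<Sigma> \<and> smooth_fan N' \<Sigma>' \<longrightarrow>
       tropical_fan (N \<times> N') (product_fan \<Sigma> \<Sigma>') \<and> smooth_fan (N \<times> N') (product_fan \<Sigma> \<Sigma>'))"
  using smooth_fan_Times[OF tropical_fan_cone_complex[OF assms(1)] tropical_fan_cone_complex[OF assms(2)]]
    tropical_fan_Times[OF assms] by blast

end
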